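(* Let $g\ge1$ be an integer and for $j\in\mathbb Z$ define $V_j=\{a\in\mathcal H^g\setminus\mathcal S^g\mid n(\tilde f)=j\}$. Then $\mathcal H^g\setminus\mathcal S^g$ is the following union of non-empty, open and pairwise disjoint sets: $$\mathcal H^g\setminus\mathcal S^g=V_{1-g}\cup V_{3-g}\cup\cdots\cup V_{g-3}\cup V_{g-1},$$ the indices being $j=1-g,3-g,\ldots,g-3,g-1$.
   Context: Polynomials. $P^d$ is the space of complex polynomials in $\lambda$ of degree at most $d$, and $P^d_{\mathbb R}\subset P^d$ is the real subspace of those $p(\lambda)=\sum_{i=0}^d p_i\lambda^i$ with $p_{d-i}=\overline{p_i}$ for all $i$. The space $\mathcal H^g$. $\mathcal H^g$ is the set of polynomials $a$ of degree $2g$ such that $a\in P^{2g}_{\mathbb R}$, $\lambda^{-g}a(\lambda)>0$ for all $\lambda\in S^1=\{|\lambda|=1\}$, the highest coefficient of $a$ has absolute value $1$, and the roots of $a$ are pairwise distinct. It is a real-analytic manifold of real dimension $2g$, with the topology given by the roots (equivalently the coefficients) of $a$. For $a\in\mathcal H^g$, $X_a$ is the smooth hyperelliptic curve of genus $g$ given by the compactification of $y^2=\lambda a(\lambda)$. The planes $\mathcal B_a$. For $b\in P^{g+1}_{\mathbb R}$ put $\Theta_b=\frac{b(\lambda)\,d\lambda}{\lambda y}$, a meromorphic differential on $X_a$. $\mathcal B_a$ is the real $2$-dimensional vector space of those $b\in P^{g+1}_{\mathbb R}$ for which all periods of $\Theta_b$ are purely imaginary. Each $b\in\mathcal B_a$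 is uniquely determined by $b(0)\in\mathbb C$, which can be arbitrary. The set $\mathcal S^g$. $\mathcal S^g$ is the set of $a\in\mathcal H^g$ for which there is $\lambda_0\in S^1$ with $b(\lambda_0)=0$ for all $b\in\mathcal B_a$. Winding number. For $a\in\mathcal H^g$ let $b_1,b_2\in\mathcal B_a$ be the elements with $b_1(0)=1$, $b_2(0)=i$, and put $\tilde f=\frac{b_1+ib_2}{b_1-ib_2}$ (common factors cancelled). It maps $S^1$ to $S^1$, and $n(\tilde f)\in\mathbb Z$ is the topological degree of $\tilde f|_{S^1}:S^1\to S^1$. *)

theory Defs
  imports
    "HOL-Complex_Analysis.Complex_Analysis"
    "HOL-Computational_Algebra.Computational_Algebra"
    "HOL-Computational_Algebra.Field_as_Ring"
begin

definition real_polys :: "nat \<Rightarrow> complex poly set" where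
  "real_polys d = {p. degree p \<le> d \<and> (\<forall>i\<le>d. coeff p (d - i) = cnj (coeff p i))}"

definition H_space :: "nat \<Rightarrow> complex poly set" where
  "H_space g = {a. degree a = 2 * g \<and> a \<in> real_polys (2 * g) \<and>
     (\<forall>l. cmod l = 1 \<longrightarrow> poly a l / l ^ g \<in> \<real> \<and> Re (poly a l / l ^ g) > 0) \<and>
     cmod (lead_coeff a) = 1 \<and> rsquarefree a}"

text \<open>The topology of coefficients: all but finitely many coefficients vanish on \<^term>\<open>H_space g\<close>,
  so the product topology on sequences induces the usual topology on coefficient vectors.\<close>

definition H_topology :: "nat \<Rightarrow> complex poly topology" where
  "H_topology g = pullback_topology (H_space g) coeff (euclidean :: (nat \<Rightarrow> complex) topology)"

text \<open>The affine part of the hyperelliptic curve \<open>X\<^sub>a\<close>. Its compactification adds one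
  point over \<open>\<lambda> = \<infinity>\<close>.\<close>

definition affine_curve :: "complex poly \<Rightarrow> (complex \<times> complex) set" where
  "affine_curve a = {(l, y). y\<^sup>2 = l * poly a l}"

text \<open>The value of the differential \<open>\<Theta>\<^sub>b = b(\<lambda>) d\<lambda> / (\<lambda> y)\<close> at a point of the affine curve with
  \<open>\<lambda> \<noteq> 0\<close> on a tangent vector \<open>(d\<lambda>, dy)\<close>. At the roots of \<open>a\<close>, where \<open>y = 0\<close> and \<open>\<lambda>\<close> is not a
  local coordinate, the relation \<open>2 y dy = (\<lambda> a)' d\<lambda>\<close> gives \<open>d\<lambda> / y = 2 dy / (\<lambda> a)'\<close>.\<close>

definition Theta ::
  "complex poly \<Rightarrow> complex poly \<Rightarrow> complex \<times> complex \<Rightarrow> complex \<times> complex \<Rightarrow> complex" where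
  "Theta a b = (\<lambda>(l, y) (dl, dy).
     if y \<noteq> 0 then poly b l * dl / (l * y)
     else 2 * poly b l * dy / (l * poly (pderiv ([:0, 1:] * a)) l))"

text \<open>The only possible poles of \<open>\<Theta>\<^sub>b\<close> are the points over \<open>\<lambda> = 0\<close> and \<open>\<lambda> = \<infinity>\<close>. The residues there
  vanish because \<open>\<Theta>\<^sub>b\<close> is odd under \<open>y \<mapsto> -y\<close>, which fixes both points; so integrating over
  closed paths that avoid them gives exactly the periods over the homology classes of \<open>X\<^sub>a\<close>.\<close>

definition periods :: "complex poly \<Rightarrow> complex poly \<Rightarrow> complex set" where
  "periods a b =
     {integral {0..1} (\<lambda>t. Theta a b (\<gamma> t) (vector_derivative \<gamma> (at t))) | \<gamma>.
        valid_path \<gamma> \<and> pathfinish \<gamma> = pathstart \<gamma> \<and>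
        path_image \<gamma> \<subseteq> affine_curve a - {(l, y). l = 0}}"

definition B_plane :: "nat \<Rightarrow> complex poly \<Rightarrow> complex poly set" where
  "B_plane g a = {b \<in> real_polys (g + 1). \<forall>w \<in> periods a b. Re w = 0}"

definition S_space :: "nat \<Rightarrow> complex poly set" where
  "S_space g = {a \<in> H_space g. \<exists>l0. cmod l0 = 1 \<and> (\<forall>b \<in> B_plane g a. poly b l0 = 0)}"

definition b_at :: "nat \<Rightarrow> complex poly \<Rightarrow> complex \<Rightarrow> complex poly" where
  "b_at g a c = (THE b. b \<in> B_plane g a \<and> poly b 0 = c)"

definition f_tilde :: "nat \<Rightarrow> complex poly \<Rightarrow> complex \<Rightarrow> complex" where
  "f_tilde g a l =
     (let p = b_at g a 1 + smult \<i> (b_at g a \<i>);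
          q = b_at g a 1 - smult \<i> (b_at g a \<i>)
      in poly (p div gcd p q) l / poly (q div gcd p q) l)"

text \<open>The degree of a self-map of the unit circle, expressed as the winding number about \<open>0\<close> of the
  image of the positively oriented unit circle.\<close>

definition V_set :: "nat \<Rightarrow> int \<Rightarrow> complex poly set" where
  "V_set g j = {a \<in> H_space g - S_space g.
     winding_number (f_tilde g a \<circ> circlepath 0 1) 0 = of_int j}"

end

theory Submission
  imports Defs
begin

text \<open>The periods of \<open>\<Theta>\<^sub>b\<close> are imaginary iff \<open>Re \<integral> \<Theta>\<^sub>b\<close> is a single-valued function \<open>h\<close> on the curve, odd
  under \<open>y \<mapsto> -y\<close>. Put \<open>q = b\<^sub>1 - i b\<^sub>2\<close> and \<open>p = b\<^sub>1 + i b\<^sub>2\<close>, so that \<open>p\<close> is the reflection of \<open>q\<close> in the unit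
  circle. Then \<open>a\<close> lies in \<open>S\<^sup>g\<close> iff \<open>q\<close> has a zero on the circle, and otherwise \<open>f\<close> has degree
  \<open>g + 1 - 2 k\<close>, where \<open>k\<close> is the number of zeros of \<open>q\<close> in the disc.

  Since \<open>q(0) = 2\<close> and \<open>p(0) = 0\<close>, \<open>deg q \<le> g\<close> and \<open>k \<le> g\<close>. If \<open>k = 0\<close>, then \<open>|p| < |q|\<close> in the disc, so
  \<open>F = h\<^sub>1 - i h\<^sub>2\<close> preserves orientation; \<open>F\<^sup>2\<close> is a function on the disc, vanishing on the circle and at
  the roots of \<open>a\<close>, and the set of \<open>w \<noteq> 0\<close> with at least two preimages is open, closed and nonempty,
  although it avoids a neighbourhood of \<open>\<infinity>\<close>. Hence \<open>k \<ge> 1\<close>.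

  The sets are open because \<open>b\<^sub>1, b\<^sub>2\<close> depend continuously on \<open>a\<close>. For non-emptiness one raises the genus
  by opening a node: \<open>a\<close> is multiplied by a quadratic polynomial whose two roots are close to a point
  \<open>\<beta>\<close> of the circle. In the limit \<open>q\<close> becomes \<open>(1 - \<lambda>/\<beta>) q\<close>, and the vanishing of the real part of a
  small period shows that the new zero lies inside or outside of the circle according to the sign of
  \<open>Re (\<beta> q'(\<beta>) / q(\<beta>)) - (g + 1) / 2\<close>. Both signs occur for \<open>g = 1\<close> and persist, so every
  \<open>1 \<le> k \<le> g\<close> is attained.\<close>

section \<open>Linear systems and coefficientwise convergence\<close>

text \<open>The periods are integrals over arbitrary closed paths, while existence, uniqueness and
  continuity of \<open>b\<close> call for finitely many linear conditions. The potential mediates.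
  Slits from the branch points, directed away from a generic base point \<open>z0\<close>, leave a
  star-shaped domain, and \<open>h\<close> exists as soon as the loops from \<open>z0\<close> around
  the branch points have integrals with equal real parts: 2g real equations for the g complex
  coefficients between the two ends of \<open>b\<close>. Uniqueness is a maximum principle: if both
  end coefficients vanish, |h| is a continuous function of \<lambda> on the whole sphere, reflection
  taking care of infinity. Uniqueness then gives existence by counting dimensions and continuity by
  compactness. The compactness argument survives the collision of two branch points, because the
  real part of every loop integral is -2 times one and the same value of \<open>h\<close> over
  \<open>z0\<close>. The threshold (g + 1)/2 in the node opening is the real part of \<beta>
  Y'(\<beta>) / Y(\<beta>) for a branch \<open>y = Y(\<lambda>)\<close>; it reflects that
  \<lambda>^(-g) a(\<lambda>) is real on the circle.\<close>

lemma underdetermined_system: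
  fixes A :: "'i \<Rightarrow> 'j \<Rightarrow> real"
  assumes "finite I" "finite J" "card I < card J"
  shows "\<exists>x. (\<exists>j\<in>J. x j \<noteq> 0) \<and> (\<forall>i\<in>I. (\<Sum>j\<in>J. A i j * x j) = 0)"
  using assms
proof (induction I arbitrary: A J rule: finite_induct)
  case empty
  then obtain j where "j \<in> J" by fastforce
  then show ?case by (intro exI[of _ "\<lambda>_. 1"]) auto
next
  case (insert i0 I)
  show ?case
  proof (cases "\<forall>j\<in>J. A i0 j = 0")
    case True
    obtain x where "\<exists>j\<in>J. x j \<noteq> 0" "\<forall>i\<in>I. (\<Sum>j\<in>J. A i j * x j) = 0"
      using insert.IH[of J A] insert.prems insert.hyps by auto
    with True show ?thesis by (intro exI[of _ x]) auto
  next
    case False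
    then obtain j0 where j0: "j0 \<in> J" "A i0 j0 \<noteq> 0" by auto
    \<comment> \<open>The rows after Gaussian elimination of the variable \<open>j0\<close> by means
      of equation \<open>i0\<close>.\<close>
    define A' where "A' = (\<lambda>i j. A i j - A i j0 * A i0 j / A i0 j0)"
    have "card I < card (J - {j0})"
      using insert.prems insert.hyps j0 by (simp add: card_Diff_singleton)
    then obtain x where x: "\<exists>j\<in>J-{j0}. x j \<noteq> 0" "\<forall>i\<in>I. (\<Sum>j\<in>J-{j0}. A' i j * x j) = 0"
      using insert.IH[of "J - {j0}" A'] insert.prems by auto
    define x0 where "x0 = - (\<Sum>j\<in>J-{j0}. A i0 j * x j) / A i0 j0"
    define x' where "x' = x(j0 := x0)"
    have spl: "(\<Sum>j\<in>J. A i j * x' j) = A i j0 * x0 + (\<Sum>j\<in>J-{j0}. A i j * x j)" for i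
      using sum.remove[of J j0 "\<lambda>j. A i j * x' j"] insert.prems j0
      by (simp add: x'_def)
    have "(\<Sum>j\<in>J. A i j * x' j) = 0" if "i \<in> insert i0 I" for i
    proof (cases "i = i0")
      case True
      then show ?thesis using j0 by (simp add: spl x0_def)
    next
      case False
      then have "(\<Sum>j\<in>J-{j0}. (A i j - A i j0 * A i0 j / A i0 j0) * x j) = 0"
        using x(2) that by (simp add: A'_def)
      also have "(\<Sum>j\<in>J-{j0}. (A i j - A i j0 * A i0 j / A i0 j0) * x j) =
          (\<Sum>j\<in>J-{j0}. A i j * x j) - A i j0 / A i0 j0 * (\<Sum>j\<in>J-{j0}. A i0 j * x j)"
        by (simp add: left_diff_distrib sum_subtractf sum_distrib_left mult.assoc)
      finally have "(\<Sum>j\<in>J-{j0}. A i j * x j) = A i j0 / A i0 j0 * (\<Sum>j\<in>J-{j0}. A i0 j * x j)"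
        by simp
      then show ?thesis using j0 by (simp add: spl x0_def)
    qed
    moreover have "\<exists>j\<in>J. x' j \<noteq> 0" using x(1) by (auto simp: x'_def)
    ultimately show ?thesis by blast
  qed
qed

text \<open>The right-hand side becomes one more column, indexed by \<open>None\<close>. A
  nontrivial solution of the enlarged homogeneous system has a nonzero entry there, since otherwise
  injectivity would make it trivial; dividing by this entry solves the inhomogeneous system.\<close>

lemma injective_system_solvable:
  fixes A :: "'i \<Rightarrow> 'j \<Rightarrow> real"
  assumes fin: "finite I" "finite J" and card: "card I = card J"
    and inj: "\<And>x. (\<And>i. i \<in> I \<Longrightarrow> (\<Sum>j\<in>J. A i j * x j) = 0) \<Longrightarrow> \<forall>j\<in>J. x j = 0"
  shows "\<exists>x. \<forall>i\<in>I. (\<Sum>j\<in>J. A i j * x j) = d i"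
proof -
  define B where "B = (\<lambda>i j. case j of None \<Rightarrow> - d i | Some j \<Rightarrow> A i j)"
  have fin': "finite (insert None (Some ` J))" using fin by auto
  have "card (insert None (Some ` J)) = Suc (card J)"
    using fin by (subst card_insert_disjoint) (auto simp: card_image)
  then obtain x where x: "\<exists>j\<in>insert None (Some ` J). x j \<noteq> 0"
     "\<forall>i\<in>I. (\<Sum>j\<in>insert None (Some ` J). B i j * x j) = 0"
    using underdetermined_system[OF fin(1) fin', of B] card by auto
  have *: "(\<Sum>j\<in>insert None (Some ` J). B i j * x j) = - d i * x None + (\<Sum>j\<in>J. A i j * x (Some j))" for i
    using fin by (subst sum.insert) (auto simp: sum.reindex B_def)
  have ne: "x None \<noteq> 0"
  proof
    assume "x None = 0"
    then have "\<forall>j\<in>J. x (Some j) = 0" using inj[of "\<lambda>j. x (Some j)"] x(2) * by simp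
    with \<open>x None = 0\<close> x(1) show False by auto
  qed
  show ?thesis
  proof (intro exI[of _ "\<lambda>j. x (Some j) / x None"] ballI)
    fix i assume "i \<in> I"
    then have "(\<Sum>j\<in>J. A i j * x (Some j)) = d i * x None" using x(2) * by fastforce
    then show "(\<Sum>j\<in>J. A i j * (x (Some j) / x None)) = d i"
      using ne by (simp add: sum_divide_distrib[symmetric])
  qed
qed

text \<open>Each complex unknown counts as two real ones, so \<open>g\<close> complex coefficients
  face \<open>2 * g\<close> real equations. The boolean in the index selects the real or imaginary
  part of the unknown; the coefficient \<open>- Im (M x i)\<close> is the real part of
  \<open>\<i> * M x i\<close>.\<close>

lemma complex_coeffs_solvable:
  fixes M :: "'x \<Rightarrow> nat \<Rightarrow> complex"
  assumes fin: "finite X" and card: "card X = 2 * g"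
    and inj: "\<And>c. (\<And>x. x \<in> X \<Longrightarrow> Re (\<Sum>i<g. c i * M x i) = 0) \<Longrightarrow> \<forall>i<g. c i = 0"
  shows "\<exists>c. \<forall>x\<in>X. Re (\<Sum>i<g. c i * M x i) = d x"
proof -
  define A where "A = (\<lambda>x (i, r). if r then Re (M x i) else - Im (M x i))"
  define J where "J = {..<g} \<times> (UNIV :: bool set)"
  define cc where "cc = (\<lambda>x::nat \<times> bool \<Rightarrow> real. \<lambda>i. Complex (x (i, True)) (x (i, False)))"
  have *: "(\<Sum>j\<in>J. A x j * y j) = Re (\<Sum>i<g. cc y i * M x i)" for x y
  proof -
    have "(\<Sum>j\<in>J. A x j * y j) = (\<Sum>i<g. \<Sum>r\<in>UNIV. A x (i, r) * y (i, r))"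
      by (simp add: sum.cartesian_product J_def case_prod_unfold)
    then show ?thesis by (simp add: UNIV_bool A_def cc_def algebra_simps)
  qed
  have "\<exists>y. \<forall>x\<in>X. (\<Sum>j\<in>J. A x j * y j) = d x"
  proof (rule injective_system_solvable)
    show "finite J" "card X = card J" by (auto simp: J_def card card_cartesian_product)
    fix y assume y: "\<And>x. x \<in> X \<Longrightarrow> (\<Sum>j\<in>J. A x j * y j) = 0"
    have "\<forall>i<g. cc y i = 0" by (rule inj) (simp only: *[symmetric] y)
    then have "y (i, r) = 0" if "i < g" for i r
      using that by (cases r) (auto simp: cc_def complex_eq_iff)
    then show "\<forall>j\<in>J. y j = 0" by (auto simp: J_def)
  qed (rule fin)
  then obtain y where "\<forall>x\<in>X. (\<Sum>j\<in>J. A x j * y j) = d x" by blast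
  then have "\<forall>x\<in>X. Re (\<Sum>i<g. cc y i * M x i) = d x" by (simp only: *)
  then show ?thesis by (intro exI[of _ "cc y"])
qed

section \<open>Reflection of polynomials in the unit circle\<close>

text \<open>The antilinear map taking p(\<lambda>) to \<lambda>^d times the conjugate of p(1 / cnj
  \<lambda>). The nominal degree \<open>d\<close> is explicit because the actual degree may be
  smaller; \<open>real_polys d\<close> consists of the fixed points.\<close>

definition poly_star :: "nat \<Rightarrow> complex poly \<Rightarrow> complex poly" where
  "poly_star d p = (\<Sum>i\<le>d. monom (cnj (coeff p (d - i))) i)"

lemma coeff_poly_star: "coeff (poly_star d p) i = (if i \<le> d then cnj (coeff p (d - i)) else 0)"
  by (simp add: poly_star_def coeff_sum)

lemma degree_poly_star: "degree (poly_star d p) \<le> d"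
  by (rule degree_le) (simp add: coeff_poly_star)

lemma poly_star_star: "degree p \<le> d \<Longrightarrow> poly_star d (poly_star d p) = p"
  by (rule poly_eqI) (auto simp: coeff_poly_star coeff_eq_0)

lemma poly_star_add: "poly_star d (p + q) = poly_star d p + poly_star d q"
  and poly_star_smult: "poly_star d (smult c p) = smult (cnj c) (poly_star d p)"
  and poly_star_diff: "poly_star d (p - q) = poly_star d p - poly_star d q"
  by (auto intro!: poly_eqI simp: coeff_poly_star)

lemma real_polys_iff: "p \<in> real_polys d \<longleftrightarrow> degree p \<le> d \<and> poly_star d p = p"
proof
  assume "p \<in> real_polys d"
  then show "degree p \<le> d \<and> poly_star d p = p"
    by (auto simp: real_polys_def poly_eq_iff coeff_poly_star coeff_eq_0)
next
  assume *: "degree p \<le> d \<and> poly_star d p = p"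
  have "coeff p (d - i) = cnj (coeff p i)" if "i \<le> d" for i
    using * that coeff_poly_star[of d p "d - i"] by simp
  with * show "p \<in> real_polys d" by (auto simp: real_polys_def)
qed

lemma poly_altdef_le: "degree p \<le> d \<Longrightarrow> poly (p :: complex poly) x = (\<Sum>i\<le>d. coeff p i * x ^ i)"
  by (subst poly_altdef, intro sum.mono_neutral_left) (auto simp: coeff_eq_0)

lemma poly_poly_star:
  assumes "degree p \<le> d" "l \<noteq> 0"
  shows "poly (poly_star d p) l = l ^ d * cnj (poly p (1 / cnj l))"
proof -
  have "poly (poly_star d p) l = (\<Sum>i\<le>d. cnj (coeff p (d - i)) * l ^ i)"
    using poly_altdef_le[OF degree_poly_star] by (simp add: coeff_poly_star)
  also have "\<dots> = (\<Sum>i\<le>d. cnj (coeff p i) * l ^ (d - i))"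
    by (rule sum.reindex_bij_witness[of _ "\<lambda>i. d - i" "\<lambda>i. d - i"]) auto
  also have "\<dots> = (\<Sum>i\<le>d. l ^ d * (cnj (coeff p i) * (1 / l) ^ i))"
    using assms by (intro sum.cong) (auto simp: power_diff field_simps)
  also have "\<dots> = l ^ d * cnj (poly p (1 / cnj l))"
    by (simp add: poly_altdef_le[OF assms(1)] sum_distrib_left)
  finally show ?thesis .
qed

lemma poly_real_circle:
  assumes "p \<in> real_polys d" "cmod l = 1"
  shows "poly p l = l ^ d * cnj (poly p l)"
proof -
  have "1 / cnj l = l" using assms(2)
    by (metis complex_div_cnj complex_norm_square div_by_1 mult.right_neutral nonzero_eq_divide_eq
        norm_one of_real_1 power_one complex_cnj_zero_iff norm_zero zero_neq_one)
  then show ?thesis using assms poly_poly_star[of p d l] by (force simp: real_polys_iff)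
qed

section \<open>Convergence of polynomials of bounded degree\<close>

text \<open>The common degree bound upgrades coefficientwise convergence to uniform convergence on
  bounded sets, also when the degree drops in the limit.\<close>

definition poly_conv :: "nat \<Rightarrow> (nat \<Rightarrow> complex poly) \<Rightarrow> complex poly \<Rightarrow> bool" where
  "poly_conv d p q \<longleftrightarrow> (\<forall>n. degree (p n) \<le> d) \<and> degree q \<le> d \<and> (\<forall>i. (\<lambda>n. coeff (p n) i) \<longlonglongrightarrow> coeff q i)"

lemma poly_conv_poly:
  assumes "poly_conv d p q" "z \<longlonglongrightarrow> z0"
  shows "(\<lambda>n. poly (p n) (z n)) \<longlonglongrightarrow> poly q z0"
proof -
  have "(\<lambda>n. \<Sum>i\<le>d. coeff (p n) i * z n ^ i) \<longlonglongrightarrow> (\<Sum>i\<le>d. coeff q i * z0 ^ i)"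
    using assms by (intro tendsto_intros) (auto simp: poly_conv_def)
  then show ?thesis using assms(1) by (simp add: poly_conv_def poly_altdef_le[of _ d])
qed

lemma poly_conv_subseq: "poly_conv d p q \<Longrightarrow> strict_mono r \<Longrightarrow> poly_conv d (\<lambda>n. p (r n)) q"
  unfolding poly_conv_def using LIMSEQ_subseq_LIMSEQ by (fastforce simp: o_def)

lemma poly_conv_bounded:
  assumes "poly_conv d p q" "bounded S"
  obtains B where "\<And>n z. z \<in> S \<Longrightarrow> cmod (poly (p n) z) \<le> B"
proof -
  from assms(2) obtain R where R: "\<And>z. z \<in> S \<Longrightarrow> cmod z \<le> R" by (auto simp: bounded_iff)
  have "\<exists>C. \<forall>n. cmod (coeff (p n) i) \<le> C" for i
  proof -
    have "convergent (\<lambda>n. coeff (p n) i)" using assms(1) unfolding poly_conv_def convergent_def by blast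
    then have "Bseq (\<lambda>n. coeff (p n) i)" by (rule convergent_imp_Bseq)
    then show ?thesis unfolding Bseq_def by blast
  qed
  then obtain C where C: "\<And>i n. cmod (coeff (p n) i) \<le> C i" by metis
  have "cmod (poly (p n) z) \<le> (\<Sum>i\<le>d. C i * R ^ i)" if "z \<in> S" for n z
  proof -
    have "cmod (poly (p n) z) \<le> (\<Sum>i\<le>d. cmod (coeff (p n) i * z ^ i))"
      using assms(1) by (simp add: poly_conv_def poly_altdef_le[of _ d] norm_sum)
    also have "\<dots> \<le> (\<Sum>i\<le>d. C i * R ^ i)"
      using C R[OF that] by (intro sum_mono) (auto simp: norm_mult norm_power intro!: mult_mono power_mono order_trans[OF norm_ge_zero C])
    finally show ?thesis .
  qed
  then show ?thesis using that by blast
qed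

lemma poly_conv_uniform:
  assumes "poly_conv d p q" "bounded S" "e > 0"
  shows "\<forall>\<^sub>F n in sequentially. \<forall>z\<in>S. cmod (poly (p n) z - poly q z) < e"
proof -
  from assms(2) obtain R where R: "\<And>z. z \<in> S \<Longrightarrow> cmod z \<le> R" by (auto simp: bounded_iff)
  have "(\<lambda>n. \<Sum>i\<le>d. cmod (coeff (p n) i - coeff q i) * R ^ i) \<longlonglongrightarrow> (\<Sum>i\<le>d. cmod (coeff q i - coeff q i) * R ^ i)"
    using assms(1) by (intro tendsto_intros) (auto simp: poly_conv_def)
  then have "\<forall>\<^sub>F n in sequentially. (\<Sum>i\<le>d. cmod (coeff (p n) i - coeff q i) * R ^ i) < e"
    using assms(3) by (intro order_tendstoD(2)) auto
  then show ?thesis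
  proof eventually_elim
    case (elim n)
    show ?case
    proof
      fix z assume z: "z \<in> S"
      have "poly (p n) z - poly q z = (\<Sum>i\<le>d. (coeff (p n) i - coeff q i) * z ^ i)"
        using assms(1) by (simp add: poly_conv_def poly_altdef_le[of _ d] sum_subtractf algebra_simps)
      also have "cmod \<dots> \<le> (\<Sum>i\<le>d. cmod (coeff (p n) i - coeff q i) * R ^ i)"
        using R[OF z] by (intro sum_norm_le) (auto simp: norm_mult norm_power intro!: mult_left_mono power_mono)
      finally show "cmod (poly (p n) z - poly q z) < e" using elim by simp
    qed
  qed
qed

lemma bounded_coeffs_subseq:
  fixes p :: "nat \<Rightarrow> complex poly"
  assumes "\<And>n. degree (p n) \<le> d" "\<And>n i. cmod (coeff (p n) i) \<le> C"
  obtains q r where "strict_mono r" "poly_conv d (\<lambda>n. p (r n)) q"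
proof -
  have "\<exists>r. strict_mono (r :: nat \<Rightarrow> nat) \<and> (\<forall>i<k. convergent (\<lambda>n. coeff (p (r n)) i))" for k
  proof (induction k)
    case 0
    show ?case by (intro exI[of _ id]) (auto simp: strict_mono_def)
  next
    case (Suc k)
    then obtain r :: "nat \<Rightarrow> nat" where r: "strict_mono r" "\<forall>i<k. convergent (\<lambda>n. coeff (p (r n)) i)" by auto
    have "bounded (range (\<lambda>n. coeff (p (r n)) k))" using assms(2) by (auto simp: bounded_iff)
    then obtain l s where s: "strict_mono s" "((\<lambda>n. coeff (p (r n)) k) \<circ> s) \<longlonglongrightarrow> l"
      using bounded_imp_convergent_subsequence by metis
    have "convergent (\<lambda>n. coeff (p (r (s n))) i)" if "i < Suc k" for i
    proof (cases "i = k")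
      case True then show ?thesis using s by (auto simp: o_def convergent_def)
    next
      case False
      then have "convergent ((\<lambda>n. coeff (p (r n)) i) \<circ> s)"
        using r s that by (intro convergent_subseq_convergent) auto
      then show ?thesis by (simp add: o_def)
    qed
    then show ?case using r s by (intro exI[of _ "r \<circ> s"]) (auto simp: strict_mono_def)
  qed
  then obtain r :: "nat \<Rightarrow> nat" where r: "strict_mono r" "\<forall>i<Suc d. convergent (\<lambda>n. coeff (p (r n)) i)" by blast
  then obtain c where c: "\<And>i. i \<le> d \<Longrightarrow> (\<lambda>n. coeff (p (r n)) i) \<longlonglongrightarrow> c i"
    unfolding convergent_def by (metis less_Suc_eq_le)
  define q where "q = (\<Sum>i\<le>d. monom (c i) i)"
  have cq: "coeff q i = (if i \<le> d then c i else 0)" for i by (simp add: q_def coeff_sum)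
  have "degree q \<le> d" by (rule degree_le) (simp add: cq)
  moreover have "(\<lambda>n. coeff (p (r n)) i) \<longlonglongrightarrow> coeff q i" for i
  proof (cases "i \<le> d")
    case True then show ?thesis using c by (simp add: cq)
  next
    case False
    then have "coeff (p n) i = 0" for n using assms(1)[of n] by (simp add: coeff_eq_0)
    then show ?thesis using False by (simp add: cq)
  qed
  ultimately show ?thesis using that r(1) assms(1) by (auto simp: poly_conv_def)
qed

text \<open>Divide by the size of the coefficients: the scaled sequences have convergent subsequences, also
  when the coefficients of \<open>b n\<close> are unbounded (then \<open>t0 = 0\<close>).\<close>

lemma poly_conv_if_scaled_limits:
  fixes b :: "nat \<Rightarrow> complex poly"
  assumes deg: "\<And>n. degree (b n) \<le> d" and deg': "degree b0 \<le> d"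
    and lim: "\<And>r t t0 c. strict_mono r \<Longrightarrow> t \<longlonglongrightarrow> t0 \<Longrightarrow>
       poly_conv d (\<lambda>n. smult (of_real (t n)) (b (r n))) c \<Longrightarrow> c = smult (of_real t0) b0"
  shows "poly_conv d b b0"
proof (rule ccontr)
  assume "\<not> poly_conv d b b0"
  then obtain i where i: "\<not> (\<lambda>n. coeff (b n) i) \<longlonglongrightarrow> coeff b0 i"
    using deg deg' by (auto simp: poly_conv_def)
  then obtain e where e: "e > 0" "\<forall>N. \<exists>n\<ge>N. \<not> dist (coeff (b n) i) (coeff b0 i) < e"
    unfolding lim_sequentially by blast
  have "\<exists>\<^sub>\<infinity>n. \<not> dist (coeff (b n) i) (coeff b0 i) < e"
    using e(2) by (auto simp: INFM_nat_le)
  then obtain r0 :: "nat \<Rightarrow> nat" where r0: "strict_mono r0" "\<And>n. \<not> dist (coeff (b (r0 n)) i) (coeff b0 i) < e"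
    using infinite_enumerate[of "{n. \<not> dist (coeff (b n) i) (coeff b0 i) < e}"]
    by (auto simp: frequently_cofinite)
  define N where "N = (\<lambda>p :: complex poly. \<Sum>i\<le>d. cmod (coeff p i))"
  \<comment> \<open>This weight makes \<open>N\<close> of the scaled polynomial plus
    \<open>t n\<close> equal to 1, so the limits \<open>c\<close> and \<open>t0\<close> cannot both
    vanish. As \<open>c\<close> is \<open>t0\<close> times \<open>b0\<close>, already
    \<open>t0\<close> is nonzero, and dividing by it recovers the unscaled sequence.\<close>
  define t where "t = (\<lambda>n. 1 / (1 + N (b (r0 n))))"
  have N0: "N p \<ge> 0" for p by (auto simp: N_def sum_nonneg)
  have t: "0 < t n" "t n \<le> 1" for n using N0[of "b (r0 n)"] by (auto simp: t_def add_pos_nonneg)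
  have Ns: "N (smult (of_real s) p) = s * N p" if "s \<ge> 0" for s p
    using that by (simp add: N_def norm_mult sum_distrib_left)
  have tN: "N (smult (of_real (t n)) (b (r0 n))) + t n = 1" for n
  proof -
    have "1 + N (b (r0 n)) > 0" using N0[of "b (r0 n)"] by linarith
    then show ?thesis using t[of n] by (simp add: Ns less_imp_le) (simp add: t_def field_simps)
  qed
  have bd: "cmod (coeff (smult (of_real (t n)) (b (r0 n))) j) \<le> 1" for n j
  proof (cases "j \<le> d")
    case True
    then have "cmod (coeff (smult (of_real (t n)) (b (r0 n))) j) \<le> N (smult (of_real (t n)) (b (r0 n)))"
      unfolding N_def by (intro member_le_sum) auto
    then show ?thesis using tN[of n] t[of n] by linarith
  next
    case False then show ?thesis using deg[of "r0 n"] by (simp add: coeff_eq_0)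
  qed
  have deg1: "degree (smult (of_real (t n)) (b (r0 n))) \<le> d" for n
    using degree_smult_le deg order_trans by blast
  obtain c r1 where r1: "strict_mono r1" "poly_conv d (\<lambda>n. smult (of_real (t (r1 n))) (b (r0 (r1 n)))) c"
    using bounded_coeffs_subseq[of "\<lambda>n. smult (of_real (t n)) (b (r0 n))" d 1] deg1 bd by metis
  have "bounded (range (\<lambda>n. t (r1 n)))" unfolding bounded_iff using t by (intro exI[of _ 1]) (auto simp: abs_of_pos)
  then obtain t0 r2 where r2: "strict_mono r2" "((\<lambda>n. t (r1 n)) \<circ> r2) \<longlonglongrightarrow> t0"
    using bounded_imp_convergent_subsequence by metis
  define r where "r = r0 \<circ> (r1 \<circ> r2)"
  define s where "s = (\<lambda>n. t (r1 (r2 n)))"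
  have s: "s \<longlonglongrightarrow> t0" using r2 by (simp add: o_def s_def)
  have r: "strict_mono r" using r0 r1 r2 by (auto simp: r_def strict_mono_def)
  have conv: "poly_conv d (\<lambda>n. smult (of_real (s n)) (b (r n))) c"
    using poly_conv_subseq[OF r1(2) r2(1)] by (simp add: s_def r_def)
  have c: "c = smult (of_real t0) b0" using lim[OF r s conv] .
  have t0: "t0 \<ge> 0" using s t by (intro LIMSEQ_le_const[OF s]) (auto simp: s_def intro: less_imp_le)
  have "(\<lambda>n. N (smult (of_real (s n)) (b (r n))) + s n) \<longlonglongrightarrow> N c + t0"
    unfolding N_def using conv s by (intro tendsto_intros) (auto simp: poly_conv_def)
  moreover have "(\<lambda>n. N (smult (of_real (s n)) (b (r n))) + s n) = (\<lambda>_. 1)"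
    using tN by (auto simp: s_def r_def)
  ultimately have "N c + t0 = 1" using LIMSEQ_unique tendsto_const by metis
  then have t0': "t0 \<noteq> 0" using c by (auto simp: N_def)
  have "(\<lambda>n. coeff (smult (of_real (s n)) (b (r n))) i / of_real (s n)) \<longlonglongrightarrow> coeff c i / of_real t0"
    using conv s t0' by (intro tendsto_intros) (auto simp: poly_conv_def)
  moreover have "coeff (smult (of_real (s n)) (b (r n))) i / of_real (s n) = coeff (b (r n)) i" for n
    using t[of "r1 (r2 n)"] by (simp add: s_def)
  ultimately have "(\<lambda>n. coeff (b (r n)) i) \<longlonglongrightarrow> coeff b0 i" using t0' by (simp add: c)
  then have "\<forall>\<^sub>F n in sequentially. dist (coeff (b (r n)) i) (coeff b0 i) < e"
    using e(1) by (simp add: tendsto_iff)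
  then show False using r0(2) by (auto simp: r_def eventually_sequentially)
qed

section \<open>Potentials on the curve\<close>

text \<open>\<open>h\<close> plays the role of \<open>Re \<integral> \<Theta>\<^sub>b\<close>, normalised to be odd under the hyperelliptic involution. Only its values on
  the affine curve matter; at the branch points oddness forces the value \<open>0\<close>.\<close>

definition potential :: "complex poly \<Rightarrow> complex poly \<Rightarrow> (complex \<Rightarrow> complex \<Rightarrow> real) \<Rightarrow> bool" where
  "potential a b h \<longleftrightarrow> (\<forall>l y. y\<^sup>2 = l * poly a l \<longrightarrow> h l (- y) = - h l y) \<and>
     (\<forall>Y r l. r > 0 \<and> Y holomorphic_on ball l r \<and>
        (\<forall>z\<in>ball l r. (Y z)\<^sup>2 = z * poly a z \<and> z * poly a z \<noteq> 0) \<longrightarrow>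
        ((\<lambda>z. h z (Y z)) has_derivative (\<lambda>d. Re (poly b l * d / (l * Y l)))) (at l))"

lemma potential_odd: "potential a b h \<Longrightarrow> y\<^sup>2 = l * poly a l \<Longrightarrow> h l (- y) = - h l y"
  by (auto simp: potential_def)

lemma potential_0: "potential a b h \<Longrightarrow> l * poly a l = 0 \<Longrightarrow> h l 0 = 0"
  using potential_odd[of a b h 0 l] by simp

lemma potential_abs:
  assumes "potential a b h" "y\<^sup>2 = l * poly a l" "w\<^sup>2 = l * poly a l"
  shows "\<bar>h l y\<bar> = \<bar>h l w\<bar>"
proof -
  have "y = w \<or> y = - w" using assms(2,3) by (metis power2_eq_iff)
  then show ?thesis using potential_odd[OF assms(1,3)] by auto
qed

lemma potential_add: "potential a b h \<Longrightarrow> potential a c k \<Longrightarrow> potential a (b + c) (\<lambda>l y. h l y + k l y)"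
  unfolding potential_def
  by (auto simp: algebra_simps add_divide_distrib intro!: derivative_eq_intros)

lemma potential_scale:
  assumes pot: "potential a b h"
  shows "potential a (smult (of_real c) b) (\<lambda>l y. c * h l y)"
proof -
  have "((\<lambda>z. c * h z (Y z)) has_derivative (\<lambda>d. Re (poly (smult (of_real c) b) l * d / (l * Y l)))) (at l)"
    if *: "r > 0 \<and> Y holomorphic_on ball l r \<and> (\<forall>z\<in>ball l r. (Y z)\<^sup>2 = z * poly a z \<and> z * poly a z \<noteq> 0)" for Y r l
  proof -
    have "((\<lambda>z. h z (Y z)) has_derivative (\<lambda>d. Re (poly b l * d / (l * Y l)))) (at l)"
      using pot * unfolding potential_def by blast
    then have "((\<lambda>z. c * h z (Y z)) has_derivative (\<lambda>d. c * Re (poly b l * d / (l * Y l)))) (at l)"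
      by (rule has_derivative_mult_right)
    moreover have "c * Re (poly b l * d / (l * Y l)) = Re (poly (smult (of_real c) b) l * d / (l * Y l))" for d
    proof -
      have *: "poly (smult (of_real c) b) l * d / (l * Y l) = of_real c * (poly b l * d / (l * Y l))" by simp
      have "Re (of_real c * w) = c * Re w" for w by simp
      then show ?thesis by (simp only: *)
    qed
    ultimately show ?thesis by (simp only:)
  qed
  with pot show ?thesis unfolding potential_def by simp
qed

lemma potential_minus: "potential a b h \<Longrightarrow> potential a (- b) (\<lambda>l y. - h l y)"
  using potential_scale[of a b h "-1"] by simp

lemma potential_diff: "potential a b h \<Longrightarrow> potential a c k \<Longrightarrow> potential a (b - c) (\<lambda>l y. h l y - k l y)"
  using potential_add[OF _ potential_minus] by fastforce

lemma Re_csqrt_pos: "Re z > 0 \<Longrightarrow> Re (csqrt z) > 0"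
proof (rule ccontr)
  assume z: "Re z > 0" and "\<not> Re (csqrt z) > 0"
  then have "Re (csqrt z) = 0" using csqrt_principal[of z] by auto
  then have "Re ((csqrt z)\<^sup>2) \<le> 0" by (simp add: power2_eq_square)
  then show False using z by simp
qed

text \<open>The condition \<open>Re (Y z / y) > 0\<close> selects one of the two roots pointwise.
  Any continuous lift through \<open>(l, y)\<close> satisfies it nearby and therefore coincides with
  \<open>Y\<close> there.\<close>

lemma sqrt_branch:
  fixes a :: "complex poly"
  assumes y: "y\<^sup>2 = l * poly a l" "y \<noteq> 0"
  obtains r Y where "r > 0" "Y holomorphic_on ball l r" "Y l = y"
    "\<And>z. z \<in> ball l r \<Longrightarrow> (Y z)\<^sup>2 = z * poly a z \<and> z * poly a z \<noteq> 0 \<and> Re (Y z / y) > 0"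
proof -
  define P where "P = (\<lambda>z. z * poly a z)"
  have P: "P l \<noteq> 0" "y\<^sup>2 = P l" using y by (auto simp: P_def)
  have "isCont (\<lambda>z. P z / P l) l" using P unfolding P_def by (intro continuous_intros) auto
  then obtain r where r: "r > 0" "\<And>z. dist z l < r \<Longrightarrow> cmod (P z / P l - P l / P l) < 1"
    unfolding continuous_at_eps_delta dist_norm by (meson zero_less_one)
  have pos: "Re (P z / P l) > 0" if "z \<in> ball l r" for z
  proof -
    have "cmod (P z / P l - 1) < 1" using r(2)[of z] that P by (simp add: dist_commute)
    then show ?thesis using abs_Re_le_cmod[of "P z / P l - 1"] by simp
  qed
  define Y where "Y = (\<lambda>z. y * csqrt (P z / P l))"
  show ?thesis
  proof
    show "Y holomorphic_on ball l r" unfolding Y_def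
    proof -
      have "P holomorphic_on ball l r" unfolding P_def by (intro holomorphic_intros)
      moreover have "P z / P l \<notin> \<real>\<^sub>\<le>\<^sub>0" if "z \<in> ball l r" for z
        using pos[OF that] by (simp add: complex_nonpos_Reals_iff)
      ultimately show "(\<lambda>z. y * csqrt (P z / P l)) holomorphic_on ball l r"
        using P(1) by (intro holomorphic_intros) auto
    qed
    show "Y l = y" using P by (simp add: Y_def)
    fix z assume z: "z \<in> ball l r"
    have "(Y z)\<^sup>2 = P z" using P by (simp add: Y_def power_mult_distrib)
    moreover have "P z \<noteq> 0" using pos[OF z] by auto
    moreover have "Re (Y z / y) > 0" using Re_csqrt_pos[OF pos[OF z]] y by (simp add: Y_def)
    ultimately show "(Y z)\<^sup>2 = z * poly a z \<and> z * poly a z \<noteq> 0 \<and> Re (Y z / y) > 0"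
      by (simp add: P_def)
  qed (use r in auto)
qed

lemma sqrt_branch_unique:
  fixes v w y :: complex
  assumes "v\<^sup>2 = w\<^sup>2" "Re (v / y) > 0" "Re (w / y) > 0"
  shows "v = w"
  using assms by (auto simp: power2_eq_iff)

lemma potential_local:
  assumes pot: "potential a b h" and y: "y\<^sup>2 = l * poly a l" "y \<noteq> 0"
  obtains r Y where "r > 0" "Y holomorphic_on ball l r" "Y l = y"
    "\<forall>z\<in>ball l r. (Y z)\<^sup>2 = z * poly a z \<and> z * poly a z \<noteq> 0"
    "\<forall>z\<in>ball l r. \<forall>w. w\<^sup>2 = z * poly a z \<longrightarrow> Re (w / y) > 0 \<longrightarrow> w = Y z"
    "\<forall>z\<in>ball l r. ((\<lambda>z. h z (Y z)) has_derivative (\<lambda>d. Re (poly b z * d / (z * Y z)))) (at z)"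
proof -
  obtain r Y where Y: "r > 0" "Y holomorphic_on ball l r" "Y l = y"
    "\<And>z. z \<in> ball l r \<Longrightarrow> (Y z)\<^sup>2 = z * poly a z \<and> z * poly a z \<noteq> 0 \<and> Re (Y z / y) > 0"
    using sqrt_branch[OF y] by blast
  have der: "((\<lambda>z. h z (Y z)) has_derivative (\<lambda>d. Re (poly b z * d / (z * Y z)))) (at z)" if "z \<in> ball l r" for z
  proof -
    have sub: "ball z (r - dist l z) \<subseteq> ball l r" by (simp add: ball_subset_ball_iff dist_commute)
    then have "Y holomorphic_on ball z (r - dist l z)" using Y(2) holomorphic_on_subset by blast
    then show ?thesis using pot that sub Y(4) unfolding potential_def
      by (elim conjE allE[of _ Y] allE[of _ "r - dist l z"] allE[of _ z]) (auto simp: subset_iff)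
  qed
  show ?thesis
  proof (rule that[OF Y(1,2,3)])
    have "w = Y z" if "z \<in> ball l r" "w\<^sup>2 = z * poly a z" "Re (w / y) > 0" for z w
      using sqrt_branch_unique[of w "Y z" y] Y(4)[OF that(1)] that by auto
    then show "\<forall>z\<in>ball l r. \<forall>w. w\<^sup>2 = z * poly a z \<longrightarrow> Re (w / y) > 0 \<longrightarrow> w = Y z" by blast
  qed (use Y(4) der in auto)
qed

lemma eventually_on_branch:
  fixes l y :: "'a::real_normed_vector \<Rightarrow> complex"
  assumes "continuous (at t within T) l" "continuous (at t within T) y" "y t \<noteq> 0" "r > 0"
  shows "\<forall>\<^sub>F u in at t within T. l u \<in> ball (l t) r \<and> Re (y u / y t) > 0 \<and> u \<in> T"
proof -
  have "((\<lambda>u. Re (y u / y t)) \<longlongrightarrow> Re (y t / y t)) (at t within T)"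
    using assms by (intro tendsto_intros) (auto simp: continuous_within)
  then have "\<forall>\<^sub>F u in at t within T. Re (y u / y t) > 0"
    using assms(3) by (intro order_tendstoD) auto
  moreover have "\<forall>\<^sub>F u in at t within T. dist (l u) (l t) < r"
    using assms by (auto simp: continuous_within tendsto_iff)
  moreover have "\<forall>\<^sub>F u in at t within T. u \<in> T" by (simp add: eventually_at_filter)
  ultimately show ?thesis by eventually_elim (auto simp: dist_commute)
qed

text \<open>Near \<open>t\<close> the lift \<open>y\<close> is a holomorphic branch composed with
  \<open>l\<close>, so continuity of \<open>y\<close> suffices. The set \<open>T\<close> will be a
  parameter interval of a path as well as an open set in the plane.\<close>

lemma potential_has_derivative:
  fixes l y :: "'a::real_normed_vector \<Rightarrow> complex"
  assumes pot: "potential a b h"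
    and curve: "\<And>u. u \<in> T \<Longrightarrow> (y u)\<^sup>2 = l u * poly a (l u)"
    and t: "t \<in> T" "y t \<noteq> 0"
    and l: "(l has_derivative l') (at t within T)" and y: "continuous (at t within T) y"
  shows "((\<lambda>u. h (l u) (y u)) has_derivative (\<lambda>d. Re (poly b (l t) * l' d / (l t * y t)))) (at t within T)"
proof -
  obtain r Y where Y': "r > 0" "Y holomorphic_on ball (l t) r" "Y (l t) = y t"
    "\<forall>z\<in>ball (l t) r. (Y z)\<^sup>2 = z * poly a z \<and> z * poly a z \<noteq> 0"
    "\<forall>z\<in>ball (l t) r. \<forall>w. w\<^sup>2 = z * poly a z \<longrightarrow> Re (w / y t) > 0 \<longrightarrow> w = Y z"
    "\<forall>z\<in>ball (l t) r. ((\<lambda>z. h z (Y z)) has_derivative (\<lambda>d. Re (poly b z * d / (z * Y z)))) (at z)"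
    using potential_local[OF pot curve[OF t(1)] t(2)] by blast
  note Y = Y'(1,3) Y'(5,6)[rule_format]
  have "((\<lambda>u. h (l u) (Y (l u))) has_derivative (\<lambda>d. Re (poly b (l t) * l' d / (l t * Y (l t))))) (at t within T)"
    by (rule has_derivative_compose[OF l Y(4)]) (use Y(1) in auto)
  then show ?thesis unfolding Y(2)
  proof (rule has_derivative_transform_eventually)
    show "\<forall>\<^sub>F u in at t within T. h (l u) (Y (l u)) = h (l u) (y u)"
      using eventually_on_branch[OF has_derivative_continuous[OF l] y t(2) Y(1)]
    proof eventually_elim
      case (elim u)
      then have "y u = Y (l u)" by (intro Y(3)[OF _ curve]) simp_all
      then show ?case by simp
    qed
  qed (use Y(2) t in auto)
qed

text \<open>Needed at the corners of piecewise smooth paths, where no derivative is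
  available.\<close>

lemma potential_continuous:
  fixes l y :: "'a::real_normed_vector \<Rightarrow> complex"
  assumes pot: "potential a b h"
    and curve: "\<And>u. u \<in> T \<Longrightarrow> (y u)\<^sup>2 = l u * poly a (l u)"
    and t: "t \<in> T" "y t \<noteq> 0"
    and l: "continuous (at t within T) l" and y: "continuous (at t within T) y"
  shows "continuous (at t within T) (\<lambda>u. h (l u) (y u))"
proof -
  obtain r Y where Y': "r > 0" "Y holomorphic_on ball (l t) r" "Y (l t) = y t"
    "\<forall>z\<in>ball (l t) r. (Y z)\<^sup>2 = z * poly a z \<and> z * poly a z \<noteq> 0"
    "\<forall>z\<in>ball (l t) r. \<forall>w. w\<^sup>2 = z * poly a z \<longrightarrow> Re (w / y t) > 0 \<longrightarrow> w = Y z"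
    "\<forall>z\<in>ball (l t) r. ((\<lambda>z. h z (Y z)) has_derivative (\<lambda>d. Re (poly b z * d / (z * Y z)))) (at z)"
    using potential_local[OF pot curve[OF t(1)] t(2)] by blast
  note Y = Y'(1,3) Y'(5,6)[rule_format]
  have "isCont (\<lambda>z. h z (Y z)) (l t)"
    by (rule has_derivative_continuous[OF Y(4)]) (use Y(1) in auto)
  from isCont_tendsto_compose[OF this l[unfolded continuous_within]]
  have "((\<lambda>u. h (l u) (Y (l u))) \<longlongrightarrow> h (l t) (Y (l t))) (at t within T)" .
  moreover have "\<forall>\<^sub>F u in at t within T. h (l u) (Y (l u)) = h (l u) (y u)"
    using eventually_on_branch[OF l y t(2) Y(1)]
  proof eventually_elim
    case (elim u)
    then have "y u = Y (l u)" by (intro Y(3)[OF _ curve]) simp_all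
    then show ?case by simp
  qed
  ultimately have "((\<lambda>u. h (l u) (y u)) \<longlongrightarrow> h (l t) (Y (l t))) (at t within T)"
    by (rule Lim_transform_eventually)
  then show ?thesis by (simp add: continuous_within Y(2))
qed

section \<open>Parity and primitives at the branch points\<close>

lemma has_field_derivative_mirror:
  fixes f :: "complex \<Rightarrow> complex"
  assumes "(f has_field_derivative D) (at (- s))"
  shows "((\<lambda>s. f (- s)) has_field_derivative - D) (at s)"
  using DERIV_chain2[OF assms DERIV_minus[OF DERIV_ident]] by simp

text \<open>Two successive difference quotients at 0; evenness makes \<open>deriv f 0\<close>
  vanish. This is what excludes a residue of the differential over \<lambda> = 0.\<close>

lemma even_removable:
  assumes N: "open N" "0 \<in> N" "\<And>s. s \<in> N \<Longrightarrow> - s \<in> N"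
    and f: "f holomorphic_on N" "\<And>s::complex. s \<in> N \<Longrightarrow> f (- s) = f s"
  obtains g where "g holomorphic_on N" "\<And>s. s \<in> N \<Longrightarrow> g (- s) = g s" "\<And>s. s \<in> N \<Longrightarrow> f s = f 0 + s\<^sup>2 * g s"
proof -
  define f1 where "f1 = (\<lambda>s. if s = 0 then deriv f 0 else (f s - f 0) / (s - 0))"
  have int: "0 \<in> interior N" using N interior_open by auto
  have f1: "f1 holomorphic_on N" unfolding f1_def by (rule pole_lemma[OF f(1) int])
  define g where "g = (\<lambda>s. if s = 0 then deriv f1 0 else (f1 s - f1 0) / (s - 0))"
  have g: "g holomorphic_on N" unfolding g_def by (rule pole_lemma[OF f1 int])
  have df: "(f has_field_derivative deriv f 0) (at 0)"
    using f(1) N holomorphic_derivI by blast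
  have "((\<lambda>s. f (- s)) has_field_derivative - deriv f 0) (at 0)"
    using df has_field_derivative_mirror[of f "deriv f 0" 0] by simp
  then have "(f has_field_derivative - deriv f 0) (at 0)"
    by (rule has_field_derivative_transform_within_open[OF _ N(1,2)]) (use f(2) in auto)
  then have "deriv f 0 = - deriv f 0" using df DERIV_unique by blast
  then have d0: "deriv f 0 = 0" by simp
  show ?thesis
  proof (rule that[OF g])
    fix s assume s: "s \<in> N"
    show "g (- s) = g s" using f(2)[OF s] d0 by (auto simp: g_def f1_def field_simps)
    show "f s = f 0 + s\<^sup>2 * g s" using d0 by (auto simp: g_def f1_def field_simps power2_eq_square)
  qed
qed

text \<open>Antisymmetrising a primitive of an even function fixes the constant of
  integration.\<close>

lemma odd_primitive:
  assumes N: "open N" "0 \<in> N" "\<And>s. s \<in> N \<Longrightarrow> closed_segment 0 s \<subseteq> N" "\<And>s. s \<in> N \<Longrightarrow> - s \<in> N"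
    and f: "f holomorphic_on N" "\<And>s::complex. s \<in> N \<Longrightarrow> f (- s) = f s"
  obtains F where "\<And>s. F (- s) = - F s" "\<And>s. s \<in> N \<Longrightarrow> (F has_field_derivative f s) (at s)"
proof -
  have "starlike N" using N(2,3) by (auto simp: starlike_def)
  then obtain G where G: "\<And>s. s \<in> N \<Longrightarrow> (G has_field_derivative f s) (at s)"
    using holomorphic_starlike_primitive[of N f "{}"] N(1) f(1)
    by (metis Diff_empty finite.emptyI holomorphic_on_imp_continuous_on holomorphic_on_open
        field_differentiable_def)
  define F where "F = (\<lambda>s. (G s - G (- s)) / 2)"
  show ?thesis
  proof
    show "F (- s) = - F s" for s by (simp add: F_def field_simps)
    fix s assume s: "s \<in> N"
    have "((\<lambda>s. G (- s)) has_field_derivative f (- s) * - 1) (at s)"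
      using has_field_derivative_mirror[OF G[OF N(4)[OF s]]] by simp
    from DERIV_cdivide[OF DERIV_diff[OF G[OF s] this]]
    have "(F has_field_derivative (f s - f (- s) * - 1) / 2) (at s)"
      unfolding F_def .
    then show "(F has_field_derivative f s) (at s)" using f(2)[OF s] by simp
  qed
qed

text \<open>With \<lambda> = x + \<kappa> s^2 and y = s E, the zero of d\<lambda> at s = 0 cancels
  that of y, and the differential b d\<lambda> / (\<lambda> y) becomes an even function of s times
  ds. Over x = 0 it has a double pole without residue, and \<open>- k / s\<close> is the principal
  part of its primitive.\<close>

lemma branch_primitive:
  fixes E :: "complex \<Rightarrow> complex"
  assumes N: "open N" "0 \<in> N" "\<And>s. s \<in> N \<Longrightarrow> closed_segment 0 s \<subseteq> N" "\<And>s. s \<in> N \<Longrightarrow> - s \<in> N"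
    and E: "E holomorphic_on N" "\<And>s. s \<in> N \<Longrightarrow> E (- s) = E s" "\<And>s. s \<in> N \<Longrightarrow> E s \<noteq> 0"
    and \<kappa>: "\<kappa> \<noteq> 0" and nz: "\<And>s. s \<in> N \<Longrightarrow> x \<noteq> 0 \<Longrightarrow> x + \<kappa> * s\<^sup>2 \<noteq> 0"
  obtains F k where "\<forall>s. F (- s) = - F s" "F holomorphic_on N"
    "\<forall>s\<in>N. s \<noteq> 0 \<longrightarrow>
      ((\<lambda>s. F s - k / s) has_field_derivative 2 * \<kappa> * poly b (x + \<kappa> * s\<^sup>2) / ((x + \<kappa> * s\<^sup>2) * E s)) (at s)"
    "x = 0 \<longrightarrow> k = 2 * poly b 0 / E 0" "x \<noteq> 0 \<longrightarrow> k = 0"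
    "x \<noteq> 0 \<longrightarrow> (\<forall>s\<in>N.
      (F has_field_derivative 2 * \<kappa> * poly b (x + \<kappa> * s\<^sup>2) / ((x + \<kappa> * s\<^sup>2) * E s)) (at s))"
proof (cases "x = 0")
  case False
  define f where "f = (\<lambda>s. 2 * \<kappa> * poly b (x + \<kappa> * s\<^sup>2) / ((x + \<kappa> * s\<^sup>2) * E s))"
  have f1: "f holomorphic_on N" unfolding f_def using nz E(3) False
    by (intro holomorphic_intros E(1)) auto
  have f2: "f (- s) = f s" if "s \<in> N" for s using E(2)[OF that] by (simp add: f_def)
  obtain F where F: "\<And>s. F (- s) = - F s" "\<And>s. s \<in> N \<Longrightarrow> (F has_field_derivative f s) (at s)"
    using odd_primitive[OF N f1 f2] by metis
  have "F holomorphic_on N" using F(2) N(1) by (auto simp: holomorphic_on_open)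
  then show ?thesis using F False by (intro that[of F 0]) (auto simp: f_def)
next
  case True
  define f where "f = (\<lambda>s. 2 * poly b (\<kappa> * s\<^sup>2) / E s)"
  have f1: "f holomorphic_on N" unfolding f_def using E(3) by (intro holomorphic_intros E(1)) auto
  have f2: "f (- s) = f s" if "s \<in> N" for s using E(2)[OF that] by (simp add: f_def)
  obtain g where g: "g holomorphic_on N" "\<And>s. s \<in> N \<Longrightarrow> g (- s) = g s" "\<And>s. s \<in> N \<Longrightarrow> f s = f 0 + s\<^sup>2 * g s"
    using even_removable[OF N(1,2,4) f1 f2] by blast
  obtain F where F: "\<And>s. F (- s) = - F s" "\<And>s. s \<in> N \<Longrightarrow> (F has_field_derivative g s) (at s)"
    using odd_primitive[OF N g(1,2)] by metis
  have "((\<lambda>s. F s - f 0 / s) has_field_derivative 2 * \<kappa> * poly b (x + \<kappa> * s\<^sup>2) / ((x + \<kappa> * s\<^sup>2) * E s)) (at s)"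
    if s: "s \<in> N" "s \<noteq> 0" for s
  proof -
    have "((\<lambda>s. F s - f 0 / s) has_field_derivative g s + f 0 / s\<^sup>2) (at s)"
    proof -
      have "((\<lambda>s. f 0 / s) has_field_derivative - (f 0 / s\<^sup>2)) (at s)"
        using s(2) by (auto intro!: derivative_eq_intros simp: power2_eq_square)
      from DERIV_diff[OF F(2)[OF s(1)] this] show ?thesis by simp
    qed
    moreover have "g s + f 0 / s\<^sup>2 = f s / s\<^sup>2"
      by (subst g(3)[OF s(1)]) (use s in \<open>simp add: add_divide_distrib\<close>)
    moreover have "f s / s\<^sup>2 = 2 * \<kappa> * poly b (x + \<kappa> * s\<^sup>2) / ((x + \<kappa> * s\<^sup>2) * E s)"
      using True s \<kappa> E(3)[OF s(1)] by (simp add: f_def)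
    ultimately show ?thesis by simp
  qed
  moreover have "F holomorphic_on N" using F(2) N(1) by (auto simp: holomorphic_on_open)
  ultimately show ?thesis using F True by (intro that[of F "f 0"]) (auto simp: f_def)
qed

text \<open>Equivalently, \<open>l * poly a l\<close> has only simple zeros, so each of them is a
  simple branch point of the curve.\<close>

definition regular :: "complex poly \<Rightarrow> bool" where
  "regular a \<longleftrightarrow> poly a 0 \<noteq> 0 \<and> rsquarefree a"

lemma regular_branch:
  assumes "regular a" "x * poly a x = 0"
  obtains e where "\<forall>z. z * poly a z = (z - x) * poly e z" "poly e x \<noteq> 0"
proof (cases "x = 0")
  case True
  then show ?thesis using assms that[of a] by (auto simp: regular_def)
next
  case False
  then have "poly a x = 0" using assms by simp
  then obtain c where c: "a = [:-x, 1:] * c" by (auto simp: poly_eq_0_iff_dvd dvd_def)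
  have "poly (pderiv a) x \<noteq> 0" using assms(1) \<open>poly a x = 0\<close>
    by (auto simp: regular_def rsquarefree_roots)
  then have "poly c x \<noteq> 0" by (auto simp: c pderiv_mult pderiv_pCons pderiv_diff pderiv_smult)
  then show ?thesis using False by (intro that[of "[:0, 1:] * c"]) (auto simp: c algebra_simps)
qed

text \<open>Near a branch point \<open>x\<close> the curve is parametrised by \<open>s \<mapsto> (x + s\<^sup>2, s E (x + s\<^sup>2))\<close>.\<close>

definition branch_chart :: "complex poly \<Rightarrow> complex \<Rightarrow> real \<Rightarrow> (complex \<Rightarrow> complex) \<Rightarrow> complex poly \<Rightarrow> bool" where
  "branch_chart a x \<rho> E e \<longleftrightarrow> \<rho> > 0 \<and> E holomorphic_on ball x (\<rho>\<^sup>2) \<and>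
     (\<forall>z\<in>ball x (\<rho>\<^sup>2). (E z)\<^sup>2 = poly e z \<and> E z \<noteq> 0 \<and> poly e z \<noteq> 0) \<and>
     (\<forall>z. z * poly a z = (z - x) * poly e z) \<and> (x \<noteq> 0 \<longrightarrow> \<rho>\<^sup>2 \<le> cmod x)"

text \<open>The disc around \<open>x\<close> has radius \<open>\<rho>\<^sup>2\<close> because it is
  the image of the parameter disc of radius \<open>\<rho>\<close>. For \<open>x \<noteq> 0\<close>
  the bound by \<open>cmod x\<close> keeps the pole at \<lambda> = 0 outside.\<close>

lemma exists_branch_chart:
  assumes reg: "regular a" and x: "x * poly a x = 0"
  obtains \<rho> E e where "branch_chart a x \<rho> E e"
proof -
  obtain e where e': "\<forall>z. z * poly a z = (z - x) * poly e z" and e2: "poly e x \<noteq> 0"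
    using regular_branch[OF reg x] by blast
  note e = e'[rule_format] e2
  have "isCont (poly e) x" by simp
  then have "\<exists>r>0. \<forall>z. dist z x < r \<longrightarrow> dist (poly e z) (poly e x) < cmod (poly e x)"
    using e(2) unfolding continuous_at_eps_delta by simp
  then obtain r where r: "r > 0" "\<And>z. dist z x < r \<Longrightarrow> dist (poly e z) (poly e x) < cmod (poly e x)" by auto
  define \<rho> where "\<rho> = sqrt (if x = 0 then r else min r (cmod x))"
  have \<rho>: "\<rho> > 0" "\<rho>\<^sup>2 \<le> r" "x \<noteq> 0 \<Longrightarrow> \<rho>\<^sup>2 \<le> cmod x" using r(1) by (auto simp: \<rho>_def)
  have enz: "poly e z \<noteq> 0" if "z \<in> ball x (\<rho>\<^sup>2)" for z
    using r(2)[of z] that \<rho>(2) by (auto simp: dist_commute)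
  obtain E where E: "E holomorphic_on ball x (\<rho>\<^sup>2)" "\<And>z. z \<in> ball x (\<rho>\<^sup>2) \<Longrightarrow> poly e z = (E z)\<^sup>2"
  proof -
    have "poly e holomorphic_on ball x (\<rho>\<^sup>2)" by (intro holomorphic_intros)
    from contractible_imp_holomorphic_sqrt[OF this convex_imp_contractible[OF convex_ball] enz]
    show ?thesis using that by blast
  qed
  have Enz: "E z \<noteq> 0" if "z \<in> ball x (\<rho>\<^sup>2)" for z using E(2)[OF that] enz[OF that] by auto
  show ?thesis
    by (rule that[of \<rho> E e]) (use \<rho> E enz Enz e in \<open>auto simp: branch_chart_def\<close>)
qed

text \<open>The definition of \<open>potential\<close> asks for no regularity at branch points; it
  is recovered here. On the punctured parameter disc, \<open>h\<close> and the real part of the odd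
  primitive have the same derivative, so they differ by a constant, and the constant is 0 because
  both are odd.\<close>

lemma potential_in_chart:
  assumes pot: "potential a b h" and ch: "branch_chart a x \<rho> E e"
  obtains F k where
    "F holomorphic_on ball 0 \<rho>" "\<forall>s. F (- s) = - F s"
    "\<forall>s\<in>ball 0 \<rho>. s \<noteq> 0 \<longrightarrow> h (x + s\<^sup>2) (s * E (x + s\<^sup>2)) = Re (F s - k / s)"
    "x = 0 \<longrightarrow> k = 2 * poly b 0 / E 0"
    "\<forall>s\<in>ball 0 \<rho>. s \<noteq> 0 \<longrightarrow> ((\<lambda>s. F s - k / s) has_field_derivative 2 * poly b (x + s\<^sup>2) / ((x + s\<^sup>2) * E (x + s\<^sup>2))) (at s)"
    "x \<noteq> 0 \<longrightarrow> k = 0 \<and> (\<forall>s\<in>ball 0 \<rho>. (F has_field_derivative 2 * poly b (x + s\<^sup>2) / ((x + s\<^sup>2) * E (x + s\<^sup>2))) (at s))"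
proof -
  have \<rho>: "\<rho> > 0" "x \<noteq> 0 \<Longrightarrow> \<rho>\<^sup>2 \<le> cmod x" and E1: "E holomorphic_on ball x (\<rho>\<^sup>2)"
    and E2: "\<And>z. z \<in> ball x (\<rho>\<^sup>2) \<Longrightarrow> poly e z = (E z)\<^sup>2"
    and Enz: "\<And>z. z \<in> ball x (\<rho>\<^sup>2) \<Longrightarrow> E z \<noteq> 0"
    and e: "\<And>z. z * poly a z = (z - x) * poly e z"
    using ch by (auto simp: branch_chart_def)
  note E = E1 E2
  define N where "N = ball (0::complex) \<rho>"
  have sq: "x + s\<^sup>2 \<in> ball x (\<rho>\<^sup>2)" if "s \<in> N" for s
    using that by (auto simp: N_def dist_norm norm_power intro!: power_strict_mono)
  have nz: "x + 1 * s\<^sup>2 \<noteq> 0" if "s \<in> N" "x \<noteq> 0" for s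
  proof
    assume "x + 1 * s\<^sup>2 = 0"
    then have "cmod x = cmod s ^ 2" by (metis mult_1 neg_eq_iff_add_eq_0 norm_minus_cancel norm_power)
    then show False using sq[OF that(1)] \<rho>(2)[OF that(2)] by (simp add: dist_norm norm_power)
  qed
  have N: "open N" "0 \<in> N" "\<And>s. s \<in> N \<Longrightarrow> closed_segment 0 s \<subseteq> N" "\<And>s. s \<in> N \<Longrightarrow> - s \<in> N"
  proof -
    show "closed_segment 0 s \<subseteq> N" if "s \<in> N" for s
      using that \<rho>(1) unfolding N_def by (intro closed_segment_subset) auto
  qed (use \<rho>(1) in \<open>auto simp: N_def\<close>)
  have EN: "(\<lambda>s. E (x + s\<^sup>2)) holomorphic_on N"
  proof -
    have "(E \<circ> (\<lambda>s. x + s\<^sup>2)) holomorphic_on N"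
      by (rule holomorphic_on_compose_gen[OF _ E(1)]) (use sq in \<open>auto intro!: holomorphic_intros\<close>)
    then show ?thesis by (simp add: o_def)
  qed
  have Ev: "E (x + (- s)\<^sup>2) = E (x + s\<^sup>2)" for s by simp
  have En: "E (x + s\<^sup>2) \<noteq> 0" if "s \<in> N" for s using Enz[OF sq[OF that]] .
  obtain F k where F': "\<forall>s. F (- s) = - F s" and F2: "F holomorphic_on N"
    and F3: "\<forall>s\<in>N. s \<noteq> 0 \<longrightarrow>
      ((\<lambda>s. F s - k / s) has_field_derivative 2 * 1 * poly b (x + 1 * s\<^sup>2) / ((x + 1 * s\<^sup>2) * E (x + s\<^sup>2))) (at s)"
    and F4: "x = 0 \<longrightarrow> k = 2 * poly b 0 / E (x + 0\<^sup>2)" "x \<noteq> 0 \<longrightarrow> k = 0"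
    "x \<noteq> 0 \<longrightarrow> (\<forall>s\<in>N.
      (F has_field_derivative 2 * 1 * poly b (x + 1 * s\<^sup>2) / ((x + 1 * s\<^sup>2) * E (x + s\<^sup>2))) (at s))"
    using branch_primitive[OF N EN Ev En one_neq_zero nz, of b] by blast
  note F = F'[rule_format] F2 F3[rule_format] F4[rule_format]
  define \<eta> where "\<eta> = (\<lambda>s. h (x + s\<^sup>2) (s * E (x + s\<^sup>2)) - Re (F s - k / s))"
  have curve: "(s * E (x + s\<^sup>2))\<^sup>2 = (x + s\<^sup>2) * poly a (x + s\<^sup>2)" if "s \<in> N" for s
    using E(2)[OF sq[OF that]] e[of "x + s\<^sup>2"] by (simp add: power_mult_distrib)
  have d0: "(\<eta> has_derivative (\<lambda>_. 0)) (at s)" if s: "s \<in> N - {0}" for s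
  proof -
    have op: "open (N - {0})" using N(1) by auto
    have 1: "((\<lambda>s. h (x + s\<^sup>2) (s * E (x + s\<^sup>2))) has_derivative
      (\<lambda>d. Re (poly b (x + s\<^sup>2) * (2 * s * d) / ((x + s\<^sup>2) * (s * E (x + s\<^sup>2)))))) (at s within (N - {0}))"
    proof (rule potential_has_derivative[OF pot])
      show "((\<lambda>s. x + s\<^sup>2) has_derivative (\<lambda>d. 2 * s * d)) (at s within (N - {0}))"
        by (auto intro!: derivative_eq_intros)
      have "continuous_on N (\<lambda>s. s * E (x + s\<^sup>2))"
        by (intro holomorphic_on_imp_continuous_on holomorphic_intros EN)
      then show "continuous (at s within (N - {0})) (\<lambda>s. s * E (x + s\<^sup>2))"
        using s by (meson Diff_subset continuous_on_eq_continuous_within continuous_on_subset)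
      show "s * E (x + s\<^sup>2) \<noteq> 0" using s Enz sq by auto
    qed (use s curve in auto)
    have "((\<lambda>s. F s - k / s) has_derivative (\<lambda>d. 2 * 1 * poly b (x + 1 * s\<^sup>2) / ((x + 1 * s\<^sup>2) * E (x + s\<^sup>2)) * d)) (at s)"
      using F(3)[of s, unfolded has_field_derivative_def] s by blast
    then have "((\<lambda>s. Re (F s - k / s)) has_derivative (\<lambda>d. Re (2 * poly b (x + s\<^sup>2) / ((x + s\<^sup>2) * E (x + s\<^sup>2)) * d))) (at s)"
      using has_derivative_Re by fastforce
    then have "(\<eta> has_derivative (\<lambda>d. Re (poly b (x + s\<^sup>2) * (2 * s * d) / ((x + s\<^sup>2) * (s * E (x + s\<^sup>2)))) -
        Re (2 * poly b (x + s\<^sup>2) / ((x + s\<^sup>2) * E (x + s\<^sup>2)) * d))) (at s)"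
      unfolding \<eta>_def using 1 s at_within_open[OF s op] by (intro has_derivative_diff) auto
    moreover have "poly b (x + s\<^sup>2) * (2 * s * d) / ((x + s\<^sup>2) * (s * E (x + s\<^sup>2))) =
       2 * poly b (x + s\<^sup>2) / ((x + s\<^sup>2) * E (x + s\<^sup>2)) * d" for d
    proof -
      have "poly b (x + s\<^sup>2) * (2 * s * d) / ((x + s\<^sup>2) * (s * E (x + s\<^sup>2))) =
        (s * (2 * poly b (x + s\<^sup>2) * d)) / (s * ((x + s\<^sup>2) * E (x + s\<^sup>2)))"
        by (simp add: mult_ac)
      also have "\<dots> = (2 * poly b (x + s\<^sup>2) * d) / ((x + s\<^sup>2) * E (x + s\<^sup>2))"
        using s by (intro nonzero_mult_divide_mult_cancel_left) auto
      finally show ?thesis by simp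
    qed
    ultimately show ?thesis by simp
  qed
  have "connected (N - {0})" using connected_open_delete[OF N(1)] by (simp add: N_def)
  moreover have "open (N - {0})" using N(1) by auto
  ultimately have "\<eta> constant_on (N - {0})"
    by (intro has_derivative_zero_connected_constant_on[of _ "{}"])
      (auto intro!: continuous_at_imp_continuous_on has_derivative_at_withinI d0 has_derivative_continuous[OF d0])
  then obtain c where c: "\<And>s. s \<in> N \<Longrightarrow> s \<noteq> 0 \<Longrightarrow> \<eta> s = c" by (auto simp: constant_on_def)
  have "\<eta> (- s) = - \<eta> s" if "s \<in> N" for s
    using potential_odd[OF pot curve[OF that]] by (simp add: \<eta>_def F(1))
  moreover obtain s0 where s0: "s0 \<in> N" "s0 \<noteq> 0"
    using \<rho>(1) by (intro that[of "of_real (\<rho> / 2)"]) (auto simp: N_def)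
  ultimately have "c = - c" using c[of s0] c[of "- s0"] N(4) by auto
  then have \<eta>0: "\<eta> s = 0" if "s \<in> N" "s \<noteq> 0" for s using c that by auto
  show ?thesis
  proof (rule that[of F k])
    show "\<forall>s\<in>ball 0 \<rho>. s \<noteq> 0 \<longrightarrow> h (x + s\<^sup>2) (s * E (x + s\<^sup>2)) = Re (F s - k / s)"
      using \<eta>0 by (auto simp: \<eta>_def N_def)
    show "\<forall>s\<in>ball 0 \<rho>. s \<noteq> 0 \<longrightarrow> ((\<lambda>s. F s - k / s) has_field_derivative 2 * poly b (x + s\<^sup>2) / ((x + s\<^sup>2) * E (x + s\<^sup>2))) (at s)"
      using F(3) by (auto simp: N_def)
    show "x \<noteq> 0 \<longrightarrow> k = 0 \<and> (\<forall>s\<in>ball 0 \<rho>. (F has_field_derivative 2 * poly b (x + s\<^sup>2) / ((x + s\<^sup>2) * E (x + s\<^sup>2))) (at s))"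
      using F(5,6) by (auto simp: N_def)
  qed (use F in \<open>auto simp: N_def\<close>)
qed

lemma potential_at_branch:
  assumes pot: "potential a b h" and reg: "regular a" and x: "x * poly a x = 0"
  obtains \<rho> E F k e where "\<rho> > 0" "E holomorphic_on ball x (\<rho>\<^sup>2)"
    "\<forall>z\<in>ball x (\<rho>\<^sup>2). (E z)\<^sup>2 = poly e z \<and> E z \<noteq> 0 \<and> poly e z \<noteq> 0"
    "\<forall>z. z * poly a z = (z - x) * poly e z"
    "F holomorphic_on ball 0 \<rho>" "\<forall>s. F (- s) = - F s"
    "\<forall>s\<in>ball 0 \<rho>. s \<noteq> 0 \<longrightarrow> h (x + s\<^sup>2) (s * E (x + s\<^sup>2)) = Re (F s - k / s)"
    "x = 0 \<longrightarrow> k = 2 * poly b 0 / E 0"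
    "\<forall>s\<in>ball 0 \<rho>. s \<noteq> 0 \<longrightarrow> ((\<lambda>s. F s - k / s) has_field_derivative 2 * poly b (x + s\<^sup>2) / ((x + s\<^sup>2) * E (x + s\<^sup>2))) (at s)"
    "x \<noteq> 0 \<longrightarrow> k = 0 \<and> (\<forall>s\<in>ball 0 \<rho>. (F has_field_derivative 2 * poly b (x + s\<^sup>2) / ((x + s\<^sup>2) * E (x + s\<^sup>2))) (at s))"
proof -
  obtain \<rho> E e where ch: "branch_chart a x \<rho> E e" by (rule exists_branch_chart[OF reg x])
  show ?thesis
    by (rule potential_in_chart[OF pot ch], rule that)
      (use ch in \<open>auto simp: branch_chart_def\<close>)
qed

lemma finite_branch_points: "regular a \<Longrightarrow> finite {x. x * poly a x = 0}"
proof -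
  assume "regular a"
  then have "a \<noteq> 0" by (auto simp: regular_def)
  then have "[:0, 1:] * a \<noteq> 0" by simp
  from poly_roots_finite[OF this] show ?thesis by simp
qed

lemma connected_nonbranch:
  assumes "regular a"
  shows "connected (UNIV - {x. x * poly a x = 0})" "open (UNIV - {x. x * poly a x = 0})"
  using connected_open_delete_finite[OF open_UNIV connected_UNIV _ finite_branch_points[OF assms]]
    open_Diff[OF open_UNIV finite_imp_closed[OF finite_branch_points[OF assms]]] by simp_all

text \<open>Uniqueness of the potential of a given \<open>b\<close>, applied to differences. The
  square of \<open>h\<close> descends to the \<lambda>-plane and is constant off the branch points,
  whose complement is connected; in the chart at 0 the odd primitive is constant, hence 0.\<close>

lemma potential_of_zero:
  assumes pot: "potential a 0 h" and reg: "regular a" and y: "y\<^sup>2 = l * poly a l"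
  shows "h l y = 0"
proof -
  define U where "U = UNIV - {x. x * poly a x = 0}"
  define v where "v = (\<lambda>l. (h l (csqrt (l * poly a l)))\<^sup>2)"
  have v: "v l = (h l y)\<^sup>2" if "y\<^sup>2 = l * poly a l" for l y
    using potential_abs[OF pot that, of "csqrt (l * poly a l)"] unfolding v_def
    by (metis power2_abs power2_csqrt)
  have d0: "(v has_derivative (\<lambda>_. 0)) (at l)" if l: "l \<in> U" for l
  proof -
    have cs: "(csqrt (l * poly a l))\<^sup>2 = l * poly a l" "csqrt (l * poly a l) \<noteq> 0"
      using l by (auto simp: U_def)
    obtain r Y where Y': "r > 0" "Y holomorphic_on ball l r" "Y l = csqrt (l * poly a l)"
    "\<forall>z\<in>ball l r. (Y z)\<^sup>2 = z * poly a z \<and> z * poly a z \<noteq> 0"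
    "\<forall>z\<in>ball l r. \<forall>w. w\<^sup>2 = z * poly a z \<longrightarrow> Re (w / csqrt (l * poly a l)) > 0 \<longrightarrow> w = Y z"
    "\<forall>z\<in>ball l r. ((\<lambda>z. h z (Y z)) has_derivative (\<lambda>d. Re (poly 0 z * d / (z * Y z)))) (at z)"
      by (rule potential_local[OF pot cs]) (rule that)
    note Y = Y'(1,4,6)
    have "((\<lambda>z. h z (Y z)) has_derivative (\<lambda>_. 0)) (at l)"
      using bspec[OF Y(3), of l] Y(1) by simp
    then have "((\<lambda>z. h z (Y z) * h z (Y z)) has_derivative (\<lambda>_. 0)) (at l)"
      using has_derivative_mult[of "\<lambda>z. h z (Y z)" "\<lambda>_. 0" l UNIV "\<lambda>z. h z (Y z)" "\<lambda>_. 0"] by simp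
    then show ?thesis
    proof (rule has_derivative_transform_within_open[OF _ open_ball])
      fix z assume "z \<in> ball l r"
      then have "(Y z)\<^sup>2 = z * poly a z" using Y(2) by blast
      from v[OF this] show "h z (Y z) * h z (Y z) = v z" by (simp only: power2_eq_square)
    qed (use Y(1) in simp)
  qed
  have "v constant_on U"
    using connected_nonbranch[OF reg] unfolding U_def[symmetric]
    by (intro has_derivative_zero_connected_constant_on[of _ "{}"])
      (auto intro!: continuous_at_imp_continuous_on has_derivative_at_withinI d0 has_derivative_continuous[OF d0])
  then obtain c where c: "\<And>l. l \<in> U \<Longrightarrow> v l = c" by (auto simp: constant_on_def)
  have z0: "(0::complex) * poly a 0 = 0" by simp
  obtain \<rho> E F k e where B': "\<rho> > 0" "E holomorphic_on ball 0 (\<rho>\<^sup>2)"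
    "\<forall>z\<in>ball 0 (\<rho>\<^sup>2). (E z)\<^sup>2 = poly e z \<and> E z \<noteq> 0 \<and> poly e z \<noteq> 0"
    "\<forall>z. z * poly a z = (z - 0) * poly e z"
    "F holomorphic_on ball 0 \<rho>" "\<forall>s. F (- s) = - F s"
    "\<forall>s\<in>ball 0 \<rho>. s \<noteq> 0 \<longrightarrow> h (0 + s\<^sup>2) (s * E (0 + s\<^sup>2)) = Re (F s - k / s)"
    "0 = (0::complex) \<longrightarrow> k = 2 * poly 0 0 / E 0"
    "\<forall>s\<in>ball 0 \<rho>. s \<noteq> 0 \<longrightarrow> ((\<lambda>s. F s - k / s) has_field_derivative 2 * poly 0 (0 + s\<^sup>2) / ((0 + s\<^sup>2) * E (0 + s\<^sup>2))) (at s)"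
    "(0::complex) \<noteq> 0 \<longrightarrow> k = 0 \<and> (\<forall>s\<in>ball 0 \<rho>. (F has_field_derivative 2 * poly 0 (0 + s\<^sup>2) / ((0 + s\<^sup>2) * E (0 + s\<^sup>2))) (at s))"
    by (rule potential_at_branch[OF pot reg z0]) (rule that)
  note B = B'(1,3,4,6,7,8,5,9)
  have k: "k = 0" using B(6) by simp
  have "(F has_field_derivative 0) (at s)" if "s \<in> ball 0 \<rho>" "s \<noteq> 0" for s using B(8) that k by auto
  then have "F constant_on ball 0 \<rho>"
    by (intro DERIV_zero_connected_constant_on[of _ "{0}"] holomorphic_on_imp_continuous_on B(7)) auto
  then have F0: "F s = 0" if "s \<in> ball 0 \<rho>" for s
  proof -
    have "F s = F 0" using \<open>F constant_on ball 0 \<rho>\<close> that B(1) by (metis centre_in_ball constant_on_def)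
    moreover have "F 0 = 0" using B(4)[rule_format, of 0] by simp
    ultimately show ?thesis by simp
  qed
  define s where "s = complex_of_real (\<rho> / 2)"
  have s: "s \<in> ball 0 \<rho>" "s \<noteq> 0" using B(1) by (auto simp: s_def)
  have s2: "s\<^sup>2 \<in> ball 0 (\<rho>\<^sup>2)" using s(1) by (auto simp: norm_power intro!: power_strict_mono)
  have "h (s\<^sup>2) (s * E (s\<^sup>2)) = 0" using B(5)[rule_format, OF s] F0[OF s(1)] k by simp
  moreover have P: "s\<^sup>2 * poly a (s\<^sup>2) = (s * E (s\<^sup>2))\<^sup>2" "s\<^sup>2 * poly a (s\<^sup>2) \<noteq> 0"
    using B(2)[rule_format, OF s2] B(3)[rule_format, of "s\<^sup>2"] s(2) by (auto simp: power_mult_distrib)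
  moreover have "s\<^sup>2 \<in> U" using P(2) unfolding U_def by blast
  ultimately have "c = 0" using c[of "s\<^sup>2"] v[OF P(1)[symmetric]] by simp
  show ?thesis
  proof (cases "l * poly a l = 0")
    case True
    from y True have "y\<^sup>2 = 0" by (rule trans)
    then show ?thesis using potential_0[OF pot True] by simp
  next
    case False
    then show ?thesis using c[of l] \<open>c = 0\<close> v[OF y] by (auto simp: U_def)
  qed
qed

section \<open>Reflection in the unit circle and uniqueness\<close>

definition reflection_symmetric :: "nat \<Rightarrow> complex poly \<Rightarrow> bool" where
  "reflection_symmetric g a \<longleftrightarrow> (\<forall>l. l \<noteq> 0 \<longrightarrow> poly a l = l ^ (2 * g) * cnj (poly a (1 / cnj l)))"

lemma H_space_props:
  assumes "a \<in> H_space g"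
  shows "regular a" "reflection_symmetric g a" "degree a = 2 * g"
    "\<And>l. cmod l = 1 \<Longrightarrow> \<exists>t>0. poly a l = of_real t * l ^ g"
    "\<And>l. cmod l = 1 \<Longrightarrow> poly a l \<noteq> 0"
proof -
  have deg: "degree a = 2 * g" and re: "poly_star (2 * g) a = a" and sf: "rsquarefree a"
    and lc: "cmod (lead_coeff a) = 1" and pos: "\<And>l. cmod l = 1 \<Longrightarrow> poly a l / l ^ g \<in> \<real> \<and> Re (poly a l / l ^ g) > 0"
    using assms by (auto simp: H_space_def real_polys_iff)
  have "coeff a 0 = cnj (coeff a (2 * g))" using arg_cong[OF re, of "\<lambda>p. coeff p 0"] by (simp add: coeff_poly_star)
  then have "poly a 0 \<noteq> 0" using lc deg by (auto simp: poly_0_coeff_0)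
  then show "regular a" using sf by (simp add: regular_def)
  show "reflection_symmetric g a" unfolding reflection_symmetric_def
  proof (intro allI impI)
    fix l :: complex assume "l \<noteq> 0"
    from poly_poly_star[OF _ this, of a "2 * g"] re deg
    show "poly a l = l ^ (2 * g) * cnj (poly a (1 / cnj l))" by (metis order_refl)
  qed
  show "degree a = 2 * g" by (rule deg)
  fix l :: complex assume l: "cmod l = 1"
  define t where "t = Re (poly a l / l ^ g)"
  have "poly a l / l ^ g = of_real t" using pos[OF l] by (simp add: t_def complex_is_Real_iff complex_eq_iff)
  then have t: "poly a l = of_real t * l ^ g" "t > 0" using l pos[OF l] by (auto simp: t_def field_simps)
  then show "\<exists>t>0. poly a l = of_real t * l ^ g" by blast
  show "poly a l \<noteq> 0" using t l by auto
qed

text \<open>The antiholomorphic involution of the curve lying over \<lambda> \<mapsto> 1 / cnj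
  \<lambda>. At \<open>l = 0\<close> the convention for division by zero makes it fix the point
  \<open>(0, 0)\<close>.\<close>

lemma curve_reflect:
  assumes sym: "reflection_symmetric g a" and y: "y\<^sup>2 = l * poly a l"
  shows "(cnj y / cnj l ^ (g + 1))\<^sup>2 = (1 / cnj l) * poly a (1 / cnj l)"
proof (cases "l = 0")
  case False
  have *: "poly a l = l ^ (2 * g) * cnj (poly a (1 / cnj l))"
    using sym False unfolding reflection_symmetric_def by blast
  have "cnj (poly a l) = cnj l ^ (2 * g) * poly a (1 / cnj l)" by (subst *) simp
  moreover have "(cnj y)\<^sup>2 = cnj l * cnj (poly a l)" using y by (metis complex_cnj_mult complex_cnj_power)
  ultimately have "(cnj y)\<^sup>2 = cnj l * (cnj l ^ (2 * g) * poly a (1 / cnj l))" by simp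
  moreover have "(cnj l ^ (g + 1))\<^sup>2 = cnj l * cnj l * cnj l ^ (2 * g)"
  proof -
    have "(g + 1) * 2 = Suc (Suc (2 * g))" by simp
    then have "(cnj l ^ (g + 1))\<^sup>2 = cnj l ^ Suc (Suc (2 * g))" by (metis power_mult)
    then show ?thesis by simp
  qed
  ultimately show ?thesis using False by (simp add: power_divide)
qed (use y in auto)

text \<open>The minus sign stems from d\<lambda>/\<lambda>, which the reflection turns into minus
  its conjugate.\<close>

lemma potential_reflect:
  assumes pot: "potential a b h" and sym: "reflection_symmetric g a" and deg: "degree b \<le> g + 1"
  shows "potential a (- poly_star (g + 1) b) (\<lambda>l y. h (1 / cnj l) (cnj y / cnj l ^ (g + 1)))"
  unfolding potential_def
proof (intro conjI allI impI; (elim conjE)?)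
  fix l y :: complex assume "y\<^sup>2 = l * poly a l"
  from potential_odd[OF pot curve_reflect[OF sym this]]
  show "h (1 / cnj l) (cnj (- y) / cnj l ^ (g + 1)) = - h (1 / cnj l) (cnj y / cnj l ^ (g + 1))" by simp
next
  fix Y :: "complex \<Rightarrow> complex" and r :: real and l :: complex
  assume r: "0 < r" and Y: "Y holomorphic_on ball l r" "\<forall>z\<in>ball l r. (Y z)\<^sup>2 = z * poly a z \<and> z * poly a z \<noteq> 0"
  have l: "l \<in> ball l r" using r by simp
  have l0: "l \<noteq> 0" and Yl: "Y l \<noteq> 0" using bspec[OF Y(2) l] by auto
  have "((\<lambda>z. h (1 / cnj z) (cnj (Y z) / cnj z ^ (g + 1))) has_derivative
     (\<lambda>d. Re (poly b (1 / cnj l) * (- (cnj d / (cnj l)\<^sup>2)) / ((1 / cnj l) * (cnj (Y l) / cnj l ^ (g + 1)))))) (at l within ball l r)"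
  proof (rule potential_has_derivative[OF pot])
    show "(cnj (Y u) / cnj u ^ (g + 1))\<^sup>2 = 1 / cnj u * poly a (1 / cnj u)" if "u \<in> ball l r" for u
      using curve_reflect[OF sym, of "Y u" u] Y(2) that by blast
    show "((\<lambda>x. 1 / cnj x) has_derivative (\<lambda>d. - (cnj d / (cnj l)\<^sup>2))) (at l within ball l r)"
      using l0 by (auto intro!: derivative_eq_intros simp: power2_eq_square)
    have "continuous (at l) Y"
      using Y(1) l by (meson continuous_on_eq_continuous_at holomorphic_on_imp_continuous_on open_ball)
    then have "continuous (at l within ball l r) Y" by (rule continuous_at_imp_continuous_at_within)
    then show "continuous (at l within ball l r) (\<lambda>u. cnj (Y u) / cnj u ^ (g + 1))"
      using l0 by (intro continuous_intros) auto
  qed (use l l0 Yl in auto)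
  moreover have "Re (poly b (1 / cnj l) * (- (cnj d / (cnj l)\<^sup>2)) / ((1 / cnj l) * (cnj (Y l) / cnj l ^ (g + 1)))) =
     Re (poly (- poly_star (g + 1) b) l * d / (l * Y l))" for d
  proof -
    have "poly b (1 / cnj l) * (- (cnj d / (cnj l)\<^sup>2)) / ((1 / cnj l) * (cnj (Y l) / cnj l ^ (g + 1))) =
        cnj (poly (- poly_star (g + 1) b) l * d / (l * Y l))"
      using l0 Yl poly_poly_star[OF deg l0] by (simp add: field_simps power2_eq_square)
    then show ?thesis by (simp only: complex_cnj(1) cnj.simps)
  qed
  ultimately show "((\<lambda>z. h (1 / cnj z) (cnj (Y z) / cnj z ^ (g + 1))) has_derivative
     (\<lambda>d. Re (poly (- poly_star (g + 1) b) l * d / (l * Y l)))) (at l)"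
    using at_within_open[OF l open_ball] by (simp only:)
qed

lemma potential_reflect_eq:
  assumes pot: "potential a b h" and reg: "regular a" and sym: "reflection_symmetric g a" and deg: "degree b \<le> g + 1"
    and y: "y\<^sup>2 = l * poly a l"
  shows "poly_star (g + 1) b = b \<Longrightarrow> h (1 / cnj l) (cnj y / cnj l ^ (g + 1)) = - h l y"
    "poly_star (g + 1) b = - b \<Longrightarrow> h (1 / cnj l) (cnj y / cnj l ^ (g + 1)) = h l y"
proof -
  note refl = potential_reflect[OF pot sym deg]
  show "h (1 / cnj l) (cnj y / cnj l ^ (g + 1)) = - h l y" if "poly_star (g + 1) b = b"
    using potential_of_zero[of a "\<lambda>l y. h l y + h (1 / cnj l) (cnj y / cnj l ^ (g + 1))", OF _ reg y]
      potential_add[OF pot refl] that by simp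
  show "h (1 / cnj l) (cnj y / cnj l ^ (g + 1)) = h l y" if "poly_star (g + 1) b = - b"
    using potential_of_zero[of a "\<lambda>l y. h l y - h (1 / cnj l) (cnj y / cnj l ^ (g + 1))", OF _ reg y]
      potential_diff[OF pot refl] that by simp
qed

lemma inverse_cnj_circle: "cmod l = 1 \<Longrightarrow> 1 / cnj l = l"
  by (metis complex_div_cnj complex_norm_square div_by_1 mult.right_neutral nonzero_eq_divide_eq
        norm_one of_real_1 power_one complex_cnj_zero_iff norm_zero zero_neq_one)

text \<open>Positivity of \<lambda>^(-g) a(\<lambda>) makes the involution fix the points over the
  unit circle, and not merely exchange the two sheets there. A potential of a real \<open>b\<close>
  changes sign under the involution, so it vanishes at these points.\<close>

lemma potential_circle:
  assumes a: "a \<in> H_space g" and pot: "potential a b h" and b: "b \<in> real_polys (g + 1)"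
    and l: "cmod l = 1" and y: "y\<^sup>2 = l * poly a l"
  shows "h l y = 0"
proof -
  obtain t where t: "t > 0" "poly a l = of_real t * l ^ g" using H_space_props(4)[OF a l] by blast
  have l0: "l \<noteq> 0" using l by auto
  have y2: "y\<^sup>2 = of_real t * l ^ (g + 1)" using y t by simp
  have "cmod y ^ 2 = cmod (y\<^sup>2)" by (simp add: norm_power)
  also have "\<dots> = t" using y2 t l by (simp add: norm_mult norm_power)
  finally have "y * cnj y = of_real t" by (metis complex_norm_square of_real_power)
  moreover have y0: "y \<noteq> 0" using y2 t l0 by auto
  moreover have "cnj l = 1 / l" using inverse_cnj_circle[OF l] l0 by (metis complex_cnj_cnj complex_cnj_divide complex_cnj_one)
  ultimately have "cnj y / cnj l ^ (g + 1) = y"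
  proof -
    have "y * (cnj y / cnj l ^ (g + 1)) = of_real t * l ^ (g + 1)"
    proof -
      have "cnj l ^ (g + 1) * l ^ (g + 1) = 1"
        unfolding power_mult_distrib[symmetric] \<open>cnj l = 1 / l\<close> using l0 by simp
      moreover have "cnj l ^ (g + 1) \<noteq> 0" using l0 by simp
      ultimately have "l ^ (g + 1) = 1 / cnj l ^ (g + 1)" by (metis mult.commute nonzero_eq_divide_eq)
      then have "y * (cnj y / cnj l ^ (g + 1)) = y * cnj y * l ^ (g + 1)"
        by (simp only: times_divide_eq_right mult_1_right mult.assoc)
      then show ?thesis using \<open>y * cnj y = of_real t\<close> by simp
    qed
    also have "\<dots> = y * y" using y2 by (simp add: power2_eq_square)
    finally show ?thesis using y0 by (metis mult_left_cancel)
  qed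
  then have "h l y = - h l y"
    using potential_reflect_eq(1)[OF pot H_space_props(1,2)[OF a] _ y, of] b inverse_cnj_circle[OF l]
    by (auto simp: real_polys_iff)
  then show ?thesis by simp
qed

lemma poly_zero_on_ball:
  fixes b :: "complex poly"
  assumes "r > 0" "\<And>z. z \<in> ball l r \<Longrightarrow> poly b z = 0"
  shows "b = 0"
proof (rule ccontr)
  assume "b \<noteq> 0"
  then have "finite {z. poly b z = 0}" by (rule poly_roots_finite)
  moreover have "ball l r \<subseteq> {z. poly b z = 0}" using assms(2) by auto
  ultimately have "finite (ball l r)" by (rule finite_subset[rotated])
  then show False using assms(1) uncountable_ball countable_finite by blast
qed

text \<open>By oddness |h| depends on \<lambda> alone. At a branch point it tends to 0, except that
  over \<lambda> = 0 the constant coefficient of \<open>b\<close> produces a pole; hence the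
  hypothesis there.\<close>

lemma abs_potential_continuous:
  assumes pot: "potential a b h" and reg: "regular a" and b0: "l = 0 \<Longrightarrow> coeff b 0 = 0"
  shows "continuous (at l) (\<lambda>l. \<bar>h l (csqrt (l * poly a l))\<bar>)"
proof (cases "l * poly a l = 0")
  case False
  have cs: "(csqrt (l * poly a l))\<^sup>2 = l * poly a l" "csqrt (l * poly a l) \<noteq> 0" using False by auto
  obtain r Y where Y': "r > 0" "Y holomorphic_on ball l r" "Y l = csqrt (l * poly a l)"
    "\<forall>z\<in>ball l r. (Y z)\<^sup>2 = z * poly a z \<and> z * poly a z \<noteq> 0"
    "\<forall>z\<in>ball l r. \<forall>w. w\<^sup>2 = z * poly a z \<longrightarrow> Re (w / csqrt (l * poly a l)) > 0 \<longrightarrow> w = Y z"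
    "\<forall>z\<in>ball l r. ((\<lambda>z. h z (Y z)) has_derivative (\<lambda>d. Re (poly b z * d / (z * Y z)))) (at z)"
    by (rule potential_local[OF pot cs]) (rule that)
  note Y = Y'(1,3,4,6)
  have "isCont (\<lambda>z. h z (Y z)) l"
    by (rule has_derivative_continuous[OF bspec[OF Y(4)]]) (use Y(1) in auto)
  then have "isCont (\<lambda>z. \<bar>h z (Y z)\<bar>) l" by (intro continuous_intros)
  moreover have "\<forall>\<^sub>F z in nhds l. \<bar>h z (Y z)\<bar> = \<bar>h z (csqrt (z * poly a z))\<bar>"
  proof -
    have "\<forall>\<^sub>F z in nhds l. z \<in> ball l r" using Y(1) by (intro eventually_nhds_in_open) auto
    then show ?thesis
    proof eventually_elim
      case (elim z)
      then have "(Y z)\<^sup>2 = z * poly a z" using Y(3) by blast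
      then show ?case by (rule potential_abs[OF pot]) simp
    qed
  qed
  ultimately show ?thesis by (simp cong: isCont_cong)
next
  case True
  obtain \<rho> E F k e where B': "\<rho> > 0" "E holomorphic_on ball l (\<rho>\<^sup>2)"
    "\<forall>z\<in>ball l (\<rho>\<^sup>2). (E z)\<^sup>2 = poly e z \<and> E z \<noteq> 0 \<and> poly e z \<noteq> 0"
    "\<forall>z. z * poly a z = (z - l) * poly e z"
    "F holomorphic_on ball 0 \<rho>" "\<forall>s. F (- s) = - F s"
    "\<forall>s\<in>ball 0 \<rho>. s \<noteq> 0 \<longrightarrow> h (l + s\<^sup>2) (s * E (l + s\<^sup>2)) = Re (F s - k / s)"
    "l = (0::complex) \<longrightarrow> k = 2 * poly b 0 / E 0"
    "\<forall>s\<in>ball 0 \<rho>. s \<noteq> 0 \<longrightarrow> ((\<lambda>s. F s - k / s) has_field_derivative 2 * poly b (l + s\<^sup>2) / ((l + s\<^sup>2) * E (l + s\<^sup>2))) (at s)"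
    "l \<noteq> 0 \<longrightarrow> k = 0 \<and> (\<forall>s\<in>ball 0 \<rho>. (F has_field_derivative 2 * poly b (l + s\<^sup>2) / ((l + s\<^sup>2) * E (l + s\<^sup>2))) (at s))"
    by (rule potential_at_branch[OF pot reg True]) (rule that)
  note B = B'(1,3,4,5,6,7,8,10)
  have k: "k = 0" using B(7,8) b0 by (cases "l = 0") (auto simp: poly_0_coeff_0)
  have F0: "F 0 = 0" using B(5)[rule_format, of 0] by simp
  have "isCont F 0"
    using B(4) B(1) by (meson centre_in_ball continuous_on_eq_continuous_at holomorphic_on_imp_continuous_on open_ball)
  then have "isCont (\<lambda>s. \<bar>Re (F s)\<bar>) 0" by (intro isCont_rabs isCont_Re)
  then have "((\<lambda>s. \<bar>Re (F s)\<bar>) \<longlongrightarrow> 0) (at 0)" using F0 by (auto simp: isCont_def)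
  then have "\<exists>d>0. \<forall>s. s \<noteq> 0 \<and> cmod s < d \<longrightarrow> \<bar>Re (F s)\<bar> < \<epsilon>" if "\<epsilon> > 0" for \<epsilon>
    using that by (auto simp: LIM_eq)
  then have lim: "\<exists>d>0. \<forall>s. cmod s < d \<longrightarrow> \<bar>Re (F s)\<bar> < \<epsilon>" if "\<epsilon> > 0" for \<epsilon>
    using that F0 by (metis abs_zero zero_complex.sel(1))
  show ?thesis unfolding continuous_at_eps_delta
  proof (intro allI impI)
    fix \<epsilon> :: real assume "\<epsilon> > 0"
    then obtain d where d: "d > 0" "\<And>s. cmod s < d \<Longrightarrow> \<bar>Re (F s)\<bar> < \<epsilon>" using lim by blast
    have h0: "h l (csqrt (l * poly a l)) = 0" using potential_0[OF pot True] True by (metis csqrt_0)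
    show "\<exists>\<delta>>0. \<forall>x'. dist x' l < \<delta> \<longrightarrow> dist \<bar>h x' (csqrt (x' * poly a x'))\<bar> \<bar>h l (csqrt (l * poly a l))\<bar> < \<epsilon>"
    proof (intro exI[of _ "(min d \<rho>)\<^sup>2"] conjI allI impI)
      show "(min d \<rho>)\<^sup>2 > 0" using d(1) B(1) by simp
      fix z assume z: "dist z l < (min d \<rho>)\<^sup>2"
      show "dist \<bar>h z (csqrt (z * poly a z))\<bar> \<bar>h l (csqrt (l * poly a l))\<bar> < \<epsilon>"
      proof (cases "z = l")
        case True then show ?thesis using \<open>\<epsilon> > 0\<close> by simp
      next
        case False
        define s where "s = csqrt (z - l)"
        have s: "s\<^sup>2 = z - l" "s \<noteq> 0" using False by (auto simp: s_def)
        have "dist z l = cmod s ^ 2" by (simp only: dist_norm s(1)[symmetric] norm_power)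
        then have "cmod s ^ 2 < (min d \<rho>)\<^sup>2" using z by simp
        then have cs: "cmod s < min d \<rho>" by (rule power_less_imp_less_base) (use d(1) B(1) in simp)
        have zs: "l + s\<^sup>2 = z" using s by simp
        have "cmod s ^ 2 < \<rho>\<^sup>2" using cs by (intro power_strict_mono) auto
        then have "z \<in> ball l (\<rho>\<^sup>2)" using \<open>dist z l = cmod s ^ 2\<close> by (simp add: dist_commute)
        then have "(s * E z)\<^sup>2 = z * poly a z"
          using bspec[OF B(2)] B(3)[rule_format, of z] s(1) by (simp add: power_mult_distrib)
        then have "\<bar>h z (csqrt (z * poly a z))\<bar> = \<bar>h z (s * E z)\<bar>" by (intro potential_abs[OF pot]) auto
        also have "\<dots> = \<bar>Re (F s)\<bar>" using B(6)[rule_format, of s] cs s k zs by simp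
        also have "\<dots> < \<epsilon>" using d(2) cs by simp
        finally show ?thesis using h0 by simp
      qed
    qed
  qed
qed

lemma ball_primitive:
  assumes "f holomorphic_on ball (l::complex) r"
  obtains H where "\<forall>z\<in>ball l r. (H has_field_derivative f z) (at z)"
proof (cases "r > 0")
  case True
  have "starlike (ball l r)" using True by (intro convex_imp_starlike) auto
  moreover have "f field_differentiable at z" if "z \<in> ball l r - {}" for z
    using assms that by (auto simp: holomorphic_on_open field_differentiable_def)
  ultimately show ?thesis
    using holomorphic_starlike_primitive[of "ball l r" f "{}"] assms that
    by (meson finite.emptyI holomorphic_on_imp_continuous_on open_ball)
next
  case False
  then have "ball l r = {}" by simp
  then show ?thesis using that by blast
qed

lemma poly_zero_if_Re_derivative_zero:
  assumes "\<And>d. Re (c * d / w) = 0" "w \<noteq> 0"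
  shows "c = (0::complex)"
proof -
  have "Re (c * (w * cnj c) / w) = 0" by (rule assms(1))
  then have "Re (c * cnj c) = 0" using assms(2) by simp
  then show ?thesis by (simp add: complex_mult_cnj complex_eq_iff sum_power2_eq_zero_iff)
qed

lemma potential_zero_imp_poly_zero:
  assumes pot: "potential a b h" and reg: "regular a" and z: "\<And>l y. y\<^sup>2 = l * poly a l \<Longrightarrow> h l y = 0"
  shows "b = 0"
proof -
  have "infinite (UNIV - {x. x * poly a x = 0})"
    using finite_branch_points[OF reg] infinite_UNIV_char_0 by (intro Diff_infinite_finite)
  then obtain l where l: "l * poly a l \<noteq> 0" by (metis (mono_tags, lifting) DiffE ex_in_conv finite.emptyI mem_Collect_eq)
  have cs: "(csqrt (l * poly a l))\<^sup>2 = l * poly a l" "csqrt (l * poly a l) \<noteq> 0" using l by auto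
  obtain r Y where Y': "r > 0" "Y holomorphic_on ball l r" "Y l = csqrt (l * poly a l)"
    "\<forall>z\<in>ball l r. (Y z)\<^sup>2 = z * poly a z \<and> z * poly a z \<noteq> 0"
    "\<forall>z\<in>ball l r. \<forall>w. w\<^sup>2 = z * poly a z \<longrightarrow> Re (w / csqrt (l * poly a l)) > 0 \<longrightarrow> w = Y z"
    "\<forall>z\<in>ball l r. ((\<lambda>z. h z (Y z)) has_derivative (\<lambda>d. Re (poly b z * d / (z * Y z)))) (at z)"
    by (rule potential_local[OF pot cs]) (rule that)
  show ?thesis
  proof (rule poly_zero_on_ball[OF Y'(1)])
    fix z assume zb: "z \<in> ball l r"
    have "((\<lambda>z. h z (Y z)) has_derivative (\<lambda>_. 0)) (at z)"
    proof (rule has_derivative_transform_within_open[OF has_derivative_const[of 0] open_ball zb])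
      fix x assume "x \<in> ball l r"
      then have "(Y x)\<^sup>2 = x * poly a x" using Y'(4) by blast
      from z[OF this] show "0 = h x (Y x)" by simp
    qed
    then have "(\<lambda>d. Re (poly b z * d / (z * Y z))) = (\<lambda>_. 0)"
      using bspec[OF Y'(6) zb] has_derivative_unique by blast
    then have "Re (poly b z * d / (z * Y z)) = 0" for d by meson
    moreover have "z * Y z \<noteq> 0" using bspec[OF Y'(4) zb] by auto
    ultimately show "poly b z = 0" by (rule poly_zero_if_Re_derivative_zero)
  qed
qed

text \<open>Maximum principle. By invariance of |h| under reflection, its maximum over the closed
  disc is a maximum over the whole plane. If it is positive, it is attained away from the branch
  points, where \<open>h\<close> is locally the real part of a holomorphic function; this function
  is then constant, and \<open>b\<close> vanishes.\<close>

lemma potential_unique_symmetric: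
  assumes pot: "potential a b h" and reg: "regular a" and sym: "reflection_symmetric g a" and deg: "degree b \<le> g + 1"
    and star: "poly_star (g + 1) b = b \<or> poly_star (g + 1) b = - b" and b0: "coeff b 0 = 0"
  shows "b = 0"
proof -
  define w where "w = (\<lambda>l. \<bar>h l (csqrt (l * poly a l))\<bar>)"
  have w: "w l = \<bar>h l y\<bar>" if "y\<^sup>2 = l * poly a l" for l y
    unfolding w_def by (rule potential_abs[OF pot _ that]) simp
  have wr: "w (1 / cnj l) = w l" for l
  proof -
    let ?y = "csqrt (l * poly a l)"
    have y: "?y\<^sup>2 = l * poly a l" by simp
    have "w (1 / cnj l) = \<bar>h (1 / cnj l) (cnj ?y / cnj l ^ (g + 1))\<bar>"
      by (rule w[OF curve_reflect[OF sym y]])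
    also have "\<dots> = \<bar>h l ?y\<bar>"
      using potential_reflect_eq[OF pot reg sym deg y] star by auto
    finally show ?thesis by (simp add: w_def)
  qed
  have "continuous_on (cball 0 1) w" unfolding w_def
    by (intro continuous_at_imp_continuous_on ballI abs_potential_continuous[OF pot reg b0])
  then obtain l1 where l1: "l1 \<in> cball 0 1" "\<And>z. z \<in> cball 0 1 \<Longrightarrow> w z \<le> w l1"
    using continuous_attains_sup[of "cball 0 1" w] by auto
  have glob: "w z \<le> w l1" for z
  proof (cases "cmod z \<le> 1")
    case False
    then have "1 / cnj z \<in> cball 0 1" by (simp add: norm_divide divide_le_eq)
    then show ?thesis using l1(2) wr by metis
  qed (use l1 in simp)
  show ?thesis
  proof (cases "w l1 = 0")
    case True
    have "h l y = 0" if "y\<^sup>2 = l * poly a l" for l y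
      using w[OF that] glob[of l] True by simp
    then show ?thesis by (rule potential_zero_imp_poly_zero[OF pot reg])
  next
    case False
    have l: "l1 * poly a l1 \<noteq> 0"
    proof
      assume "l1 * poly a l1 = 0"
      then show False using False potential_0[OF pot, of l1] unfolding w_def by (metis abs_zero csqrt_0)
    qed
    have cs: "(csqrt (l1 * poly a l1))\<^sup>2 = l1 * poly a l1" "csqrt (l1 * poly a l1) \<noteq> 0" using l by auto
    obtain r Y where Y': "r > 0" "Y holomorphic_on ball l1 r" "Y l1 = csqrt (l1 * poly a l1)"
    "\<forall>z\<in>ball l1 r. (Y z)\<^sup>2 = z * poly a z \<and> z * poly a z \<noteq> 0"
    "\<forall>z\<in>ball l1 r. \<forall>w. w\<^sup>2 = z * poly a z \<longrightarrow> Re (w / csqrt (l1 * poly a l1)) > 0 \<longrightarrow> w = Y z"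
    "\<forall>z\<in>ball l1 r. ((\<lambda>z. h z (Y z)) has_derivative (\<lambda>d. Re (poly b z * d / (z * Y z)))) (at z)"
      by (rule potential_local[OF pot cs]) (rule that)
    have Y2: "(Y z)\<^sup>2 = z * poly a z" "z * Y z \<noteq> 0" if "z \<in> ball l1 r" for z
      using bspec[OF Y'(4) that] by auto
    have "(\<lambda>z. poly b z / (z * Y z)) holomorphic_on ball l1 r"
      using Y2(2) by (intro holomorphic_intros Y'(2)) auto
    then obtain H where H: "\<forall>z\<in>ball l1 r. (H has_field_derivative poly b z / (z * Y z)) (at z)"
      by (rule ball_primitive)
    have d0: "((\<lambda>z. h z (Y z) - Re (H z)) has_derivative (\<lambda>_. 0)) (at z)" if "z \<in> ball l1 r" for z
    proof -
      have "(H has_derivative (\<lambda>d. poly b z / (z * Y z) * d)) (at z)"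
        using bspec[OF H that] unfolding has_field_derivative_def .
      from has_derivative_diff[OF bspec[OF Y'(6) that] has_derivative_Re[OF this]]
      show ?thesis by simp
    qed
    have "(\<lambda>z. h z (Y z) - Re (H z)) constant_on ball l1 r"
      by (intro has_derivative_zero_connected_constant_on[of _ "{}"])
        (auto intro!: continuous_at_imp_continuous_on has_derivative_at_withinI d0 has_derivative_continuous[OF d0])
    then obtain c where c: "h z (Y z) - Re (H z) = c" if "z \<in> ball l1 r" for z by (auto simp: constant_on_def)
    define \<sigma> where "\<sigma> = sgn (h l1 (Y l1))"
    have l1b: "l1 \<in> ball l1 r" using Y'(1) by simp
    have hl1: "\<bar>h l1 (Y l1)\<bar> = w l1" using w[OF Y2(1)[OF l1b]] by simp
    have \<sigma>: "\<bar>\<sigma>\<bar> = 1" "\<sigma> * h l1 (Y l1) = w l1"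
      using False hl1 by (auto simp: \<sigma>_def sgn_if split: if_splits)
    \<comment> \<open>The modulus of \<open>G\<close> is the exponential of \<sigma> times the real
      part of \<open>H\<close>, which converts the maximum of \<sigma> h at \<open>l1\<close> into a
      maximum of a holomorphic modulus.\<close>
    define G where "G = (\<lambda>z. exp (of_real \<sigma> * H z))"
    have "(\<lambda>z. exp (of_real \<sigma> * H z)) holomorphic_on ball l1 r"
    proof -
      have "H holomorphic_on ball l1 r" using H by (auto simp: holomorphic_on_open)
      then show ?thesis by (intro holomorphic_intros)
    qed
    then have "G holomorphic_on ball l1 r" by (simp add: G_def)
    moreover have "cmod (G z) \<le> cmod (G l1)" if z: "z \<in> ball l1 r" for z
    proof -
      have "\<sigma> * h z (Y z) \<le> w z" using w[OF Y2(1)[OF z]] \<sigma>(1)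
        by (metis abs_ge_self abs_mult mult_1)
      then have "\<sigma> * h z (Y z) \<le> \<sigma> * h l1 (Y l1)" using glob[of z] \<sigma>(2) by linarith
      then have "\<sigma> * (Re (H z) + c) \<le> \<sigma> * (Re (H l1) + c)"
        using c[OF z] c[OF l1b] by (metis add.commute diff_add_cancel)
      then show ?thesis by (simp add: G_def algebra_simps)
    qed
    ultimately have "G constant_on ball l1 r"
      using maximum_modulus_principle[of G "ball l1 r" "ball l1 r" l1] l1b by auto
    then obtain C where C: "\<And>z. z \<in> ball l1 r \<Longrightarrow> G z = C" by (auto simp: constant_on_def)
    show ?thesis
    proof (rule poly_zero_on_ball[OF Y'(1)])
      fix z assume z: "z \<in> ball l1 r"
      have 1: "(G has_field_derivative exp (of_real \<sigma> * H z) * (of_real \<sigma> * (poly b z / (z * Y z)))) (at z)"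
        unfolding G_def by (intro DERIV_chain2[OF DERIV_exp] DERIV_cmult bspec[OF H z])
      have 2: "(G has_field_derivative 0) (at z)"
        by (rule has_field_derivative_transform_within_open[OF DERIV_const[of C] open_ball z]) (use C in simp)
      have "exp (of_real \<sigma> * H z) * (of_real \<sigma> * (poly b z / (z * Y z))) = 0"
        by (rule DERIV_unique[OF 1 2])
      then show "poly b z = 0" using \<sigma>(1) Y2(2)[OF z] by auto
    qed
  qed
qed

text \<open>Reflection swaps the two end coefficients. As both vanish, the symmetric and the
  antisymmetric part of \<open>b\<close> vanish at 0 as well.\<close>

lemma potential_unique:
  assumes pot: "potential a b h" and reg: "regular a" and sym: "reflection_symmetric g a" and deg: "degree b \<le> g + 1"
    and b0: "coeff b 0 = 0" and bt: "coeff b (g + 1) = 0"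
  shows "b = 0"
proof -
  note refl = potential_reflect[OF pot sym deg]
  have "b + poly_star (g + 1) b = 0"
  proof (rule potential_unique_symmetric[OF _ reg sym])
    show "potential a (b + poly_star (g + 1) b) (\<lambda>l y. h l y - h (1 / cnj l) (cnj y / cnj l ^ (g + 1)))"
      using potential_diff[OF pot refl] by simp
  qed (use deg degree_poly_star b0 bt in \<open>auto intro!: degree_add_le simp: poly_star_add poly_star_star coeff_poly_star\<close>)
  moreover have "b - poly_star (g + 1) b = 0"
  proof (rule potential_unique_symmetric[OF _ reg sym])
    show "potential a (b - poly_star (g + 1) b) (\<lambda>l y. h l y + h (1 / cnj l) (cnj y / cnj l ^ (g + 1)))"
      using potential_add[OF pot refl] by simp
  qed (use deg degree_poly_star b0 bt in \<open>auto intro!: degree_diff_le simp: poly_star_diff poly_star_star coeff_poly_star\<close>)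
  ultimately have "b + b = 0" by (metis add_cancel_right_right eq_iff_diff_eq_0)
  then have "coeff b i + coeff b i = 0" for i by (metis coeff_0 coeff_add)
  then show ?thesis by (simp add: poly_eq_iff)
qed

text \<open>Normalising each factor to 1 at \<open>z0\<close> makes all principal square roots of
  the factors equal to 1 there, which fixes the sheet at the base point.\<close>

lemma regular_product:
  assumes "regular a" "\<And>x. x * poly a x = 0 \<Longrightarrow> z0 \<noteq> x"
  shows "z * poly a z = z0 * poly a z0 * (\<Prod>x\<in>{x. x * poly a x = 0}. (z - x) / (z0 - x))"
proof -
  define P where "P = [:0, 1:] * a"
  have pP: "poly P w = w * poly a w" for w by (simp add: P_def)
  have "rsquarefree P" unfolding rsquarefree_roots
  proof (intro allI notI, elim conjE)
    fix w assume w: "poly P w = 0" "poly (pderiv P) w = 0"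
    have "poly (pderiv P) w = poly a w + w * poly (pderiv a) w" by (simp add: P_def pderiv_mult pderiv_pCons)
    with w show False using assms(1) by (auto simp: regular_def rsquarefree_roots pP)
  qed
  then have "P = smult (lead_coeff P) (\<Prod>x | poly P x = 0. [:- x, 1:])"
    using complex_poly_decompose_rsquarefree by metis
  then have *: "poly P w = lead_coeff P * (\<Prod>x | x * poly a x = 0. w - x)" for w
    by (metis (no_types, lifting) pP poly_smult poly_prod poly_pCons poly_0 Collect_cong prod.cong
      mult_zero_right add_0_right mult_1_right uminus_add_conv_diff mult.right_neutral)
  have "poly P z * (\<Prod>x | x * poly a x = 0. z0 - x) = poly P z0 * (\<Prod>x | x * poly a x = 0. z - x)"
    unfolding * by simp
  moreover have "(\<Prod>x | x * poly a x = 0. z0 - x) \<noteq> 0"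
    using assms finite_branch_points[OF assms(1)] by (subst prod_zero_iff) auto
  ultimately show ?thesis by (simp add: prod_dividef pP field_simps)
qed

lemma csqrt_nonpos_free_continuous:
  "closed {z :: complex. (z - x) / c \<in> \<real>\<^sub>\<le>\<^sub>0}"
proof -
  have "continuous_on UNIV (\<lambda>z. (z - x) / c)"
    by (cases "c = 0") (auto intro!: continuous_intros)
  from continuous_closed_preimage[OF this closed_UNIV closed_nonpos_Reals_complex]
  show ?thesis by (simp add: vimage_def)
qed

section \<open>Slit plane and periods\<close>

text \<open>Slits run from the branch points to infinity, in the directions pointing away from a generic \<open>z0\<close>.
  The additional points of \<open>Z\<close> will be avoided by all paths.\<close>

locale slit_curve =
  fixes a :: "complex poly" and z0 :: complex and Z :: "complex set"
  assumes reg: "regular a"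
    and finZ: "finite Z"
    and branchZ: "\<And>x. x * poly a x = 0 \<Longrightarrow> x \<in> Z"
    and generic: "\<And>x x'. x \<in> Z \<Longrightarrow> x' \<in> Z \<Longrightarrow> x \<noteq> x' \<Longrightarrow> Im ((z0 - x) / (z0 - x')) \<noteq> 0"
    and z0Z: "z0 \<notin> Z"
begin

definition Br :: "complex set" where "Br = {x. x * poly a x = 0}"
definition slit :: "complex \<Rightarrow> complex set" where "slit x = {z. (z - x) / (z0 - x) \<in> \<real>\<^sub>\<le>\<^sub>0}"
text \<open>The branch cut of \<open>csqrt\<close> becomes exactly \<open>slit x\<close>.\<close>

definition root_at :: "complex \<Rightarrow> complex \<Rightarrow> complex" where "root_at x z = csqrt ((z - x) / (z0 - x))"
definition Y0 :: complex where "Y0 = csqrt (z0 * poly a z0)"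
definition YY :: "complex \<Rightarrow> complex" where "YY z = Y0 * (\<Prod>x\<in>Br. root_at x z)"
text \<open>The branch \<open>YY\<close> without its factor vanishing at \<open>x\<close>. It is
  holomorphic across \<open>slit x\<close>, so in the parameter \<open>s = root_at x z\<close> the
  product \<open>s * EE x z\<close> continues \<open>YY\<close> through this slit onto the other
  sheet.\<close>

definition EE :: "complex \<Rightarrow> complex \<Rightarrow> complex" where "EE x z = Y0 * (\<Prod>x'\<in>Br - {x}. root_at x' z)"
definition U :: "complex set" where "U = - (\<Union>x\<in>Br. slit x)"
text \<open>The chart at \<open>x\<close>, inverse to \<open>root_at x\<close>, scaled so that the
  two points over \<open>z0\<close> are \<open>s = 1\<close> and \<open>s = - 1\<close>.\<close>

definition lam :: "complex \<Rightarrow> complex \<Rightarrow> complex" where "lam x s = x + (z0 - x) * s\<^sup>2"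
definition T :: "complex \<Rightarrow> complex set" where "T x = {s. \<forall>x'\<in>Br - {x}. lam x s \<notin> slit x'}"
text \<open>The star-shaped core of \<open>T x\<close> about 0, taken in order to have
  primitives.\<close>

definition N :: "complex \<Rightarrow> complex set" where "N x = {s. closed_segment 0 s \<subseteq> T x}"

lemma finBr: "finite Br" unfolding Br_def by (rule finite_branch_points[OF reg])

lemma BrZ: "x \<in> Br \<Longrightarrow> x \<in> Z" using branchZ by (auto simp: Br_def)

lemma z0_ne: "x \<in> Z \<Longrightarrow> z0 - x \<noteq> 0" using z0Z by auto

lemma zero_Br: "0 \<in> Br" by (simp add: Br_def)

lemma in_slit_self: "x \<in> slit x" by (simp add: slit_def)

lemma YY_sq: "(YY z)\<^sup>2 = z * poly a z"
proof -
  have "z0 \<noteq> x" if "x * poly a x = 0" for x using that branchZ z0Z by auto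
  from regular_product[OF reg this, of z]
  show ?thesis by (simp add: YY_def Y0_def power_mult_distrib prod_power_distrib root_at_def Br_def)
qed

lemma YY_EE: "x \<in> Br \<Longrightarrow> YY z = root_at x z * EE x z"
  using prod.remove[OF finBr, of x "\<lambda>x. root_at x z"] by (simp add: YY_def EE_def)

lemma EE_sq: "x \<in> Br \<Longrightarrow> z * poly a z = (z - x) / (z0 - x) * (EE x z)\<^sup>2"
  using YY_sq[of z] YY_EE[of x z] by (simp add: power_mult_distrib root_at_def)

lemma closed_slit: "closed (slit x)"
  unfolding slit_def by (rule csqrt_nonpos_free_continuous)

lemma root_at_holomorphic: "x \<in> Z \<Longrightarrow> A \<inter> slit x = {} \<Longrightarrow> root_at x holomorphic_on A"
  unfolding root_at_def using z0_ne[of x] by (intro holomorphic_intros) (auto simp: slit_def)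

lemma root_at_nz: "x \<in> Z \<Longrightarrow> z \<noteq> x \<Longrightarrow> root_at x z \<noteq> 0"
  using z0_ne by (simp add: root_at_def)

lemma Y0_nz: "Y0 \<noteq> 0" using branchZ[of z0] z0Z by (auto simp: Y0_def)

lemma EE_holomorphic: "(\<And>x'. x' \<in> Br \<Longrightarrow> x' \<noteq> x \<Longrightarrow> A \<inter> slit x' = {}) \<Longrightarrow> EE x holomorphic_on A"
  unfolding EE_def by (intro holomorphic_intros root_at_holomorphic BrZ) auto

lemma EE_nz: "(\<And>x'. x' \<in> Br \<Longrightarrow> x' \<noteq> x \<Longrightarrow> z \<noteq> x') \<Longrightarrow> EE x z \<noteq> 0"
  unfolding EE_def using finBr Y0_nz root_at_nz BrZ by (auto simp: prod_zero_iff)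

lemma open_U: "open U" unfolding U_def using finBr closed_slit by (auto intro!: open_Compl closed_UN)

lemma U_nonbranch: "z \<in> U \<Longrightarrow> z * poly a z \<noteq> 0"
  using in_slit_self by (auto simp: U_def Br_def)

lemma YY_holomorphic: "YY holomorphic_on U"
  unfolding YY_def by (intro holomorphic_intros root_at_holomorphic BrZ) (auto simp: U_def)

lemma z0U: "z0 \<in> U"
  using z0_ne BrZ by (auto simp: U_def slit_def)

text \<open>The slits point away from \<open>z0\<close>: a segment starting at \<open>z0\<close>
  that meets a slit stays on it from then on, so its endpoint would lie on the slit too.\<close>

lemma starlike_U: "z \<in> U \<Longrightarrow> closed_segment z0 z \<subseteq> U"
proof
  fix p assume z: "z \<in> U" and "p \<in> closed_segment z0 z"
  then obtain t where t: "0 \<le> t" "t \<le> 1" "p = (1 - t) *\<^sub>R z0 + t *\<^sub>R z" by (auto simp: closed_segment_def)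
  have "p \<notin> slit x" if x: "x \<in> Br" for x
  proof
    assume "p \<in> slit x"
    then obtain v where v: "(p - x) / (z0 - x) = of_real v" "v \<le> 0" by (auto simp: slit_def nonpos_Reals_def)
    have ne: "z0 - x \<noteq> 0" using z0_ne BrZ x by auto
    have "p - x = (1 - t) * (z0 - x) + t * (z - x)" by (simp add: t(3) scaleR_conv_of_real algebra_simps)
    then have "of_real v = (1 - t) + t * ((z - x) / (z0 - x))"
      using v(1) ne by (simp add: add_divide_distrib)
    then have eq: "of_real t * ((z - x) / (z0 - x)) = of_real (v - (1 - t))" by (simp add: algebra_simps)
    have "t \<noteq> 0"
    proof
      assume "t = 0"
      with eq have "of_real (v - 1) = (0 :: complex)" by simp
      then show False using v(2) by (simp only: of_real_eq_0_iff)
    qed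
    then have "(z - x) / (z0 - x) = of_real ((v - (1 - t)) / t)"
      using eq by (metis nonzero_mult_div_cancel_left of_real_divide of_real_eq_0_iff)
    moreover have "(v - (1 - t)) / t \<le> 0" using t v by (auto intro!: divide_nonpos_nonneg)
    ultimately have "z \<in> slit x" by (simp only: slit_def mem_Collect_eq nonpos_Reals_of_real_iff)
    then show False using z x by (auto simp: U_def)
  qed
  then show "p \<in> U" by (auto simp: U_def)
qed

text \<open>The left-hand point lies on the ray from \<open>z0\<close> through \<open>x\<close>. On
  a slit of another point \<open>x'\<close> it would make \<open>x\<close>, \<open>x'\<close> and
  \<open>z0\<close> collinear, against the generic choice of \<open>z0\<close>.\<close>

lemma ray_avoids:
  assumes "x \<in> Z" "x' \<in> Z" "x \<noteq> x'" "c \<ge> 0"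
  shows "z0 - of_real c * (z0 - x) \<notin> slit x'" "z0 - of_real c * (z0 - x) \<noteq> x'"
proof -
  show *: "z0 - of_real c * (z0 - x) \<notin> slit x'"
  proof
    assume "z0 - of_real c * (z0 - x) \<in> slit x'"
    then obtain v where v: "(z0 - of_real c * (z0 - x) - x') / (z0 - x') = of_real v" "v \<le> 0"
      by (auto simp: slit_def nonpos_Reals_def)
    have "(z0 - of_real c * (z0 - x) - x') / (z0 - x') = 1 - of_real c * ((z0 - x) / (z0 - x'))"
      using z0_ne[OF assms(2)] by (simp add: field_simps)
    then have eq: "of_real c * ((z0 - x) / (z0 - x')) = of_real (1 - v)" using v by (simp add: algebra_simps)
    then have "c \<noteq> 0" using v(2) by (metis add_cancel_left_left diff_eq_eq mult_zero_left not_one_le_zero of_real_0 of_real_eq_0_iff)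
    moreover have "c * Im ((z0 - x) / (z0 - x')) = 0"
      using arg_cong[OF eq, of Im] by (simp only: Im_complex_of_real times_complex.sel Re_complex_of_real)
    ultimately show False using generic[OF assms(1-3)] by simp
  qed
  then show "z0 - of_real c * (z0 - x) \<noteq> x'" using in_slit_self by metis
qed

lemma lam_ray: "s\<^sup>2 = of_real v \<Longrightarrow> lam x s = z0 - of_real (1 - v) * (z0 - x)"
  by (simp add: lam_def algebra_simps)

text \<open>For \<open>0 \<le> v\<close> the point \<open>lam x s\<close> lies between
  \<open>x\<close> and \<open>z0\<close>; for \<open>v \<le> 0\<close> it lies on the slit of
  \<open>x\<close>, where \<open>s\<close> is imaginary. The chart therefore covers the whole slit
  and reaches the base point.\<close>

lemma in_N:
  assumes "x \<in> Br" "s\<^sup>2 = of_real v" "v \<le> 1"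
  shows "s \<in> N x"
  unfolding N_def
proof (intro CollectI subsetI)
  fix p assume "p \<in> closed_segment 0 s"
  then obtain u where u: "0 \<le> u" "u \<le> 1" "p = of_real u * s" by (auto simp: closed_segment_def scaleR_conv_of_real)
  have p2: "p\<^sup>2 = of_real (u\<^sup>2 * v)" using u assms(2) by (simp add: power_mult_distrib)
  have "u\<^sup>2 * v \<le> 1"
  proof (cases "v \<ge> 0")
    case True
    have "u\<^sup>2 \<le> 1" using u by (simp add: power_le_one)
    then show ?thesis using True assms(3) by (metis mult_le_one zero_le_power2 mult.commute)
  next
    case False
    then have "u\<^sup>2 * v \<le> 0" by (simp add: mult_nonneg_nonpos)
    then show ?thesis by simp
  qed
  then have "lam x p \<notin> slit x'" if "x' \<in> Br" "x' \<noteq> x" for x'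
    unfolding lam_ray[OF p2] using that BrZ assms(1) by (intro ray_avoids(1)) auto
  then show "p \<in> T x" by (auto simp: T_def)
qed

lemma open_T: "open (T x)"
proof -
  have "T x = (\<Inter>x'\<in>Br - {x}. - {s. lam x s \<in> slit x'})" by (auto simp: T_def)
  moreover have "closed {s. lam x s \<in> slit x'}" for x'
  proof -
    have "continuous_on UNIV (lam x)" unfolding lam_def by (intro continuous_intros)
    from continuous_closed_preimage[OF this closed_UNIV closed_slit] show ?thesis by (simp add: vimage_def)
  qed
  ultimately show ?thesis using finBr by (auto intro!: open_INT)
qed

lemma N_T: "s \<in> N x \<Longrightarrow> s \<in> T x" by (auto simp: N_def)

lemma N_star: "s \<in> N x \<Longrightarrow> closed_segment 0 s \<subseteq> N x"
proof
  fix p assume s: "s \<in> N x" and p: "p \<in> closed_segment 0 s"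
  then have "closed_segment 0 p \<subseteq> closed_segment 0 s" by (simp add: subset_closed_segment)
  then show "p \<in> N x" using s by (auto simp: N_def)
qed

lemma T_minus: "s \<in> T x \<Longrightarrow> - s \<in> T x" by (simp add: T_def lam_def)

lemma N_minus: "s \<in> N x \<Longrightarrow> - s \<in> N x"
proof -
  assume s: "s \<in> N x"
  have "p \<in> T x" if "p \<in> closed_segment 0 (- s)" for p
  proof -
    have "- p \<in> closed_segment 0 s" using that by (auto simp: closed_segment_def scaleR_conv_of_real)
    then show ?thesis using s T_minus[of "- p"] by (auto simp: N_def)
  qed
  then show "- s \<in> N x" by (auto simp: N_def)
qed

lemma open_N: "open (N x)"
  unfolding open_dist
proof
  fix s assume s: "s \<in> N x"
  have "compact (closed_segment 0 s)" by (rule compact_segment)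
  then obtain e where e: "e > 0" "(\<Union>p\<in>closed_segment 0 s. ball p e) \<subseteq> T x"
    using compact_subset_open_imp_ball_epsilon_subset[OF _ open_T, of "closed_segment 0 s" x] s
    by (auto simp: N_def)
  show "\<exists>e>0. \<forall>s'. dist s' s < e \<longrightarrow> s' \<in> N x"
  proof (intro exI[of _ e] conjI allI impI)
    fix s' assume s': "dist s' s < e"
    have "p \<in> T x" if p: "p \<in> closed_segment 0 s'" for p
    proof -
      obtain u where u: "0 \<le> u" "u \<le> 1" "p = of_real u * s'" using p by (auto simp: closed_segment_def scaleR_conv_of_real)
      have "dist (of_real u * s) p = u * dist s' s"
        using u by (simp add: dist_norm norm_mult right_diff_distrib[symmetric] norm_minus_commute)
      also have "\<dots> \<le> dist s' s" using u by (simp add: mult_left_le_one_le)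
      finally have "p \<in> ball (of_real u * s) e" using s' by simp
      moreover have "of_real u * s \<in> closed_segment 0 s" using u by (auto simp: closed_segment_def scaleR_conv_of_real)
      ultimately show ?thesis using e(2) by blast
    qed
    then show "s' \<in> N x" by (auto simp: N_def)
  qed (use e in auto)
qed

lemma zero_N: "x \<in> Br \<Longrightarrow> 0 \<in> N x" using in_N[of x 0 0] by simp

lemma EE_lam_holomorphic: "(\<lambda>s. EE x (lam x s)) holomorphic_on T x"
proof -
  have "(EE x \<circ> lam x) holomorphic_on T x"
  proof (rule holomorphic_on_compose)
    show "lam x holomorphic_on T x" unfolding lam_def by (intro holomorphic_intros)
    show "EE x holomorphic_on lam x ` T x" by (rule EE_holomorphic) (auto simp: T_def)
  qed
  then show ?thesis by (simp add: o_def)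
qed

lemma EE_lam_nz: "s \<in> T x \<Longrightarrow> EE x (lam x s) \<noteq> 0"
  by (rule EE_nz) (use in_slit_self in \<open>auto simp: T_def\<close>)

lemma lam_nz: "s \<in> T x \<Longrightarrow> x \<noteq> 0 \<Longrightarrow> lam x s \<noteq> 0"
  using zero_Br in_slit_self[of 0] by (auto simp: T_def)

lemma lam_nz': "s \<in> T x \<Longrightarrow> x \<in> Br \<Longrightarrow> s \<noteq> 0 \<Longrightarrow> lam x s \<noteq> 0"
  using lam_nz[of s x] z0_ne[OF BrZ, of x] by (cases "x = 0") (auto simp: lam_def)

text \<open>The coefficient of ds in the pull-back of \<Theta>_b under the chart
  \<open>s \<mapsto> (lam x s, s * EE x (lam x s))\<close>.\<close>

definition dK :: "complex poly \<Rightarrow> complex \<Rightarrow> complex \<Rightarrow> complex" where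
  "dK b x s = 2 * (z0 - x) * poly b (lam x s) / (lam x s * EE x (lam x s))"

text \<open>\<open>branch_primitive\<close> with \<kappa> = z0 - x. The polar term
  \<open>k / s\<close>, present only at x = 0, is odd and is absorbed into \<open>K\<close>; hence
  the exception at s = 0.\<close>

lemma exists_primitive:
  assumes x: "x \<in> Br"
  shows "\<exists>K. (\<forall>s. K (- s) = - K s) \<and> (\<forall>s\<in>N x. s \<noteq> 0 \<longrightarrow> (K has_field_derivative dK b x s) (at s))"
proof -
  have E: "(\<lambda>s. EE x (lam x s)) holomorphic_on N x"
    by (rule holomorphic_on_subset[OF EE_lam_holomorphic]) (use N_T in auto)
  have 1: "EE x (lam x (- s)) = EE x (lam x s)" for s by (simp add: lam_def)
  have 2: "EE x (lam x s) \<noteq> 0" if "s \<in> N x" for s using EE_lam_nz N_T that by blast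
  have 3: "x + (z0 - x) * s\<^sup>2 \<noteq> 0" if "s \<in> N x" "x \<noteq> 0" for s
    using lam_nz[OF N_T[OF that(1)] that(2)] by (simp add: lam_def)
  obtain F k where F: "\<forall>s. F (- s) = - F s" "F holomorphic_on N x"
    "\<forall>s\<in>N x. s \<noteq> 0 \<longrightarrow>
      ((\<lambda>s. F s - k / s) has_field_derivative 2 * (z0 - x) * poly b (x + (z0 - x) * s\<^sup>2) / ((x + (z0 - x) * s\<^sup>2) * EE x (lam x s))) (at s)"
    "x = 0 \<longrightarrow> k = 2 * poly b 0 / EE x (lam x 0)" "x \<noteq> 0 \<longrightarrow> k = 0"
    "x \<noteq> 0 \<longrightarrow> (\<forall>s\<in>N x.
      (F has_field_derivative 2 * (z0 - x) * poly b (x + (z0 - x) * s\<^sup>2) / ((x + (z0 - x) * s\<^sup>2) * EE x (lam x s))) (at s))"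
    by (rule branch_primitive[OF open_N zero_N[OF x] N_star N_minus E 1 2 z0_ne[OF BrZ[OF x]] 3, of b]) (assumption | rule that)+
  show ?thesis
    by (rule exI[of _ "\<lambda>s. F s - k / s"]) (use F(1,3) in \<open>auto simp: dK_def lam_def\<close>)
qed

end

lemma eventually_nhds_pos:
  "isCont f l \<Longrightarrow> f l > (0::real) \<Longrightarrow> \<forall>\<^sub>F z in nhds l. f z > 0"
  using order_tendstoD(1)[of f "f l" "at l" 0] by (simp add: isCont_def eventually_nhds_conv_at)

section \<open>Half ellipses in the charts and the loops they define\<close>

definition ell :: "real \<Rightarrow> real \<Rightarrow> complex" where
  "ell \<delta> t = Complex (cos (pi * t)) (\<delta> * sin (pi * t))"

definition ell' :: "real \<Rightarrow> real \<Rightarrow> complex" where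
  "ell' \<delta> t = Complex (- pi * sin (pi * t)) (\<delta> * pi * cos (pi * t))"

lemma ell_has_vector_derivative: "(ell \<delta> has_vector_derivative ell' \<delta> t) (at t within A)"
proof -
  have "((\<lambda>t. of_real (cos (pi * t)) + \<i> * of_real (\<delta> * sin (pi * t))) has_vector_derivative
     of_real (- pi * sin (pi * t)) + \<i> * of_real (\<delta> * pi * cos (pi * t))) (at t within A)"
    by (auto intro!: derivative_eq_intros has_vector_derivative_of_real has_vector_derivative_mult_right
        simp: has_real_derivative_iff_has_vector_derivative[symmetric])
  then show ?thesis unfolding ell_def[abs_def] ell'_def Complex_eq .
qed

lemma continuous_ell: "continuous_on A (ell \<delta>)"
  unfolding ell_def[abs_def] Complex_eq by (intro continuous_intros)

lemma continuous_ell': "continuous_on A (ell' \<delta>)"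
  unfolding ell'_def[abs_def] Complex_eq by (intro continuous_intros)

lemma ell_ends: "ell \<delta> 0 = 1" "ell \<delta> 1 = - 1"
  by (auto simp: ell_def complex_eq_iff)

lemma ell_nz: "\<delta> > 0 \<Longrightarrow> ell \<delta> t \<noteq> 0"
proof
  assume "\<delta> > 0" "ell \<delta> t = 0"
  then have "cos (pi * t) = 0" "sin (pi * t) = 0" by (auto simp: ell_def complex_eq_iff)
  then show False using sin_cos_squared_add[of "pi * t"] by simp
qed

context slit_curve begin

text \<open>As \<delta> tends to 0 the half ellipse collapses to \<open>{-1..1}\<close>, whose image
  runs from \<open>z0\<close> straight to \<open>x\<close> and back. By genericity this segment
  meets \<open>Z\<close> only at \<open>x\<close>, that is at s = 0, and the half ellipse bypasses
  0.\<close>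

lemma good_ellipse_at:
  assumes x: "x \<in> Br"
  shows "\<forall>\<^sub>F \<delta> in at_right 0. \<forall>t\<in>{0..1}. ell \<delta> t \<in> N x \<and> lam x (ell \<delta> t) \<notin> Z"
proof -
  define O' where "O' = N x \<inter> (\<Inter>\<zeta>\<in>Z - {x}. - {s. lam x s = \<zeta>})"
  have "closed {s. lam x s = \<zeta>}" for \<zeta>
  proof -
    have "continuous_on UNIV (lam x)" unfolding lam_def by (intro continuous_intros)
    from continuous_closed_preimage[OF this closed_UNIV closed_singleton[of \<zeta>]] show ?thesis by (simp add: vimage_def)
  qed
  then have op: "open O'" unfolding O'_def using finZ open_N by (auto intro!: open_Int open_INT)
  have sub: "complex_of_real ` {-1..1} \<subseteq> O'"
  proof
    fix s assume "s \<in> complex_of_real ` {-1..1}"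
    then obtain c where c: "-1 \<le> c" "c \<le> 1" "s = of_real c" by auto
    have s2: "s\<^sup>2 = of_real (c\<^sup>2)" using c by simp
    have c2: "c\<^sup>2 \<le> 1" using c by (simp add: abs_square_le_1 abs_le_iff)
    have "lam x s \<noteq> \<zeta>" if "\<zeta> \<in> Z - {x}" for \<zeta>
      unfolding lam_ray[OF s2] using that BrZ[OF x] c2 by (intro ray_avoids(2)) auto
    then show "s \<in> O'" using in_N[OF x s2 c2] by (auto simp: O'_def)
  qed
  have "compact (complex_of_real ` {-1..1})" by (intro compact_continuous_image continuous_intros) auto
  then obtain e where e: "e > 0" "(\<Union>p\<in>complex_of_real ` {-1..1}. ball p e) \<subseteq> O'"
    using compact_subset_open_imp_ball_epsilon_subset[OF _ op sub] by blast
  have "ell \<delta> t \<in> N x \<and> lam x (ell \<delta> t) \<notin> Z" if \<delta>: "0 < \<delta>" "\<delta> < e" for \<delta> t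
  proof -
    have "dist (of_real (cos (pi * t))) (ell \<delta> t) = \<bar>\<delta> * sin (pi * t)\<bar>"
      by (simp add: dist_norm cmod_def ell_def)
    also have "\<dots> \<le> \<delta>" using \<delta> by (simp add: abs_mult mult_left_le)
    finally have "ell \<delta> t \<in> ball (of_real (cos (pi * t))) e" using \<delta> by simp
    moreover have "complex_of_real (cos (pi * t)) \<in> complex_of_real ` {-1..1}" by auto
    ultimately have "ell \<delta> t \<in> O'" using e(2) by blast
    moreover have "lam x (ell \<delta> t) \<noteq> x" using ell_nz[OF \<delta>(1)] z0_ne[OF BrZ[OF x]] by (simp add: lam_def)
    ultimately show ?thesis by (auto simp: O'_def)
  qed
  then show ?thesis using e(1) unfolding eventually_at_right_field by (intro exI[of _ e]) auto
qed

lemma good_ellipse: "\<exists>\<delta>>0. \<forall>x\<in>Br. \<forall>t\<in>{0..1}. ell \<delta> t \<in> N x \<and> lam x (ell \<delta> t) \<notin> Z"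
proof -
  have "\<forall>\<^sub>F \<delta> in at_right 0. \<forall>x\<in>Br. \<forall>t\<in>{0..1}. ell \<delta> t \<in> N x \<and> lam x (ell \<delta> t) \<notin> Z"
    using good_ellipse_at by (intro eventually_ball_finite finBr) auto
  moreover have "\<forall>\<^sub>F \<delta> in at_right 0. \<delta> > (0::real)" by (simp add: eventually_at_right_less)
  ultimately have "\<forall>\<^sub>F \<delta> in at_right (0::real). \<delta> > 0 \<and> (\<forall>x\<in>Br. \<forall>t\<in>{0..1}. ell \<delta> t \<in> N x \<and> lam x (ell \<delta> t) \<notin> Z)"
    by eventually_elim auto
  then show ?thesis using eventually_happens'[OF trivial_limit_at_right_real] by blast
qed

text \<open>\<open>ll x\<close> is a thin closed loop from \<open>z0\<close> around \<open>x\<close>, the image of half an ellipse from \<open>1\<close> to \<open>-1\<close> under the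
  chart at \<open>x\<close>; its lift joins \<open>(z0, y)\<close> to \<open>(z0, -y)\<close>. So \<open>Re (J b x)\<close> equals \<open>-2 h(z0, y)\<close> for every
  potential \<open>h\<close>, and the differences of the \<open>J b x\<close> are periods.\<close>

definition d0 :: real where
  "d0 = (SOME \<delta>. \<delta> > 0 \<and> (\<forall>x\<in>Br. \<forall>t\<in>{0..1}. ell \<delta> t \<in> N x \<and> lam x (ell \<delta> t) \<notin> Z))"

lemma d0: "d0 > 0" "x \<in> Br \<Longrightarrow> t \<in> {0..1} \<Longrightarrow> ell d0 t \<in> N x"
  "x \<in> Br \<Longrightarrow> t \<in> {0..1} \<Longrightarrow> lam x (ell d0 t) \<notin> Z"
  using someI_ex[OF good_ellipse] unfolding d0_def by blast+

definition ll :: "complex \<Rightarrow> real \<Rightarrow> complex" where "ll x t = lam x (ell d0 t)"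
text \<open>The differential along the lifted loop with the factor \<open>poly b\<close> split off,
  so that \<open>J\<close> is visibly linear in \<open>b\<close>. The factor \<open>ell d0 t\<close>
  of d\<lambda> cancels against that of y.\<close>

definition wt :: "complex \<Rightarrow> real \<Rightarrow> complex" where
  "wt x t = 2 * (z0 - x) * ell' d0 t / (ll x t * EE x (ll x t))"
definition J :: "complex poly \<Rightarrow> complex \<Rightarrow> complex" where
  "J b x = integral {0..1} (\<lambda>t. poly b (ll x t) * wt x t)"

lemma continuous_ll: "continuous_on A (ll x)"
  unfolding ll_def lam_def by (intro continuous_intros continuous_ell)

lemma ll_nz: "x \<in> Br \<Longrightarrow> t \<in> {0..1} \<Longrightarrow> ll x t \<noteq> 0"
  using d0(3)[of x t] BrZ[OF zero_Br] by (auto simp: ll_def)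

lemma EE_ll_nz: "x \<in> Br \<Longrightarrow> t \<in> {0..1} \<Longrightarrow> EE x (ll x t) \<noteq> 0"
  using EE_lam_nz[OF N_T[OF d0(2)]] by (simp add: ll_def)

lemma continuous_EE_ll: "x \<in> Br \<Longrightarrow> continuous_on {0..1} (\<lambda>t. EE x (ll x t))"
  unfolding ll_def
  by (rule continuous_on_compose2[OF holomorphic_on_imp_continuous_on[OF EE_lam_holomorphic] continuous_ell])
    (use N_T d0 in auto)

lemma continuous_wt: "x \<in> Br \<Longrightarrow> continuous_on {0..1} (wt x)"
  unfolding wt_def using ll_nz EE_ll_nz
  by (intro continuous_intros continuous_ell' continuous_ll continuous_EE_ll) auto

lemma J_integrable: "x \<in> Br \<Longrightarrow> (\<lambda>t. poly b (ll x t) * wt x t) integrable_on {0..1}"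
  by (intro integrable_continuous_interval continuous_intros continuous_ll continuous_wt)

lemma J_add: "x \<in> Br \<Longrightarrow> J (b + c) x = J b x + J c x"
  unfolding J_def using J_integrable by (simp add: ring_distribs integral_add)

lemma J_smult: "J (smult c b) x = c * J b x"
  unfolding J_def by (simp add: mult.assoc)

lemma J_monom_sum:
  assumes "x \<in> Br" "finite I"
  shows "J (\<Sum>i\<in>I. monom (c i) (m i)) x = (\<Sum>i\<in>I. c i * J (monom 1 (m i)) x)"
  using assms(2)
proof (induction I rule: finite_induct)
  case empty
  then show ?case by (simp add: J_def)
next
  case (insert i I)
  then show ?case using assms(1) J_add[of x "monom (c i) (m i)" "\<Sum>i\<in>I. monom (c i) (m i)"] J_smult[of "c i" "monom 1 (m i)" x]
    by (simp add: smult_monom)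
qed

lemma J_eq_primitive:
  assumes x: "x \<in> Br" and K: "\<And>s. K (- s) = - K s"
    "\<And>s. s \<in> N x \<Longrightarrow> s \<noteq> 0 \<Longrightarrow> (K has_field_derivative dK b x s) (at s)"
  shows "J b x = - 2 * K 1"
proof -
  have "((\<lambda>t. K (ell d0 t)) has_vector_derivative poly b (ll x t) * wt x t) (at t within {0..1})" if "t \<in> {0..1}" for t
  proof -
    have "(K has_field_derivative dK b x (ell d0 t)) (at (ell d0 t))"
      using K(2) d0(1) d0(2)[OF x that] ell_nz by blast
    from field_vector_diff_chain_within[OF ell_has_vector_derivative has_field_derivative_at_within[OF this]]
    have "((\<lambda>t. K (ell d0 t)) has_vector_derivative ell' d0 t * dK b x (ell d0 t)) (at t within {0..1})"
      by (simp add: o_def)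
    then show ?thesis by (simp add: dK_def wt_def ll_def mult_ac)
  qed
  from fundamental_theorem_of_calculus[OF zero_le_one this]
  have "((\<lambda>t. poly b (ll x t) * wt x t) has_integral K (ell d0 1) - K (ell d0 0)) {0..1}" .
  then have "J b x = K (- 1) - K 1" unfolding J_def by (simp add: ell_ends integral_unique)
  then show ?thesis using K(1)[of 1] by simp
qed

text \<open>The right half-plane of the parameter is the sheet \<open>y = YY\<close>; the left
  half-plane is the other sheet and the imaginary axis lies over the slit.\<close>

lemma lam_right:
  assumes x: "x \<in> Br" and s: "s \<in> T x" "Re s > 0"
  shows "lam x s \<in> U" "root_at x (lam x s) = s" "YY (lam x s) = s * EE x (lam x s)"
proof -
  have q: "(lam x s - x) / (z0 - x) = s\<^sup>2" using z0_ne[OF BrZ[OF x]] by (simp add: lam_def)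
  have "s\<^sup>2 \<notin> \<real>\<^sub>\<le>\<^sub>0"
  proof
    assume *: "s\<^sup>2 \<in> \<real>\<^sub>\<le>\<^sub>0"
    then have "Im s = 0" using s(2) by (auto simp: complex_nonpos_Reals_iff power2_eq_square)
    then show False using * s(2) by (auto simp: complex_nonpos_Reals_iff power2_eq_square mult_le_0_iff)
  qed
  then have "lam x s \<notin> slit x" by (simp add: slit_def q)
  then show "lam x s \<in> U" using s(1) by (auto simp: U_def T_def)
  show r: "root_at x (lam x s) = s" unfolding root_at_def q using s(2) by (intro csqrt_square) auto
  show "YY (lam x s) = s * EE x (lam x s)" using YY_EE[OF x, of "lam x s"] by (simp add: r)
qed

text \<open>The star centre 0 lies on the boundary of the half-plane, so a small half disc replaces
  it as the common part of all segments.\<close>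

lemma connected_N_right:
  assumes x: "x \<in> Br"
  shows "connected (N x \<inter> {s. Re s > 0})"
proof -
  obtain e where e: "e > 0" "ball 0 e \<subseteq> N x"
    using open_N zero_N[OF x] open_contains_ball by blast
  define B where "B = ball 0 e \<inter> {s. Re s > 0}"
  have "convex B" unfolding B_def by (intro convex_Int convex_ball convex_halfspace_Re_gt)
  have Bne: "of_real (e / 2) \<in> B" using e(1) by (simp add: B_def)
  define C where "C = (\<lambda>s. B \<union> {of_real u * s | u. 0 < u \<and> u \<le> 1})"
  have conn: "connected (C s)" if s: "Re s > 0" for s
  proof -
    have "connected ((\<lambda>u. of_real u * s) ` {0<..1})"
      by (intro connected_continuous_image continuous_intros) auto
    moreover have "(\<lambda>u. of_real u * s) ` {0<..1} = {of_real u * s | u. 0 < u \<and> u \<le> 1}" by auto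
    ultimately have "connected {of_real u * s | u. 0 < u \<and> u \<le> 1}" by simp
    moreover have "B \<inter> {of_real u * s | u. 0 < u \<and> u \<le> 1} \<noteq> {}"
    proof -
      have s0: "cmod s > 0" using s by auto
      define u where "u = min 1 (e / (2 * cmod s))"
      have u: "0 < u" "u \<le> 1" using e s0 by (auto simp: u_def)
      have "u * cmod s \<le> e / (2 * cmod s) * cmod s" unfolding u_def by (intro mult_right_mono) auto
      also have "\<dots> = e / 2" using s0 by simp
      finally have "u * cmod s < e" using e(1) by simp
      then have "of_real u * s \<in> B" using u s by (simp add: B_def norm_mult)
      then show ?thesis using u by blast
    qed
    ultimately show ?thesis unfolding C_def by (rule connected_Un[OF convex_connected[OF \<open>convex B\<close>]])
  qed
  have "connected (\<Union> (C ` (N x \<inter> {s. Re s > 0})))"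
  proof (rule connected_Union)
    show "\<Inter> (C ` (N x \<inter> {s. Re s > 0})) \<noteq> {}" using Bne by (auto simp: C_def)
  qed (use conn in auto)
  moreover have "\<Union> (C ` (N x \<inter> {s. Re s > 0})) = N x \<inter> {s. Re s > 0}"
  proof (intro equalityI subsetI)
    fix p assume "p \<in> \<Union> (C ` (N x \<inter> {s. Re s > 0}))"
    then obtain s where s: "s \<in> N x" "Re s > 0" "p \<in> C s" by auto
    show "p \<in> N x \<inter> {s. Re s > 0}"
    proof (cases "p \<in> B")
      case True then show ?thesis using e(2) by (auto simp: B_def)
    next
      case False
      then obtain u where u: "0 < u" "u \<le> 1" "p = of_real u * s" using s(3) by (auto simp: C_def)
      then have "p \<in> closed_segment 0 s" by (auto simp: closed_segment_def scaleR_conv_of_real)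
      then show ?thesis using N_star[OF s(1)] u s(2) by auto
    qed
  next
    fix p assume "p \<in> N x \<inter> {s. Re s > 0}"
    moreover have "p \<in> C p" unfolding C_def by (auto intro!: exI[of _ 1])
    ultimately show "p \<in> \<Union> (C ` (N x \<inter> {s. Re s > 0}))" by blast
  qed
  ultimately show ?thesis by simp
qed

text \<open>The potential is glued from the real part of one primitive on the slit plane, with both
  signs, and from the real parts of the odd primitives in the charts that cover the slits. By
  \<open>J_eq_primitive\<close> the hypothesis says that the latter agree at s = 1, the common point
  over \<open>z0\<close>, and this is what makes the pieces fit.\<close>

theorem slit_potential:
  assumes J: "\<And>x. x \<in> Br \<Longrightarrow> Re (J b x) = Re (J b 0)"
  shows "\<exists>h. potential a b h"
proof -
  obtain K where K: "\<And>x s. x \<in> Br \<Longrightarrow> K x (- s) = - K x s"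
    "\<And>x s. x \<in> Br \<Longrightarrow> s \<in> N x \<Longrightarrow> s \<noteq> 0 \<Longrightarrow> (K x has_field_derivative dK b x s) (at s)"
    using exists_primitive[of _ b] by metis
  have ReK: "Re (K x 1) = Re (K 0 1)" if "x \<in> Br" for x
    using J[OF that] J_eq_primitive[OF that, of "K x" b] J_eq_primitive[OF zero_Br, of "K 0" b] K that zero_Br by simp
  define f where "f = (\<lambda>z. poly b z / (z * YY z))"
  have YY_nz: "YY z \<noteq> 0" "z \<noteq> 0" if "z \<in> U" for z
    using YY_sq[of z] U_nonbranch[OF that] by auto
  have fh: "f holomorphic_on U" unfolding f_def using YY_nz by (intro holomorphic_intros YY_holomorphic) auto
  have "starlike U" using z0U starlike_U by (auto simp: starlike_def)
  moreover have "f field_differentiable at z" if "z \<in> U - {}" for z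
    using fh that open_U by (auto simp: holomorphic_on_open field_differentiable_def)
  ultimately obtain H0 where H0: "\<forall>z\<in>U. (H0 has_field_derivative f z) (at z)"
    using holomorphic_starlike_primitive[of U f "{}"] holomorphic_on_imp_continuous_on[OF fh] open_U by blast
  \<comment> \<open>The additive constant is fixed by the value at \<open>z0\<close>, where the real
    parts of all \<open>K x 1\<close> coincide.\<close>
  define H where "H = (\<lambda>z. H0 z - H0 z0 + K 0 1)"
  have H: "(H has_field_derivative f z) (at z)" if "z \<in> U" for z
    unfolding H_def using H0 that by (auto intro!: derivative_eq_intros)
  \<comment> \<open>Both sides come from primitives of the same differential in \<open>s\<close> on
    the connected right half of \<open>N x\<close>; their real parts are compared at s = 1.\<close>
  have HK: "Re (H (lam x s)) = Re (K x s)" if x: "x \<in> Br" and s: "s \<in> N x" "Re s > 0" for x s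
  proof -
    define M where "M = N x \<inter> {s. Re s > 0}"
    have opM: "open M" unfolding M_def by (intro open_Int open_N open_halfspace_Re_gt)
    have D: "((\<lambda>s. H (lam x s) - K x s) has_field_derivative 0) (at s)" if s: "s \<in> M" for s
    proof -
      have sT: "s \<in> T x" "Re s > 0" "s \<noteq> 0" "s \<in> N x" using s N_T by (auto simp: M_def)
      have "(lam x has_field_derivative 2 * (z0 - x) * s) (at s)"
        unfolding lam_def by (auto intro!: derivative_eq_intros)
      from DERIV_diff[OF DERIV_chain2[OF H[OF lam_right(1)[OF x sT(1,2)]] this] K(2)[OF x sT(4,3)]]
      have "((\<lambda>s. H (lam x s) - K x s) has_field_derivative f (lam x s) * (2 * (z0 - x) * s) - dK b x s) (at s)" .
      moreover have "f (lam x s) * (2 * (z0 - x) * s) = dK b x s"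
      proof -
        have "f (lam x s) * (2 * (z0 - x) * s) = s * (2 * (z0 - x) * poly b (lam x s)) / (s * (lam x s * EE x (lam x s)))"
          by (simp add: f_def lam_right(3)[OF x sT(1,2)] mult_ac)
        also have "\<dots> = dK b x s" unfolding dK_def using sT(3) by (rule nonzero_mult_divide_mult_cancel_left)
        finally show ?thesis .
      qed
      ultimately show ?thesis by simp
    qed
    have "(\<lambda>s. H (lam x s) - K x s) constant_on M"
      using has_field_derivative_0_imp_constant_on[of M, OF D connected_N_right[OF x, folded M_def] opM] by blast
    moreover have "1 \<in> M" "s \<in> M" using in_N[OF x, of 1 1] s by (auto simp: M_def)
    ultimately have "H (lam x s) - K x s = H (lam x 1) - K x 1" by (auto simp: constant_on_def)
    then have "Re (H (lam x s)) - Re (K x s) = Re (H (lam x 1)) - Re (K x 1)" by (metis minus_complex.sel(1))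
    then show ?thesis using ReK[OF x] by (simp add: H_def lam_def)
  qed
  define sx where "sx = (\<lambda>l. SOME x. x \<in> Br \<and> l \<in> slit x)"
  \<comment> \<open>On a slit, \<open>y / EE (sx l) l\<close> is the chart parameter of the point
    \<open>(l, y)\<close>, so no sheet has to be chosen there. By genericity the slits are disjoint,
    which makes \<open>sx\<close> unambiguous.\<close>
  define h where "h = (\<lambda>l y. if l \<in> U then (if y = YY l then Re (H l) else - Re (H l)) else Re (K (sx l) (y / EE (sx l) l)))"
  have uniq: "x = x'" if u: "x \<in> Br" "x' \<in> Br" "l \<in> slit x" "l \<in> slit x'" for x x' l
  proof (rule ccontr)
    assume "x \<noteq> x'"
    obtain v where v: "(l - x) / (z0 - x) = of_real v" "v \<le> 0" using u(3) by (auto simp: slit_def nonpos_Reals_def)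
    have "l = z0 - of_real (1 - v) * (z0 - x)"
      using v z0_ne[OF BrZ[OF u(1)]] by (simp add: field_simps)
    then show False using ray_avoids(1)[of x x' "1 - v"] BrZ u \<open>x \<noteq> x'\<close> v by auto
  qed
  have sx: "sx l = x" if "x \<in> Br" "l \<in> slit x" for x l
    unfolding sx_def using that uniq by (intro some_equality) auto
  \<comment> \<open>The chart formula holds on all of \<open>N x\<close>: the right half-plane by
    \<open>HK\<close>, the left half-plane by oddness, the imaginary axis by the definition of
    \<open>h\<close> on slits.\<close>
  have C: "h (lam x s) (s * EE x (lam x s)) = Re (K x s)" if x: "x \<in> Br" and s: "s \<in> N x" "s \<noteq> 0" for x s
  proof -
    consider "Re s > 0" | "Re s < 0" | "Re s = 0" by linarith
    then show ?thesis
    proof cases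
      case 1
      then show ?thesis using lam_right[OF x N_T[OF s(1)] 1] HK[OF x s(1) 1] by (simp add: h_def)
    next
      case 2
      then have r: "Re (- s) > 0" by simp
      have ls: "lam x (- s) = lam x s" by (simp add: lam_def)
      note q = lam_right[OF x N_T[OF N_minus[OF s(1)]] r, unfolded ls]
      have "YY (lam x s) \<noteq> 0" using YY_nz q(1) by blast
      then have "s * EE x (lam x s) \<noteq> YY (lam x s)" using q(3) by auto
      then have "h (lam x s) (s * EE x (lam x s)) = - Re (H (lam x s))" using q(1) by (simp add: h_def)
      then show ?thesis using HK[OF x N_minus[OF s(1)] r] K(1)[OF x, of s] by (simp add: ls)
    next
      case 3
      have "(lam x s - x) / (z0 - x) = s\<^sup>2" using z0_ne[OF BrZ[OF x]] by (simp add: lam_def)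
      moreover have "s\<^sup>2 \<in> \<real>\<^sub>\<le>\<^sub>0" using 3 by (simp add: complex_nonpos_Reals_iff power2_eq_square)
      ultimately have sl: "lam x s \<in> slit x" by (simp add: slit_def)
      then have "lam x s \<notin> U" using x by (auto simp: U_def)
      then show ?thesis using sx[OF x sl] EE_lam_nz[OF N_T[OF s(1)]] by (simp add: h_def)
    qed
  qed
  have "potential a b h"
    unfolding potential_def
  proof (intro conjI allI impI; (elim conjE)?)
    fix l y :: complex assume y: "y\<^sup>2 = l * poly a l"
    show "h l (- y) = - h l y"
    proof (cases "l \<in> U")
      case True
      have "y = YY l \<or> y = - YY l" using y YY_sq[of l] by (metis power2_eq_iff)
      then show ?thesis using YY_nz(1)[OF True] True by (auto simp: h_def)
    next
      case False
      then obtain x where x: "x \<in> Br" "l \<in> slit x" by (auto simp: U_def)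
      then show ?thesis using False sx[OF x] K(1)[OF x(1), of "y / EE x l"] by (simp add: h_def)
    qed
  next
    fix Y :: "complex \<Rightarrow> complex" and r :: real and l :: complex
    assume r: "0 < r" and Yh: "Y holomorphic_on ball l r" and Y: "\<forall>z\<in>ball l r. (Y z)\<^sup>2 = z * poly a z \<and> z * poly a z \<noteq> 0"
    have lb: "l \<in> ball l r" using r by simp
    have ev: "\<forall>\<^sub>F z in nhds l. z \<in> ball l r" using r by (intro eventually_nhds_in_open) auto
    have Yl: "(Y l)\<^sup>2 = l * poly a l" "Y l \<noteq> 0" "l \<noteq> 0" "l \<notin> Br" using bspec[OF Y lb] by (auto simp: Br_def)
    have Yc: "isCont Y l" using Yh lb
      by (meson continuous_on_eq_continuous_at holomorphic_on_imp_continuous_on open_ball)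
    show "((\<lambda>z. h z (Y z)) has_derivative (\<lambda>d. Re (poly b l * d / (l * Y l)))) (at l)"
    proof (cases "l \<in> U")
      case True
      obtain \<sigma> :: real where \<sigma>: "\<sigma> = 1 \<or> \<sigma> = -1" "Y l = of_real \<sigma> * YY l"
        using Yl(1) YY_sq[of l] power2_eq_iff[of "Y l" "YY l"] by (metis mult_1 mult_minus1 of_real_1 of_real_minus)
      have "isCont YY l" using YY_holomorphic True open_U
        by (meson continuous_on_eq_continuous_at holomorphic_on_imp_continuous_on)
      have ne: "YY l \<noteq> 0" using YY_nz True by blast
      have "isCont (\<lambda>z. Re (of_real \<sigma> * YY z / Y l)) l"
        using \<open>isCont YY l\<close> Yl(2) by (intro isCont_Re continuous_intros) auto
      then have 1: "\<forall>\<^sub>F z in nhds l. Re (of_real \<sigma> * YY z / Y l) > 0"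
        by (rule eventually_nhds_pos) (use \<sigma>(2)[symmetric] Yl(2) in simp)
      have "isCont (\<lambda>z. Re (Y z / Y l)) l"
        using Yc Yl(2) by (intro isCont_Re continuous_intros) auto
      then have 2: "\<forall>\<^sub>F z in nhds l. Re (Y z / Y l) > 0"
        by (rule eventually_nhds_pos) (use Yl(2) in simp)
      have 3: "\<forall>\<^sub>F z in nhds l. z \<in> U" using True open_U by (intro eventually_nhds_in_open) auto
      have E: "\<forall>\<^sub>F z in nhds l. \<sigma> * Re (H z) = h z (Y z)"
        using 1 2 3 ev
      proof eventually_elim
        case (elim z)
        have "(Y z)\<^sup>2 = (of_real \<sigma> * YY z)\<^sup>2"
          using bspec[OF Y elim(4)] YY_sq[of z] \<sigma>(1) by (auto simp: power_mult_distrib)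
        then have "Y z = of_real \<sigma> * YY z" by (rule sqrt_branch_unique[OF _ elim(2,1)])
        then show ?case using \<sigma>(1) elim(3) YY_nz(1)[OF elim(3)] by (auto simp: h_def)
      qed
      have "((\<lambda>z. \<sigma> * Re (H z)) has_derivative (\<lambda>d. Re (poly b l * d / (l * Y l)))) (at l)"
      proof -
        have "(H has_derivative (\<lambda>d. f l * d)) (at l)" using H[OF True] unfolding has_field_derivative_def .
        from has_derivative_mult_right[OF has_derivative_Re[OF this], of \<sigma>]
        have "((\<lambda>z. \<sigma> * Re (H z)) has_derivative (\<lambda>d. \<sigma> * Re (f l * d))) (at l)" .
        moreover have "\<sigma> * Re (f l * d) = Re (poly b l * d / (l * Y l))" for d
        proof -
          have "\<sigma> * Re (f l * d) = Re (of_real \<sigma> * (f l * d))" by simp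
          also have "of_real \<sigma> * (f l * d) = poly b l * d / (l * Y l)"
            using \<sigma> ne by (auto simp: f_def)
          finally show ?thesis .
        qed
        ultimately show ?thesis by (simp only:)
      qed
      then show ?thesis
        by (rule has_derivative_transform_eventually)
          (use E in \<open>auto simp: eventually_at_filter intro: eventually_mono eventually_nhds_x_imp_x\<close>)
    next
      case False
      then obtain x where x: "x \<in> Br" "l \<in> slit x" by (auto simp: U_def)
      have ne: "z0 - x \<noteq> 0" using z0_ne BrZ x by blast
      \<comment> \<open>The branch \<open>YY\<close> jumps across the slit, but
        \<open>Y / EE x\<close> is a holomorphic root of \<open>(z - x) / (z0 - x)\<close> near
        \<open>l\<close>, hence a chart parameter in which \<open>h\<close> is the real part of
        \<open>K x\<close>.\<close>
      define s where "s = (\<lambda>z. Y z / EE x z)"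
      define V where "V = ball l r \<inter> - (\<Union>x'\<in>Br - {x}. slit x')"
      have opV: "open V" unfolding V_def using finBr closed_slit by (auto intro!: open_Int open_Compl closed_UN)
      have lV: "l \<in> V" using lb x uniq by (auto simp: V_def)
      have Enz: "EE x z \<noteq> 0" if "z \<in> V" for z
        using that in_slit_self by (intro EE_nz) (auto simp: V_def)
      have "EE x holomorphic_on V" by (rule EE_holomorphic) (auto simp: V_def)
      moreover have "Y holomorphic_on V" using Yh by (rule holomorphic_on_subset) (auto simp: V_def)
      ultimately have sh: "s holomorphic_on V" unfolding s_def using Enz by (intro holomorphic_intros) auto
      have s2: "(s z)\<^sup>2 = (z - x) / (z0 - x)" if z: "z \<in> V" for z
      proof -
        have "(Y z)\<^sup>2 = (z - x) / (z0 - x) * (EE x z)\<^sup>2" using Y z EE_sq[OF x(1), of z] by (auto simp: V_def)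
        then show ?thesis using Enz[OF z] by (simp add: s_def power_divide)
      qed
      have ls: "lam x (s z) = z" if "z \<in> V" for z using s2[OF that] ne by (simp add: lam_def)
      have snz: "s l \<noteq> 0" using Yl Enz[OF lV] by (simp add: s_def)
      obtain v where v: "(l - x) / (z0 - x) = of_real v" "v \<le> 0" using x(2) by (auto simp: slit_def nonpos_Reals_def)
      have sN: "s l \<in> N x" using in_N[OF x(1), of "s l" v] s2[OF lV] v by simp
      have "open (s -` N x \<inter> V)"
        using continuous_open_preimage[OF holomorphic_on_imp_continuous_on[OF sh] opV open_N] by (simp add: Int_commute)
      obtain s' where s': "(s has_field_derivative s') (at l)"
        using sh lV opV by (auto simp: holomorphic_on_open)
      have "((\<lambda>z. (s z)\<^sup>2) has_field_derivative 2 * s l * s') (at l)"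
        using s' by (auto intro!: derivative_eq_intros)
      then have "((\<lambda>z. (z - x) / (z0 - x)) has_field_derivative 2 * s l * s') (at l)"
        by (rule has_field_derivative_transform_within_open[OF _ opV lV]) (use s2 in auto)
      moreover have "((\<lambda>z. (z - x) / (z0 - x)) has_field_derivative 1 / (z0 - x)) (at l)"
        using ne by (auto intro!: derivative_eq_intros)
      ultimately have "2 * s l * s' = 1 / (z0 - x)" by (rule DERIV_unique)
      then have s'eq: "2 * (z0 - x) * s' = 1 / s l" using snz ne by (simp add: field_simps)
      have "((\<lambda>z. K x (s z)) has_field_derivative dK b x (s l) * s') (at l)"
        by (rule DERIV_chain2[OF K(2)[OF x(1) sN snz] s'])
      moreover have "dK b x (s l) * s' = poly b l / (l * Y l)"
      proof -
        have "dK b x (s l) * s' = (2 * (z0 - x) * s') * (poly b l / (l * EE x l))"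
          by (simp add: dK_def ls[OF lV])
        also have "\<dots> = poly b l / (l * (s l * EE x l))" unfolding s'eq by simp
        also have "s l * EE x l = Y l" using Enz[OF lV] by (simp add: s_def)
        finally show ?thesis .
      qed
      ultimately have "((\<lambda>z. K x (s z)) has_field_derivative poly b l / (l * Y l)) (at l)"
        by (simp only:)
      from has_derivative_Re[OF this[unfolded has_field_derivative_def]]
      have "((\<lambda>z. Re (K x (s z))) has_derivative (\<lambda>d. Re (poly b l * d / (l * Y l)))) (at l)"
        by (simp only: times_divide_eq_left)
      then show ?thesis
      proof (rule has_derivative_transform_within_open)
        show "open ((s -` N x \<inter> V) \<inter> - {x})" using \<open>open (s -` N x \<inter> V)\<close> by auto
        show "l \<in> (s -` N x \<inter> V) \<inter> - {x}" using sN lV Yl(4) x(1) by auto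
        fix z assume z: "z \<in> (s -` N x \<inter> V) \<inter> - {x}"
        then have zV: "z \<in> V" by auto
        have "s z \<noteq> 0" using s2[OF zV] z ne by auto
        then have "h z (s z * EE x z) = Re (K x (s z))" using C[OF x(1), of "s z"] z ls[OF zV] by auto
        moreover have "s z * EE x z = Y z" using Enz[OF zV] by (simp add: s_def)
        ultimately show "Re (K x (s z)) = h z (Y z)" by simp
      qed
    qed
  qed
  then show ?thesis by blast
qed

end

text \<open>The positions of \<open>z0\<close> excluded by a pair of distinct points are those on
  the line through them; finitely many lines are negligible.\<close>

lemma exists_generic_point:
  fixes Z :: "complex set"
  assumes "finite Z"
  obtains z0 where "z0 \<notin> Z" "\<And>x x'. x \<in> Z \<Longrightarrow> x' \<in> Z \<Longrightarrow> x \<noteq> x' \<Longrightarrow> Im ((z0 - x) / (z0 - x')) \<noteq> 0"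
proof -
  define L where "L = (\<lambda>(x, x'). {z. (\<i> * (x - x')) \<bullet> z = - Im (x * cnj x')})"
  define A where "A = {p \<in> Z \<times> Z. fst p \<noteq> snd p}"
  have "finite A" using assms by (auto simp: A_def)
  have "negligible (\<Union> (L ` A))"
    using \<open>finite A\<close> by (intro negligible_Union) (auto simp: L_def A_def intro!: negligible_hyperplane)
  from negligible_Un[OF negligible_finite[OF assms] this] have "negligible (Z \<union> \<Union> (L ` A))" .
  then have "Z \<union> \<Union> (L ` A) \<noteq> UNIV" using non_negligible_UNIV by metis
  then obtain z0 where z0: "z0 \<notin> Z" "z0 \<notin> \<Union> (L ` A)" by auto
  show ?thesis
  proof (rule that[OF z0(1)])
    fix x x' assume x: "x \<in> Z" "x' \<in> Z" "x \<noteq> x'"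
    then have "(x, x') \<in> A" by (simp add: A_def)
    then have "z0 \<notin> L (x, x')" using z0(2) by blast
    then have "(\<i> * (x - x')) \<bullet> z0 \<noteq> - Im (x * cnj x')" by (simp add: L_def)
    moreover have "Im ((z0 - x) * cnj (z0 - x')) = (\<i> * (x - x')) \<bullet> z0 + Im (x * cnj x')"
      by (simp add: inner_complex_def algebra_simps)
    ultimately have "Im ((z0 - x) * cnj (z0 - x')) \<noteq> 0" by simp
    moreover have "Im ((z0 - x) / (z0 - x')) = Im ((z0 - x) * cnj (z0 - x')) / (cmod (z0 - x'))\<^sup>2"
      by (metis complex_div_cnj Im_divide_of_real of_real_power)
    moreover have "cmod (z0 - x') \<noteq> 0" using z0(1) x(2) by auto
    ultimately show "Im ((z0 - x) / (z0 - x')) \<noteq> 0" by simp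
  qed
qed

lemma exists_slit_curve:
  assumes "regular a" "finite W"
  obtains z0 where "slit_curve a z0 ({x. x * poly a x = 0} \<union> W)"
proof -
  have fin: "finite ({x. x * poly a x = 0} \<union> W)" using finite_branch_points[OF assms(1)] assms(2) by simp
  show ?thesis
  proof (rule exists_generic_point[OF fin])
    fix z0 assume *: "z0 \<notin> {x. x * poly a x = 0} \<union> W"
      "\<And>x x'. x \<in> {x. x * poly a x = 0} \<union> W \<Longrightarrow> x' \<in> {x. x * poly a x = 0} \<union> W \<Longrightarrow> x \<noteq> x' \<Longrightarrow> Im ((z0 - x) / (z0 - x')) \<noteq> 0"
    show ?thesis
    proof (rule that, unfold_locales)
      show "Im ((z0 - x) / (z0 - x')) \<noteq> 0"
        if "x \<in> {x. x * poly a x = 0} \<union> W" "x' \<in> {x. x * poly a x = 0} \<union> W" "x \<noteq> x'" for x x'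
        using *(2) that by blast
    qed (use * assms(1) fin in auto)
  qed
qed

section \<open>Existence and uniqueness of the differentials\<close>

lemma card_roots_H_space:
  assumes "a \<in> H_space g"
  shows "card {x. poly a x = 0} = 2 * g"
proof -
  have sf: "rsquarefree a" and deg: "degree a = 2 * g" using assms by (auto simp: H_space_def)
  then have a0: "a \<noteq> 0" by (auto simp: rsquarefree_def)
  have "a = smult (lead_coeff a) (\<Prod>x | poly a x = 0. [:- x, 1:])"
    using complex_poly_decompose_rsquarefree[OF sf] by simp
  then have "degree a = degree (\<Prod>x | poly a x = 0. [:- x, 1:])"
    using a0 by (metis degree_smult_eq leading_coeff_0_iff)
  also have "\<dots> = (\<Sum>x | poly a x = 0. degree [:- x, 1:])"
    by (rule degree_prod_sum_eq) auto
  finally show ?thesis using deg by simp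
qed

text \<open>The unknowns are the \<open>g\<close> middle coefficients, the equations compare
  \<open>Re (J b x)\<close> for the 2g roots \<open>x\<close> of \<open>a\<close> with
  \<open>Re (J b 0)\<close>. A solution of the homogeneous system yields a potential with vanishing
  end coefficients, so the system is injective by \<open>potential_unique\<close>.\<close>

lemma potential_exists:
  assumes a: "a \<in> H_space g"
  obtains b h where "degree b \<le> g + 1" "coeff b 0 = c0" "coeff b (g + 1) = c1" "potential a b h"
proof -
  note reg = H_space_props(1)[OF a] and sym = H_space_props(2)[OF a]
  define Z where "Z = {x. x * poly a x = 0} \<union> {}"
  obtain z0 where "slit_curve a z0 Z"
    unfolding Z_def by (rule exists_slit_curve[OF reg finite.emptyI])
  then interpret slit_curve a z0 Z .
  define X where "X = Br - {0}"
  have finX: "finite X" using finBr by (simp add: X_def)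
  have "X = {x. poly a x = 0}" using reg by (auto simp: X_def Br_def regular_def)
  then have cardX: "card X = 2 * g" using card_roots_H_space[OF a] by simp
  define M where "M = (\<lambda>x i. J (monom 1 (i + 1)) x - J (monom 1 (i + 1)) 0)"
  define mid where "mid = (\<lambda>c. \<Sum>i<g. monom (c i) (i + 1) :: complex poly)"
  have Jmid: "J (mid c) x - J (mid c) 0 = (\<Sum>i<g. c i * M x i)" if "x \<in> Br" for c x
    using J_monom_sum[OF that, of "{..<g}" c "\<lambda>i. i + 1"] J_monom_sum[OF zero_Br, of "{..<g}" c "\<lambda>i. i + 1"]
    by (simp add: mid_def M_def sum_subtractf right_diff_distrib)
  have cmid: "coeff (mid c) i = (if 1 \<le> i \<and> i \<le> g then c (i - 1) else 0)" for c i
    by (cases i) (auto simp: mid_def coeff_sum)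
  have dmid: "degree (mid c) \<le> g + 1" for c by (rule degree_le) (simp add: cmid)
  define b0 where "b0 = monom c0 0 + monom c1 (g + 1)"
  have "\<exists>c. \<forall>x\<in>X. Re (\<Sum>i<g. c i * M x i) = - Re (J b0 x - J b0 0)"
  proof (rule complex_coeffs_solvable[OF finX cardX])
    fix c assume c: "\<And>x. x \<in> X \<Longrightarrow> Re (\<Sum>i<g. c i * M x i) = 0"
    have "Re (J (mid c) x) = Re (J (mid c) 0)" if "x \<in> Br" for x
    proof (cases "x = 0")
      case False
      then have "Re (J (mid c) x - J (mid c) 0) = 0" using c[of x] Jmid[OF that] that by (simp add: X_def)
      then show ?thesis by simp
    qed simp
    then obtain h where "potential a (mid c) h" using slit_potential[of "mid c"] by blast
    then have "mid c = 0" by (rule potential_unique[OF _ reg sym dmid]) (auto simp: cmid)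
    then have "c i = 0" if "i < g" for i using cmid[of c "i + 1"] that by simp
    then show "\<forall>i<g. c i = 0" by blast
  qed
  then obtain c where c: "\<And>x. x \<in> X \<Longrightarrow> Re (\<Sum>i<g. c i * M x i) = - Re (J b0 x - J b0 0)" by blast
  define b where "b = b0 + mid c"
  have "Re (J b x) = Re (J b 0)" if x: "x \<in> Br" for x
  proof (cases "x = 0")
    case False
    then have "x \<in> X" using x by (simp add: X_def)
    then have "Re (J (mid c) x - J (mid c) 0) = - Re (J b0 x - J b0 0)" using c Jmid[OF x] by simp
    then show ?thesis by (simp add: b_def J_add[OF x] J_add[OF zero_Br])
  qed simp
  then obtain h where h: "potential a b h" using slit_potential[of b] by blast
  have "degree b0 \<le> g + 1" by (rule degree_le) (simp add: b0_def)
  then have "degree b \<le> g + 1" using dmid by (simp add: b_def degree_add_le)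
  then show ?thesis using h by (intro that[of b h]) (auto simp: b_def b0_def cmid)
qed

text \<open>Prescribing \<open>c\<close> and \<open>cnj c\<close> at the two ends suffices:
  \<open>b\<close> minus its reflection again has a potential, and its end coefficients vanish, so
  it is 0.\<close>

lemma real_potential_exists:
  assumes a: "a \<in> H_space g"
  shows "\<exists>!b. b \<in> real_polys (g + 1) \<and> (\<exists>h. potential a b h) \<and> poly b 0 = c"
proof -
  note reg = H_space_props(1)[OF a] and sym = H_space_props(2)[OF a]
  obtain b h where b: "degree b \<le> g + 1" "coeff b 0 = c" "coeff b (g + 1) = cnj c" "potential a b h"
    by (rule potential_exists[OF a])
  have "b - poly_star (g + 1) b = 0"
  proof (rule potential_unique[OF _ reg sym])
    show "potential a (b - poly_star (g + 1) b) (\<lambda>l y. h l y + h (1 / cnj l) (cnj y / cnj l ^ (g + 1)))"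
      using potential_add[OF b(4) potential_reflect[OF b(4) sym b(1)]] by simp
  qed (use b degree_poly_star in \<open>auto intro!: degree_diff_le simp: coeff_poly_star\<close>)
  then have br: "b \<in> real_polys (g + 1)" using b(1) by (simp add: real_polys_iff)
  show ?thesis
  proof (rule ex1I[of _ b])
    show "b \<in> real_polys (g + 1) \<and> (\<exists>h. potential a b h) \<and> poly b 0 = c"
      using br b by (auto simp: poly_0_coeff_0)
    fix b' assume *: "b' \<in> real_polys (g + 1) \<and> (\<exists>h. potential a b' h) \<and> poly b' 0 = c"
    then obtain h' where h': "potential a b' h'" by blast
    have "coeff b' (g + 1) = cnj (coeff b' 0)" "coeff b (g + 1) = cnj (coeff b 0)"
      using * br by (auto simp: real_polys_def)
    moreover have "coeff b' 0 = coeff b 0" using * b(2) by (simp add: poly_0_coeff_0)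
    ultimately have "b' - b = 0"
      using * br by (intro potential_unique[OF potential_diff[OF h' b(4)] reg sym])
        (auto simp: real_polys_def intro!: degree_diff_le)
    then show "b' = b" by simp
  qed
qed

section \<open>Imaginary periods and single-valued potentials\<close>

text \<open>Links the chart at \<open>x\<close>, where the square of \<open>E x\<close> is
  \<open>poly e x\<close>, to the denominator of \<open>Theta\<close> at points with y = 0.\<close>

lemma pderiv_at_branch:
  assumes "\<forall>z. z * poly a z = (z - x) * poly e z"
  shows "poly (pderiv ([:0, 1:] * a)) x = poly (e :: complex poly) x"
proof -
  have "[:0, 1:] * a = [:- x, 1:] * e"
  proof -
    have "poly ([:0, 1:] * a) z = poly ([:- x, 1:] * e) z" for z
    proof -
      have "poly ([:0, 1:] * a) z = z * poly a z" by simp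
      also have "\<dots> = (z - x) * poly e z" using assms by blast
      also have "\<dots> = poly ([:- x, 1:] * e) z" by (simp add: algebra_simps)
      finally show ?thesis .
    qed
    then show ?thesis by (simp add: poly_eq_poly_eq_iff[symmetric] fun_eq_iff del: mult_pCons_left)
  qed
  then show ?thesis by (simp add: pderiv_mult pderiv_pCons pderiv_diff pderiv_smult)
qed

text \<open>A path on the curve may run through a branch point. There
  \<open>S = y / E(\<lambda>)\<close> is the local parameter, it is differentiable along the path
  together with \<open>l\<close> and \<open>y\<close>, and \<open>h\<close> is the real part of a
  holomorphic function of it.\<close>

lemma potential_along_branch:
  fixes l y :: "real \<Rightarrow> complex"
  assumes pot: "potential a b h" and reg: "regular a"
    and curve: "\<And>u. u \<in> T \<Longrightarrow> (y u)\<^sup>2 = l u * poly a (l u)"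
    and t: "t \<in> T" "y t = 0" "l t \<noteq> 0"
    and cont: "continuous (at t within T) l" "continuous (at t within T) y"
  shows "continuous (at t within T) (\<lambda>u. h (l u) (y u))"
    "\<And>l' y'. (l has_vector_derivative l') (at t within T) \<Longrightarrow> (y has_vector_derivative y') (at t within T) \<Longrightarrow>
      ((\<lambda>u. h (l u) (y u)) has_vector_derivative Re (Theta a b (l t, y t) (l', y'))) (at t within T)"
proof -
  define x where "x = l t"
  have xb: "x * poly a x = 0" using curve[OF t(1)] t(2) by (simp add: x_def)
  obtain \<rho> E F k e where B': "\<rho> > 0" "E holomorphic_on ball x (\<rho>\<^sup>2)"
    "\<forall>z\<in>ball x (\<rho>\<^sup>2). (E z)\<^sup>2 = poly e z \<and> E z \<noteq> 0 \<and> poly e z \<noteq> 0"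
    "\<forall>z. z * poly a z = (z - x) * poly e z"
    "F holomorphic_on ball 0 \<rho>" "\<forall>s. F (- s) = - F s"
    "\<forall>s\<in>ball 0 \<rho>. s \<noteq> 0 \<longrightarrow> h (x + s\<^sup>2) (s * E (x + s\<^sup>2)) = Re (F s - k / s)"
    "x = (0::complex) \<longrightarrow> k = 2 * poly b 0 / E 0"
    "\<forall>s\<in>ball 0 \<rho>. s \<noteq> 0 \<longrightarrow> ((\<lambda>s. F s - k / s) has_field_derivative 2 * poly b (x + s\<^sup>2) / ((x + s\<^sup>2) * E (x + s\<^sup>2))) (at s)"
    "x \<noteq> 0 \<longrightarrow> k = 0 \<and> (\<forall>s\<in>ball 0 \<rho>. (F has_field_derivative 2 * poly b (x + s\<^sup>2) / ((x + s\<^sup>2) * E (x + s\<^sup>2))) (at s))"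
    by (rule potential_at_branch[OF pot reg xb]) (rule that)
  have x0: "x \<noteq> 0" using t by (simp add: x_def)
  have k: "k = 0" and DF: "\<forall>s\<in>ball 0 \<rho>. (F has_field_derivative 2 * poly b (x + s\<^sup>2) / ((x + s\<^sup>2) * E (x + s\<^sup>2))) (at s)"
    using B'(10) x0 by auto
  define S where "S = (\<lambda>u. y u / E (l u))"
  have rep: "h (l u) (y u) = Re (F (S u))" if u: "u \<in> T" "l u \<in> ball x (\<rho>\<^sup>2)" for u
  proof -
    have E: "(E (l u))\<^sup>2 = poly e (l u)" "E (l u) \<noteq> 0" using bspec[OF B'(3) u(2)] by auto
    have "(y u)\<^sup>2 = (l u - x) * (E (l u))\<^sup>2" using curve[OF u(1)] B'(4)[rule_format, of "l u"] E(1) by simp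
    then have s2: "(S u)\<^sup>2 = l u - x" using E(2) by (simp add: S_def power_divide)
    then have "cmod (S u) ^ 2 < \<rho>\<^sup>2" using u(2) by (metis dist_commute dist_norm mem_ball norm_power)
    then have sb: "S u \<in> ball 0 \<rho>" using B'(1) by (simp add: power_less_imp_less_base)
    show ?thesis
    proof (cases "S u = 0")
      case True
      then have "y u = 0" "l u = x" using s2 E(2) by (auto simp: S_def)
      then show ?thesis using potential_0[OF pot xb] True B'(6)[rule_format, of 0] by simp
    next
      case False
      have "x + (S u)\<^sup>2 = l u" "S u * E (l u) = y u" using s2 E(2) by (auto simp: S_def)
      then show ?thesis using B'(7)[rule_format, OF sb False] k by simp
    qed
  qed
  have ev: "\<forall>\<^sub>F u in at t within T. Re (F (S u)) = h (l u) (y u)"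
  proof -
    have "\<forall>\<^sub>F u in at t within T. l u \<in> ball x (\<rho>\<^sup>2)"
      using cont(1) B'(1) by (auto simp: continuous_within tendsto_iff x_def dist_commute)
    moreover have "\<forall>\<^sub>F u in at t within T. u \<in> T" by (simp add: eventually_at_filter)
    ultimately show ?thesis by eventually_elim (simp add: rep)
  qed
  have St: "S t = 0" using t by (simp add: S_def)
  have Ext: "E x \<noteq> 0" "(E x)\<^sup>2 = poly e x" using bspec[OF B'(3), of x] B'(1) by auto
  have ht: "Re (F (S t)) = h (l t) (y t)" using rep[OF t(1)] B'(1) by (simp add: x_def)
  obtain E' where E': "(E has_field_derivative E') (at x)"
    using B'(1,2) by (metis centre_in_ball holomorphic_derivI open_ball zero_less_power)
  have D0: "(F has_field_derivative 2 * poly b x / (x * E x)) (at 0)"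
    using bspec[OF DF, of 0] B'(1) by simp
  have Sc: "continuous (at t within T) S"
  proof -
    have "continuous (at t within T) (\<lambda>u. E (l u))"
      by (rule continuous_within_compose3[OF _ cont(1)]) (use DERIV_isCont[OF E'] in \<open>simp add: x_def\<close>)
    then show ?thesis unfolding S_def using cont(2) Ext(1) by (intro continuous_intros) (simp_all add: x_def)
  qed
  have "((\<lambda>u. Re (F (S u))) \<longlongrightarrow> Re (F (S t))) (at t within T)"
  proof (intro tendsto_Re isCont_tendsto_compose[of _ F])
    show "isCont F (S t)" using DERIV_isCont[OF D0] St by simp
    show "(S \<longlongrightarrow> S t) (at t within T)" using Sc by (simp add: continuous_within)
  qed
  from Lim_transform_eventually[OF this ev] ht
  show "continuous (at t within T) (\<lambda>u. h (l u) (y u))" by (simp add: continuous_within)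
  fix l' y' assume l': "(l has_vector_derivative l') (at t within T)" and y': "(y has_vector_derivative y') (at t within T)"
  have "((\<lambda>u. E (l u)) has_vector_derivative l' * E') (at t within T)"
    using field_vector_diff_chain_within[OF l' has_field_derivative_at_within[OF E'[unfolded x_def]]] by (simp add: o_def)
  then have "(S has_vector_derivative y' / E x) (at t within T)"
    unfolding S_def has_vector_derivative_def
    by (rule has_derivative_eq_rhs[OF has_derivative_divide[OF y'[unfolded has_vector_derivative_def]]])
      (use Ext t in \<open>auto simp: x_def fun_eq_iff scaleR_conv_of_real divide_simps\<close>)
  then have "((\<lambda>u. F (S u)) has_vector_derivative (y' / E x) * (2 * poly b x / (x * E x))) (at t within T)"
    using field_vector_diff_chain_within[of S _ t T F] D0 St has_field_derivative_at_within by (fastforce simp: o_def)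
  from has_derivative_Re[OF this[unfolded has_vector_derivative_def]]
  have "((\<lambda>u. Re (F (S u))) has_vector_derivative Re ((y' / E x) * (2 * poly b x / (x * E x)))) (at t within T)"
    by (simp add: has_vector_derivative_def)
  moreover have "(y' / E x) * (2 * poly b x / (x * E x)) = Theta a b (l t, y t) (l', y')"
  proof -
    have "poly (pderiv ([:0, 1:] * a)) x = E x * E x"
      using pderiv_at_branch[OF B'(4)] Ext(2) by (simp only: power2_eq_square)
    then have "Theta a b (l t, y t) (l', y') = 2 * poly b x * y' / (x * (E x * E x))"
      using t(2) by (simp only: Theta_def x_def[symmetric] prod.case simp_thms if_False)
    then show ?thesis by (simp add: mult_ac)
  qed
  ultimately have "((\<lambda>u. Re (F (S u))) has_vector_derivative Re (Theta a b (l t, y t) (l', y'))) (at t within T)" by simp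
  then show "((\<lambda>u. h (l u) (y u)) has_vector_derivative Re (Theta a b (l t, y t) (l', y'))) (at t within T)"
    unfolding has_vector_derivative_def
    by (rule has_derivative_transform_eventually[OF _ ev ht t(1)])
qed

text \<open>The real part of the integrand is the derivative of \<open>h\<close> along the path, so
  over a closed path it integrates to 0.\<close>

lemma potential_imp_periods_imaginary:
  assumes pot: "potential a b h" and reg: "regular a" and w: "w \<in> periods a b"
  shows "Re w = 0"
proof -
  obtain \<gamma> where \<gamma>: "w = integral {0..1} (\<lambda>t. Theta a b (\<gamma> t) (vector_derivative \<gamma> (at t)))"
    "valid_path \<gamma>" "pathfinish \<gamma> = pathstart \<gamma>" "path_image \<gamma> \<subseteq> affine_curve a - {(l, y). l = 0}"
    using w by (auto simp: periods_def)
  define f where "f = (\<lambda>t. Theta a b (\<gamma> t) (vector_derivative \<gamma> (at t)))"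
  define l where "l = (\<lambda>t. fst (\<gamma> t))"
  define y where "y = (\<lambda>t. snd (\<gamma> t))"
  have curve: "(y t)\<^sup>2 = l t * poly a (l t)" "l t \<noteq> 0" if "t \<in> {0..1}" for t
  proof -
    have "\<gamma> t \<in> path_image \<gamma>" using that by (simp add: path_image_def)
    from subsetD[OF \<gamma>(4) this]
    show "(y t)\<^sup>2 = l t * poly a (l t)" "l t \<noteq> 0"
      by (auto simp: affine_curve_def l_def y_def split: prod.splits)
  qed
  obtain S where S: "finite S" "continuous_on {0..1} \<gamma>" "\<gamma> C1_differentiable_on ({0..1} - S)"
    using \<gamma>(2) by (auto simp: valid_path_def piecewise_C1_differentiable_on_def)
  have lc: "continuous_on {0..1} l" and yc: "continuous_on {0..1} y"
    unfolding l_def y_def by (intro continuous_intros S(2))+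
  have cont: "continuous_on {0..1} (\<lambda>t. h (l t) (y t))"
    unfolding continuous_on_eq_continuous_within
  proof
    fix t :: real assume t: "t \<in> {0..1}"
    have c: "continuous (at t within {0..1}) l" "continuous (at t within {0..1}) y"
      using lc yc t by (auto simp: continuous_on_eq_continuous_within)
    show "continuous (at t within {0..1}) (\<lambda>t. h (l t) (y t))"
    proof (cases "y t = 0")
      case True
      from potential_along_branch(1)[OF pot reg curve(1) t this curve(2)[OF t] c] show ?thesis .
    next
      case False
      from potential_continuous[OF pot curve(1) t this c] show ?thesis .
    qed
  qed
  have der: "((\<lambda>t. h (l t) (y t)) has_vector_derivative Re (f t)) (at t)" if "t \<in> {0<..<1} - S" for t
  proof -
    have t: "t \<in> {0..1}" "t \<in> {0<..<1}" using that by auto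
    have at: "at t within {0..1} = at t" using t(2) by (intro at_within_interior) auto
    define D where "D = vector_derivative \<gamma> (at t)"
    have D: "(\<gamma> has_vector_derivative D) (at t)"
    proof -
      have "t \<in> {0..1} - S" using that by auto
      then have "\<gamma> differentiable at t" using S(3) unfolding C1_differentiable_on_eq by (metis bspec)
      then show ?thesis unfolding D_def by (simp only: vector_derivative_works)
    qed
    have l': "(l has_vector_derivative fst D) (at t within {0..1})" and y': "(y has_vector_derivative snd D) (at t within {0..1})"
      using has_derivative_fst[OF D[unfolded has_vector_derivative_def]] has_derivative_snd[OF D[unfolded has_vector_derivative_def]]
      by (simp_all only: at l_def y_def has_vector_derivative_def fst_scaleR snd_scaleR)
    have g: "\<gamma> t = (l t, y t)" "D = (fst D, snd D)" by (auto simp: l_def y_def)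
    have c: "continuous (at t within {0..1}) l" "continuous (at t within {0..1}) y"
      using lc yc t by (auto simp: continuous_on_eq_continuous_within)
    have "((\<lambda>t. h (l t) (y t)) has_vector_derivative Re (Theta a b (l t, y t) (fst D, snd D))) (at t within {0..1})"
    proof (cases "y t = 0")
      case True
      from potential_along_branch(2)[OF pot reg curve(1) t(1) this curve(2)[OF t(1)] c l' y'] show ?thesis .
    next
      case False
      from potential_has_derivative[OF pot curve(1) t(1) False l'[unfolded has_vector_derivative_def] c(2)]
      have "((\<lambda>t. h (l t) (y t)) has_derivative (\<lambda>d. Re (poly b (l t) * (d *\<^sub>R fst D) / (l t * y t)))) (at t within {0..1})" .
      moreover have "Re (poly b (l t) * (d *\<^sub>R fst D) / (l t * y t)) = d *\<^sub>R Re (Theta a b (l t, y t) (fst D, snd D))" for d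
      proof -
        have "poly b (l t) * (d *\<^sub>R fst D) / (l t * y t) = d *\<^sub>R Theta a b (l t, y t) (fst D, snd D)"
          using False by (simp add: Theta_def case_prod_unfold scaleR_conv_of_real)
        then show ?thesis by (simp only: scaleR_complex.sel real_scaleR_def)
      qed
      ultimately show ?thesis by (simp only: has_vector_derivative_def)
    qed
    then show ?thesis unfolding at f_def D_def[symmetric] g(1) g(2)[symmetric] .
  qed
  have 1: "((\<lambda>t. Re (f t)) has_integral h (l 1) (y 1) - h (l 0) (y 0)) {0..1}"
    by (rule fundamental_theorem_of_calculus_interior_strong[OF S(1) zero_le_one der cont])
  have "l 1 = l 0" "y 1 = y 0" using \<gamma>(3) by (auto simp: pathfinish_def pathstart_def l_def y_def)
  with 1 have 1: "((\<lambda>t. Re (f t)) has_integral 0) {0..1}" by simp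
  show ?thesis
  \<comment> \<open>If the integrand is not integrable, \<open>integral\<close> takes the default
    value 0, whose real part vanishes too.\<close>
  proof (cases "f integrable_on {0..1}")
    case True
    then have "(f has_integral w) {0..1}" unfolding \<gamma>(1) f_def by (rule integrable_integral)
    then have "((\<lambda>t. Re (f t)) has_integral Re w) {0..1}" by (rule has_integral_Re)
    then show ?thesis using 1 has_integral_unique by blast
  next
    case False
    then show ?thesis unfolding \<gamma>(1) using not_integrable_integral[of f "{0..1}"] by (simp add: f_def)
  qed
qed

text \<open>Evaluates the integral over a joined path from primitives along its two halves. Real
  homogeneity of \<theta> in the tangent vector is what the reparametrisations at speeds 2 and -2
  require.\<close>

lemma join_reverse_integral:
  fixes \<gamma>1 \<gamma>2 D1 D2 :: "real \<Rightarrow> complex \<times> complex" and \<Phi>1 \<Phi>2 :: "real \<Rightarrow> complex"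
  assumes D1: "\<And>t. t \<in> {0..1} \<Longrightarrow> (\<gamma>1 has_vector_derivative D1 t) (at t)"
    and D2: "\<And>t. t \<in> {0..1} \<Longrightarrow> (\<gamma>2 has_vector_derivative D2 t) (at t)"
    and \<Phi>1: "\<And>t. t \<in> {0..1} \<Longrightarrow> (\<Phi>1 has_vector_derivative \<theta> (\<gamma>1 t) (D1 t)) (at t)"
    and \<Phi>2: "\<And>t. t \<in> {0..1} \<Longrightarrow> (\<Phi>2 has_vector_derivative \<theta> (\<gamma>2 t) (D2 t)) (at t)"
    and lin: "\<And>p v c. \<theta> p (c *\<^sub>R v) = c *\<^sub>R \<theta> p v"
  defines "\<gamma> \<equiv> \<gamma>1 +++ reversepath \<gamma>2"
  shows "integral {0..1} (\<lambda>t. \<theta> (\<gamma> t) (vector_derivative \<gamma> (at t))) = (\<Phi>1 1 - \<Phi>1 0) - (\<Phi>2 1 - \<Phi>2 0)"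
proof -
  have d1: "((\<lambda>t. f (2 * t)) has_vector_derivative 2 *\<^sub>R D) (at t)"
    if "(f has_vector_derivative D) (at (2 * t))" for f :: "real \<Rightarrow> 'b::real_normed_vector" and D t
  proof -
    have "((\<lambda>t. 2 * t) has_vector_derivative 2) (at t)" for t :: real
      by (auto intro!: derivative_eq_intros simp: has_real_derivative_iff_has_vector_derivative[symmetric])
    from vector_diff_chain_at[OF this that] show ?thesis by (simp add: o_def)
  qed
  have d2: "((\<lambda>t. f (2 - 2 * t)) has_vector_derivative (- 2) *\<^sub>R D) (at t)"
    if "(f has_vector_derivative D) (at (2 - 2 * t))" for f :: "real \<Rightarrow> 'b::real_normed_vector" and D t
  proof -
    have "((\<lambda>t. 2 - 2 * t) has_vector_derivative - 2) (at t)" for t :: real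
      by (auto intro!: derivative_eq_intros simp: has_real_derivative_iff_has_vector_derivative[symmetric])
    from vector_diff_chain_at[OF this that] show ?thesis by (simp add: o_def)
  qed
  have g1: "\<gamma> t = \<gamma>1 (2 * t)" if "t < 1/2" for t using that by (simp add: \<gamma>_def joinpaths_def)
  have g2: "\<gamma> t = \<gamma>2 (2 - 2 * t)" if "t > 1/2" for t using that by (simp add: \<gamma>_def joinpaths_def reversepath_def)
  define f where "f = (\<lambda>t. \<theta> (\<gamma> t) (vector_derivative \<gamma> (at t)))"
  have i1: "(f has_integral \<Phi>1 (2 * (1/2)) - \<Phi>1 (2 * 0)) {0..1/2}"
  proof (rule fundamental_theorem_of_calculus_interior_strong[of "{}"])
    fix t :: real assume t: "t \<in> {0<..<1/2} - {}"
    then have t2: "2 * t \<in> {0..1}" by auto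
    have "(\<gamma> has_vector_derivative 2 *\<^sub>R D1 (2 * t)) (at t)"
      by (rule has_vector_derivative_transform_within_open[OF d1[OF D1[OF t2]], of "{..<1/2}"]) (use t g1 in auto)
    then have "vector_derivative \<gamma> (at t) = 2 *\<^sub>R D1 (2 * t)" by (rule vector_derivative_at)
    then have "f t = 2 *\<^sub>R \<theta> (\<gamma>1 (2 * t)) (D1 (2 * t))" using t g1 by (simp add: f_def lin)
    then show "((\<lambda>t. \<Phi>1 (2 * t)) has_vector_derivative f t) (at t)" using d1[OF \<Phi>1[OF t2]] by simp
  next
    show "continuous_on {0..1/2} (\<lambda>t. \<Phi>1 (2 * t))"
      by (intro continuous_at_imp_continuous_on ballI has_vector_derivative_continuous[OF d1[OF \<Phi>1]]) auto
  qed auto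
  have i2: "(f has_integral \<Phi>2 (2 - 2 * 1) - \<Phi>2 (2 - 2 * (1/2))) {1/2..1}"
  proof (rule fundamental_theorem_of_calculus_interior_strong[of "{}"])
    fix t :: real assume t: "t \<in> {1/2<..<1} - {}"
    then have t2: "2 - 2 * t \<in> {0..1}" by auto
    have "(\<gamma> has_vector_derivative (- 2) *\<^sub>R D2 (2 - 2 * t)) (at t)"
      by (rule has_vector_derivative_transform_within_open[OF d2[OF D2[OF t2]], of "{1/2<..}"]) (use t g2 in auto)
    then have "vector_derivative \<gamma> (at t) = (- 2) *\<^sub>R D2 (2 - 2 * t)" by (rule vector_derivative_at)
    then have "f t = (- 2) *\<^sub>R \<theta> (\<gamma>2 (2 - 2 * t)) (D2 (2 - 2 * t))" using t g2 by (simp only: f_def lin) auto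
    then show "((\<lambda>t. \<Phi>2 (2 - 2 * t)) has_vector_derivative f t) (at t)" using d2[OF \<Phi>2[OF t2]] by simp
  next
    show "continuous_on {1/2..1} (\<lambda>t. \<Phi>2 (2 - 2 * t))"
      by (intro continuous_at_imp_continuous_on ballI has_vector_derivative_continuous[OF d2[OF \<Phi>2]]) auto
  qed auto
  from has_integral_combine[OF _ _ i1 i2] have "(f has_integral \<Phi>1 1 - \<Phi>1 0 + (\<Phi>2 0 - \<Phi>2 1)) {0..1}" by simp
  then show ?thesis unfolding f_def[symmetric] by (simp add: integral_unique)
qed

lemma Theta_scale: "Theta a b p (c *\<^sub>R v) = c *\<^sub>R Theta a b p v"
  by (cases p, cases v) (simp add: Theta_def scaleR_conv_of_real)

context slit_curve begin

text \<open>Both lifted loops lead from the same point over \<open>z0\<close> to its conjugate under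
  y \<mapsto> -y, so one followed by the reverse of the other is closed.\<close>

lemma slit_period:
  assumes x: "x \<in> Br" and x': "x' \<in> Br"
  shows "(J b x - J b x') \<in> periods a b"
proof -
  obtain K where K: "\<And>x s. x \<in> Br \<Longrightarrow> K x (- s) = - K x s"
    "\<And>x s. x \<in> Br \<Longrightarrow> s \<in> N x \<Longrightarrow> s \<noteq> 0 \<Longrightarrow> (K x has_field_derivative dK b x s) (at s)"
    using exists_primitive[of _ b] by metis
  define yy where "yy = (\<lambda>x s. s * EE x (lam x s))"
  define p where "p = (\<lambda>x t. (lam x (ell d0 t), yy x (ell d0 t)))"
  define D where "D = (\<lambda>x t. (ell' d0 t * (2 * (z0 - x) * ell d0 t), ell' d0 t * deriv (yy x) (ell d0 t)))"
  have T: "ell d0 t \<in> T x" if "x \<in> Br" "t \<in> {0..1}" for x t using N_T d0(2) that by blast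
  have yh: "yy x holomorphic_on T x" for x
    unfolding yy_def by (intro holomorphic_intros EE_lam_holomorphic)
  have pD: "(p x has_vector_derivative D x t) (at t)" if "x \<in> Br" "t \<in> {0..1}" for x t
  proof -
    have "(lam x has_field_derivative 2 * (z0 - x) * ell d0 t) (at (ell d0 t))"
      unfolding lam_def by (auto intro!: derivative_eq_intros)
    from field_vector_diff_chain_at[OF ell_has_vector_derivative this]
    have 1: "((\<lambda>t. lam x (ell d0 t)) has_vector_derivative ell' d0 t * (2 * (z0 - x) * ell d0 t)) (at t)" by (simp add: o_def)
    from field_vector_diff_chain_at[OF ell_has_vector_derivative holomorphic_derivI[OF yh open_T T[OF that]]]
    have 2: "((\<lambda>t. yy x (ell d0 t)) has_vector_derivative ell' d0 t * deriv (yy x) (ell d0 t)) (at t)" by (simp add: o_def)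
    from has_vector_derivative_Pair[OF 1 2] show ?thesis unfolding p_def D_def .
  qed
  have vp: "valid_path (p x)" if "x \<in> Br" for x
  proof -
    have "continuous_on {0..1} (\<lambda>t. deriv (yy x) (ell d0 t))"
      by (rule continuous_on_compose2[OF holomorphic_on_imp_continuous_on[OF holomorphic_deriv[OF yh open_T]] continuous_ell])
        (use T[OF that] in auto)
    then have "continuous_on {0..1} (D x)"
      unfolding D_def by (intro continuous_intros continuous_ell' continuous_ell)
    then have "p x C1_differentiable_on {0..1}" unfolding C1_differentiable_on_def using pD[OF that] by blast
    then show ?thesis unfolding valid_path_def by (rule C1_differentiable_imp_piecewise)
  qed
  have yn: "yy x (ell d0 t) \<noteq> 0" if "x \<in> Br" "t \<in> {0..1}" for x t
    using EE_lam_nz[OF T[OF that]] ell_nz[OF d0(1)] by (simp add: yy_def)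
  have KD: "((\<lambda>t. K x (ell d0 t)) has_vector_derivative Theta a b (p x t) (D x t)) (at t)"
    if "x \<in> Br" "t \<in> {0..1}" for x t
  proof -
    have "(K x has_field_derivative dK b x (ell d0 t)) (at (ell d0 t))"
      using K(2)[OF that(1) d0(2)[OF that] ell_nz[OF d0(1)]] .
    from field_vector_diff_chain_at[OF ell_has_vector_derivative this]
    have "((\<lambda>t. K x (ell d0 t)) has_vector_derivative ell' d0 t * dK b x (ell d0 t)) (at t)" by (simp add: o_def)
    moreover have "ell' d0 t * dK b x (ell d0 t) = Theta a b (p x t) (D x t)"
    proof -
      have "Theta a b (p x t) (D x t) = (ell d0 t * (ell' d0 t * (2 * (z0 - x) * poly b (lam x (ell d0 t))))) /
         (ell d0 t * (lam x (ell d0 t) * EE x (lam x (ell d0 t))))"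
        using yn[OF that] by (simp add: Theta_def p_def D_def yy_def mult_ac)
      also have "\<dots> = ell' d0 t * dK b x (ell d0 t)"
        using ell_nz[OF d0(1)] by (simp add: dK_def)
      finally show ?thesis by simp
    qed
    ultimately show ?thesis by simp
  qed
  define \<gamma> where "\<gamma> = p x +++ reversepath (p x')"
  have ends: "p x 0 = (z0, Y0 * (\<Prod>x\<in>Br. 1))" "p x 1 = (z0, - (Y0 * (\<Prod>x\<in>Br. 1)))" if "x \<in> Br" for x
  proof -
    have "EE x z0 = Y0"
      unfolding EE_def root_at_def using z0_ne[OF BrZ] by (simp add: prod.neutral)
    then show "p x 0 = (z0, Y0 * (\<Prod>x\<in>Br. 1))" "p x 1 = (z0, - (Y0 * (\<Prod>x\<in>Br. 1)))"
      by (auto simp: p_def yy_def ell_ends lam_def)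
  qed
  have img: "path_image (p x) \<subseteq> affine_curve a - {(l, y). l = 0}" if xB: "x \<in> Br" for x
  proof
    fix q assume "q \<in> path_image (p x)"
    then obtain t where t: "t \<in> {0..1}" "q = p x t" by (auto simp: path_image_def)
    have "(lam x (ell d0 t) - x) / (z0 - x) = (ell d0 t)\<^sup>2" using z0_ne[OF BrZ[OF xB]] by (simp add: lam_def)
    then have "(yy x (ell d0 t))\<^sup>2 = lam x (ell d0 t) * poly a (lam x (ell d0 t))"
      using EE_sq[OF xB, of "lam x (ell d0 t)"] by (simp add: yy_def power_mult_distrib)
    moreover have "lam x (ell d0 t) \<noteq> 0" using lam_nz'[OF T[OF xB t(1)] xB] ell_nz[OF d0(1)] by blast
    ultimately show "q \<in> affine_curve a - {(l, y). l = 0}" by (auto simp: t(2) p_def affine_curve_def)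
  qed
  have "valid_path \<gamma>" unfolding \<gamma>_def
    by (intro valid_path_join valid_path_imp_reverse vp x x')
      (simp add: pathfinish_def pathstart_def reversepath_def ends(2)[OF x] ends(2)[OF x'])
  moreover have "pathfinish \<gamma> = pathstart \<gamma>"
  proof -
    have "pathstart (p x) = pathstart (p x')" by (simp add: ends(1)[OF x] ends(1)[OF x'] pathstart_def)
    then show ?thesis unfolding \<gamma>_def by simp
  qed
  moreover have "path_image \<gamma> \<subseteq> affine_curve a - {(l, y). l = 0}"
    unfolding \<gamma>_def using path_image_join_subset[of "p x" "reversepath (p x')"] img[OF x] img[OF x'] by auto
  moreover have "integral {0..1} (\<lambda>t. Theta a b (\<gamma> t) (vector_derivative \<gamma> (at t))) = J b x - J b x'"
    using join_reverse_integral[of "p x" "D x" "p x'" "D x'" "\<lambda>t. K x (ell d0 t)" "Theta a b" "\<lambda>t. K x' (ell d0 t)",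
        OF pD[OF x] pD[OF x'] KD[OF x] KD[OF x'] Theta_scale]
      J_eq_primitive[OF x, of "K x" b] J_eq_primitive[OF x', of "K x'" b] K x x'
    by (simp add: \<gamma>_def ell_ends)
  ultimately show ?thesis unfolding periods_def by (intro CollectI exI[of _ \<gamma>]) auto
qed

end

text \<open>From left to right only the finitely many periods of \<open>slit_period\<close> enter;
  the potential built from them controls all the others.\<close>

lemma periods_imaginary_iff_potential:
  assumes reg: "regular a"
  shows "(\<forall>w\<in>periods a b. Re w = 0) \<longleftrightarrow> (\<exists>h. potential a b h)"
proof
  assume per: "\<forall>w\<in>periods a b. Re w = 0"
  define Z where "Z = {x. x * poly a x = 0} \<union> {}"
  obtain z0 where "slit_curve a z0 Z"
    unfolding Z_def by (rule exists_slit_curve[OF reg finite.emptyI])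
  then interpret slit_curve a z0 Z .
  have "Re (J b x) = Re (J b 0)" if "x \<in> Br" for x
    using bspec[OF per slit_period[OF that zero_Br]] by simp
  then show "\<exists>h. potential a b h" by (rule slit_potential)
qed (use potential_imp_periods_imaginary[OF _ reg] in blast)

lemma B_plane_iff:
  assumes "a \<in> H_space g"
  shows "b \<in> B_plane g a \<longleftrightarrow> b \<in> real_polys (g + 1) \<and> (\<exists>h. potential a b h)"
  using periods_imaginary_iff_potential[OF H_space_props(1)[OF assms]] by (auto simp: B_plane_def)

lemma b_at_props:
  assumes "a \<in> H_space g"
  shows "b_at g a c \<in> real_polys (g + 1)" "\<exists>h. potential a (b_at g a c) h" "poly (b_at g a c) 0 = c"
    "\<And>b. b \<in> real_polys (g + 1) \<Longrightarrow> potential a b h \<Longrightarrow> b = b_at g a (poly b 0)"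
proof -
  have ex: "\<exists>!b. b \<in> B_plane g a \<and> poly b 0 = c" for c
    using real_potential_exists[OF assms, of c] unfolding B_plane_iff[OF assms] by (simp add: conj_assoc)
  have "b_at g a c \<in> B_plane g a \<and> poly (b_at g a c) 0 = c"
    unfolding b_at_def by (rule theI'[OF ex])
  then show "b_at g a c \<in> real_polys (g + 1)" "\<exists>h. potential a (b_at g a c) h" "poly (b_at g a c) 0 = c"
    unfolding B_plane_iff[OF assms] by auto
  show "b = b_at g a (poly b 0)" if "b \<in> real_polys (g + 1)" "potential a b h" for b
    unfolding b_at_def using that B_plane_iff[OF assms] by (intro the1_equality[OF ex, symmetric]) blast
qed

section \<open>Degeneration and continuity\<close>

lemma eventually_lower_bound:
  fixes f :: "real \<Rightarrow> complex"
  assumes "continuous_on {0..1} f" "\<And>t. t \<in> {0..1} \<Longrightarrow> f t \<noteq> 0"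
  obtains c where "c > 0" "\<And>t. t \<in> {0..1} \<Longrightarrow> cmod (f t) \<ge> c"
proof -
  have "continuous_on {0..1} (\<lambda>t. cmod (f t))" using assms(1) by (intro continuous_intros)
  then obtain t0 where "t0 \<in> {0..1}" "\<And>t. t \<in> {0..1} \<Longrightarrow> cmod (f t0) \<le> cmod (f t)"
    using continuous_attains_inf[of "{0..1}" "\<lambda>t. cmod (f t)"] by auto
  then show ?thesis using that[of "cmod (f t0)"] assms(2) by auto
qed

context slit_curve begin

text \<open>On the compact loop the quotient \<open>q n\<close> of the radicands tends uniformly to
  1, so its principal root carries the lift of the loop over to the curve of \<open>an n\<close>. By
  oddness of \<open>hn n\<close> the integral there is -2 times a value of \<open>hn n\<close> over
  \<open>z0\<close> in which \<open>x\<close> does not occur.\<close>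

lemma lifted_integral:
  assumes x: "x \<in> Br" and mz: "\<And>z. poly m z = 0 \<Longrightarrow> z \<in> Z"
    and ca: "poly_conv d an (a * m\<^sup>2)" and cb: "poly_conv d' bn (m * b)"
    and pot: "\<And>n. potential (an n) (bn n) (hn n)"
  defines "q \<equiv> (\<lambda>n l. poly (an n) l / (poly a l * (poly m l)\<^sup>2))"
  defines "g \<equiv> (\<lambda>n t. poly (bn n) (ll x t) / (poly m (ll x t) * csqrt (q n (ll x t))) * wt x t)"
  shows "\<forall>\<^sub>F n in sequentially. integral {0..1} (\<lambda>t. Re (g n t)) = - 2 * hn n z0 (YY z0 * poly m z0 * csqrt (q n z0))"
    "(\<lambda>n. integral {0..1} (\<lambda>t. Re (g n t))) \<longlonglongrightarrow> Re (J b x)"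
proof -
  have lZ: "ll x t \<notin> Z" if "t \<in> {0..1}" for t using d0(3)[OF x that] by (simp add: ll_def)
  have mnz: "poly m (ll x t) \<noteq> 0" and anz: "poly a (ll x t) \<noteq> 0" and lnz: "ll x t \<noteq> 0" if "t \<in> {0..1}" for t
    using lZ[OF that] mz branchZ by auto
  define A where "A = (\<lambda>t. poly a (ll x t) * (poly m (ll x t))\<^sup>2)"
  have Ac: "continuous_on {0..1} A" unfolding A_def by (intro continuous_intros continuous_ll)
  obtain c where c: "c > 0" "\<And>t. t \<in> {0..1} \<Longrightarrow> cmod (A t) \<ge> c"
    using eventually_lower_bound[OF Ac] mnz anz by (auto simp: A_def)
  have bdl: "bounded (ll x ` {0..1})"
    by (intro compact_imp_bounded compact_continuous_image continuous_ll) auto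
  have "\<forall>\<^sub>F n in sequentially. \<forall>z\<in>ll x ` {0..1}. cmod (poly (an n) z - poly (a * m\<^sup>2) z) < c / 2"
    by (rule poly_conv_uniform[OF ca bdl]) (use c in simp)
  then have ev: "\<forall>\<^sub>F n in sequentially. \<forall>t\<in>{0..1}. cmod (q n (ll x t) - 1) < 1 / 2"
  proof eventually_elim
    case (elim n)
    show ?case
    proof
      fix t :: real assume t: "t \<in> {0..1}"
      have An: "A t \<noteq> 0" using mnz[OF t] anz[OF t] by (simp add: A_def)
      have "cmod (poly (an n) (ll x t) - A t) < c / 2" using elim t by (simp add: A_def)
      also have "\<dots> \<le> cmod (A t) / 2" using c(2)[OF t] by simp
      finally have "cmod (poly (an n) (ll x t) - A t) / cmod (A t) < 1 / 2" using An by (simp add: field_simps)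
      moreover have "q n (ll x t) - 1 = (poly (an n) (ll x t) - A t) / A t"
        using An by (simp add: q_def A_def diff_divide_distrib)
      ultimately show "cmod (q n (ll x t) - 1) < 1 / 2" by (simp add: norm_divide)
    qed
  qed
  have qRe: "Re (q n (ll x t)) > 1 / 2" "q n (ll x t) \<notin> \<real>\<^sub>\<le>\<^sub>0" "q n (ll x t) \<noteq> 0" "cmod (csqrt (q n (ll x t))) \<ge> 1 / 2"
    if "\<forall>t\<in>{0..1}. cmod (q n (ll x t) - 1) < 1 / 2" "t \<in> {0..1}" for n t
  proof -
    have "\<bar>Re (q n (ll x t) - 1)\<bar> < 1 / 2" using that abs_Re_le_cmod le_less_trans by blast
    then show *: "Re (q n (ll x t)) > 1 / 2" unfolding minus_complex.sel one_complex.sel by linarith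
    then show "q n (ll x t) \<notin> \<real>\<^sub>\<le>\<^sub>0" by (auto simp: complex_nonpos_Reals_iff)
    then show "q n (ll x t) \<noteq> 0" by auto
    have "(1 / 2)\<^sup>2 \<le> cmod (q n (ll x t))"
      using * abs_Re_le_cmod[of "q n (ll x t)"] by (simp add: power2_eq_square)
    also have "\<dots> = cmod (csqrt (q n (ll x t))) ^ 2" by (simp flip: norm_power)
    finally show "cmod (csqrt (q n (ll x t))) \<ge> 1 / 2" by (rule power2_le_imp_le) simp
  qed
  have qc: "continuous_on {0..1} (\<lambda>t. q n (ll x t))" for n
    unfolding q_def using mnz anz by (intro continuous_intros continuous_ll) auto
  have csc: "continuous_on {0..1} (\<lambda>t. csqrt (q n (ll x t)))" if "\<forall>t\<in>{0..1}. cmod (q n (ll x t) - 1) < 1 / 2" for n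
  proof -
    have "continuous_on (- \<real>\<^sub>\<le>\<^sub>0) csqrt"
      by (intro continuous_at_imp_continuous_on ballI continuous_at_csqrt) auto
    from continuous_on_compose2[OF this qc] show ?thesis using qRe(2)[OF that] by blast
  qed
  have gc: "continuous_on {0..1} (g n)" if "\<forall>t\<in>{0..1}. cmod (q n (ll x t) - 1) < 1 / 2" for n
    unfolding g_def using mnz qRe(3)[OF that]
    by (intro continuous_intros continuous_ll csc[OF that] continuous_wt[OF x]) auto
  define yy where "yy = (\<lambda>t. ell d0 t * EE x (ll x t))"
  have yy2: "(yy t)\<^sup>2 = ll x t * poly a (ll x t)" if "t \<in> {0..1}" for t
  proof -
    have "(ll x t - x) / (z0 - x) = (ell d0 t)\<^sup>2" using z0_ne[OF BrZ[OF x]] by (simp add: ll_def lam_def)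
    then show ?thesis using EE_sq[OF x, of "ll x t"] by (simp add: yy_def power_mult_distrib)
  qed
  have yyn: "yy t \<noteq> 0" if "t \<in> {0..1}" for t using yy2[OF that] lnz[OF that] anz[OF that] by auto
  have yyc: "continuous_on {0..1} yy" unfolding yy_def by (intro continuous_intros continuous_ell continuous_EE_ll[OF x])
  define l' where "l' = (\<lambda>t. ell' d0 t * (2 * (z0 - x) * ell d0 t))"
  have ll': "(ll x has_vector_derivative l' t) (at t within {0..1})" for t
  proof -
    have "(lam x has_field_derivative 2 * (z0 - x) * ell d0 t) (at (ell d0 t) within ell d0 ` {0..1})"
      unfolding lam_def by (auto intro!: derivative_eq_intros)
    from field_vector_diff_chain_within[OF ell_has_vector_derivative this]
    show ?thesis by (simp add: o_def ll_def[abs_def] l'_def)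
  qed
  have wtl: "l' t / (ll x t * yy t) = wt x t" for t
  proof -
    have "l' t / (ll x t * yy t) = (ell d0 t * (2 * (z0 - x) * ell' d0 t)) / (ell d0 t * (ll x t * EE x (ll x t)))"
      by (simp add: l'_def yy_def mult_ac)
    also have "\<dots> = wt x t" unfolding wt_def using ell_nz[OF d0(1)] by (rule nonzero_mult_divide_mult_cancel_left)
    finally show ?thesis .
  qed
  have z0YY: "yy 0 = YY z0" "yy 1 = - YY z0" "ll x 0 = z0" "ll x 1 = z0"
  proof -
    have "root_at x z0 = 1" unfolding root_at_def using z0_ne[OF BrZ[OF x]] by simp
    then show "yy 0 = YY z0" "yy 1 = - YY z0" "ll x 0 = z0" "ll x 1 = z0"
      using YY_EE[OF x, of z0] by (auto simp: yy_def ll_def lam_def ell_ends)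
  qed
  show "\<forall>\<^sub>F n in sequentially. integral {0..1} (\<lambda>t. Re (g n t)) = - 2 * hn n z0 (YY z0 * poly m z0 * csqrt (q n z0))"
    using ev
  proof eventually_elim
    case (elim n)
    define yn where "yn = (\<lambda>t. yy t * poly m (ll x t) * csqrt (q n (ll x t)))"
    have yn2: "(yn t)\<^sup>2 = ll x t * poly (an n) (ll x t)" if "t \<in> {0..1}" for t
      using yy2[OF that] mnz[OF that] anz[OF that] by (simp add: yn_def power_mult_distrib q_def)
    have ync: "continuous_on {0..1} yn" unfolding yn_def
      by (intro continuous_intros continuous_ll csc[OF elim] yyc)
    have ynn: "yn t \<noteq> 0" if "t \<in> {0..1}" for t
      using yyn[OF that] mnz[OF that] qRe(3)[OF elim that] by (simp add: yn_def)
    have "((\<lambda>t. hn n (ll x t) (yn t)) has_vector_derivative Re (g n t)) (at t within {0..1})" if t: "t \<in> {0..1}" for t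
    proof -
      have "continuous (at t within {0..1}) yn" using ync t by (simp add: continuous_on_eq_continuous_within)
      from potential_has_derivative[OF pot yn2 t ynn[OF t] ll'[unfolded has_vector_derivative_def] this]
      have D: "((\<lambda>t. hn n (ll x t) (yn t)) has_derivative
         (\<lambda>d. Re (poly (bn n) (ll x t) * (d *\<^sub>R l' t) / (ll x t * yn t)))) (at t within {0..1})" .
      have "poly (bn n) (ll x t) * (d *\<^sub>R l' t) / (ll x t * yn t) = d *\<^sub>R g n t" for d
      proof -
        have "poly (bn n) (ll x t) * (d *\<^sub>R l' t) / (ll x t * yn t) =
           of_real d * (poly (bn n) (ll x t) / (poly m (ll x t) * csqrt (q n (ll x t))) * (l' t / (ll x t * yy t)))"
          by (simp add: yn_def scaleR_conv_of_real mult_ac)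
        then show ?thesis by (simp only: wtl g_def scaleR_conv_of_real)
      qed
      then show ?thesis using D by (simp add: has_vector_derivative_def)
    qed
    from fundamental_theorem_of_calculus[OF zero_le_one this]
    have "integral {0..1} (\<lambda>t. Re (g n t)) = hn n (ll x 1) (yn 1) - hn n (ll x 0) (yn 0)"
      by (simp add: integral_unique)
    moreover have "yn 1 = - (YY z0 * poly m z0 * csqrt (q n z0))" "yn 0 = YY z0 * poly m z0 * csqrt (q n z0)"
      by (simp_all add: yn_def z0YY)
    moreover have "hn n z0 (- (yn 0)) = - hn n z0 (yn 0)"
      using yn2[of 0] by (intro potential_odd[OF pot]) (simp add: z0YY)
    ultimately show ?case by (simp add: z0YY)
  qed
  \<comment> \<open>The square roots are controlled only from \<open>n0\<close> on; the convergence
    theorem is applied to the shifted sequence, and the shift is undone at the end.\<close>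
  obtain n0 where n0: "\<And>n. n \<ge> n0 \<Longrightarrow> \<forall>t\<in>{0..1}. cmod (q n (ll x t) - 1) < 1 / 2"
    using ev by (auto simp: eventually_sequentially)
  obtain B where B: "\<And>n z. z \<in> ll x ` {0..1} \<Longrightarrow> cmod (poly (bn n) z) \<le> B"
    using poly_conv_bounded[OF cb bdl] by blast
  obtain W where W': "\<forall>t\<in>{0..1}. cmod (wt x t) \<le> W"
    using compact_imp_bounded[OF compact_continuous_image[OF continuous_wt[OF x] compact_Icc]] by (auto simp: bounded_iff)
  note W = W'[rule_format]
  have mc: "continuous_on {0..1} (\<lambda>t. poly m (ll x t))" by (intro continuous_intros continuous_ll)
  obtain mu where mu: "mu > 0" "\<And>t. t \<in> {0..1} \<Longrightarrow> cmod (poly m (ll x t)) \<ge> mu"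
    using eventually_lower_bound[OF mc] mnz by blast
  have "(\<lambda>k. integral {0..1} (\<lambda>t. Re (g (k + n0) t))) \<longlonglongrightarrow> integral {0..1} (\<lambda>t. Re (poly b (ll x t) * wt x t))"
  proof (rule dominated_convergence(2))
    show "(\<lambda>t. Re (g (k + n0) t)) integrable_on {0..1}" for k
      by (intro integrable_continuous_interval continuous_intros gc n0) simp
    show "(\<lambda>t. B / (mu * (1 / 2)) * W) integrable_on {0..1::real}" by (rule integrable_const_ivl)
    fix k and t :: real assume t: "t \<in> {0..1}"
    have B0: "B \<ge> 0" using B[of "ll x t" 0] t norm_ge_zero order_trans by blast
    have "cmod (g (k + n0) t) = cmod (poly (bn (k + n0)) (ll x t)) / (cmod (poly m (ll x t)) * cmod (csqrt (q (k + n0) (ll x t)))) * cmod (wt x t)"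
      by (simp add: g_def norm_mult norm_divide)
    also have "\<dots> \<le> B / (mu * (1 / 2)) * W"
      using B0 mu(1) by (intro mult_mono frac_le W t B mu(2) qRe(4)[OF n0] divide_nonneg_nonneg mult_pos_pos) (use t in auto)
    finally show "norm (Re (g (k + n0) t)) \<le> B / (mu * (1 / 2)) * W"
      using abs_Re_le_cmod[of "g (k + n0) t"] by simp
  next
    fix t :: real assume t: "t \<in> {0..1}"
    have 1: "(\<lambda>n. poly (bn n) (ll x t)) \<longlonglongrightarrow> poly (m * b) (ll x t)" by (rule poly_conv_poly[OF cb tendsto_const])
    have "(\<lambda>n. q n (ll x t)) \<longlonglongrightarrow> poly (a * m\<^sup>2) (ll x t) / (poly a (ll x t) * (poly m (ll x t))\<^sup>2)"
      unfolding q_def using mnz[OF t] anz[OF t] by (intro tendsto_intros poly_conv_poly[OF ca tendsto_const]) auto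
    then have "(\<lambda>n. q n (ll x t)) \<longlonglongrightarrow> 1" using mnz[OF t] anz[OF t] by simp
    from isCont_tendsto_compose[OF continuous_at_csqrt[of 1] this]
    have "(\<lambda>n. csqrt (q n (ll x t))) \<longlonglongrightarrow> 1" by simp
    then have "(\<lambda>n. g n t) \<longlonglongrightarrow> poly (m * b) (ll x t) / (poly m (ll x t) * 1) * wt x t"
      unfolding g_def using mnz[OF t] by (intro tendsto_intros 1) auto
    then have "(\<lambda>n. g n t) \<longlonglongrightarrow> poly b (ll x t) * wt x t" using mnz[OF t] by simp
    from LIMSEQ_ignore_initial_segment[OF tendsto_Re[OF this], of n0]
    show "(\<lambda>k. Re (g (k + n0) t)) \<longlonglongrightarrow> Re (poly b (ll x t) * wt x t)" .
  qed
  then have "(\<lambda>n. integral {0..1} (\<lambda>t. Re (g n t))) \<longlonglongrightarrow> integral {0..1} (\<lambda>t. Re (poly b (ll x t) * wt x t))"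
    by (rule LIMSEQ_offset)
  moreover have "integral {0..1} (\<lambda>t. Re (poly b (ll x t) * wt x t)) = Re (J b x)"
    unfolding J_def using has_integral_Re[OF integrable_integral[OF J_integrable[OF x, of b]]] by (rule integral_unique)
  ultimately show "(\<lambda>n. integral {0..1} (\<lambda>t. Re (g n t))) \<longlonglongrightarrow> Re (J b x)" by simp
qed

end

text \<open>With \<open>m = 1\<close> this gives continuity; a linear \<open>m\<close> covers two roots of \<open>a\<^sub>n\<close> colliding at the root of \<open>m\<close>.\<close>

theorem potential_limit:
  assumes reg: "regular a" and m0: "\<And>x. x * poly a x = 0 \<Longrightarrow> poly m x \<noteq> 0"
    and ca: "poly_conv d an (a * m\<^sup>2)" and cb: "poly_conv d' bn (m * b)"
    and pot: "\<And>n. potential (an n) (bn n) (hn n)"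
  shows "\<exists>h. potential a b h"
proof -
  have "m \<noteq> 0" using m0[of 0] by auto
  then have finm: "finite {z. poly m z = 0}" by (rule poly_roots_finite)
  define Z where "Z = {x. x * poly a x = 0} \<union> {z. poly m z = 0}"
  obtain z0 where "slit_curve a z0 Z"
    unfolding Z_def by (rule exists_slit_curve[OF reg finm])
  then interpret slit_curve a z0 Z .
  have mz: "z \<in> Z" if "poly m z = 0" for z using that by (simp add: Z_def)
  have "Re (J b x) = Re (J b 0)" if x: "x \<in> Br" for x
  proof -
    \<comment> \<open>The integrals over the loops around \<open>x\<close> and around 0 are
      eventually the same number, -2 times one value of \<open>hn n\<close>; hence their limits have
      equal real parts.\<close>
    note 1 = lifted_integral[OF x mz ca cb pot] and 2 = lifted_integral[OF zero_Br mz ca cb pot]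
    show ?thesis
      by (rule LIMSEQ_unique[OF Lim_transform_eventually[OF 1(2) eventually_mono[OF eventually_conj[OF 1(1) 2(1)]]] 2(2)]) (assumption | elim conjE, simp only:)+
  qed
  then show ?thesis by (rule slit_potential)
qed

lemma real_polys_limit:
  assumes "poly_conv d p q" "\<And>n. p n \<in> real_polys d"
  shows "q \<in> real_polys d"
proof -
  have "coeff q (d - i) = cnj (coeff q i)" if "i \<le> d" for i
  proof (rule LIMSEQ_unique)
    show "(\<lambda>n. coeff (p n) (d - i)) \<longlonglongrightarrow> coeff q (d - i)" using assms(1) by (simp add: poly_conv_def)
    have "(\<lambda>n. cnj (coeff (p n) i)) \<longlonglongrightarrow> cnj (coeff q i)"
      using assms(1) by (intro tendsto_cnj) (simp add: poly_conv_def)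
    then show "(\<lambda>n. coeff (p n) (d - i)) \<longlonglongrightarrow> cnj (coeff q i)"
      using assms(2) that by (simp add: real_polys_def)
  qed
  then show ?thesis using assms(1) by (simp add: real_polys_def poly_conv_def)
qed

lemma real_polys_scale: "p \<in> real_polys d \<Longrightarrow> smult (of_real t) p \<in> real_polys d"
  using degree_smult_le order_trans by (auto simp: real_polys_def)

lemma b_at_scale:
  assumes "a \<in> H_space g"
  shows "b_at g a (of_real t * c) = smult (of_real t) (b_at g a c)"
proof -
  obtain h where "potential a (b_at g a c) h" using b_at_props(2)[OF assms] by blast
  then have "potential a (smult (of_real t) (b_at g a c)) (\<lambda>l y. t * h l y)" by (rule potential_scale)
  from b_at_props(4)[OF assms real_polys_scale[OF b_at_props(1)[OF assms]] this]
  show ?thesis by (simp add: b_at_props(3)[OF assms])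
qed

text \<open>Every limit of a rescaled subsequence is real, has a potential for \<open>a\<close> by
  \<open>potential_limit\<close>, and has the value \<open>t0 c\<close> at 0; uniqueness identifies
  it.\<close>

theorem b_at_continuous:
  assumes an: "\<And>n. an n \<in> H_space g" and a: "a \<in> H_space g" and conv: "poly_conv (2 * g) an a"
  shows "poly_conv (g + 1) (\<lambda>n. b_at g (an n) c) (b_at g a c)"
proof (rule poly_conv_if_scaled_limits)
  show "degree (b_at g (an n) c) \<le> g + 1" for n using b_at_props(1)[OF an] by (simp add: real_polys_def)
  show "degree (b_at g a c) \<le> g + 1" using b_at_props(1)[OF a] by (simp add: real_polys_def)
  fix r t t0 b
  assume r: "strict_mono r" and t: "t \<longlonglongrightarrow> t0"
    and cb: "poly_conv (g + 1) (\<lambda>n. smult (of_real (t n)) (b_at g (an (r n)) c)) b"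
  have "\<forall>n. \<exists>h. potential (an n) (b_at g (an n) c) h" using b_at_props(2)[OF an] by blast
  then obtain h where h: "\<And>n. potential (an n) (b_at g (an n) c) (h n)" by metis
  have "\<exists>h. potential a b h"
  proof (rule potential_limit[OF H_space_props(1)[OF a], where m = 1])
    show "poly_conv (2 * g) (\<lambda>n. an (r n)) (a * 1\<^sup>2)" using poly_conv_subseq[OF conv r] by simp
    show "poly_conv (g + 1) (\<lambda>n. smult (of_real (t n)) (b_at g (an (r n)) c)) (1 * b)" using cb by simp
    show "potential (an (r n)) (smult (of_real (t n)) (b_at g (an (r n)) c)) (\<lambda>l y. t n * h (r n) l y)" for n
      by (rule potential_scale[OF h])
  qed simp
  then obtain h' where h': "potential a b h'" by blast
  have br: "b \<in> real_polys (g + 1)"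
    by (rule real_polys_limit[OF cb]) (intro real_polys_scale b_at_props(1)[OF an])
  have "(\<lambda>n. poly (smult (of_real (t n)) (b_at g (an (r n)) c)) 0) \<longlonglongrightarrow> poly b 0"
    by (rule poly_conv_poly[OF cb tendsto_const])
  then have "(\<lambda>n. of_real (t n) * c) \<longlonglongrightarrow> poly b 0" by (simp add: b_at_props(3)[OF an])
  moreover have "(\<lambda>n. of_real (t n) * c) \<longlonglongrightarrow> of_real t0 * c" by (intro tendsto_intros t)
  ultimately have "poly b 0 = of_real t0 * c" by (rule LIMSEQ_unique)
  then show "b = smult (of_real t0) (b_at g a c)"
    using b_at_props(4)[OF a br h'] b_at_scale[OF a] by simp
qed

section \<open>A root of the denominator in the disc\<close>

definition qpoly :: "nat \<Rightarrow> complex poly \<Rightarrow> complex poly" where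
  "qpoly g a = b_at g a 1 - smult \<i> (b_at g a \<i>)"

definition ppoly :: "nat \<Rightarrow> complex poly \<Rightarrow> complex poly" where
  "ppoly g a = b_at g a 1 + smult \<i> (b_at g a \<i>)"

lemma qpoly_props:
  assumes a: "a \<in> H_space g"
  shows "poly_star (g + 1) (qpoly g a) = ppoly g a" "poly (qpoly g a) 0 = 2" "poly (ppoly g a) 0 = 0"
    "degree (qpoly g a) \<le> g" "degree (ppoly g a) \<le> g + 1" "qpoly g a \<noteq> 0"
proof -
  have b: "poly_star (g + 1) (b_at g a c) = b_at g a c" "degree (b_at g a c) \<le> g + 1" for c
    using b_at_props(1)[OF a, of c] by (auto simp: real_polys_iff)
  show star: "poly_star (g + 1) (qpoly g a) = ppoly g a"
    by (simp only: qpoly_def ppoly_def poly_star_diff poly_star_smult b) simp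
  show q0: "poly (qpoly g a) 0 = 2" and p0: "poly (ppoly g a) 0 = 0"
    by (simp_all add: qpoly_def ppoly_def b_at_props(3)[OF a])
  show "qpoly g a \<noteq> 0" using q0 by auto
  have dq: "degree (qpoly g a) \<le> g + 1" unfolding qpoly_def
    by (intro degree_diff_le b(2) order_trans[OF degree_smult_le b(2)])
  show "degree (ppoly g a) \<le> g + 1" using degree_poly_star[of "g + 1" "qpoly g a"] star by simp
  have "cnj (coeff (qpoly g a) (g + 1)) = coeff (ppoly g a) 0"
    unfolding star[symmetric] by (simp add: coeff_poly_star)
  then have "coeff (qpoly g a) (g + 1) = 0" using p0 by (simp add: poly_0_coeff_0)
  then show "degree (qpoly g a) \<le> g" using dq
    by (metis Suc_eq_plus1 degree_0 eq_zero_or_degree_less le_antisym leading_coeff_0_iff not_less_eq_eq zero_le)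
qed

text \<open>Root by root this is the Blaschke inequality: |l - \<rho>|^2 - |1 - cnj l \<rho>|^2 =
  (|\<rho>|^2 - 1)(1 - |l|^2), which is nonnegative for |\<rho>| \<ge> 1.\<close>

lemma no_roots_in_disc_bound:
  fixes q :: "complex poly"
  assumes "q \<noteq> 0" "\<And>z. cmod z < 1 \<Longrightarrow> poly q z \<noteq> 0" "cmod l < 1" "l \<noteq> 0"
  shows "cmod l ^ degree q * cmod (poly q (1 / cnj l)) \<le> cmod (poly q l)"
  using assms(1,2)
proof (induction "degree q" arbitrary: q)
  case 0
  then obtain c where "q = [:c:]" by (metis degree_eq_zeroE)
  then show ?case by simp
next
  case (Suc n)
  have "\<not> constant (poly q)" using Suc.hyps(2) constant_degree by (metis Zero_not_Suc)
  then obtain \<rho> where \<rho>: "poly q \<rho> = 0" using fundamental_theorem_of_algebra by blast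
  then obtain q' where q': "q = [:-\<rho>, 1:] * q'" by (auto simp: poly_eq_0_iff_dvd dvd_def)
  have q0: "q' \<noteq> 0" using Suc.prems(1) q' by auto
  have "degree q = Suc (degree q')" using q0 unfolding q' by (subst degree_mult_eq) auto
  then have n: "n = degree q'" using Suc.hyps(2) by simp
  have "cmod l ^ degree q' * cmod (poly q' (1 / cnj l)) \<le> cmod (poly q' l)"
    using Suc.hyps(1)[OF n q0] Suc.prems(2) q' by auto
  moreover have "cmod l * cmod (1 / cnj l - \<rho>) \<le> cmod (l - \<rho>)"
  proof -
    have \<rho>1: "cmod \<rho> \<ge> 1" using Suc.prems(2)[of \<rho>] \<rho> by force
    have "cmod l * cmod (1 / cnj l - \<rho>) = cmod (1 - cnj l * \<rho>)"
    proof -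
      have "cnj l * (1 / cnj l - \<rho>) = 1 - cnj l * \<rho>" using assms(4) by (simp add: right_diff_distrib)
      then show ?thesis by (metis complex_mod_cnj norm_mult)
    qed
    moreover have "(cmod (1 - cnj l * \<rho>))\<^sup>2 \<le> (cmod (l - \<rho>))\<^sup>2"
    proof -
      have "(cmod (l - \<rho>))\<^sup>2 - (cmod (1 - cnj l * \<rho>))\<^sup>2 = ((cmod \<rho>)\<^sup>2 - 1) * (1 - (cmod l)\<^sup>2)"
        unfolding cmod_power2 by (simp add: power2_eq_square algebra_simps)
      moreover have "(cmod \<rho>)\<^sup>2 \<ge> 1" using \<rho>1 by (simp add: one_le_power)
      moreover have "(cmod l)\<^sup>2 \<le> 1" using assms(3) by (simp add: power_le_one)
      ultimately show ?thesis by (metis diff_ge_0_iff_ge mult_nonneg_nonneg)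
    qed
    ultimately show ?thesis by (metis norm_ge_zero power2_le_imp_le)
  qed
  ultimately have "(cmod l * cmod (1 / cnj l - \<rho>)) * (cmod l ^ degree q' * cmod (poly q' (1 / cnj l))) \<le> cmod (l - \<rho>) * cmod (poly q' l)"
    by (intro mult_mono) auto
  moreover have "poly q w = (w - \<rho>) * poly q' w" for w by (simp add: q' algebra_simps)
  ultimately show ?case
    by (simp only: \<open>degree q = Suc (degree q')\<close> norm_mult power_Suc mult_ac)
qed

text \<open>Strictness comes from the surplus power of |l|: the reflection has nominal degree
  \<open>g + 1\<close>, while \<open>qpoly g a\<close> has degree at most \<open>g\<close>.\<close>

lemma ppoly_less_qpoly:
  assumes a: "a \<in> H_space g" and nr: "\<And>z. cmod z < 1 \<Longrightarrow> poly (qpoly g a) z \<noteq> 0" and l: "cmod l < 1"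
  shows "cmod (poly (ppoly g a) l) < cmod (poly (qpoly g a) l)"
proof (cases "l = 0")
  case True
  then show ?thesis using qpoly_props(2,3)[OF a] by simp
next
  case False
  define q where "q = qpoly g a"
  have dq: "degree q \<le> g" "q \<noteq> 0" using qpoly_props(4,6)[OF a] by (auto simp: q_def)
  have "poly (ppoly g a) l = l ^ (g + 1) * cnj (poly q (1 / cnj l))"
    using poly_poly_star[of q "g + 1" l] dq False qpoly_props(1)[OF a] by (simp add: q_def)
  then have "cmod (poly (ppoly g a) l) = cmod l ^ (g + 1) * cmod (poly q (1 / cnj l))"
    by (simp add: norm_mult norm_power)
  also have "cmod l ^ (g + 1) = cmod l ^ (g + 1 - degree q) * cmod l ^ degree q"
    using dq by (simp flip: power_add)
  also have "\<dots> * cmod (poly q (1 / cnj l)) = cmod l ^ (g + 1 - degree q) * (cmod l ^ degree q * cmod (poly q (1 / cnj l)))"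
    by simp
  also have "\<dots> \<le> cmod l ^ (g + 1 - degree q) * cmod (poly q l)"
    using no_roots_in_disc_bound[OF dq(2) nr[folded q_def] l False] by (intro mult_left_mono) auto
  also have "\<dots> < 1 * cmod (poly q l)"
  proof (rule mult_strict_right_mono)
    show "cmod l ^ (g + 1 - degree q) < 1" using dq l by (intro power_Suc_less_one power_less_one_iff[THEN iffD2]) auto
    show "0 < cmod (poly q l)" using nr[OF l] by (simp add: q_def)
  qed
  finally show ?thesis by (simp add: q_def)
qed

text \<open>The real-linear map d \<mapsto> A d + cnj (C d) at \<open>z0\<close> expands distances
  at least by the factor |A| - |C| = 4\<delta>, and the nonlinear remainder \<psi> has Lipschitz
  constant at most 2\<delta> on a small ball.\<close>

lemma sense_preserving_locally_injective:
  fixes f :: "complex \<Rightarrow> complex"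
  assumes r: "r > 0" and der: "\<And>z. z \<in> ball z0 r \<Longrightarrow> (f has_derivative (\<lambda>d. A z * d + cnj (C z * d))) (at z)"
    and cont: "isCont A z0" "isCont C z0" and pos: "cmod (C z0) < cmod (A z0)"
  obtains r' where "0 < r'" "r' \<le> r" "inj_on f (ball z0 r')"
proof -
  define \<delta> where "\<delta> = (cmod (A z0) - cmod (C z0)) / 4"
  have \<delta>: "\<delta> > 0" using pos by (simp add: \<delta>_def)
  obtain r1 where r1: "r1 > 0" "\<And>z. dist z z0 < r1 \<Longrightarrow> dist (A z) (A z0) < \<delta>"
    using cont(1) \<delta> unfolding continuous_at_eps_delta by blast
  obtain r2 where r2: "r2 > 0" "\<And>z. dist z z0 < r2 \<Longrightarrow> dist (C z) (C z0) < \<delta>"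
    using cont(2) \<delta> unfolding continuous_at_eps_delta by blast
  define r' where "r' = min r (min r1 r2)"
  define \<psi> where "\<psi> = (\<lambda>z. f z - (A z0 * z + cnj (C z0 * z)))"
  have d\<psi>: "(\<psi> has_derivative (\<lambda>d. (A z * d + cnj (C z * d)) - (A z0 * d + cnj (C z0 * d)))) (at z within ball z0 r')"
    if "z \<in> ball z0 r'" for z
  proof -
    have "(f has_derivative (\<lambda>d. A z * d + cnj (C z * d))) (at z within ball z0 r')"
      by (rule has_derivative_at_withinI[OF der]) (use that in \<open>simp add: r'_def\<close>)
    moreover have "((\<lambda>z. A z0 * z + cnj (C z0 * z)) has_derivative (\<lambda>d. A z0 * d + cnj (C z0 * d))) (at z within ball z0 r')"
      using bounded_linear_imp_has_derivative[OF bounded_linear_add[OF bounded_linear_mult_right[of "A z0"]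
          bounded_linear_compose[OF bounded_linear_cnj bounded_linear_mult_right[of "C z0"]]]] .
    ultimately show ?thesis unfolding \<psi>_def by (rule has_derivative_diff)
  qed
  have on: "onorm (\<lambda>d. (A z * d + cnj (C z * d)) - (A z0 * d + cnj (C z0 * d))) \<le> 2 * \<delta>" if "z \<in> ball z0 r'" for z
  proof (rule onorm_le)
    fix d
    have "(A z * d + cnj (C z * d)) - (A z0 * d + cnj (C z0 * d)) = (A z - A z0) * d + cnj ((C z - C z0) * d)"
      by (simp add: algebra_simps)
    also have "cmod \<dots> \<le> cmod ((A z - A z0) * d) + cmod (cnj ((C z - C z0) * d))" by (rule norm_triangle_ineq)
    also have "\<dots> = (cmod (A z - A z0) + cmod (C z - C z0)) * cmod d"
      by (simp only: complex_mod_cnj norm_mult distrib_right)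
    also have "\<dots> \<le> (2 * \<delta>) * cmod d"
      using r1(2)[of z] r2(2)[of z] that by (intro mult_right_mono) (auto simp: r'_def dist_norm norm_minus_commute)
    finally show "cmod ((A z * d + cnj (C z * d)) - (A z0 * d + cnj (C z0 * d))) \<le> 2 * \<delta> * cmod d" .
  qed
  show ?thesis
  proof (rule that[of r'])
    show "0 < r'" "r' \<le> r" using r r1 r2 by (auto simp: r'_def)
    show "inj_on f (ball z0 r')"
    proof (rule inj_onI, rule ccontr)
      fix u v assume u: "u \<in> ball z0 r'" and v: "v \<in> ball z0 r'" and eq: "f u = f v" and ne: "u \<noteq> v"
      have "cmod (\<psi> u - \<psi> v) \<le> 2 * \<delta> * cmod (u - v)"
        by (rule differentiable_bound[OF convex_ball d\<psi> on u v])
      moreover have "\<psi> u - \<psi> v = - (A z0 * (u - v) + cnj (C z0 * (u - v)))"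
        using eq by (simp add: \<psi>_def algebra_simps)
      ultimately have "cmod (A z0 * (u - v) + cnj (C z0 * (u - v))) \<le> 2 * \<delta> * cmod (u - v)" by (metis norm_minus_cancel)
      moreover have "cmod (A z0 * (u - v)) - cmod (cnj (C z0 * (u - v))) \<le> cmod (A z0 * (u - v) + cnj (C z0 * (u - v)))"
        by (rule norm_diff_ineq)
      ultimately have "cmod (A z0) * cmod (u - v) - cmod (C z0) * cmod (u - v) \<le> 2 * \<delta> * cmod (u - v)"
        by (simp only: complex_mod_cnj norm_mult) 
      then have "(cmod (A z0) - cmod (C z0)) * cmod (u - v) \<le> (2 * \<delta>) * cmod (u - v)" by (simp add: algebra_simps)
      then have "4 * \<delta> \<le> 2 * \<delta>" using ne by (simp add: \<delta>_def mult_le_cancel_right)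
      then show False using \<delta> by simp
    qed
  qed
qed

lemma has_derivative_Complex:
  assumes "(f has_derivative f') F" "(k has_derivative k') F"
  shows "((\<lambda>x. Complex (f x) (k x)) has_derivative (\<lambda>d. Complex (f' d) (k' d))) F"
  unfolding Complex_eq
  by (intro has_derivative_add has_derivative_of_real has_derivative_mult_right assms)

text \<open>The reason for the sign in \<open>F = h1 - \<i> h2\<close>: its holomorphic derivative
  involves \<open>qpoly\<close> and its antiholomorphic one \<open>ppoly\<close>, each divided by
  2.\<close>

lemma complex_pair_eq:
  "Complex (Re (b1 * w)) (- Re (b2 * w)) = (b1 - \<i> * b2) / 2 * w + cnj ((b1 + \<i> * b2) / 2 * w)"
  by (simp add: complex_eq_iff field_simps)

text \<open>An inconsistent context if \<open>g \<ge> 1\<close>.\<close>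

locale sense_preserving =
  fixes g :: nat and a :: "complex poly" and h1 h2 :: "complex \<Rightarrow> complex \<Rightarrow> real"
  assumes a: "a \<in> H_space g"
    and h1: "potential a (b_at g a 1) h1" and h2: "potential a (b_at g a \<i>) h2"
    and no_root: "\<And>z. cmod z < 1 \<Longrightarrow> poly (qpoly g a) z \<noteq> 0"
begin

lemma reg: "regular a" using H_space_props[OF a] by blast

definition F :: "complex \<Rightarrow> complex \<Rightarrow> complex" where "F l y = Complex (h1 l y) (- h2 l y)"
definition G :: "complex \<Rightarrow> complex" where "G l = (F l (csqrt (l * poly a l)))\<^sup>2"

lemma F_odd: "y\<^sup>2 = l * poly a l \<Longrightarrow> F l (- y) = - F l y"
  using potential_odd[OF h1] potential_odd[OF h2] by (simp add: F_def complex_eq_iff)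

lemma G_eq:
  assumes y: "y\<^sup>2 = l * poly a l"
  shows "G l = (F l y)\<^sup>2"
proof -
  have "(csqrt (l * poly a l))\<^sup>2 = y\<^sup>2" using y by simp
  then have "csqrt (l * poly a l) = y \<or> csqrt (l * poly a l) = - y" by (simp only: power2_eq_iff)
  then show ?thesis using F_odd[OF y] by (auto simp: G_def)
qed

lemma norm_G: "cmod (G l) = \<bar>h1 l (csqrt (l * poly a l))\<bar>\<^sup>2 + \<bar>h2 l (csqrt (l * poly a l))\<bar>\<^sup>2"
  by (simp add: G_def norm_power F_def cmod_power2)

text \<open>Continuity of the modulus is available also at the branch points other than 0 and on the
  circle, and it suffices for the compactness arguments.\<close>

lemma norm_G_continuous: "l \<noteq> 0 \<Longrightarrow> isCont (\<lambda>l. cmod (G l)) l"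
  unfolding norm_G
  by (intro continuous_intros abs_potential_continuous[OF h1 reg] abs_potential_continuous[OF h2 reg]) auto

lemma F_zero: "h1 l y = 0 \<Longrightarrow> h2 l y = 0 \<Longrightarrow> F l y = 0"
  by (simp add: F_def complex_eq_iff)

lemma G_circle: "cmod l = 1 \<Longrightarrow> G l = 0"
  using potential_circle[OF a h1 b_at_props(1)[OF a], of l "csqrt (l * poly a l)"]
    potential_circle[OF a h2 b_at_props(1)[OF a], of l "csqrt (l * poly a l)"]
  by (simp add: G_def F_zero)

lemma G_branch: "l * poly a l = 0 \<Longrightarrow> G l = 0"
  using F_zero[OF potential_0[OF h1, of l] potential_0[OF h2, of l]] unfolding G_def by (metis csqrt_0 power_zero_numeral)

lemma dominated: "cmod z < 1 \<Longrightarrow> cmod (poly (ppoly g a) z) < cmod (poly (qpoly g a) z)"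
  by (rule ppoly_less_qpoly[OF a no_root])

text \<open>Off the branch points a branch of \<open>F\<close> is a function of \<lambda> with
  complex derivative part larger than the antilinear one, since \<open>ppoly\<close> is dominated by
  \<open>qpoly\<close> in the disc.\<close>

lemma local_form:
  assumes l: "cmod l < 1" "l * poly a l \<noteq> 0"
  obtains r f where "r > 0" "\<forall>z\<in>ball l r. cmod z < 1 \<and> z \<noteq> 0" "inj_on f (ball l r)" "continuous_on (ball l r) f"
    "\<forall>z\<in>ball l r. G z = (f z)\<^sup>2"
proof -
  have cs: "(csqrt (l * poly a l))\<^sup>2 = l * poly a l" "csqrt (l * poly a l) \<noteq> 0" using l by auto
  obtain r Y where Y: "r > 0" "Y holomorphic_on ball l r" "Y l = csqrt (l * poly a l)"
    "\<And>z. z \<in> ball l r \<Longrightarrow> (Y z)\<^sup>2 = z * poly a z \<and> z * poly a z \<noteq> 0 \<and> Re (Y z / csqrt (l * poly a l)) > 0"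
    using sqrt_branch[OF cs] by blast
  define A where "A = (\<lambda>z. poly (qpoly g a) z / 2 * (1 / (z * Y z)))"
  define C where "C = (\<lambda>z. poly (ppoly g a) z / 2 * (1 / (z * Y z)))"
  have der: "((\<lambda>z. F z (Y z)) has_derivative (\<lambda>d. A z * d + cnj (C z * d))) (at z)" if z: "z \<in> ball l r" for z
  proof -
    have Yc: "continuous (at z within ball l r) Y"
      using holomorphic_on_imp_continuous_on[OF Y(2)] z by (simp add: continuous_on_eq_continuous_within)
    have Yz: "Y z \<noteq> 0" using Y(4)[OF z] by auto
    have cur: "(Y u)\<^sup>2 = u * poly a u" if "u \<in> ball l r" for u using Y(4)[OF that] by blast
    have D: "((\<lambda>z. h z (Y z)) has_derivative (\<lambda>d. Re (poly b z * d / (z * Y z)))) (at z)" if "potential a b h" for b h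
      using potential_has_derivative[where T = "ball l r" and y = Y and l = "\<lambda>u. u" and t = z, OF that cur z Yz has_derivative_ident Yc]
        at_within_open[OF z open_ball] by simp
    have "((\<lambda>z. F z (Y z)) has_derivative
       (\<lambda>d. Complex (Re (poly (b_at g a 1) z * d / (z * Y z))) (- Re (poly (b_at g a \<i>) z * d / (z * Y z))))) (at z)"
      unfolding F_def by (intro has_derivative_Complex has_derivative_minus D h1 h2)
    moreover have "Complex (Re (poly (b_at g a 1) z * d / (z * Y z))) (- Re (poly (b_at g a \<i>) z * d / (z * Y z)))
       = A z * d + cnj (C z * d)" for d
      using complex_pair_eq[of "poly (b_at g a 1) z" "d / (z * Y z)" "poly (b_at g a \<i>) z"]
      by (simp add: A_def C_def qpoly_def ppoly_def)
    ultimately show ?thesis by (simp only:)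
  qed
  have lb: "l \<in> ball l r" using Y(1) by simp
  have "Y holomorphic_on ball l r" by (rule Y(2))
  then have Yc: "isCont Y l" using lb
    by (meson continuous_on_eq_continuous_at holomorphic_on_imp_continuous_on open_ball)
  have nz: "l \<noteq> 0" "Y l \<noteq> 0" using l cs(2) Y(3) by auto
  have Ac: "isCont A l" and Cc: "isCont C l" unfolding A_def C_def using nz by (intro continuous_intros Yc; simp)+
  have "cmod (C l) < cmod (A l)"
    using dominated[OF l(1)] nz by (simp add: A_def C_def norm_mult norm_divide divide_strict_right_mono)
  then obtain r' where r': "0 < r'" "r' \<le> r" "inj_on (\<lambda>z. F z (Y z)) (ball l r')"
    using sense_preserving_locally_injective[OF Y(1) der Ac Cc] by blast
  define r'' where "r'' = min r' (min (1 - cmod l) (cmod l))"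
  have sub: "ball l r'' \<subseteq> ball l r'" "ball l r'' \<subseteq> ball l r" using r' by (auto simp: r''_def)
  show ?thesis
  proof (rule that[of r'' "\<lambda>z. F z (Y z)"])
    show "r'' > 0" using r' l nz by (simp add: r''_def)
    show "\<forall>z\<in>ball l r''. cmod z < 1 \<and> z \<noteq> 0"
    proof
      fix z assume z: "z \<in> ball l r''"
      then have "cmod (l - z) < 1 - cmod l" "cmod (l - z) < cmod l" by (auto simp: r''_def dist_norm)
      moreover have "cmod z \<le> cmod l + cmod (l - z)" using norm_triangle_ineq4[of l "l - z"] by simp
      ultimately show "cmod z < 1 \<and> z \<noteq> 0" by auto
    qed
    show "inj_on (\<lambda>z. F z (Y z)) (ball l r'')" using r'(3) sub(1) by (rule inj_on_subset)
    show "continuous_on (ball l r'') (\<lambda>z. F z (Y z))"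
      using der sub(2) by (intro continuous_at_imp_continuous_on ballI has_derivative_continuous[OF der]) auto
    show "\<forall>z\<in>ball l r''. G z = (F z (Y z))\<^sup>2"
      using G_eq Y(4) sub(2) by blast
  qed
qed

text \<open>Near a zero of \<open>f\<close> its square would identify opposite values. Where
  \<open>f\<close> does not vanish, its values stay in a half-plane on which squaring is
  injective.\<close>

lemma G_locally_injective:
  assumes l: "cmod l < 1" "l \<noteq> 0" "G l \<noteq> 0"
  obtains r where "r > 0" "\<forall>z\<in>ball l r. cmod z < 1 \<and> z \<noteq> 0" "inj_on G (ball l r)" "continuous_on (ball l r) G"
proof -
  have "l * poly a l \<noteq> 0" using G_branch l(3) by blast
  then obtain r f where rf: "r > 0" "\<forall>z\<in>ball l r. cmod z < 1 \<and> z \<noteq> 0" "inj_on f (ball l r)" "continuous_on (ball l r) f"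
    "\<forall>z\<in>ball l r. G z = (f z)\<^sup>2"
    using local_form[OF l(1)] by blast
  have lb: "l \<in> ball l r" using rf(1) by simp
  have fl: "f l \<noteq> 0" using bspec[OF rf(5) lb] l(3) by auto
  have "isCont f l" using rf(4) lb by (simp add: continuous_on_eq_continuous_at)
  then have "isCont (\<lambda>z. Re (f z / f l)) l" using fl by (intro isCont_Re continuous_intros) auto
  from eventually_nhds_pos[OF this] have "\<forall>\<^sub>F z in nhds l. Re (f z / f l) > 0" using fl by simp
  then obtain d where d: "d > 0" "\<And>z. dist z l < d \<Longrightarrow> Re (f z / f l) > 0"
    unfolding eventually_nhds_metric by blast
  define r' where "r' = min r d"
  have sub: "ball l r' \<subseteq> ball l r" by (auto simp: r'_def)
  show ?thesis
  proof (rule that[of r'])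
    show "r' > 0" using rf d by (simp add: r'_def)
    show "\<forall>z\<in>ball l r'. cmod z < 1 \<and> z \<noteq> 0" using rf(2) sub by blast
    show "inj_on G (ball l r')"
    proof (rule inj_onI)
      fix u v assume u: "u \<in> ball l r'" and v: "v \<in> ball l r'" and eq: "G u = G v"
      have "(f u)\<^sup>2 = (f v)\<^sup>2" using eq rf(5) u v sub by (metis subsetD)
      moreover have "Re (f u / f l) > 0" "Re (f v / f l) > 0" using u v d(2) by (auto simp: r'_def dist_commute)
      ultimately have "f u = f v" by (rule sqrt_branch_unique)
      then show "u = v" using rf(3) u v sub by (meson inj_onD subsetD)
    qed
    have "continuous_on (ball l r') (\<lambda>z. (f z)\<^sup>2)"
      by (intro continuous_intros continuous_on_subset[OF rf(4) sub])
    then show "continuous_on (ball l r') G"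
      by (rule continuous_on_eq) (use rf(5) sub in auto)
  qed
qed

text \<open>The points of an annulus with |G| at least \<open>e\<close> form a compact set that
  misses the circle, so their moduli have a maximum below 1.\<close>

lemma near_circle:
  assumes "e > 0"
  obtains r where "0 < r" "r < 1" "\<And>l. r < cmod l \<Longrightarrow> cmod l < 1 \<Longrightarrow> cmod (G l) < e"
proof -
  define K where "K = {l. 1 / 2 \<le> cmod l \<and> cmod l \<le> 1}"
  have K: "K = cball 0 1 - ball 0 (1 / 2)" by (auto simp: K_def)
  have "compact K" unfolding K by (intro compact_diff) auto
  have cont: "continuous_on K (\<lambda>l. cmod (G l))"
    by (intro continuous_at_imp_continuous_on ballI norm_G_continuous) (auto simp: K_def)
  define K' where "K' = K \<inter> (\<lambda>l. cmod (G l)) -` {e..}"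
  have "compact K'" unfolding K'_def
    using continuous_closed_preimage[OF cont compact_imp_closed[OF \<open>compact K\<close>] closed_atLeast] \<open>compact K\<close>
    by (metis Int_lower1 compact_Int_closed inf.absorb_iff2 Int_absorb1 Int_absorb2)
  show ?thesis
  proof (cases "K' = {}")
    case True
    show ?thesis
    proof (rule that[of "1 / 2"])
      fix l :: complex assume "1 / 2 < cmod l" "cmod l < 1"
      then have "l \<in> K" by (simp add: K_def)
      then show "cmod (G l) < e" using True by (force simp: K'_def)
    qed auto
  next
    case False
    then obtain l0 where l0: "l0 \<in> K'" "\<And>l. l \<in> K' \<Longrightarrow> cmod l \<le> cmod l0"
      using continuous_attains_sup[OF \<open>compact K'\<close> _ continuous_on_norm_id] by auto
    have "cmod l0 \<noteq> 1" using l0(1) G_circle[of l0] assms by (auto simp: K'_def)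
    then have l0': "cmod l0 < 1" "1 / 2 \<le> cmod l0" using l0(1) by (auto simp: K'_def K_def)
    show ?thesis
    proof (rule that[of "cmod l0"])
      fix l :: complex assume l: "cmod l0 < cmod l" "cmod l < 1"
      then have "l \<in> K" using l0' by (simp add: K_def)
      then show "cmod (G l) < e" using l0(2)[of l] l by (force simp: K'_def)
    qed (use l0' in auto)
  qed
qed

text \<open>In the parameter s with \<lambda> = s^2, \<open>F\<close> is a Lipschitz function minus
  \<open>k / s\<close>. On a small disc the pole dominates, so \<open>F\<close> is injective in s;
  as it is odd, its square is injective in \<lambda>.\<close>

lemma near_zero:
  obtains r c where "0 < r" "r < 1" "c > 0" "\<And>u v. 0 < cmod u \<Longrightarrow> cmod u < r \<Longrightarrow> 0 < cmod v \<Longrightarrow> cmod v < r \<Longrightarrow> G u = G v \<Longrightarrow> u = v"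
    "\<And>u. 0 < cmod u \<Longrightarrow> cmod u < r \<Longrightarrow> cmod (G u) \<ge> c / cmod u"
proof -
  obtain \<rho> E e where ch: "branch_chart a 0 \<rho> E e" using exists_branch_chart[OF reg, of 0] by auto
  obtain F1 k1 where F1: "F1 holomorphic_on ball 0 \<rho>" "\<forall>s. F1 (- s) = - F1 s"
    "\<forall>s\<in>ball 0 \<rho>. s \<noteq> 0 \<longrightarrow> h1 (0 + s\<^sup>2) (s * E (0 + s\<^sup>2)) = Re (F1 s - k1 / s)"
    "(0::complex) = 0 \<longrightarrow> k1 = 2 * poly (b_at g a 1) 0 / E 0"
    "\<forall>s\<in>ball 0 \<rho>. s \<noteq> 0 \<longrightarrow> ((\<lambda>s. F1 s - k1 / s) has_field_derivative 2 * poly (b_at g a 1) (0 + s\<^sup>2) / ((0 + s\<^sup>2) * E (0 + s\<^sup>2))) (at s)"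
    "(0::complex) \<noteq> 0 \<longrightarrow> k1 = 0 \<and> (\<forall>s\<in>ball 0 \<rho>. (F1 has_field_derivative 2 * poly (b_at g a 1) (0 + s\<^sup>2) / ((0 + s\<^sup>2) * E (0 + s\<^sup>2))) (at s))"
    by (rule potential_in_chart[OF h1 ch]) (rule that)
  obtain F2 k2 where F2: "F2 holomorphic_on ball 0 \<rho>" "\<forall>s. F2 (- s) = - F2 s"
    "\<forall>s\<in>ball 0 \<rho>. s \<noteq> 0 \<longrightarrow> h2 (0 + s\<^sup>2) (s * E (0 + s\<^sup>2)) = Re (F2 s - k2 / s)"
    "(0::complex) = 0 \<longrightarrow> k2 = 2 * poly (b_at g a \<i>) 0 / E 0"
    "\<forall>s\<in>ball 0 \<rho>. s \<noteq> 0 \<longrightarrow> ((\<lambda>s. F2 s - k2 / s) has_field_derivative 2 * poly (b_at g a \<i>) (0 + s\<^sup>2) / ((0 + s\<^sup>2) * E (0 + s\<^sup>2))) (at s)"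
    "(0::complex) \<noteq> 0 \<longrightarrow> k2 = 0 \<and> (\<forall>s\<in>ball 0 \<rho>. (F2 has_field_derivative 2 * poly (b_at g a \<i>) (0 + s\<^sup>2) / ((0 + s\<^sup>2) * E (0 + s\<^sup>2))) (at s))"
    by (rule potential_in_chart[OF h2 ch]) (rule that)
  have ch': "\<rho> > 0" "\<And>z. z \<in> ball 0 (\<rho>\<^sup>2) \<Longrightarrow> (E z)\<^sup>2 = poly e z \<and> E z \<noteq> 0" "\<And>z. z * poly a z = (z - 0) * poly e z"
    using ch by (auto simp: branch_chart_def)
  have E0: "E 0 \<noteq> 0" using ch'(1) ch'(2)[of 0] by simp
  \<comment> \<open>The values 1 and \<i> of the two polynomials at 0 give the principal parts
    \<open>k / s\<close> and \<open>\<i> * k / s\<close>, and exactly then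
    \<open>h1 - \<i> h2\<close> has the complex pole \<open>- k / s\<close>.\<close>
  define k where "k = 2 / E 0"
  have k: "k1 = k" "k2 = \<i> * k" "k \<noteq> 0" using F1(4) F2(4) E0 by (auto simp: k_def b_at_props(3)[OF a])
  define \<Psi> where "\<Psi> = (\<lambda>s. Complex (Re (F1 s)) (- Re (F2 s)))"
  define \<Phi> where "\<Phi> = (\<lambda>s. \<Psi> s - k / s)"
  have FP: "F (s\<^sup>2) (s * E (s\<^sup>2)) = \<Phi> s" if "s \<in> ball 0 \<rho>" "s \<noteq> 0" for s
  proof -
    have "Re (k2 / s) = - Im (k / s)" 
    proof -
      have "Re (\<i> * z) = - Im z" for z by simp
      then show ?thesis unfolding k(2) by (metis times_divide_eq_right)
    qed
    then show ?thesis
      using bspec[OF F1(3) that(1)] bspec[OF F2(3) that(1)] that(2) k(1) by (simp add: F_def \<Phi>_def \<Psi>_def complex_eq_iff)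
  qed
  have cur: "(s * E (s\<^sup>2))\<^sup>2 = s\<^sup>2 * poly a (s\<^sup>2)" if "s \<in> ball 0 \<rho>" for s
  proof -
    have "s\<^sup>2 \<in> ball 0 (\<rho>\<^sup>2)" using that by (auto simp: norm_power intro!: power_strict_mono)
    then show ?thesis using ch'(2)[of "s\<^sup>2"] ch'(3)[of "s\<^sup>2"] by (auto simp: power_mult_distrib)
  qed
  have GP: "G (s\<^sup>2) = (\<Phi> s)\<^sup>2" if "s \<in> ball 0 \<rho>" "s \<noteq> 0" for s
    using G_eq[OF cur[OF that(1)]] FP[OF that] by simp
  have dP: "(\<Psi> has_derivative (\<lambda>d. Complex (Re (deriv F1 s * d)) (- Re (deriv F2 s * d)))) (at s)" if "s \<in> ball 0 \<rho>" for s
    unfolding \<Psi>_def using holomorphic_derivI[OF F1(1) open_ball that] holomorphic_derivI[OF F2(1) open_ball that]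
    by (intro has_derivative_Complex has_derivative_minus has_derivative_Re) (auto simp: has_field_derivative_def)
  have cb: "cball 0 (\<rho> / 2) \<subseteq> ball 0 \<rho>" using ch'(1) by auto
  have c1: "continuous_on (cball 0 (\<rho> / 2)) (deriv F1)" "continuous_on (cball 0 (\<rho> / 2)) (deriv F2)"
    using holomorphic_on_imp_continuous_on[OF holomorphic_deriv[OF F1(1) open_ball]]
      holomorphic_on_imp_continuous_on[OF holomorphic_deriv[OF F2(1) open_ball]] continuous_on_subset cb by blast+
  obtain M1 where M1: "\<forall>s\<in>cball 0 (\<rho> / 2). cmod (deriv F1 s) \<le> M1"
    using compact_imp_bounded[OF compact_continuous_image[OF c1(1) compact_cball]] by (auto simp: bounded_iff)
  obtain M2 where M2: "\<forall>s\<in>cball 0 (\<rho> / 2). cmod (deriv F2 s) \<le> M2"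
    using compact_imp_bounded[OF compact_continuous_image[OF c1(2) compact_cball]] by (auto simp: bounded_iff)
  define M where "M = \<bar>M1\<bar> + \<bar>M2\<bar> + 1"
  have M: "M > 0" by (simp add: M_def)
  have lip: "cmod (\<Psi> s - \<Psi> t) \<le> M * cmod (s - t)" if s: "s \<in> cball 0 (\<rho> / 2)" and t: "t \<in> cball 0 (\<rho> / 2)" for s t
  proof (rule differentiable_bound[OF convex_cball _ _ s t])
    fix x assume x: "x \<in> cball (0::complex) (\<rho> / 2)"
    show "(\<Psi> has_derivative (\<lambda>d. Complex (Re (deriv F1 x * d)) (- Re (deriv F2 x * d)))) (at x within cball 0 (\<rho> / 2))"
      by (rule has_derivative_at_withinI[OF dP[OF subsetD[OF cb x]]])
    show "onorm (\<lambda>d. Complex (Re (deriv F1 x * d)) (- Re (deriv F2 x * d))) \<le> M"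
    proof (rule onorm_le)
      fix d
      have "cmod (Complex (Re (deriv F1 x * d)) (- Re (deriv F2 x * d))) \<le> \<bar>Re (deriv F1 x * d)\<bar> + \<bar>Re (deriv F2 x * d)\<bar>"
        using cmod_le[of "Complex (Re (deriv F1 x * d)) (- Re (deriv F2 x * d))"] by simp
      also have "\<dots> \<le> cmod (deriv F1 x * d) + cmod (deriv F2 x * d)" by (intro add_mono abs_Re_le_cmod)
      also have "\<dots> = (cmod (deriv F1 x) + cmod (deriv F2 x)) * cmod d" by (simp add: norm_mult distrib_right)
      also have "\<dots> \<le> M * cmod d"
        using bspec[OF M1 x] bspec[OF M2 x] by (intro mult_right_mono) (auto simp: M_def)
      finally show "cmod (Complex (Re (deriv F1 x * d)) (- Re (deriv F2 x * d))) \<le> M * cmod d" .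
    qed
  qed
  have \<Psi>odd: "\<Psi> (- s) = - \<Psi> s" for s using F1(2) F2(2) by (simp add: \<Psi>_def complex_eq_iff)
  have \<Psi>0: "\<Psi> 0 = 0" using \<Psi>odd[of 0] by simp
  \<comment> \<open>For |s|, |t| < r0 the difference of the pole terms, |k| |s - t| / (|s| |t|),
    exceeds the Lipschitz bound M |s - t|.\<close>
  define r0 where "r0 = min (min (\<rho> / 2) (1 / 2)) (sqrt (cmod k / (2 * M)))"
  have r0: "r0 > 0" "r0 \<le> \<rho> / 2" "r0 \<le> 1 / 2" "M * r0\<^sup>2 \<le> cmod k / 2"
  proof -
    show "r0 > 0" "r0 \<le> \<rho> / 2" "r0 \<le> 1 / 2" using ch'(1) k M by (auto simp: r0_def)
    have "r0\<^sup>2 \<le> (sqrt (cmod k / (2 * M)))\<^sup>2" using \<open>r0 > 0\<close> by (intro power_mono) (auto simp: r0_def)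
    also have "\<dots> = cmod k / (2 * M)" using M by simp
    finally show "M * r0\<^sup>2 \<le> cmod k / 2" using M by (simp add: field_simps)
  qed
  have small: "M * (cmod s * cmod t) < cmod k" if "cmod s < r0" "cmod t < r0" for s t
  proof -
    have "cmod s * cmod t \<le> r0\<^sup>2" unfolding power2_eq_square using that r0(1) by (intro mult_mono) auto
    then have "M * (cmod s * cmod t) \<le> M * r0\<^sup>2" using M by simp
    moreover have "cmod k > 0" using k(3) by simp
    ultimately show ?thesis using r0(4) by linarith
  qed
  have inj: "s = t" if s: "s \<noteq> 0" "cmod s < r0" and t: "t \<noteq> 0" "cmod t < r0" and eq: "\<Phi> s = \<Phi> t" for s t
  proof (rule ccontr)
    assume ne: "s \<noteq> t"
    have "\<Psi> s - \<Psi> t = k / s - k / t" using eq by (simp add: \<Phi>_def algebra_simps)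
    also have "\<dots> = k * (t - s) / (s * t)" using s t by (simp add: field_simps)
    finally have "cmod k * cmod (s - t) / (cmod s * cmod t) = cmod (\<Psi> s - \<Psi> t)"
      by (simp add: norm_divide norm_mult norm_minus_commute)
    also have "\<dots> \<le> M * cmod (s - t)" using lip[of s t] s t r0 by simp
    finally have "cmod k * cmod (s - t) \<le> (M * (cmod s * cmod t)) * cmod (s - t)"
      using s t by (simp add: divide_le_eq mult_ac)
    then have "cmod k \<le> M * (cmod s * cmod t)" using ne by (simp add: mult_le_cancel_right)
    then show False using small[OF s(2) t(2)] by simp
  qed
  have rt: "\<exists>s. s\<^sup>2 = u \<and> s \<noteq> 0 \<and> cmod s < r0 \<and> s \<in> ball 0 \<rho>" if "0 < cmod u" "cmod u < r0\<^sup>2" for u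
  proof -
    have "cmod (csqrt u) ^ 2 = cmod u" by (simp flip: norm_power)
    then have "cmod (csqrt u) ^ 2 < r0 ^ 2" using that(2) by simp
    then have "cmod (csqrt u) < r0" by (rule power_less_imp_less_base) (use r0(1) in simp)
    then show ?thesis using that r0 by (intro exI[of _ "csqrt u"]) auto
  qed
  show ?thesis
  proof (rule that[of "r0\<^sup>2" "(cmod k)\<^sup>2 / 4"])
    show "0 < r0\<^sup>2" using r0 by simp
    have "r0\<^sup>2 \<le> (1 / 2)\<^sup>2" using r0 by (intro power_mono) auto
    also have "\<dots> < 1" by (simp add: power2_eq_square)
    finally show "r0\<^sup>2 < 1" .
    show "(cmod k)\<^sup>2 / 4 > 0" using k(3) by simp
    fix u v assume u: "0 < cmod u" "cmod u < r0\<^sup>2" and v: "0 < cmod v" "cmod v < r0\<^sup>2" and eq: "G u = G v"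
    obtain s where s: "s\<^sup>2 = u" "s \<noteq> 0" "cmod s < r0" "s \<in> ball 0 \<rho>" using rt[OF u] by blast
    obtain t where t: "t\<^sup>2 = v" "t \<noteq> 0" "cmod t < r0" "t \<in> ball 0 \<rho>" using rt[OF v] by blast
    have "(\<Phi> s)\<^sup>2 = (\<Phi> t)\<^sup>2" using eq GP s t by metis
    then have "\<Phi> s = \<Phi> t \<or> \<Phi> s = - \<Phi> t" by (simp add: power2_eq_iff)
    moreover have "- \<Phi> t = \<Phi> (- t)" by (simp add: \<Phi>_def \<Psi>odd)
    ultimately have "s = t \<or> s = - t" using inj[of s t] inj[of s "- t"] s t by auto
    then show "u = v" using s t by auto
  next
    fix u assume u: "0 < cmod u" "cmod u < r0\<^sup>2"
    obtain s where s: "s\<^sup>2 = u" "s \<noteq> 0" "cmod s < r0" "s \<in> ball 0 \<rho>" using rt[OF u] by blast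
    have "cmod (\<Psi> s) \<le> M * cmod s" using lip[of s 0] s r0 ch'(1) by (simp add: \<Psi>0)
    also have "\<dots> \<le> cmod k / (2 * cmod s)"
    proof -
      have "cmod s * cmod s \<le> r0\<^sup>2" unfolding power2_eq_square using s r0(1) by (intro mult_mono) auto
      then have "M * (cmod s * cmod s) \<le> cmod k / 2" using r0(4) M by (meson mult_left_mono less_imp_le order_trans)
      then show ?thesis using s(2) by (simp add: field_simps)
    qed
    finally have "cmod (\<Psi> s) \<le> cmod k / (2 * cmod s)" .
    moreover have "cmod (k / s) - cmod (\<Psi> s) \<le> cmod (\<Phi> s)"
      unfolding \<Phi>_def by (metis norm_minus_commute norm_triangle_ineq2)
    ultimately have "cmod k / (2 * cmod s) \<le> cmod (\<Phi> s)" using s(2) by (simp add: norm_divide field_simps)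
    then have "(cmod k / (2 * cmod s))\<^sup>2 \<le> (cmod (\<Phi> s))\<^sup>2" by (intro power_mono) auto
    moreover have "(cmod k / (2 * cmod s))\<^sup>2 = (cmod k)\<^sup>2 / 4 / cmod u"
      using s(1)[symmetric] by (simp add: power_divide power_mult_distrib norm_power)
    moreover have "(cmod (\<Phi> s))\<^sup>2 = cmod (G u)" using GP[OF s(4,2)] s(1) by (simp add: norm_power)
    ultimately show "(cmod k)\<^sup>2 / 4 / cmod u \<le> cmod (G u)" by simp
  qed
qed

text \<open>In the chart at \<open>x\<close> the map \<open>F\<close> has no pole and is locally
  injective in s, hence open by invariance of domain; so it reaches a square root of every small
  \<open>w\<close>.\<close>

lemma near_root:
  assumes x: "poly a x = 0" "cmod x < 1"
  obtains \<eta> r where "\<eta> > 0" "r < 1" "\<And>w. cmod w < \<eta> \<Longrightarrow> \<exists>l. 0 < cmod l \<and> cmod l < r \<and> G l = w"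
proof -
  have x0: "x \<noteq> 0" using x reg by (auto simp: regular_def)
  obtain \<rho> E e where ch: "branch_chart a x \<rho> E e" using exists_branch_chart[OF reg, of x] x by auto
  obtain F1 k1 where F1: "F1 holomorphic_on ball 0 \<rho>" "\<forall>s. F1 (- s) = - F1 s"
    "\<forall>s\<in>ball 0 \<rho>. s \<noteq> 0 \<longrightarrow> h1 (x + s\<^sup>2) (s * E (x + s\<^sup>2)) = Re (F1 s - k1 / s)"
    "x = 0 \<longrightarrow> k1 = 2 * poly (b_at g a 1) 0 / E 0"
    "\<forall>s\<in>ball 0 \<rho>. s \<noteq> 0 \<longrightarrow> ((\<lambda>s. F1 s - k1 / s) has_field_derivative 2 * poly (b_at g a 1) (x + s\<^sup>2) / ((x + s\<^sup>2) * E (x + s\<^sup>2))) (at s)"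
    "x \<noteq> 0 \<longrightarrow> k1 = 0 \<and> (\<forall>s\<in>ball 0 \<rho>. (F1 has_field_derivative 2 * poly (b_at g a 1) (x + s\<^sup>2) / ((x + s\<^sup>2) * E (x + s\<^sup>2))) (at s))"
    by (rule potential_in_chart[OF h1 ch]) (rule that)
  obtain F2 k2 where F2: "F2 holomorphic_on ball 0 \<rho>" "\<forall>s. F2 (- s) = - F2 s"
    "\<forall>s\<in>ball 0 \<rho>. s \<noteq> 0 \<longrightarrow> h2 (x + s\<^sup>2) (s * E (x + s\<^sup>2)) = Re (F2 s - k2 / s)"
    "x = 0 \<longrightarrow> k2 = 2 * poly (b_at g a \<i>) 0 / E 0"
    "\<forall>s\<in>ball 0 \<rho>. s \<noteq> 0 \<longrightarrow> ((\<lambda>s. F2 s - k2 / s) has_field_derivative 2 * poly (b_at g a \<i>) (x + s\<^sup>2) / ((x + s\<^sup>2) * E (x + s\<^sup>2))) (at s)"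
    "x \<noteq> 0 \<longrightarrow> k2 = 0 \<and> (\<forall>s\<in>ball 0 \<rho>. (F2 has_field_derivative 2 * poly (b_at g a \<i>) (x + s\<^sup>2) / ((x + s\<^sup>2) * E (x + s\<^sup>2))) (at s))"
    by (rule potential_in_chart[OF h2 ch]) (rule that)
  have ch': "\<rho> > 0" "E holomorphic_on ball x (\<rho>\<^sup>2)" "\<And>z. z \<in> ball x (\<rho>\<^sup>2) \<Longrightarrow> (E z)\<^sup>2 = poly e z \<and> E z \<noteq> 0"
    "\<And>z. z * poly a z = (z - x) * poly e z"
    using ch by (auto simp: branch_chart_def)
  have k: "k1 = 0" "k2 = 0" using F1(6) F2(6) x0 by auto
  define \<Psi> where "\<Psi> = (\<lambda>s. Complex (Re (F1 s)) (- Re (F2 s)))"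
  define A where "A = (\<lambda>s. poly (qpoly g a) (x + s\<^sup>2) / 2 * (2 / ((x + s\<^sup>2) * E (x + s\<^sup>2))))"
  define C where "C = (\<lambda>s. poly (ppoly g a) (x + s\<^sup>2) / 2 * (2 / ((x + s\<^sup>2) * E (x + s\<^sup>2))))"
  have der: "(\<Psi> has_derivative (\<lambda>d. A s * d + cnj (C s * d))) (at s)" if s: "s \<in> ball 0 \<rho>" for s
  proof -
    have D: "(F1 has_derivative (\<lambda>d. 2 * poly (b_at g a 1) (x + s\<^sup>2) / ((x + s\<^sup>2) * E (x + s\<^sup>2)) * d)) (at s)"
      "(F2 has_derivative (\<lambda>d. 2 * poly (b_at g a \<i>) (x + s\<^sup>2) / ((x + s\<^sup>2) * E (x + s\<^sup>2)) * d)) (at s)"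
      using F1(6) F2(6) x0 s unfolding has_field_derivative_def by blast+
    have "(\<Psi> has_derivative (\<lambda>d. Complex (Re (2 * poly (b_at g a 1) (x + s\<^sup>2) / ((x + s\<^sup>2) * E (x + s\<^sup>2)) * d))
        (- Re (2 * poly (b_at g a \<i>) (x + s\<^sup>2) / ((x + s\<^sup>2) * E (x + s\<^sup>2)) * d)))) (at s)"
      unfolding \<Psi>_def by (intro has_derivative_Complex has_derivative_minus has_derivative_Re D)
    moreover have "Complex (Re (2 * poly (b_at g a 1) (x + s\<^sup>2) / ((x + s\<^sup>2) * E (x + s\<^sup>2)) * d))
        (- Re (2 * poly (b_at g a \<i>) (x + s\<^sup>2) / ((x + s\<^sup>2) * E (x + s\<^sup>2)) * d)) = A s * d + cnj (C s * d)" for d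
      using complex_pair_eq[of "poly (b_at g a 1) (x + s\<^sup>2)" "2 / ((x + s\<^sup>2) * E (x + s\<^sup>2)) * d" "poly (b_at g a \<i>) (x + s\<^sup>2)"]
      by (simp add: A_def C_def qpoly_def ppoly_def mult_ac)
    ultimately show ?thesis by (simp only:)
  qed
  have Ex: "E x \<noteq> 0" using ch'(1) ch'(3)[of x] by simp
  have "isCont E x" using ch'(1,2)
    by (meson centre_in_ball continuous_on_eq_continuous_at holomorphic_on_imp_continuous_on open_ball zero_less_power)
  then have Ec: "isCont (\<lambda>s. E (x + s\<^sup>2)) 0" by (intro isCont_o2[where g = E and f = "\<lambda>s. x + s\<^sup>2"] continuous_intros) auto
  have Ac: "isCont A 0" and Cc: "isCont C 0" unfolding A_def C_def using x0 Ex by (intro continuous_intros Ec; simp)+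
  have "cmod (C 0) < cmod (A 0)"
    using dominated[OF x(2)] x0 Ex by (simp add: A_def C_def norm_mult norm_divide divide_strict_right_mono)
  then obtain r' where r': "0 < r'" "r' \<le> \<rho>" "inj_on \<Psi> (ball 0 r')"
    using sense_preserving_locally_injective[OF ch'(1) der Ac Cc] by blast
  \<comment> \<open>Keeping |s|^2 \<le> m / 2 holds \<open>x + s\<^sup>2\<close> away from both 0
    and the circle.\<close>
  define m where "m = min (cmod x) (1 - cmod x)"
  have m: "m > 0" using x x0 by (simp add: m_def)
  define r where "r = min r' (sqrt (m / 2))"
  have r: "r > 0" "r \<le> r'" "r\<^sup>2 \<le> m / 2"
  proof -
    show "r > 0" "r \<le> r'" using r' m by (auto simp: r_def)
    have "r\<^sup>2 \<le> (sqrt (m / 2))\<^sup>2" using \<open>r > 0\<close> by (intro power_mono) (auto simp: r_def)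
    then show "r\<^sup>2 \<le> m / 2" using m by simp
  qed
  have sub: "ball (0::complex) r \<subseteq> ball 0 r'" "ball (0::complex) r \<subseteq> ball 0 \<rho>" using r r' by auto
  have "continuous_on (ball 0 r) \<Psi>"
    using sub(2) by (intro continuous_at_imp_continuous_on ballI has_derivative_continuous[OF der]) auto
  then have op: "open (\<Psi> ` ball 0 r)"
    by (rule invariance_of_domain[OF _ open_ball inj_on_subset[OF r'(3) sub(1)]])
  have "F1 0 = 0" "F2 0 = 0" using F1(2)[rule_format, of 0] F2(2)[rule_format, of 0] by auto
  then have \<Psi>0: "\<Psi> 0 = 0" by (simp add: \<Psi>_def complex_eq_iff)
  have "0 \<in> \<Psi> ` ball 0 r" using \<Psi>0 r(1) by force
  then obtain d where d: "d > 0" "ball 0 d \<subseteq> \<Psi> ` ball 0 r" using op open_contains_ball by blast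
  have GP: "G (x + s\<^sup>2) = (\<Psi> s)\<^sup>2" if "s \<in> ball 0 \<rho>" for s
  proof (cases "s = 0")
    case True
    then show ?thesis using G_branch[of x] x \<Psi>0 by simp
  next
    case False
    have "x + s\<^sup>2 \<in> ball x (\<rho>\<^sup>2)" using that by (auto simp: dist_norm norm_power intro!: power_strict_mono)
    then have "(s * E (x + s\<^sup>2))\<^sup>2 = (x + s\<^sup>2) * poly a (x + s\<^sup>2)"
      using ch'(3)[of "x + s\<^sup>2"] ch'(4)[of "x + s\<^sup>2"] by (simp add: power_mult_distrib)
    then have "G (x + s\<^sup>2) = (F (x + s\<^sup>2) (s * E (x + s\<^sup>2)))\<^sup>2" by (rule G_eq)
    moreover have "F (x + s\<^sup>2) (s * E (x + s\<^sup>2)) = \<Psi> s"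
      using bspec[OF F1(3) that] bspec[OF F2(3) that] False k by (simp add: F_def \<Psi>_def)
    ultimately show ?thesis by simp
  qed
  show ?thesis
  proof (rule that[of "d\<^sup>2" "cmod x + m / 2 + m / 4"])
    show "d\<^sup>2 > 0" using d by simp
    have "m \<le> 1 - cmod x" by (simp add: m_def)
    then show "cmod x + m / 2 + m / 4 < 1" using m by linarith
    fix w assume w: "cmod w < d\<^sup>2"
    have "cmod (csqrt w) ^ 2 = cmod w" by (simp flip: norm_power)
    then have "cmod (csqrt w) ^ 2 < d ^ 2" using w by simp
    then have "cmod (csqrt w) < d" by (rule power_less_imp_less_base) (use d(1) in simp)
    then obtain s where s: "s \<in> ball 0 r" "\<Psi> s = csqrt w" using d(2) by (metis (no_types, lifting) imageE mem_ball_0 subsetD)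
    have s2: "cmod (s\<^sup>2) \<le> m / 2"
    proof -
      have "cmod s ^ 2 \<le> r\<^sup>2" using s(1) by (intro power_mono) auto
      then show ?thesis using r(3) by (simp add: norm_power)
    qed
    have "cmod (x + s\<^sup>2) < cmod x + m / 2 + m / 4" using norm_triangle_ineq[of x "s\<^sup>2"] s2 m by simp
    moreover have "cmod (x + s\<^sup>2) > 0"
    proof -
      have "cmod x \<le> cmod (x + s\<^sup>2) + cmod (s\<^sup>2)" using norm_triangle_ineq4[of "x + s\<^sup>2" "s\<^sup>2"] by simp
      moreover have "m \<le> cmod x" by (simp add: m_def)
      then have "m / 2 < cmod x" using m by linarith
      ultimately show ?thesis using s2 by linarith
    qed
    moreover have "G (x + s\<^sup>2) = w" using GP[of s] s sub by auto
    ultimately show "\<exists>l. 0 < cmod l \<and> cmod l < cmod x + m / 2 + m / 4 \<and> G l = w" by blast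
  qed
qed

lemma contradiction:
  assumes "g \<ge> 1"
  shows False
proof -
  have "card {x. poly a x = 0} \<noteq> 0" using card_roots_H_space[OF a] assms by simp
  then have "{x. poly a x = 0} \<noteq> {}" by (metis card.empty)
  then obtain x' where x': "poly a x' = 0" by auto
  \<comment> \<open>Reflection exchanges the roots of \<open>a\<close> inside and outside the
    circle, and none lies on it.\<close>
  obtain x where x: "poly a x = 0" "cmod x < 1"
  proof (cases "cmod x' < 1")
    case True
    then show ?thesis using x' that by blast
  next
    case False
    have "cmod x' \<noteq> 1" using H_space_props(5)[OF a] x' by blast
    then have x1: "cmod x' > 1" using False by simp
    have "poly a x' = x' ^ (2 * g) * cnj (poly a (1 / cnj x'))"
    proof -
      have "x' \<noteq> 0" using x1 by auto
      then show ?thesis using H_space_props(2)[OF a] unfolding reflection_symmetric_def by blast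
    qed
    then have "poly a (1 / cnj x') = 0" using x' x1 by auto
    moreover have "cmod (1 / cnj x') < 1" using x1 by (simp add: norm_divide divide_less_eq)
    ultimately show ?thesis using that by blast
  qed
  obtain \<eta> r3 where near_x: "\<eta> > 0" "r3 < 1" "\<And>w. cmod w < \<eta> \<Longrightarrow> \<exists>l. 0 < cmod l \<and> cmod l < r3 \<and> G l = w"
    using near_root[OF x] by blast
  obtain r0 c where n0: "0 < r0" "r0 < 1" "c > 0" "\<And>u v. 0 < cmod u \<Longrightarrow> cmod u < r0 \<Longrightarrow> 0 < cmod v \<Longrightarrow> cmod v < r0 \<Longrightarrow> G u = G v \<Longrightarrow> u = v"
    "\<And>u. 0 < cmod u \<Longrightarrow> cmod u < r0 \<Longrightarrow> cmod (G u) \<ge> c / cmod u"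
    using near_zero by blast
  define D where "D = {l :: complex. 0 < cmod l \<and> cmod l < 1}"
  have D: "cmod l < 1" "l \<noteq> 0" if "l \<in> D" for l using that by (auto simp: D_def)
  define S where "S = {w. w \<noteq> 0 \<and> (\<exists>u\<in>D. \<exists>v\<in>D. u \<noteq> v \<and> G u = w \<and> G v = w)}"
  \<comment> \<open>Distinct preimages have disjoint neighbourhoods on which \<open>G\<close> is
    injective; their images are open by invariance of domain.\<close>
  have "open S"
    unfolding open_subopen[of S]
  proof
    fix w assume "w \<in> S"
    then obtain u v where uv: "w \<noteq> 0" "u \<in> D" "v \<in> D" "u \<noteq> v" "G u = w" "G v = w" by (auto simp: S_def)
    have Guv: "G u \<noteq> 0" "G v \<noteq> 0" using uv by auto
    define d where "d = dist u v / 2"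
    have d: "d > 0" using uv by (simp add: d_def)
    have op: "open (G ` ball l (min r d))" if "inj_on G (ball l r)" "continuous_on (ball l r) G" for l r
      by (rule invariance_of_domain[OF continuous_on_subset[OF that(2)] open_ball inj_on_subset[OF that(1)]]) auto
    obtain ru where ru: "ru > 0" "\<forall>z\<in>ball u ru. cmod z < 1 \<and> z \<noteq> 0" "inj_on G (ball u ru)" "continuous_on (ball u ru) G"
      using G_locally_injective[OF D[OF uv(2)] Guv(1)] by blast
    obtain rv where rv: "rv > 0" "\<forall>z\<in>ball v rv. cmod z < 1 \<and> z \<noteq> 0" "inj_on G (ball v rv)" "continuous_on (ball v rv) G"
      using G_locally_injective[OF D[OF uv(3)] Guv(2)] by blast
    define O1 where "O1 = G ` ball u (min ru d) \<inter> G ` ball v (min rv d) \<inter> - {0}"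
    have "open O1" unfolding O1_def using op[OF ru(3,4)] op[OF rv(3,4)] by (intro open_Int) auto
    moreover have "w \<in> O1"
    proof -
      have "u \<in> ball u (min ru d)" "v \<in> ball v (min rv d)" using d ru(1) rv(1) by auto
      then show ?thesis unfolding O1_def using uv by (metis Compl_iff IntI image_eqI singletonD)
    qed
    moreover have "O1 \<subseteq> S"
    proof
      fix w' assume "w' \<in> O1"
      then obtain u' v' where u': "u' \<in> ball u (min ru d)" "G u' = w'" and v': "v' \<in> ball v (min rv d)" "G v' = w'" and "w' \<noteq> 0"
        by (auto simp: O1_def)
      have "u' \<noteq> v'"
      proof
        assume "u' = v'"
        then have "dist u v < d + d" using u'(1) v'(1) dist_triangle[of u v u'] by (auto simp: dist_commute)
        then show False by (simp add: d_def)
      qed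
      moreover have "u' \<in> D" "v' \<in> D" using ru(2) rv(2) u'(1) v'(1) by (auto simp: D_def)
      ultimately show "w' \<in> S" using u'(2) v'(2) \<open>w' \<noteq> 0\<close> by (auto simp: S_def)
    qed
    ultimately show "\<exists>T. open T \<and> w \<in> T \<and> T \<subseteq> S" by blast
  qed
  \<comment> \<open>For values near \<open>w \<noteq> 0\<close> the preimages stay in a compact
    annulus, as \<open>G\<close> is small near the circle and large near 0. The limits of the two
    preimages cannot merge, since \<open>G\<close> is injective near such a limit.\<close>
  have S_closed: "w \<in> S" if w: "w \<in> closure S" "w \<noteq> 0" for w
  proof -
    obtain ws where ws: "\<And>n. ws n \<in> S" "ws \<longlonglongrightarrow> w" using w(1) closure_sequential by metis
    have "\<forall>n. \<exists>p. fst p \<in> D \<and> snd p \<in> D \<and> fst p \<noteq> snd p \<and> G (fst p) = ws n \<and> G (snd p) = ws n"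
      using ws(1) by (force simp: S_def)
    then obtain p where p: "\<And>n. fst (p n) \<in> D \<and> snd (p n) \<in> D \<and> fst (p n) \<noteq> snd (p n) \<and> G (fst (p n)) = ws n \<and> G (snd (p n)) = ws n"
      by metis
    have nw: "(\<lambda>n. cmod (ws n)) \<longlonglongrightarrow> cmod w" by (intro tendsto_intros ws(2))
    have cw: "cmod w > 0" using w(2) by simp
    obtain r2 where r2: "0 < r2" "r2 < 1" "\<And>l. r2 < cmod l \<Longrightarrow> cmod l < 1 \<Longrightarrow> cmod (G l) < cmod w / 2"
      using near_circle[of "cmod w / 2"] cw by auto
    \<comment> \<open>Inside the radius \<open>c / (2 * cmod w)\<close> the lower bound of
      \<open>near_zero\<close> gives |G| > 2 |w|.\<close>
    define r1 where "r1 = min (r0 / 2) (c / (2 * cmod w))"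
    have r1: "r1 > 0" "r1 < r0" using n0 cw by (auto simp: r1_def)
    define K where "K = {l :: complex. r1 \<le> cmod l \<and> cmod l \<le> r2}"
    have "K = cball 0 r2 - ball 0 r1" by (auto simp: K_def)
    then have "compact K" by (simp add: compact_diff)
    have inK: "l \<in> K" if l: "l \<in> D" "cmod w / 2 < cmod (G l)" "cmod (G l) < 2 * cmod w" for l
    proof -
      have "cmod l \<le> r2" using r2(3)[of l] l by (force simp: D_def)
      moreover have "r1 \<le> cmod l"
      proof (rule ccontr)
        assume *: "\<not> r1 \<le> cmod l"
        have l0: "0 < cmod l" using l(1) by (simp add: D_def)
        have "cmod l < c / (2 * cmod w)" using * by (simp add: r1_def)
        then have "2 * cmod w < c / cmod l" using l0 cw by (simp add: field_simps)
        also have "\<dots> \<le> cmod (G l)" using n0(5)[of l] l0 * r1 by simp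
        finally show False using l(3) by simp
      qed
      ultimately show ?thesis by (simp add: K_def)
    qed
    have "\<forall>\<^sub>F n in sequentially. cmod w / 2 < cmod (ws n)" "\<forall>\<^sub>F n in sequentially. cmod (ws n) < 2 * cmod w"
      using cw by (intro order_tendstoD[OF nw]; linarith)+
    then have "\<forall>\<^sub>F n in sequentially. p n \<in> K \<times> K"
      by eventually_elim (use p inK in \<open>force simp: mem_Times_iff\<close>)
    then obtain n1 where n1: "\<And>n. n \<ge> n1 \<Longrightarrow> p n \<in> K \<times> K" by (auto simp: eventually_sequentially)
    have "seq_compact (K \<times> K)" using \<open>compact K\<close> compact_Times compact_imp_seq_compact by blast
    then obtain q s where q: "q \<in> K \<times> K" "strict_mono s" "((\<lambda>n. p (n + n1)) \<circ> s) \<longlonglongrightarrow> q"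
    proof -
      have "\<forall>n. p (n + n1) \<in> K \<times> K" using n1 by simp
      then show ?thesis
        using \<open>seq_compact (K \<times> K)\<close>[unfolded seq_compact_def, rule_format, of "\<lambda>n. p (n + n1)"] that by blast
    qed
    define t where "t = (\<lambda>n. s n + n1)"
    have pt: "(\<lambda>n. p (t n)) \<longlonglongrightarrow> q" using q(3) by (simp add: o_def t_def)
    have "strict_mono t" using q(2) by (auto simp: strict_mono_def t_def)
    then have wt: "(\<lambda>n. ws (t n)) \<longlonglongrightarrow> w" using LIMSEQ_subseq_LIMSEQ[OF ws(2)] by (simp add: o_def)
    have K_D: "l \<in> D" if "l \<in> K" for l using that r1 r2 by (auto simp: K_def D_def)
    have lim: "G l = w" if l: "l \<in> K" and un: "u \<longlonglongrightarrow> l" and Gu: "\<And>n. G (u n) = ws (t n)" for u l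
    proof -
      have "(\<lambda>n. cmod (G (u n))) \<longlonglongrightarrow> cmod (G l)"
        using isCont_tendsto_compose[OF norm_G_continuous un] D(2)[OF K_D[OF l]] by blast
      moreover have "(\<lambda>n. cmod (G (u n))) \<longlonglongrightarrow> cmod w" unfolding Gu by (intro tendsto_intros wt)
      ultimately have "cmod (G l) = cmod w" by (rule LIMSEQ_unique)
      then have "G l \<noteq> 0" using w(2) by auto
      then obtain rl where rl: "rl > 0" "continuous_on (ball l rl) G"
        using G_locally_injective[OF D[OF K_D[OF l]] \<open>G l \<noteq> 0\<close>] by blast
      then have "isCont G l" by (simp add: continuous_on_eq_continuous_at)
      from isCont_tendsto_compose[OF this un] have "(\<lambda>n. ws (t n)) \<longlonglongrightarrow> G l" by (simp only: Gu)
      then show ?thesis using wt by (rule LIMSEQ_unique)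
    qed
    have f: "(\<lambda>n. fst (p (t n))) \<longlonglongrightarrow> fst q" and s: "(\<lambda>n. snd (p (t n))) \<longlonglongrightarrow> snd q"
      by (intro tendsto_intros pt)+
    have qK: "fst q \<in> K" "snd q \<in> K" using q(1) by auto
    have G1: "G (fst q) = w" by (rule lim[OF qK(1) f]) (use p in blast)
    have G2: "G (snd q) = w" by (rule lim[OF qK(2) s]) (use p in blast)
    have "fst q \<noteq> snd q"
    proof
      assume eq: "fst q = snd q"
      have "G (fst q) \<noteq> 0" using G1 w(2) by simp
      then obtain rl where rl: "rl > 0" "inj_on G (ball (fst q) rl)"
        using G_locally_injective[OF D[OF K_D[OF qK(1)]] \<open>G (fst q) \<noteq> 0\<close>] by blast
      have "\<forall>\<^sub>F n in sequentially. fst (p (t n)) \<in> ball (fst q) rl" "\<forall>\<^sub>F n in sequentially. snd (p (t n)) \<in> ball (fst q) rl"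
        using f s rl(1) unfolding eq tendsto_iff by (auto simp: dist_commute)
      then have "\<forall>\<^sub>F n in sequentially. False"
      proof eventually_elim
        case (elim n)
        have "G (fst (p (t n))) = G (snd (p (t n)))" using p[of "t n"] by simp
        from inj_onD[OF rl(2) this elim] have "fst (p (t n)) = snd (p (t n))" .
        then show ?case using p by blast
      qed
      then show False by simp
    qed
    then show "w \<in> S" using G1 G2 K_D qK w(2) by (auto simp: S_def)
  qed
  have "openin (top_of_set (- {0})) S" using \<open>open S\<close> by (intro open_openin_trans) (auto simp: S_def)
  moreover have "closedin (top_of_set (- {0})) S"
  proof -
    have "S \<subseteq> - {0}" unfolding S_def by blast
    then have "S = - {0} \<inter> closure S" using S_closed closure_subset[of S] by blast
    then show ?thesis unfolding closedin_closed using closed_closure by metis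
  qed
  moreover have "connected (- {0 :: complex})"
    using connected_open_delete[OF open_UNIV connected_UNIV, of "0 :: complex"] by (simp add: Compl_eq_Diff_UNIV)
  ultimately have "S = {} \<or> S = - {0}" unfolding connected_clopen by blast
  \<comment> \<open>Large values are taken only close to 0, where \<open>G\<close> is
    injective.\<close>
  moreover have "S \<noteq> - {0}"
  proof -
    define K where "K = {l :: complex. r0 \<le> cmod l \<and> cmod l \<le> 1}"
    have "K = cball 0 1 - ball 0 r0" by (auto simp: K_def)
    then have "compact K" by (simp add: compact_diff)
    moreover have "continuous_on K (\<lambda>l. cmod (G l))"
      by (intro continuous_at_imp_continuous_on ballI norm_G_continuous) (use n0 in \<open>auto simp: K_def\<close>)
    ultimately have "bounded ((\<lambda>l. cmod (G l)) ` K)" by (intro compact_imp_bounded compact_continuous_image)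
    then obtain R where R: "\<forall>l\<in>K. cmod (G l) \<le> R" by (auto simp: bounded_iff)
    define w where "w = complex_of_real (\<bar>R\<bar> + 1)"
    have w: "cmod w > R" "w \<noteq> 0" unfolding w_def norm_of_real by (auto simp flip: of_real_add simp del: of_real_add)
    have "w \<notin> S"
    proof
      assume "w \<in> S"
      then obtain u v where uv: "u \<in> D" "v \<in> D" "u \<noteq> v" "G u = w" "G v = w" by (auto simp: S_def)
      have "cmod l < r0" if "l \<in> D" "G l = w" for l
      proof (rule ccontr)
        assume "\<not> cmod l < r0"
        then have "l \<in> K" using that by (simp add: K_def D_def)
        then show False using R w(1) that(2) by force
      qed
      then show False using n0(4)[of u v] uv by (auto simp: D_def)
    qed
    then show ?thesis using w(2) by blast
  qed
  \<comment> \<open>A nonzero value taken near the circle is small, so it is taken a second time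
    inside the radius \<open>r3\<close> provided by the root \<open>x\<close>.\<close>
  moreover have "S \<noteq> {}"
  proof -
    obtain r2 where r2: "0 < r2" "r2 < 1" "\<And>l. r2 < cmod l \<Longrightarrow> cmod l < 1 \<Longrightarrow> cmod (G l) < \<eta>"
      using near_circle[OF near_x(1)] by blast
    define r where "r = max r2 r3"
    define A where "A = {l :: complex. r < cmod l \<and> cmod l < 1}"
    have r: "0 < r" "r < 1" using r2 near_x by (auto simp: r_def)
    have A: "A = ball 0 1 - cball 0 r" by (auto simp: A_def)
    have "open A" unfolding A by (intro open_Diff) auto
    have ne: "of_real ((1 + r) / 2) \<in> A" using r unfolding A_def mem_Collect_eq norm_of_real by simp
    have "infinite A"
      using \<open>open A\<close> ne finite_imp_not_open[of A] by auto
    then have "infinite (A - {x. x * poly a x = 0})" using finite_branch_points[OF reg] by (rule Diff_infinite_finite[rotated])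
    then obtain l where l: "l \<in> A" "l * poly a l \<noteq> 0" by (metis (mono_tags, lifting) DiffE ex_in_conv finite.emptyI mem_Collect_eq)
    have l1: "cmod l < 1" using l(1) by (simp add: A_def)
    obtain rl f where f': "rl > 0" "\<forall>z\<in>ball l rl. cmod z < 1 \<and> z \<noteq> 0" "inj_on f (ball l rl)" "continuous_on (ball l rl) f"
      "\<forall>z\<in>ball l rl. G z = (f z)\<^sup>2"
      by (rule local_form[OF l1 l(2)]) (rule that)
    note f = f'(1,3,5)
    obtain d where d: "d > 0" "ball l d \<subseteq> A" using \<open>open A\<close> l(1) open_contains_ball by blast
    define e where "e = min rl d"
    \<comment> \<open>The local root \<open>f\<close> of \<open>G\<close> is injective, so
      \<open>G\<close> vanishes at no more than one point of the ball.\<close>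
    have "\<exists>l'\<in>ball l e. G l' \<noteq> 0"
    proof (rule ccontr)
      assume *: "\<not> (\<exists>l'\<in>ball l e. G l' \<noteq> 0)"
      define l2 where "l2 = l + of_real (e / 2)"
      have e: "e > 0" using f d by (simp add: e_def)
      have m: "l \<in> ball l e" "l2 \<in> ball l e" using e by (auto simp: l2_def dist_norm)
      have "f l = 0" "f l2 = 0" using * f(3) m by (auto simp: e_def)
      moreover have "l \<in> ball l rl" "l2 \<in> ball l rl" using m by (auto simp: e_def)
      ultimately have "l = l2" using inj_onD[OF f(2)] by metis
      then show False using e by (simp add: l2_def)
    qed
    then obtain l' where l': "l' \<in> A" "G l' \<noteq> 0" using d(2) by (auto simp: e_def subset_iff)
    have "cmod (G l') < \<eta>" using r2(3)[of l'] l'(1) by (simp add: A_def r_def)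
    then obtain l'' where l'': "0 < cmod l''" "cmod l'' < r3" "G l'' = G l'" using near_x(3) by blast
    have "l' \<in> D" "l'' \<in> D" "l' \<noteq> l''" using l' l'' r near_x by (auto simp: D_def A_def r_def)
    then show ?thesis using l'(2) l''(3) unfolding S_def by blast
  qed
  ultimately show False by blast
qed

end

theorem qpoly_has_root_in_disc:
  assumes a: "a \<in> H_space g" and g: "g \<ge> 1"
  shows "\<exists>z. cmod z < 1 \<and> poly (qpoly g a) z = 0"
proof (rule ccontr)
  assume no: "\<not> (\<exists>z. cmod z < 1 \<and> poly (qpoly g a) z = 0)"
  obtain h1 h2 where "potential a (b_at g a 1) h1" "potential a (b_at g a \<i>) h2"
    using b_at_props(2)[OF a] by metis
  with no a interpret sense_preserving g a h1 h2 by unfold_locales auto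
  show False by (rule contradiction[OF g])
qed

section \<open>Winding number and openness\<close>

definition disc_roots :: "complex poly \<Rightarrow> nat" where
  "disc_roots q = size (filter_mset (\<lambda>x. cmod x < 1) (proots q))"

lemma disc_roots_mult: "p \<noteq> 0 \<Longrightarrow> q \<noteq> 0 \<Longrightarrow> disc_roots (p * q) = disc_roots p + disc_roots q"
  by (simp add: disc_roots_def proots_mult)

lemma disc_roots_le_degree: "disc_roots q \<le> degree q"
  unfolding disc_roots_def using size_filter_mset_lesseq[of _ "proots q"] by (simp add: size_proots_complex)

lemma disc_roots_pos: "q \<noteq> 0 \<Longrightarrow> poly q z = 0 \<Longrightarrow> cmod z < 1 \<Longrightarrow> disc_roots q > 0"
proof -
  assume "q \<noteq> 0" "poly q z = 0" "cmod z < 1"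
  then have "z \<in># filter_mset (\<lambda>x. cmod x < 1) (proots q)" by simp
  then show ?thesis unfolding disc_roots_def by (metis empty_not_add_mset gr0I multi_member_split size_eq_0_iff_empty)
qed

lemma disc_roots_const: "degree q = 0 \<Longrightarrow> disc_roots q = 0"
  using disc_roots_le_degree[of q] by simp

lemma disc_roots_linear: "c \<noteq> 0 \<Longrightarrow> disc_roots [:- (c * \<rho>), c:] = (if cmod \<rho> < 1 then 1 else 0)"
proof -
  assume c: "c \<noteq> 0"
  have e: "[:- (c * \<rho>), c:] = smult c [:- \<rho>, 1:]" by simp
  have "size (proots [:- \<rho>, 1:]) = 1" by (simp add: size_proots_complex)
  moreover have "\<rho> \<in># proots [:- \<rho>, 1:]" by simp
  ultimately have "proots [:- \<rho>, 1:] = {#\<rho>#}"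
    by (metis add_mset_remove_trivial_eq multi_member_split size_1_singleton_mset singletonD set_mset_single)
  then show ?thesis unfolding disc_roots_def e proots_smult[OF c] by simp
qed

lemma poly_root_induct_complex [consumes 1, case_names const root]:
  fixes q :: "complex poly"
  assumes "q \<noteq> 0" "\<And>c. c \<noteq> 0 \<Longrightarrow> P [:c:]" "\<And>\<rho> q. q \<noteq> 0 \<Longrightarrow> P q \<Longrightarrow> P ([:- \<rho>, 1:] * q)"
  shows "P q"
  using assms(1)
proof (induction "degree q" arbitrary: q)
  case 0
  then obtain c where "q = [:c:]" by (metis degree_eq_zeroE)
  then show ?case using assms(2)[of c] 0 by auto
next
  case (Suc n)
  have "\<not> constant (poly q)" using Suc.hyps(2) constant_degree by (metis Zero_not_Suc)
  then obtain \<rho> where \<rho>: "poly q \<rho> = 0" using fundamental_theorem_of_algebra by blast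
  then obtain q' where q': "q = [:-\<rho>, 1:] * q'" by (auto simp: poly_eq_0_iff_dvd dvd_def)
  have q0: "q' \<noteq> 0" using Suc.prems(1) q' by auto
  have "degree q = Suc (degree q')" using q0 unfolding q' by (subst degree_mult_eq) auto
  then show ?case using assms(3)[OF q0 Suc.hyps(1)[OF _ q0], of \<rho>] Suc.hyps(2) q' by simp
qed

text \<open>The argument principle by induction over linear factors: each root contributes the
  winding number of the circle around it.\<close>

lemma log_derivative_integral:
  assumes "q \<noteq> 0" "\<And>z. cmod z = 1 \<Longrightarrow> poly q z \<noteq> 0"
  shows "((\<lambda>z. poly (pderiv q) z / poly q z) has_contour_integral (2 * of_real pi * \<i> * of_nat (disc_roots q))) (circlepath 0 1)"
  using assms
proof (induction q rule: poly_root_induct_complex)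
  case (const c)
  then show ?case by (simp add: disc_roots_const has_contour_integral_0)
next
  case (root \<rho> q)
  have nz: "poly q z \<noteq> 0" "z \<noteq> \<rho>" if "cmod z = 1" for z using root.prems[OF that] by auto
  have \<rho>1: "cmod \<rho> \<noteq> 1" using nz(2)[of \<rho>] by auto
  have \<rho>p: "\<rho> \<notin> path_image (circlepath 0 1)" using \<rho>1 by (simp add: dist_norm)
  have "winding_number (circlepath 0 1) \<rho> = of_nat (disc_roots [:- \<rho>, 1:])"
  proof (cases "cmod \<rho> < 1")
    case True
    then show ?thesis using disc_roots_linear[of 1 \<rho>] winding_number_circlepath[of \<rho> 0 1] by simp
  next
    case False
    then have "\<rho> \<notin> cball 0 1" using \<rho>1 by simp
    then have "winding_number (circlepath 0 1) \<rho> = 0"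
      by (intro winding_number_zero_outside[of _ "cball 0 1"]) (auto simp: dist_norm)
    then show ?thesis using disc_roots_linear[of 1 \<rho>] False by simp
  qed
  then have 1: "((\<lambda>w. 1 / (w - \<rho>)) has_contour_integral (2 * of_real pi * \<i> * of_nat (disc_roots [:- \<rho>, 1:]))) (circlepath 0 1)"
    using has_contour_integral_winding_number[OF valid_path_circlepath \<rho>p] by simp
  have "((\<lambda>z. 1 / (z - \<rho>) + poly (pderiv q) z / poly q z) has_contour_integral
      (2 * of_real pi * \<i> * of_nat (disc_roots [:- \<rho>, 1:]) + 2 * of_real pi * \<i> * of_nat (disc_roots q))) (circlepath 0 1)"
    by (rule has_contour_integral_add[OF 1 root.IH[OF nz(1)]])
  moreover have "1 / (z - \<rho>) + poly (pderiv q) z / poly q z = poly (pderiv ([:- \<rho>, 1:] * q)) z / poly ([:- \<rho>, 1:] * q) z"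
    if "z \<in> path_image (circlepath 0 1)" for z
  proof -
    have z: "poly q z \<noteq> 0" "z - \<rho> \<noteq> 0" using nz[of z] that by (auto simp: dist_norm)
    have "poly (pderiv ([:- \<rho>, 1:] * q)) z = poly q z + (z - \<rho>) * poly (pderiv q) z"
      by (simp add: pderiv_mult pderiv_pCons pderiv_diff pderiv_smult algebra_simps)
    moreover have "poly ([:- \<rho>, 1:] * q) z = (z - \<rho>) * poly q z" by (simp add: algebra_simps)
    ultimately show ?thesis using z by (simp add: add_frac_eq add.commute mult.commute del: mult_pCons_left)
  qed
  ultimately have "((\<lambda>z. poly (pderiv ([:- \<rho>, 1:] * q)) z / poly ([:- \<rho>, 1:] * q) z) has_contour_integral
      (2 * of_real pi * \<i> * of_nat (disc_roots [:- \<rho>, 1:]) + 2 * of_real pi * \<i> * of_nat (disc_roots q))) (circlepath 0 1)"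
    by (rule has_contour_integral_eq)
  moreover have "disc_roots ([:- \<rho>, 1:] * q) = disc_roots [:- \<rho>, 1:] + disc_roots q"
    by (rule disc_roots_mult) (use root.hyps in auto)
  ultimately show ?case by (simp only: of_nat_add distrib_left)
qed

lemma winding_number_quotient:
  assumes p: "p \<noteq> 0" "\<And>z. cmod z = 1 \<Longrightarrow> poly p z \<noteq> 0" and q: "q \<noteq> 0" "\<And>z. cmod z = 1 \<Longrightarrow> poly q z \<noteq> 0"
  shows "winding_number ((\<lambda>z. poly p z / poly q z) \<circ> circlepath 0 1) 0 = of_int (int (disc_roots p) - int (disc_roots q))"
proof -
  define f where "f = (\<lambda>z. poly p z / poly q z)"
  have pi: "path_image (circlepath 0 1) = sphere (0::complex) 1" by simp
  have an: "f analytic_on sphere 0 1" unfolding f_def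
    using q(2) by (intro analytic_on_divide) (auto simp: analytic_on_holomorphic intro!: exI[of _ UNIV] holomorphic_intros)
  have "valid_path (f \<circ> circlepath 0 1)"
    by (rule valid_path_compose_analytic[OF valid_path_circlepath an]) simp
  moreover have "0 \<notin> path_image (f \<circ> circlepath 0 1)"
    using p(2) q(2) by (auto simp: path_image_compose f_def)
  ultimately have "winding_number (f \<circ> circlepath 0 1) 0 = 1 / (2 * pi * \<i>) * contour_integral (f \<circ> circlepath 0 1) (\<lambda>w. 1 / (w - 0))"
    by (rule winding_number_valid_path)
  also have "contour_integral (f \<circ> circlepath 0 1) (\<lambda>w. 1 / (w - 0)) = contour_integral (circlepath 0 1) (\<lambda>w. deriv f w * (1 / (f w - 0)))"
    by (rule contour_integral_comp_analyticW[OF an valid_path_circlepath]) simp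
  also have "\<dots> = 2 * of_real pi * \<i> * of_nat (disc_roots p) - 2 * of_real pi * \<i> * of_nat (disc_roots q)"
  proof (rule contour_integral_unique, rule has_contour_integral_eq)
    show "((\<lambda>z. poly (pderiv p) z / poly p z - poly (pderiv q) z / poly q z) has_contour_integral
        2 * of_real pi * \<i> * of_nat (disc_roots p) - 2 * of_real pi * \<i> * of_nat (disc_roots q)) (circlepath 0 1)"
      by (intro has_contour_integral_diff log_derivative_integral p q)
    fix z assume "z \<in> path_image (circlepath (0::complex) 1)"
    then have z: "poly p z \<noteq> 0" "poly q z \<noteq> 0" using p q by (auto simp: dist_norm)
    have "(f has_field_derivative (poly (pderiv p) z * poly q z - poly p z * poly (pderiv q) z) / (poly q z * poly q z)) (at z)"
      unfolding f_def by (rule DERIV_divide[OF poly_DERIV poly_DERIV z(2)])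
    then have D: "deriv f z = (poly (pderiv p) z * poly q z - poly p z * poly (pderiv q) z) / (poly q z * poly q z)"
      by (rule DERIV_imp_deriv)
    then show "poly (pderiv p) z / poly p z - poly (pderiv q) z / poly q z = deriv f z * (1 / (f z - 0))"
      unfolding D using z by (simp add: f_def field_simps)
  qed
  also have "1 / (2 * pi * \<i>) * (2 * of_real pi * \<i> * of_nat (disc_roots p) - 2 * of_real pi * \<i> * of_nat (disc_roots q))
     = of_int (int (disc_roots p) - int (disc_roots q))" by (simp add: field_simps)
  finally show ?thesis unfolding f_def .
qed

lemma poly_star_mult_linear:
  assumes "degree q \<le> d"
  shows "poly_star (Suc d) ([:- \<rho>, 1:] * q) = [:1, - cnj \<rho>:] * poly_star d q"
proof (rule poly_eqI)
  fix i
  have "coeff q (Suc d) = 0" using assms by (simp add: coeff_eq_0)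
  then show "coeff (poly_star (Suc d) ([:- \<rho>, 1:] * q)) i = coeff ([:1, - cnj \<rho>:] * poly_star d q) i"
    by (cases i) (auto simp: coeff_poly_star coeff_pCons Suc_diff_le split: nat.splits
      intro!: arg_cong[where f = "coeff q"])
qed

text \<open>Reflection exchanges the roots inside and outside, and a deficit of the degree against
  the nominal degree \<open>d\<close> reappears as roots at 0, which lie in the disc.\<close>

lemma disc_roots_star:
  assumes "q \<noteq> 0" "degree q \<le> d" "\<And>z. cmod z = 1 \<Longrightarrow> poly q z \<noteq> 0"
  shows "disc_roots (poly_star d q) + disc_roots q = d \<and> poly_star d q \<noteq> 0"
  using assms
proof (induction q arbitrary: d rule: poly_root_induct_complex)
  case (const c)
  have "poly_star d [:c:] = monom (cnj c) d"
    by (rule poly_eqI) (auto simp: coeff_poly_star coeff_pCons split: nat.splits)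
  also have "\<dots> = smult (cnj c) ([:0, 1:] ^ d)" by (simp add: monom_altdef)
  finally have e: "poly_star d [:c:] = smult (cnj c) ([:0, 1:] ^ d)" .
  have "disc_roots ([:0, 1:] ^ d) = d"
  proof (induction d)
    case 0 then show ?case by (simp add: disc_roots_const)
  next
    case (Suc d)
    then show ?case using disc_roots_linear[of 1 0] by (simp add: disc_roots_mult del: mult_pCons_left)
  qed
  then have "disc_roots (poly_star d [:c:]) = d"
    using const unfolding e disc_roots_def by simp
  then show ?case using const e by (simp add: disc_roots_const)
next
  case (root \<rho> q)
  have deg: "degree ([:- \<rho>, 1:] * q) = Suc (degree q)" using root.hyps by (subst degree_mult_eq) auto
  then obtain d' where d: "d = Suc d'" using root.prems(1) by (cases d) auto
  have dq: "degree q \<le> d'" using root.prems(1) deg d by simp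
  have nz: "poly q z \<noteq> 0" "z \<noteq> \<rho>" if "cmod z = 1" for z using root.prems(2)[OF that] by auto
  have \<rho>1: "cmod \<rho> \<noteq> 1" using nz(2)[of \<rho>] by auto
  have IH: "disc_roots (poly_star d' q) + disc_roots q = d'" "poly_star d' q \<noteq> 0" using root.IH[OF dq nz(1)] by auto
  have lin: "disc_roots [:1, - cnj \<rho>:] = (if cmod \<rho> > 1 then 1 else 0)"
  proof (cases "\<rho> = 0")
    case True then show ?thesis by (simp add: disc_roots_const)
  next
    case False
    have "[:1, - cnj \<rho>:] = [:- (- cnj \<rho> * (1 / cnj \<rho>)), - cnj \<rho>:]" using False by simp
    then have "disc_roots [:1, - cnj \<rho>:] = (if cmod (1 / cnj \<rho>) < 1 then 1 else 0)"
      using disc_roots_linear[of "- cnj \<rho>" "1 / cnj \<rho>"] False by simp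
    then show ?thesis using False by (simp add: norm_divide divide_less_eq)
  qed
  have "disc_roots ([:- \<rho>, 1:] * q) = (if cmod \<rho> < 1 then 1 else 0) + disc_roots q"
    using disc_roots_mult[of "[:- \<rho>, 1:]" q] disc_roots_linear[of 1 \<rho>] root.hyps by (simp del: mult_pCons_left)
  moreover have "disc_roots (poly_star d ([:- \<rho>, 1:] * q)) = (if cmod \<rho> > 1 then 1 else 0) + disc_roots (poly_star d' q)"
    unfolding d poly_star_mult_linear[OF dq] using disc_roots_mult[of "[:1, - cnj \<rho>:]" "poly_star d' q"] IH(2) lin
    by (simp del: mult_pCons_left)
  moreover have "poly_star d ([:- \<rho>, 1:] * q) \<noteq> 0"
    unfolding d poly_star_mult_linear[OF dq] using IH(2) by (simp del: mult_pCons_left)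
  ultimately show ?case using IH(1) \<rho>1 d by (simp del: mult_pCons_left)
qed

lemma star_circle:
  assumes "degree q \<le> d" "cmod z = 1"
  shows "poly (poly_star d q) z = z ^ d * cnj (poly q z)"
proof -
  have "z \<noteq> 0" using assms(2) by auto
  then show ?thesis using poly_poly_star[OF assms(1)] inverse_cnj_circle[OF assms(2)] by simp
qed

text \<open>On the circle \<open>ppoly\<close> and \<open>qpoly\<close> have equal modulus. A zero
  of \<open>qpoly\<close> there is thus a common zero of both, hence of the two polynomials spanning
  \<open>B_plane g a\<close> over the reals.\<close>

lemma S_space_iff:
  assumes a: "a \<in> H_space g"
  shows "a \<in> S_space g \<longleftrightarrow> (\<exists>l. cmod l = 1 \<and> poly (qpoly g a) l = 0)"
proof -
  have "(\<forall>b\<in>B_plane g a. poly b l = 0) \<longleftrightarrow> poly (qpoly g a) l = 0" if l: "cmod l = 1" for l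
  proof
    assume *: "\<forall>b\<in>B_plane g a. poly b l = 0"
    have "b_at g a c \<in> B_plane g a" for c
      unfolding B_plane_iff[OF a] using b_at_props(1,2)[OF a] by blast
    then show "poly (qpoly g a) l = 0" using * by (simp add: qpoly_def)
  next
    assume q: "poly (qpoly g a) l = 0"
    have "poly (ppoly g a) l = 0"
      using star_circle[of "qpoly g a" "g + 1" l] qpoly_props(1,4)[OF a] l q by simp
    then have "poly (ppoly g a) l + poly (qpoly g a) l = 0" "poly (ppoly g a) l - poly (qpoly g a) l = 0" using q by auto
    then have z: "poly (b_at g a 1) l = 0" "poly (b_at g a \<i>) l = 0" by (auto simp: ppoly_def qpoly_def)
    show "\<forall>b\<in>B_plane g a. poly b l = 0"
    proof
      fix b assume "b \<in> B_plane g a"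
      then obtain h where b: "b \<in> real_polys (g + 1)" "potential a b h" using B_plane_iff[OF a] by blast
      define c where "c = poly b 0"
      obtain k1 k2 where k: "potential a (b_at g a 1) k1" "potential a (b_at g a \<i>) k2" using b_at_props(2)[OF a] by metis
      define b' where "b' = smult (of_real (Re c)) (b_at g a 1) + smult (of_real (Im c)) (b_at g a \<i>)"
      have "b' \<in> real_polys (g + 1)"
        using real_polys_scale[OF b_at_props(1)[OF a], of "Re c" 1] real_polys_scale[OF b_at_props(1)[OF a], of "Im c" \<i>]
        by (auto simp: b'_def real_polys_iff poly_star_add intro!: degree_add_le)
      moreover have "potential a b' (\<lambda>l y. Re c * k1 l y + Im c * k2 l y)"
        unfolding b'_def by (intro potential_add potential_scale k)
      moreover have "poly b' 0 = c" by (simp add: b'_def b_at_props(3)[OF a] complex_eq[symmetric] mult.commute)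
      ultimately have "b' = b_at g a c" using b_at_props(4)[OF a] by metis
      moreover have "b = b_at g a c" using b_at_props(4)[OF a b] by (simp add: c_def)
      ultimately have "b = b'" by simp
      then show "poly b l = 0" using z by (simp add: b'_def)
    qed
  qed
  then show ?thesis using a by (auto simp: S_space_def)
qed

text \<open>Where the denominator does not vanish, cancelling the greatest common divisor changes no
  value, so the uncancelled quotient determines the degree; reflection relates the root counts of
  numerator and denominator.\<close>

lemma winding_f_tilde:
  assumes a: "a \<in> H_space g" and nz: "\<And>l. cmod l = 1 \<Longrightarrow> poly (qpoly g a) l \<noteq> 0"
  shows "winding_number (f_tilde g a \<circ> circlepath 0 1) 0 = of_int (int g + 1 - 2 * int (disc_roots (qpoly g a)))"
proof -
  define p q where "p = ppoly g a" and "q = qpoly g a"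
  have deg: "degree q \<le> g + 1" using qpoly_props(4)[OF a] by (simp add: q_def)
  have p: "p = poly_star (g + 1) q" using qpoly_props(1)[OF a] by (simp add: p_def q_def)
  have q0: "q \<noteq> 0" using qpoly_props(6)[OF a] by (simp add: q_def)
  have ds: "disc_roots p + disc_roots q = g + 1" "p \<noteq> 0"
    using disc_roots_star[OF q0 deg] nz unfolding p by (auto simp: q_def)
  have pnz: "poly p l \<noteq> 0" if "cmod l = 1" for l
    unfolding p star_circle[OF deg that] using nz[OF that] that by (auto simp: q_def)
  have f: "f_tilde g a l = poly p l / poly q l" if "cmod l = 1" for l
  proof -
    define G where "G = gcd p q"
    have pq: "p = G * (p div G)" "q = G * (q div G)" by (auto simp: G_def)
    have "poly q l = poly G l * poly (q div G) l" by (subst pq(2)) (rule poly_mult)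
    moreover have "poly p l = poly G l * poly (p div G) l" by (subst pq(1)) (rule poly_mult)
    moreover have "poly q l \<noteq> 0" using nz[OF that] by (simp add: q_def)
    ultimately show ?thesis
      by (simp add: f_tilde_def Let_def G_def p_def q_def ppoly_def qpoly_def)
  qed
  have "winding_number (f_tilde g a \<circ> circlepath 0 1) 0 = winding_number ((\<lambda>z. poly p z / poly q z) \<circ> circlepath 0 1) 0"
  proof (rule winding_number_cong)
    fix t :: real assume "0 \<le> t" "t \<le> 1"
    then have "circlepath 0 1 t \<in> path_image (circlepath (0::complex) 1)" by (simp add: path_image_def)
    then have "cmod (circlepath 0 1 t) = 1" by (simp add: dist_norm)
    then show "(f_tilde g a \<circ> circlepath 0 1) t = ((\<lambda>z. poly p z / poly q z) \<circ> circlepath 0 1) t" using f by simp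
  qed
  also have "\<dots> = of_int (int (disc_roots p) - int (disc_roots q))"
    using winding_number_quotient[OF ds(2) pnz q0] nz by (simp add: q_def)
  also have "int (disc_roots p) - int (disc_roots q) = int g + 1 - 2 * int (disc_roots q)" using ds(1) by linarith
  finally show ?thesis unfolding q_def .
qed

text \<open>Rouche's argument by homotopy of the image loops. Roots are not followed individually,
  as the degree may drop in the limit and roots may escape to infinity.\<close>

lemma disc_roots_conv:
  assumes conv: "poly_conv d qn q" and nz: "\<And>z. cmod z = 1 \<Longrightarrow> poly q z \<noteq> 0"
  shows "\<forall>\<^sub>F n in sequentially. (\<forall>z. cmod z = 1 \<longrightarrow> poly (qn n) z \<noteq> 0) \<and> disc_roots (qn n) = disc_roots q"
proof -
  have q0: "q \<noteq> 0" using nz[of 1] by auto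
  have "continuous_on (sphere 0 1) (\<lambda>z. cmod (poly q z))" by (intro continuous_intros)
  then obtain z0 where z0: "z0 \<in> sphere 0 1" "\<And>z. z \<in> sphere 0 1 \<Longrightarrow> cmod (poly q z0) \<le> cmod (poly q z)"
    using continuous_attains_inf[of "sphere (0::complex) 1" "\<lambda>z. cmod (poly q z)"] by auto
  define m where "m = cmod (poly q z0)"
  have m: "m > 0" using nz[of z0] z0(1) by (simp add: m_def)
  have w: "winding_number (poly p \<circ> circlepath 0 1) 0 = of_int (int (disc_roots p))"
    if "p \<noteq> 0" "\<And>z. cmod z = 1 \<Longrightarrow> poly p z \<noteq> 0" for p
    using winding_number_quotient[OF that, of 1] by (simp add: disc_roots_const o_def)
  have "\<forall>\<^sub>F n in sequentially. \<forall>z\<in>sphere 0 1. cmod (poly (qn n) z - poly q z) < m"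
    by (rule poly_conv_uniform[OF conv _ m]) simp
  then show ?thesis
  proof eventually_elim
    case (elim n)
    have nzn: "poly (qn n) z \<noteq> 0" if "cmod z = 1" for z
    proof
      assume "poly (qn n) z = 0"
      then have "cmod (poly q z) < m" using bspec[OF elim, of z] that by simp
      then show False using z0(2)[of z] that by (simp add: m_def)
    qed
    have "poly (qn n) 1 \<noteq> 0" by (rule nzn) simp
    then have qn0: "qn n \<noteq> 0" by auto
    have path: "path (poly p \<circ> circlepath 0 1)" for p :: "complex poly"
      by (intro path_continuous_image path_circlepath continuous_intros)
    have loop: "pathfinish (poly p \<circ> circlepath 0 1) = pathstart (poly p \<circ> circlepath 0 1)" for p :: "complex poly"
      by (simp add: pathfinish_compose pathstart_compose)
    have "homotopic_loops (- {0}) (poly q \<circ> circlepath 0 1) (poly (qn n) \<circ> circlepath 0 1)"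
    proof (rule homotopic_loops_nearby_explicit[OF path path loop loop])
      fix t :: real and x :: complex assume t: "t \<in> {0..1}" and "x \<notin> - {0}"
      then have x: "x = 0" by simp
      have "circlepath 0 1 t \<in> path_image (circlepath (0::complex) 1)" using t by (simp add: path_image_def)
      then have c: "circlepath 0 1 t \<in> sphere (0::complex) 1" by simp
      show "norm ((poly (qn n) \<circ> circlepath 0 1) t - (poly q \<circ> circlepath 0 1) t) < norm ((poly q \<circ> circlepath 0 1) t - x)"
        using bspec[OF elim c] z0(2)[OF c] x by (simp add: m_def)
    qed
    then have "winding_number (poly q \<circ> circlepath 0 1) 0 = winding_number (poly (qn n) \<circ> circlepath 0 1) 0"
      by (rule winding_number_homotopic_loops)
    then have "complex_of_int (int (disc_roots q)) = of_int (int (disc_roots (qn n)))"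
      using w[OF q0 nz] w[OF qn0 nzn] by simp
    then show ?case using nzn by simp
  qed
qed

lemma poly_conv_add: "poly_conv d p q \<Longrightarrow> poly_conv d p' q' \<Longrightarrow> poly_conv d (\<lambda>n. p n + p' n) (q + q')"
  by (auto simp: poly_conv_def intro!: degree_add_le tendsto_add)

lemma poly_conv_smult: "poly_conv d p q \<Longrightarrow> poly_conv d (\<lambda>n. smult c (p n)) (smult c q)"
  by (auto simp: poly_conv_def intro!: order_trans[OF degree_smult_le] tendsto_mult_left)

lemma poly_conv_qpoly:
  assumes "\<And>c. poly_conv d (\<lambda>n. b_at g (an n) c) (bb c)"
  shows "poly_conv d (\<lambda>n. qpoly g (an n)) (bb 1 - smult \<i> (bb \<i>))"
proof -
  have "poly_conv d (\<lambda>n. b_at g (an n) 1 + smult (- \<i>) (b_at g (an n) \<i>)) (bb 1 + smult (- \<i>) (bb \<i>))"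
    by (intro poly_conv_add poly_conv_smult assms)
  then show ?thesis by (simp add: qpoly_def)
qed

lemma V_set_iff:
  "a \<in> V_set g j \<longleftrightarrow> a \<in> H_space g \<and> (\<forall>l. cmod l = 1 \<longrightarrow> poly (qpoly g a) l \<noteq> 0) \<and>
     int g + 1 - 2 * int (disc_roots (qpoly g a)) = j"
proof (cases "a \<in> H_space g")
  case True
  have "winding_number (f_tilde g a \<circ> circlepath 0 1) 0 = of_int j \<longleftrightarrow> int g + 1 - 2 * int (disc_roots (qpoly g a)) = j"
    if "\<And>l. cmod l = 1 \<Longrightarrow> poly (qpoly g a) l \<noteq> 0"
  proof -
    have "winding_number (f_tilde g a \<circ> circlepath 0 1) 0 = of_int (int g + 1 - 2 * int (disc_roots (qpoly g a)))"
      by (rule winding_f_tilde[OF True]) (rule that)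
    then show ?thesis by (simp only: of_int_eq_iff)
  qed
  then show ?thesis using S_space_iff[OF True] True by (auto simp: V_set_def)
qed (simp add: V_set_def)

text \<open>Closures in the space of coefficient sequences are sequential. A point of
  \<open>V\<close> in the closure of the complement would be a limit of points outside
  \<open>V\<close>, and a single index with \<open>an n \<in> V\<close> contradicts this.\<close>

lemma openin_H_topology_sequential:
  assumes "V \<subseteq> H_space g"
    and "\<And>a an. a \<in> V \<Longrightarrow> (\<And>n. an n \<in> H_space g) \<Longrightarrow> poly_conv (2 * g) an a \<Longrightarrow> \<exists>n. an n \<in> V"
  shows "openin (H_topology g) V"
proof -
  define U where "U = - closure (coeff ` (H_space g - V))"
  have "open U" unfolding U_def by (intro open_Compl closed_closure)
  moreover have "V = coeff -` U \<inter> H_space g"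
  proof (intro equalityI subsetI)
    fix a assume a: "a \<in> V"
    have "coeff a \<notin> closure (coeff ` (H_space g - V))"
    proof
      assume "coeff a \<in> closure (coeff ` (H_space g - V))"
      then obtain x where x: "\<And>n. x n \<in> coeff ` (H_space g - V)" "x \<longlonglongrightarrow> coeff a"
        unfolding closure_sequential by blast
      have "\<forall>n. \<exists>b. b \<in> H_space g - V \<and> x n = coeff b" using x(1) by blast
      then have "\<exists>an. \<forall>n. an n \<in> H_space g - V \<and> x n = coeff (an n)" by (rule choice)
      then obtain an where an: "\<And>n. an n \<in> H_space g - V" "\<And>n. x n = coeff (an n)" by blast
      have "(\<lambda>n. coeff (an n) i) \<longlonglongrightarrow> coeff a i" for i
      proof -
        have "continuous_on UNIV (\<lambda>f :: nat \<Rightarrow> complex. f i)" by (rule continuous_on_product_coordinates)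
        from continuous_on_tendsto_compose[OF this x(2)] show ?thesis by (simp add: an(2))
      qed
      then have "poly_conv (2 * g) an a"
        using an(1) a assms(1) H_space_props(3) unfolding poly_conv_def by (metis DiffD1 order_refl subsetD)
      then obtain n where "an n \<in> V" using assms(2)[OF a] an(1) by blast
      then show False using an(1) by blast
    qed
    then show "a \<in> coeff -` U \<inter> H_space g" using a assms(1) by (auto simp: U_def)
  next
    fix a assume "a \<in> coeff -` U \<inter> H_space g"
    then show "a \<in> V" using closure_subset[of "coeff ` (H_space g - V)"] by (auto simp: U_def)
  qed
  ultimately show ?thesis unfolding H_topology_def openin_pullback_topology by (auto simp: open_openin[symmetric])
qed

lemma openin_V_set: "openin (H_topology g) (V_set g j)"
proof (rule openin_H_topology_sequential)
  show "V_set g j \<subseteq> H_space g" by (auto simp: V_set_iff)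
  fix a an assume a: "a \<in> V_set g j" and an: "\<And>n. an n \<in> H_space g" and conv: "poly_conv (2 * g) an a"
  have aH: "a \<in> H_space g" and nz: "\<And>l. cmod l = 1 \<Longrightarrow> poly (qpoly g a) l \<noteq> 0"
    and j: "int g + 1 - 2 * int (disc_roots (qpoly g a)) = j" using a by (auto simp: V_set_iff)
  have "poly_conv (g + 1) (\<lambda>n. qpoly g (an n)) (b_at g a 1 - smult \<i> (b_at g a \<i>))"
    by (rule poly_conv_qpoly[OF b_at_continuous[OF an aH conv]])
  then have "poly_conv (g + 1) (\<lambda>n. qpoly g (an n)) (qpoly g a)" by (simp only: qpoly_def)
  then have "\<forall>\<^sub>F n in sequentially. (\<forall>z. cmod z = 1 \<longrightarrow> poly (qpoly g (an n)) z \<noteq> 0) \<and>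
      disc_roots (qpoly g (an n)) = disc_roots (qpoly g a)"
    by (rule disc_roots_conv) (rule nz)
  from eventually_happens'[OF sequentially_bot this]
  obtain n where "(\<forall>z. cmod z = 1 \<longrightarrow> poly (qpoly g (an n)) z \<noteq> 0) \<and> disc_roots (qpoly g (an n)) = disc_roots (qpoly g a)"
    by blast
  then show "\<exists>n. an n \<in> V_set g j" using an j by (auto simp: V_set_iff)
qed

lemma disc_roots_qpoly:
  assumes "a \<in> H_space g" "g \<ge> 1"
  shows "1 \<le> disc_roots (qpoly g a)" "disc_roots (qpoly g a) \<le> g"
proof -
  show "1 \<le> disc_roots (qpoly g a)"
    using qpoly_has_root_in_disc[OF assms] disc_roots_pos[OF qpoly_props(6)[OF assms(1)]] by force
  show "disc_roots (qpoly g a) \<le> g"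
    using disc_roots_le_degree[of "qpoly g a"] qpoly_props(4)[OF assms(1)] by linarith
qed

section \<open>Opening a node\<close>

text \<open>A square root that is single-valued on the circle lifts it to a closed path on the
  curve, and the real part of the integral is the increment of \<open>h\<close>.\<close>

lemma closed_branch_integral:
  assumes pot: "potential A b h" and \<rho>: "\<rho> > 0"
    and y: "continuous_on (sphere \<beta> \<rho>) y" "\<And>z. z \<in> sphere \<beta> \<rho> \<Longrightarrow> (y z)\<^sup>2 = z * poly A z \<and> y z \<noteq> 0"
  shows "(\<lambda>z. poly b z / (z * y z)) contour_integrable_on circlepath \<beta> \<rho>"
    "Re (contour_integral (circlepath \<beta> \<rho>) (\<lambda>z. poly b z / (z * y z))) = 0"
proof -
  let ?f = "\<lambda>z. poly b z / (z * y z)" and ?c = "circlepath \<beta> \<rho>"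
  have nz: "z \<noteq> 0" if "z \<in> sphere \<beta> \<rho>" for z using y(2)[OF that] by auto
  have "continuous_on (sphere \<beta> \<rho>) ?f" using y nz by (intro continuous_intros) auto
  then show int: "?f contour_integrable_on ?c"
    using \<rho> by (intro contour_integrable_continuous_circlepath) simp
  have on: "?c t \<in> sphere \<beta> \<rho>" if "t \<in> {0..1}" for t
    using that \<rho> path_image_circlepath_nonneg[of \<rho> \<beta>] by (auto simp: path_image_def)
  have der: "(?c has_derivative (\<lambda>d. d *\<^sub>R vector_derivative ?c (at t))) (at t within {0..1})" for t
    using has_vector_derivative_circlepath[of \<beta> \<rho> t "{0..1}"]
    by (simp add: has_vector_derivative_def vector_derivative_circlepath)
  have cont: "continuous_on {0..1} (\<lambda>t. y (?c t))"
    by (rule continuous_on_compose2[OF y(1)])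
      (use on in \<open>auto intro!: continuous_on_subset[OF continuous_on_path[OF path_circlepath]]\<close>)
  have "((\<lambda>t. h (?c t) (y (?c t))) has_vector_derivative Re (?f (?c t) * vector_derivative ?c (at t))) (at t within {0..1})"
    if t: "t \<in> {0..1}" for t
  proof -
    have "((\<lambda>t. h (?c t) (y (?c t))) has_derivative
        (\<lambda>d. Re (poly b (?c t) * (d *\<^sub>R vector_derivative ?c (at t)) / (?c t * y (?c t))))) (at t within {0..1})"
      by (rule potential_has_derivative[OF pot, where T = "{0..1}" and y = "\<lambda>t. y (?c t)" and l = ?c])
        (use y(2) on t der cont in \<open>auto simp: continuous_on_eq_continuous_within\<close>)
    moreover have "Re (poly b (?c t) * (d *\<^sub>R vector_derivative ?c (at t)) / (?c t * y (?c t))) =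
        d *\<^sub>R Re (?f (?c t) * vector_derivative ?c (at t))" for d
    proof -
      have "poly b (?c t) * (d *\<^sub>R vector_derivative ?c (at t)) / (?c t * y (?c t)) =
          d *\<^sub>R (?f (?c t) * vector_derivative ?c (at t))" by (simp add: scaleR_conv_of_real)
      then show ?thesis by (simp only: scaleR_complex.sel real_scaleR_def)
    qed
    ultimately show ?thesis by (simp only: has_vector_derivative_def)
  qed
  then have "((\<lambda>t. Re (?f (?c t) * vector_derivative ?c (at t))) has_integral
      (h (?c 1) (y (?c 1)) - h (?c 0) (y (?c 0)))) {0..1}"
    by (intro fundamental_theorem_of_calculus) auto
  moreover have "?c 1 = ?c 0" by (simp add: circlepath)
  ultimately have 0: "((\<lambda>t. Re (?f (?c t) * vector_derivative ?c (at t))) has_integral 0) {0..1}" by simp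
  have "((\<lambda>t. ?f (?c t) * vector_derivative ?c (at t)) has_integral contour_integral ?c ?f) {0..1}"
    using has_contour_integral_integral[OF int] by (simp add: has_contour_integral)
  then have "((\<lambda>t. Re (?f (?c t) * vector_derivative ?c (at t))) has_integral Re (contour_integral ?c ?f)) {0..1}"
    by (rule has_integral_linear[OF _ bounded_linear_Re, unfolded o_def])
  with 0 show "Re (contour_integral ?c ?f) = 0" by (rule has_integral_unique[rotated])
qed

text \<open>With s^2 = 1 - w and Re s \<ge> 0, the remainder equals (s - 1)^2 (s + 2) / (2 s).
  Moreover |s - 1| \<le> |w| because |s + 1| \<ge> 1.\<close>

lemma inverse_csqrt_approx:
  assumes w: "cmod w \<le> 1 / 2"
  shows "cmod (1 / csqrt (1 - w) - 1 - w / 2) \<le> 4 * (cmod w)\<^sup>2"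
proof -
  define s where "s = csqrt (1 - w)"
  have s2: "w = 1 - s\<^sup>2" by (simp add: s_def)
  have "Re s \<ge> 0" unfolding s_def by (rule Re_csqrt)
  then have "1 \<le> \<bar>Re (s + 1)\<bar>" by simp
  then have s1: "1 \<le> cmod (s + 1)" using abs_Re_le_cmod order_trans by blast
  have "w = - ((s - 1) * (s + 1))" unfolding s2 by (simp add: algebra_simps power2_eq_square)
  then have "cmod w = cmod (s - 1) * cmod (s + 1)" by (metis norm_minus_cancel norm_mult)
  then have d: "cmod (s - 1) \<le> cmod w" using mult_left_mono[OF s1, of "cmod (s - 1)"] by simp
  have "cmod 1 - cmod (s - 1) \<le> cmod s" using norm_triangle_ineq2[of 1 "1 - s"] by (simp add: norm_minus_commute)
  then have lo: "1 / 2 \<le> cmod s" using d w by simp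
  have "cmod s \<le> cmod (s - 1) + cmod 1" using norm_triangle_ineq[of "s - 1" 1] by simp
  then have "cmod (s + 2) \<le> 4" using d w norm_triangle_ineq[of s 2] by simp
  then have num: "cmod (s - 1) ^ 2 * cmod (s + 2) \<le> (cmod w)\<^sup>2 * 4"
    using d by (intro mult_mono power_mono) auto
  have "s \<noteq> 0" using lo by auto
  then have "1 / s - 1 - w / 2 = (s - 1)\<^sup>2 * (s + 2) / (2 * s)"
    unfolding s2 by (simp add: field_simps power2_eq_square)
  then have "cmod (1 / s - 1 - w / 2) = cmod (s - 1) ^ 2 * cmod (s + 2) / (2 * cmod s)"
    by (simp add: norm_mult norm_divide norm_power)
  also have "\<dots> \<le> (cmod w)\<^sup>2 * 4 / 1" using num lo by (intro frac_le) auto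
  finally show ?thesis by (simp add: s_def)
qed

text \<open>The first hypothesis gives x^2 = - e |x|^2, so (x / y)^2 = - |x|^2 / t is real and
  nonpositive.\<close>

lemma Re_quotient_zero:
  assumes x: "x = - e * cnj x" and y: "y\<^sup>2 = of_real t * e" and t: "t > 0" and e: "e \<noteq> 0"
  shows "Re (x / y) = 0"
proof -
  have "x\<^sup>2 = x * (- e * cnj x)" using x by (metis power2_eq_square)
  then have "x\<^sup>2 = - e * (x * cnj x)" by simp
  then have "x\<^sup>2 = - e * of_real ((cmod x)\<^sup>2)" by (simp only: complex_norm_square)
  then have "(x / y)\<^sup>2 = of_real (- (cmod x)\<^sup>2 / t)" using y t e by (simp add: power_divide field_simps)
  then have "Re ((x / y)\<^sup>2) = - (cmod x)\<^sup>2 / t" "Im ((x / y)\<^sup>2) = 0" by (metis Re_complex_of_real) (metis Im_complex_of_real \<open>(x / y)\<^sup>2 = _\<close>)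
  moreover have "- (cmod x)\<^sup>2 / t \<le> 0" using t by simp
  ultimately have "(Re (x / y))\<^sup>2 \<le> (Im (x / y))\<^sup>2" "Re (x / y) * Im (x / y) = 0"
    by (simp_all only: Re_power2 Im_power2)
  then show ?thesis by auto
qed

lemma poly_star_mult:
  assumes "degree p \<le> d" "degree q \<le> e"
  shows "poly_star (d + e) (p * q) = poly_star d p * poly_star e q"
proof -
  have deg: "degree (p * q) \<le> d + e" using assms degree_mult_le[of p q] by linarith
  have "poly (poly_star (d + e) (p * q)) z = poly (poly_star d p * poly_star e q) z" if "z \<noteq> 0" for z
    using that by (simp add: poly_poly_star assms deg power_add)
  then have "- {0} \<subseteq> {z. poly (poly_star (d + e) (p * q) - poly_star d p * poly_star e q) z = 0}" by auto
  moreover have "infinite (- {0 :: complex})"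
    unfolding Compl_eq_Diff_UNIV by (rule infinite_remove[OF infinite_UNIV_char_0])
  ultimately have "infinite {z. poly (poly_star (d + e) (p * q) - poly_star d p * poly_star e q) z = 0}"
    by (rule infinite_super)
  then have "poly_star (d + e) (p * q) - poly_star d p * poly_star e q = 0" by (metis poly_roots_finite)
  then show ?thesis by simp
qed

text \<open>The Euler operator \<lambda> d/d\<lambda> multiplies the coefficient of index j by j,
  and reflection replaces j by d - j.\<close>

lemma poly_star_pderiv:
  assumes "poly_star d p = p" "degree p \<le> d"
  shows "poly_star d ([:0, 1:] * pderiv p) = smult (of_nat d) p - [:0, 1:] * pderiv p"
proof (rule poly_eqI)
  fix i
  have c: "coeff ([:0, 1:] * pderiv p) j = of_nat j * coeff p j" for j
    by (cases j) (simp_all add: coeff_pCons coeff_pderiv)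
  have "cnj (coeff p (d - i)) = coeff p i" if "i \<le> d"
    using coeff_poly_star[of d p i] assms(1) that by simp
  then show "coeff (poly_star d ([:0, 1:] * pderiv p)) i = coeff (smult (of_nat d) p - [:0, 1:] * pderiv p) i"
    unfolding coeff_poly_star coeff_diff coeff_smult c using assms(2)
    by (auto simp: of_nat_diff algebra_simps coeff_eq_0)
qed

lemma real_poly_derivative_circle:
  assumes p: "p \<in> real_polys d" and l: "cmod l = 1"
  shows "l ^ d * cnj (l * poly (pderiv p) l) = of_nat d * poly p l - l * poly (pderiv p) l"
proof -
  have p': "degree p \<le> d" "poly_star d p = p" using p by (auto simp: real_polys_iff)
  have "degree ([:0, 1:] * pderiv p) \<le> d"
  proof (cases "d = 0")
    case True then show ?thesis using p' by (simp add: pderiv_eq_0_iff)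
  next
    case False then show ?thesis using p' degree_mult_le[of "[:0, 1::complex:]" "pderiv p"] degree_pderiv[of p] by simp
  qed
  from star_circle[OF this l] show ?thesis unfolding poly_star_pderiv[OF p'(2,1)] by simp
qed

text \<open>The function \<lambda>^(-g) a(\<lambda>) is real on the circle, so its logarithmic
  derivative along the angle, \<i> (\<lambda> a' / a - g), is real.\<close>

lemma log_derivative_circle:
  assumes a: "a \<in> H_space g" and l: "cmod l = 1"
  shows "Re (l * poly (pderiv a) l / poly a l) = g"
proof -
  have r: "a \<in> real_polys (2 * g)" using a by (simp add: H_space_def)
  have nz: "poly a l \<noteq> 0" "l \<noteq> 0" using H_space_props(5)[OF a l] l by auto
  have "cnj (l * poly (pderiv a) l / poly a l) = l ^ (2 * g) * cnj (l * poly (pderiv a) l) / (l ^ (2 * g) * cnj (poly a l))"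
    using nz by simp
  also have "\<dots> = (of_nat (2 * g) * poly a l - l * poly (pderiv a) l) / poly a l"
    by (simp only: real_poly_derivative_circle[OF r l] flip: poly_real_circle[OF r l])
  also have "\<dots> = of_nat (2 * g) - l * poly (pderiv a) l / poly a l" using nz by (simp add: diff_divide_distrib)
  finally have "Re (cnj (l * poly (pderiv a) l / poly a l)) = Re (of_nat (2 * g) - l * poly (pderiv a) l / poly a l)"
    by (rule arg_cong)
  then show ?thesis by (simp del: complex_cnj_divide complex_cnj_mult)
qed

text \<open>The quotient q' / q at \<beta> is the sum of 1 / (\<beta> - \<rho>) over the roots
  \<rho>, each term being at most 1 / \<epsilon> in modulus.\<close>

lemma poly_deriv_le_if_no_roots_near:
  assumes "q \<noteq> 0" "\<epsilon> > 0" "\<And>z. poly q z = 0 \<Longrightarrow> \<epsilon> \<le> cmod (\<beta> - z)"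
  shows "\<epsilon> * cmod (poly (pderiv q) \<beta>) \<le> degree q * cmod (poly q \<beta>)"
  using assms(1,3)
proof (induction q rule: poly_root_induct_complex)
  case (const c)
  then show ?case by simp
next
  case (root \<rho> q)
  have deg: "degree ([:- \<rho>, 1:] * q) = Suc (degree q)" using root.hyps by (subst degree_mult_eq) auto
  have \<rho>: "\<epsilon> \<le> cmod (\<beta> - \<rho>)" using root.prems[of \<rho>] by simp
  have IH: "\<epsilon> * cmod (poly (pderiv q) \<beta>) \<le> degree q * cmod (poly q \<beta>)"
    using root.prems by (intro root.IH) simp
  have "poly (pderiv ([:- \<rho>, 1:] * q)) \<beta> = poly q \<beta> + (\<beta> - \<rho>) * poly (pderiv q) \<beta>"
    unfolding pderiv_mult by (simp add: pderiv_pCons left_diff_distrib)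
  then have "\<epsilon> * cmod (poly (pderiv ([:- \<rho>, 1:] * q)) \<beta>) \<le>
      \<epsilon> * (cmod (poly q \<beta>) + cmod (\<beta> - \<rho>) * cmod (poly (pderiv q) \<beta>))"
    using assms(2) norm_triangle_ineq[of "poly q \<beta>" "(\<beta> - \<rho>) * poly (pderiv q) \<beta>"]
    by (intro mult_left_mono) (simp_all add: norm_mult)
  also have "\<dots> = \<epsilon> * cmod (poly q \<beta>) + cmod (\<beta> - \<rho>) * (\<epsilon> * cmod (poly (pderiv q) \<beta>))"
    by (simp add: algebra_simps)
  also have "\<dots> \<le> cmod (\<beta> - \<rho>) * cmod (poly q \<beta>) + cmod (\<beta> - \<rho>) * (degree q * cmod (poly q \<beta>))"
    using \<rho> IH by (intro add_mono mult_left_mono mult_right_mono) auto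
  also have "\<dots> = Suc (degree q) * cmod (poly ([:- \<rho>, 1:] * q) \<beta>)"
    unfolding poly_mult norm_mult by (simp add: algebra_simps)
  finally show ?case by (simp only: deg)
qed

lemma poly_conv_pderiv: "poly_conv d p q \<Longrightarrow> poly_conv d (\<lambda>n. pderiv (p n)) (pderiv q)"
  unfolding poly_conv_def coeff_pderiv
  by (auto intro!: tendsto_intros simp: degree_pderiv intro: le_trans[OF diff_le_self])

text \<open>The values at \<beta> tend to 0 while the derivatives there do not. By the preceding
  estimate a root must then lie within a distance of \<beta> that tends to 0.\<close>

lemma root_tracking:
  assumes conv: "poly_conv d q q0" and root: "poly q0 \<beta> = 0" and simple: "poly (pderiv q0) \<beta> \<noteq> 0"
  obtains \<nu> N where "\<nu> \<longlonglongrightarrow> \<beta>" "\<forall>n\<ge>N. poly (q n) (\<nu> n) = 0"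
proof -
  \<comment> \<open>The summand \<open>1 / Suc n\<close> keeps the radius positive even if
    \<open>q n\<close> vanishes at \<beta>, and makes the estimate below strict.\<close>
  define e where "e = (\<lambda>n. (d + 1) * cmod (poly (q n) \<beta>) / cmod (poly (pderiv (q n)) \<beta>) + 1 / (Suc n))"
  have c0: "(\<lambda>n. poly (q n) \<beta>) \<longlonglongrightarrow> 0" using poly_conv_poly[OF conv tendsto_const, of \<beta>] root by simp
  have c1: "(\<lambda>n. poly (pderiv (q n)) \<beta>) \<longlonglongrightarrow> poly (pderiv q0) \<beta>"
    by (rule poly_conv_poly[OF poly_conv_pderiv[OF conv] tendsto_const])
  have "e \<longlonglongrightarrow> (d + 1) * cmod 0 / cmod (poly (pderiv q0) \<beta>) + 0"
    unfolding e_def using simple by (intro tendsto_intros c0 c1 LIMSEQ_inverse_real_of_nat[unfolded inverse_eq_divide]) auto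
  then have e0: "e \<longlonglongrightarrow> 0" by simp
  obtain N where N: "\<forall>n\<ge>N. poly (pderiv (q n)) \<beta> \<noteq> 0"
    using tendsto_imp_eventually_ne[OF c1 simple] by (auto simp: eventually_sequentially)
  have ex: "\<exists>z. poly (q n) z = 0 \<and> cmod (\<beta> - z) < e n" if n: "n \<ge> N" for n
  proof (rule ccontr)
    assume "\<nexists>z. poly (q n) z = 0 \<and> cmod (\<beta> - z) < e n"
    then have far: "\<And>z. poly (q n) z = 0 \<Longrightarrow> e n \<le> cmod (\<beta> - z)" by force
    have q': "poly (pderiv (q n)) \<beta> \<noteq> 0" using N n by blast
    then have "q n \<noteq> 0" by auto
    have epos: "e n > 0" unfolding e_def by (intro add_nonneg_pos) auto
    have "(d + 1) * cmod (poly (q n) \<beta>) / cmod (poly (pderiv (q n)) \<beta>) * cmod (poly (pderiv (q n)) \<beta>) < e n * cmod (poly (pderiv (q n)) \<beta>)"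
      using q' by (intro mult_strict_right_mono) (auto simp: e_def)
    then have "(d + 1) * cmod (poly (q n) \<beta>) < e n * cmod (poly (pderiv (q n)) \<beta>)" using q' by simp
    also have "\<dots> \<le> degree (q n) * cmod (poly (q n) \<beta>)"
      by (rule poly_deriv_le_if_no_roots_near[OF \<open>q n \<noteq> 0\<close> epos far])
    also have "\<dots> \<le> (d + 1) * cmod (poly (q n) \<beta>)"
    proof (intro mult_right_mono)
      have "degree (q n) \<le> d + 1" using conv by (simp add: poly_conv_def le_SucI)
      then show "real (degree (q n)) \<le> real (d + 1)" by (simp only: of_nat_le_iff)
    qed simp
    finally show False by simp
  qed
  define \<nu> where "\<nu> = (\<lambda>n. if n \<ge> N then SOME z. poly (q n) z = 0 \<and> cmod (\<beta> - z) < e n else \<beta>)"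
  have \<nu>: "poly (q n) (\<nu> n) = 0 \<and> cmod (\<beta> - \<nu> n) < e n" if "n \<ge> N" for n
    using someI_ex[OF ex[OF that]] that by (simp add: \<nu>_def)
  have "(\<lambda>n. \<nu> n - \<beta>) \<longlonglongrightarrow> 0"
  proof (rule Lim_null_comparison[OF _ e0])
    show "\<forall>\<^sub>F n in sequentially. norm (\<nu> n - \<beta>) \<le> e n"
      unfolding eventually_sequentially using \<nu> by (auto simp: norm_minus_commute intro!: exI[of _ N] less_imp_le)
  qed
  then have "\<nu> \<longlonglongrightarrow> \<beta>" by (simp add: LIM_zero_iff)
  then show ?thesis using that \<nu> by blast
qed

text \<open>Horner's recursion expresses a coefficient of the quotient by the next higher one. The
  induction descends from indices beyond the degree bound, where all coefficients are 0.\<close>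

lemma poly_conv_synthetic_div:
  assumes conv: "poly_conv d q q0" and \<nu>: "\<nu> \<longlonglongrightarrow> \<beta>"
    and s: "\<And>n. q n = [:- \<nu> n, 1:] * s n" and s0: "q0 = [:- \<beta>, 1:] * s0"
  shows "poly_conv d s s0"
proof -
  have deg: "degree s \<le> d" if "degree p \<le> d" "p = [:- z, 1:] * s" for p s :: "complex poly" and z
  proof (cases "s = 0")
    case False
    then have "degree p = degree [:- z, 1:] + degree s" unfolding that(2) by (intro degree_mult_eq) auto
    then show ?thesis using that(1) by simp
  qed simp
  have step: "coeff s j = coeff p (Suc j) + z * coeff s (Suc j)" if "p = [:- z, 1:] * s" for p s :: "complex poly" and z j
    unfolding that by (simp add: coeff_pCons)
  have ds: "degree (s n) \<le> d" "degree s0 \<le> d" for n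
    using conv deg[OF _ s] deg[OF _ s0] by (simp_all only: poly_conv_def)
  have "(\<lambda>n. coeff (s n) i) \<longlonglongrightarrow> coeff s0 i" if "d + 1 \<le> i + k" for i k
    using that
  proof (induction k arbitrary: i)
    case 0
    then have "coeff (s n) i = 0" "coeff s0 i = 0" for n
      using ds(1)[of n] ds(2) by (simp_all add: coeff_eq_0)
    then show ?case by simp
  next
    case (Suc k)
    have "(\<lambda>n. coeff (q n) (Suc i) + \<nu> n * coeff (s n) (Suc i)) \<longlonglongrightarrow> coeff q0 (Suc i) + \<beta> * coeff s0 (Suc i)"
      using conv Suc by (intro tendsto_intros \<nu> Suc.IH) (auto simp: poly_conv_def)
    then show ?case by (simp only: step[OF s, symmetric] step[OF s0, symmetric])
  qed
  from this[of _ "d + 1"] ds show ?thesis by (auto simp: poly_conv_def)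
qed

lemma rsquarefree_mult_linear:
  assumes p: "rsquarefree p" and u: "poly p u \<noteq> 0"
  shows "rsquarefree (p * [:- u, 1:])"
proof -
  have nz: "p \<noteq> 0" "p * [:- u, 1:] \<noteq> 0" using p by (auto simp: rsquarefree_def simp del: mult_pCons_right)
  have "order x [:- u, 1:] = (if x = u then 1 else 0)" for x
    using order_power_n_n[of u 1] by (auto intro!: order_0I)
  then have "order x (p * [:- u, 1:]) = order x p + (if x = u then 1 else 0)" for x
    by (simp only: order_mult[OF nz(2)])
  moreover have "order u p = 0" using u by (simp add: order_root)
  ultimately show ?thesis using p nz(2) unfolding rsquarefree_def by auto
qed

lemma rsquarefree_smult: "rsquarefree p \<Longrightarrow> c \<noteq> 0 \<Longrightarrow> rsquarefree (smult c p)"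
  by (auto simp: rsquarefree_def order_smult)

text \<open>With \<open>\<tau> = (s - 1)\<^sup>2 / s\<close> the roots are \<open>\<beta> s\<close> and \<open>\<beta> / s\<close>; on the circle \<open>node_factor \<beta> \<tau> / \<lambda>\<close> is
  \<open>2 + \<tau> - 2 Re (\<lambda> / \<beta>) > 0\<close>.\<close>

definition node_factor :: "complex \<Rightarrow> real \<Rightarrow> complex poly" where
  "node_factor \<beta> \<tau> = [:- \<beta>, 2 + of_real \<tau>, - cnj \<beta>:]"

lemma H_space_mult_node_factor:
  assumes a: "a \<in> H_space g" and \<beta>: "cmod \<beta> = 1" and s: "s > 1"
    and nz: "poly a (\<beta> * of_real s) \<noteq> 0" "poly a (\<beta> / of_real s) \<noteq> 0"
  shows "a * node_factor \<beta> ((s - 1)\<^sup>2 / s) \<in> H_space (g + 1)"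
proof -
  define \<tau> where "\<tau> = (s - 1)\<^sup>2 / s"
  have \<tau>: "\<tau> > 0" using s by (simp add: \<tau>_def)
  have \<beta>0: "\<beta> \<noteq> 0" "cnj \<beta> \<noteq> 0" "cnj \<beta> * \<beta> = 1" using \<beta> complex_norm_square[of \<beta>] by (auto simp: mult.commute)
  have a': "degree a = 2 * g" "poly_star (2 * g) a = a" "cmod (lead_coeff a) = 1" "rsquarefree a"
    and pos: "\<And>l. cmod l = 1 \<Longrightarrow> poly a l / l ^ g \<in> \<real> \<and> Re (poly a l / l ^ g) > 0"
    using a by (auto simp: H_space_def real_polys_iff)
  have a0: "a \<noteq> 0" using a' by auto
  have degn: "degree (node_factor \<beta> t) = 2" for t using \<beta>0 by (simp add: node_factor_def)
  have deg: "degree (a * node_factor \<beta> \<tau>) = 2 * (g + 1)"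
    using degn[of \<tau>] a0 a' by (subst degree_mult_eq) auto
  have starn: "poly_star 2 (node_factor \<beta> \<tau>) = node_factor \<beta> \<tau>"
    by (rule poly_eqI) (auto simp: coeff_poly_star node_factor_def coeff_pCons numeral_2_eq_2 diff_Suc split: nat.splits)
  have star: "poly_star (2 * (g + 1)) (a * node_factor \<beta> \<tau>) = a * node_factor \<beta> \<tau>"
    using poly_star_mult[of a "2 * g" "node_factor \<beta> \<tau>" 2] a' degn starn by simp
  have pos': "poly (a * node_factor \<beta> \<tau>) l / l ^ (g + 1) \<in> \<real> \<and> Re (poly (a * node_factor \<beta> \<tau>) l / l ^ (g + 1)) > 0"
    if l: "cmod l = 1" for l
  proof -
    have l0: "l \<noteq> 0" using l by auto
    have l1: "cnj l = 1 / l" using inverse_cnj_circle[OF l] l0 by (auto simp: divide_simps mult.commute)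
    have e: "poly (node_factor \<beta> \<tau>) l / l = of_real (2 + \<tau> - 2 * Re (cnj \<beta> * l))"
    proof -
      have "poly (node_factor \<beta> \<tau>) l / l = 2 + of_real \<tau> - (cnj \<beta> * l + cnj (cnj \<beta> * l))"
        using l0 l1 by (simp add: node_factor_def field_simps)
      then show ?thesis by (simp only: complex_add_cnj) simp
    qed
    have "Re (cnj \<beta> * l) \<le> cmod (cnj \<beta> * l)" by (rule complex_Re_le_cmod)
    then have "Re (cnj \<beta> * l) \<le> 1" using l \<beta> by (simp add: norm_mult)
    then have p: "2 + \<tau> - 2 * Re (cnj \<beta> * l) > 0" using \<tau> by simp
    obtain x where x: "poly a l / l ^ g = of_real x" "x > 0" using pos[OF l] by (metis Re_complex_of_real Reals_cases)
    have "poly (a * node_factor \<beta> \<tau>) l / l ^ (g + 1) = poly a l / l ^ g * (poly (node_factor \<beta> \<tau>) l / l)"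
      by simp
    also have "\<dots> = of_real (x * (2 + \<tau> - 2 * Re (cnj \<beta> * l)))" unfolding e x by (simp only: of_real_mult)
    finally have "poly (a * node_factor \<beta> \<tau>) l / l ^ (g + 1) = of_real (x * (2 + \<tau> - 2 * Re (cnj \<beta> * l)))" .
    moreover have "x * (2 + \<tau> - 2 * Re (cnj \<beta> * l)) > 0" using x(2) p by simp
    ultimately show ?thesis by (simp only: Reals_of_real Re_complex_of_real simp_thms)
  qed
  have lc: "cmod (lead_coeff (a * node_factor \<beta> \<tau>)) = 1"
  proof -
    have "lead_coeff (node_factor \<beta> \<tau>) = - cnj \<beta>" using degn[of \<tau>] by (simp add: node_factor_def numeral_2_eq_2)
    then show ?thesis using a'(3) \<beta> by (simp add: lead_coeff_mult norm_mult)
  qed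
  have sf: "rsquarefree (a * node_factor \<beta> \<tau>)"
  proof -
    have e: "a * node_factor \<beta> \<tau> = smult (- cnj \<beta>) (a * [:- (\<beta> * of_real s), 1:] * [:- (\<beta> / of_real s), 1:])"
    proof -
      define u v where uv: "u = \<beta> * of_real s" "v = \<beta> / of_real s"
      have "cnj \<beta> * (u * v) = (cnj \<beta> * \<beta>) * \<beta>" using s by (simp add: uv)
      moreover have "cnj \<beta> * (u + v) = (cnj \<beta> * \<beta>) * of_real (s + 1 / s)" by (simp add: uv algebra_simps)
      moreover have "2 + \<tau> = s + 1 / s" 
        using s unfolding \<tau>_def power2_diff diff_divide_distrib add_divide_distrib
        by (simp add: power2_eq_square)
      then have "2 + of_real \<tau> = complex_of_real (s + 1 / s)" by (metis of_real_add of_real_numeral)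
      ultimately have "cnj \<beta> * (u * v) = \<beta>" "cnj \<beta> * (u + v) = 2 + of_real \<tau>" by (simp_all only: \<beta>0 mult_1)
      moreover have "smult (- cnj \<beta>) ([:- u, 1:] * [:- v, 1:]) = [:- (cnj \<beta> * (u * v)), cnj \<beta> * (u + v), - cnj \<beta>:]"
        by (simp add: algebra_simps)
      ultimately have "node_factor \<beta> \<tau> = smult (- cnj \<beta>) ([:- u, 1:] * [:- v, 1:])"
        by (simp only: node_factor_def)
      then have "node_factor \<beta> \<tau> = smult (- cnj \<beta>) ([:- (\<beta> * of_real s), 1:] * [:- (\<beta> / of_real s), 1:])"
        by (simp only: uv)
      then show ?thesis by (simp del: mult_pCons_left mult_pCons_right add: mult.assoc)
    qed
    have "rsquarefree (a * [:- (\<beta> * of_real s), 1:] * [:- (\<beta> / of_real s), 1:])"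
    proof (intro rsquarefree_mult_linear a' nz)
      have "\<beta> / of_real s \<noteq> \<beta> * of_real s"
      proof
        assume *: "\<beta> / of_real s = \<beta> * of_real s"
        have "cmod (\<beta> / of_real s) = cmod (\<beta> * of_real s)" by (rule arg_cong[OF *])
        then have "1 = s * s" using s \<beta> by (simp add: norm_divide norm_mult divide_eq_eq)
        then show False using less_1_mult[OF s s] by simp
      qed
      then show "poly (a * [:- (\<beta> * of_real s), 1:]) (\<beta> / of_real s) \<noteq> 0"
        using nz(2) unfolding poly_mult by simp
    qed
    then show ?thesis unfolding e by (rule rsquarefree_smult) (use \<beta>0 in simp)
  qed
  show ?thesis unfolding \<tau>_def[symmetric] H_space_def real_polys_iff mem_Collect_eq
    by (intro conjI allI impI deg eq_refl[OF deg] star lc sf conjunct1[OF pos'] conjunct2[OF pos'])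
qed

text \<open>The number \<open>r\<close> is chosen so that the linear polynomial \<open>m\<close>
  below is fixed by the reflection of nominal degree 1 and its square is the limiting factor
  \<open>node_factor \<beta> 0\<close>. \<open>Y\<close> is a branch of the limit curve near the
  node, on a disc free of branch points.\<close>

locale node_opening =
  fixes g :: nat and a :: "complex poly" and \<beta> r :: complex and \<tau> :: "nat \<Rightarrow> real"
    and R :: real and Y :: "complex \<Rightarrow> complex"
  assumes a: "a \<in> H_space g" and \<beta>: "cmod \<beta> = 1" and r: "r\<^sup>2 = - cnj \<beta>"
    and \<tau>: "\<And>n. \<tau> n > 0" "\<tau> \<longlonglongrightarrow> 0"
    and A: "\<And>n. a * node_factor \<beta> (\<tau> n) \<in> H_space (g + 1)"
    and R: "R > 0" and Y: "Y holomorphic_on ball \<beta> R"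
    and Ysq: "\<And>z. z \<in> ball \<beta> R \<Longrightarrow> (Y z)\<^sup>2 = z * poly a z \<and> z * poly a z \<noteq> 0"
begin

abbreviation "A n \<equiv> a * node_factor \<beta> (\<tau> n)"

definition m :: "complex poly" where "m = [:- (r * \<beta>), r:]"
text \<open>The logarithmic derivative of the branch at \<beta>; its real part is the threshold
  subtracted in \<open>slope_excess\<close>.\<close>

definition \<kappa> :: complex where "\<kappa> = \<beta> * deriv Y \<beta> / Y \<beta>"

lemma \<beta>r: "\<beta> \<noteq> 0" "r \<noteq> 0" "cmod r = 1" "cnj \<beta> * \<beta> = 1" "\<beta> * r\<^sup>2 = - 1"
proof -
  show c: "cnj \<beta> * \<beta> = 1" using \<beta> complex_norm_square[of \<beta>] by (simp add: mult.commute)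
  then show "\<beta> * r\<^sup>2 = - 1" by (simp add: r mult.commute)
  have "(cmod r)\<^sup>2 = 1" using \<beta> arg_cong[OF r, of cmod] by (simp add: norm_power)
  then show "cmod r = 1" using power2_eq_imp_eq[of "cmod r" 1] by simp
  then show "r \<noteq> 0" by auto
  show "\<beta> \<noteq> 0" using \<beta> by auto
qed

lemma node_factor_eq: "poly (node_factor \<beta> t) z = r\<^sup>2 * ((z - \<beta>)\<^sup>2 - of_real t * (\<beta> * z))"
proof -
  have "poly (node_factor \<beta> t) z = - \<beta> + (2 + of_real t) * z - cnj \<beta> * z\<^sup>2"
    by (simp add: node_factor_def power2_eq_square algebra_simps)
  also have "\<dots> = - ((cnj \<beta> * \<beta>) * \<beta>) + (cnj \<beta> * \<beta>) * (2 + of_real t) * z - cnj \<beta> * z\<^sup>2" by (simp only: \<beta>r(4) mult_1)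
  also have "\<dots> = - cnj \<beta> * ((z - \<beta>)\<^sup>2 - of_real t * (\<beta> * z))" by (simp add: power2_eq_square algebra_simps)
  finally show ?thesis by (simp only: r)
qed

lemma Y0: "Y \<beta> \<noteq> 0" "(Y \<beta>)\<^sup>2 = \<beta> * poly a \<beta>"
  using Ysq[of \<beta>] R by auto

text \<open>The real part of the period around the two nearby roots vanishes. Expanding
  \<open>(1 - \<tau> \<beta> z / (z - \<beta>)\<^sup>2) powr (-1/2)\<close> to first order in \<open>\<tau>\<close> turns this into an asymptotic formula for \<open>b n\<close> at \<open>\<beta>\<close>.\<close>

lemma period_asymptotics:
  assumes pot: "\<And>n. potential (A n) (b n) (h n)" and conv: "poly_conv d b c"
  shows "(\<lambda>n. Im (poly (b n) \<beta> / (\<beta> * Y \<beta> * r)) / \<tau> n) \<longlonglongrightarrow>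
    Re (contour_integral (circlepath \<beta> (R / 2))
      (\<lambda>z. poly c z * (1 / (z * Y z * r * (z - \<beta>))) * (\<beta> * z / (z - \<beta>)\<^sup>2 / 2))) / (2 * pi)"
proof -
  define S where "S = sphere \<beta> (R / 2)"
  \<comment> \<open>On the circle, \<open>Y z * r * (z - \<beta>) * csqrt (1 - \<tau> v)\<close> is
    a branch of the opened curve. For \<tau> = 0 the kernel 1 / (z y) is \<open>k\<close>, and
    \<open>G\<close> is the difference quotient in \<tau> of the inverse of the last factor.\<close>
  define k where "k = (\<lambda>z. 1 / (z * Y z * r * (z - \<beta>)))"
  define v where "v = (\<lambda>z. \<beta> * z / (z - \<beta>)\<^sup>2)"
  define G where "G = (\<lambda>n z. (1 / csqrt (1 - of_real (\<tau> n) * v z) - 1) / of_real (\<tau> n))"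
  let ?c = "circlepath \<beta> (R / 2)"
  have SB: "S \<subseteq> ball \<beta> R" using R by (auto simp: S_def)
  have nz: "z \<noteq> 0" "Y z \<noteq> 0" "z - \<beta> \<noteq> 0" if "z \<in> S" for z
    using Ysq[of z] SB that R by (auto simp: S_def)
  have cY: "continuous_on S Y" using holomorphic_on_imp_continuous_on[OF Y] SB continuous_on_subset by blast
  have ck: "continuous_on S k" unfolding k_def using nz \<beta>r cY by (intro continuous_intros) auto
  have cv: "continuous_on S v" unfolding v_def using nz by (intro continuous_intros) auto
  have bdd: "bounded (f ` S)" if "continuous_on S f" for f :: "complex \<Rightarrow> complex"
    using that compact_continuous_image compact_imp_bounded by (metis S_def compact_sphere)
  obtain V where V: "V > 0" "\<And>z. z \<in> S \<Longrightarrow> cmod (v z) \<le> V"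
    using bdd[OF cv] by (auto simp: bounded_pos)
  have path: "path_image ?c = S" using R by (simp add: S_def)
  have "(\<lambda>n. \<tau> n * V) \<longlonglongrightarrow> 0" using tendsto_mult_left_zero[OF \<tau>(2)] .
  then have small: "\<forall>\<^sub>F n in sequentially. \<tau> n * V < 1 / 2" by (rule order_tendstoD) simp
  have sm: "cmod (of_real (\<tau> n) * v z) \<le> \<tau> n * V" if "z \<in> S" for n z
    using V(2)[OF that] \<tau>(1)[of n] by (simp add: norm_mult)
  have UG: "uniform_limit S G (\<lambda>z. v z / 2) sequentially"
  proof (rule uniform_limitI)
    fix \<epsilon> :: real assume \<epsilon>: "\<epsilon> > 0"
    have "(\<lambda>n. \<tau> n * (4 * V\<^sup>2)) \<longlonglongrightarrow> 0" using tendsto_mult_left_zero[OF \<tau>(2)] .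
    then have "\<forall>\<^sub>F n in sequentially. \<tau> n * (4 * V\<^sup>2) < \<epsilon>" by (rule order_tendstoD) (rule \<epsilon>)
    with small show "\<forall>\<^sub>F n in sequentially. \<forall>z\<in>S. dist (G n z) (v z / 2) < \<epsilon>"
    proof eventually_elim
      case (elim n)
      show ?case
      proof
        fix z assume z: "z \<in> S"
        let ?w = "of_real (\<tau> n) * v z"
        have w: "cmod ?w \<le> \<tau> n * V" by (rule sm[OF z])
        then have "cmod ?w \<le> 1 / 2" using elim(1) by linarith
        then have "cmod (1 / csqrt (1 - ?w) - 1 - ?w / 2) \<le> 4 * (cmod ?w)\<^sup>2" by (rule inverse_csqrt_approx)
        also have "\<dots> \<le> 4 * (\<tau> n * V)\<^sup>2" using w by (intro mult_left_mono power_mono) auto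
        finally have 1: "cmod (1 / csqrt (1 - ?w) - 1 - ?w / 2) \<le> 4 * (\<tau> n * V)\<^sup>2" .
        have \<tau>0: "complex_of_real (\<tau> n) \<noteq> 0" using \<tau>(1)[of n] by simp
        have "G n z - v z / 2 = (1 / csqrt (1 - ?w) - 1 - ?w / 2) / of_real (\<tau> n)"
          using \<tau>0 unfolding G_def diff_divide_distrib by simp
        then have "dist (G n z) (v z / 2) = cmod (1 / csqrt (1 - ?w) - 1 - ?w / 2) / \<tau> n"
          using \<tau>(1)[of n] by (simp only: dist_norm norm_divide norm_of_real abs_of_pos)
        also have "\<dots> \<le> 4 * (\<tau> n * V)\<^sup>2 / \<tau> n" using 1 \<tau>(1)[of n] by (intro divide_right_mono) auto
        also have "\<dots> = \<tau> n * (4 * V\<^sup>2)" using \<tau>(1)[of n] by (simp add: power2_eq_square)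
        finally show "dist (G n z) (v z / 2) < \<epsilon>" using elim(2) by simp
      qed
    qed
  qed
  have Ub: "uniform_limit S (\<lambda>n z. poly (b n) z) (\<lambda>z. poly c z) sequentially"
    by (rule uniform_limitI) (use poly_conv_uniform[OF conv, of S] in \<open>simp add: S_def dist_norm\<close>)
  have U: "uniform_limit S (\<lambda>n z. poly (b n) z * k z * G n z) (\<lambda>z. poly c z * k z * (v z / 2)) sequentially"
    using nz by (intro uniform_lim_mult Ub UG uniform_limit_const bdd continuous_intros ck cv) auto
  have ev: "\<forall>\<^sub>F n in sequentially.
      (\<lambda>z. poly (b n) z * k z * G n z) contour_integrable_on ?c \<and>
      Re (contour_integral ?c (\<lambda>z. poly (b n) z * k z * G n z)) / (2 * pi) = Im (poly (b n) \<beta> / (\<beta> * Y \<beta> * r)) / \<tau> n"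
    using small
  proof eventually_elim
    case (elim n)
    define y where "y = (\<lambda>z. Y z * r * (z - \<beta>) * csqrt (1 - of_real (\<tau> n) * v z))"
    define x where "x = contour_integral ?c (\<lambda>z. poly (b n) z / (z * y z))"
    have w: "Re (1 - of_real (\<tau> n) * v z) > 0" if "z \<in> S" for z
      using sm[OF that, of n] elim complex_Re_le_cmod[of "of_real (\<tau> n) * v z"] by simp
    have csq: "csqrt (1 - of_real (\<tau> n) * v z) \<noteq> 0" if "z \<in> S" for z
      using w[OF that] by (metis csqrt_eq_0 less_irrefl zero_complex.sel(1))
    have "continuous_on S (\<lambda>z. csqrt (1 - of_real (\<tau> n) * v z))"
      by (rule continuous_on_compose2[OF continuous_on_csqrt])
        (intro continuous_intros cv, use w in \<open>force simp: complex_nonpos_Reals_iff\<close>)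
    then have cy: "continuous_on S y" unfolding y_def by (intro continuous_intros cY) 
    have y2: "(y z)\<^sup>2 = z * poly (A n) z \<and> y z \<noteq> 0" if z: "z \<in> S" for z
    proof
      have "(y z)\<^sup>2 = (Y z)\<^sup>2 * (r\<^sup>2 * ((z - \<beta>)\<^sup>2 * (1 - of_real (\<tau> n) * v z)))"
        by (simp only: y_def power_mult_distrib power2_csqrt mult.assoc)
      also have "(z - \<beta>)\<^sup>2 * (1 - of_real (\<tau> n) * v z) = (z - \<beta>)\<^sup>2 - of_real (\<tau> n) * (\<beta> * z)"
        using nz(3)[OF z] by (simp add: v_def right_diff_distrib)
      also have "r\<^sup>2 * \<dots> = poly (node_factor \<beta> (\<tau> n)) z" by (rule node_factor_eq[symmetric])
      also have "(Y z)\<^sup>2 = z * poly a z" using Ysq SB z by blast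
      finally show "(y z)\<^sup>2 = z * poly (A n) z" by (simp only: poly_mult mult.assoc)
      show "y z \<noteq> 0" using nz[OF z] csq[OF z] \<beta>r by (simp add: y_def)
    qed
    note cbi = closed_branch_integral[OF pot[of n], of "R / 2" \<beta> y, folded S_def]
    have int: "((\<lambda>z. poly (b n) z / (z * y z)) has_contour_integral x) ?c" and x: "Re x = 0"
      using cbi y2 cy R unfolding x_def by (auto intro: has_contour_integral_integral)
    have "(\<lambda>z. poly (b n) z / (z * Y z * r)) holomorphic_on ball \<beta> R"
      using Ysq \<beta>r by (intro holomorphic_intros Y) force
    then have "(\<lambda>z. poly (b n) z / (z * Y z * r)) holomorphic_on cball \<beta> (R / 2)"
      by (rule holomorphic_on_subset) (use R in auto)
    \<comment> \<open>The term of order zero is a residue at \<beta>. Since the period has real part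
      0, subtracting the residue and dividing by \<tau> leaves just the imaginary part of the
      normalised value of \<open>b n\<close>.\<close>
    from Cauchy_integral_circlepath_simple[OF this, of \<beta>]
    have int': "((\<lambda>z. poly (b n) z / (z * Y z * r) / (z - \<beta>)) has_contour_integral
        2 * of_real pi * \<i> * (poly (b n) \<beta> / (\<beta> * Y \<beta> * r))) ?c" using R by simp
    have int3: "((\<lambda>z. poly (b n) z * k z * G n z) has_contour_integral
        (x - 2 * of_real pi * \<i> * (poly (b n) \<beta> / (\<beta> * Y \<beta> * r))) / of_real (\<tau> n)) ?c"
    proof (rule has_contour_integral_eq[OF has_contour_integral_div[OF has_contour_integral_diff[OF int int']]])
      fix z assume "z \<in> path_image ?c"
      then have z: "z \<in> S" by (simp only: path)
      have "poly (b n) z / (z * y z) = poly (b n) z * k z * (1 / csqrt (1 - of_real (\<tau> n) * v z))"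
        by (simp add: y_def k_def)
      moreover have "poly (b n) z / (z * Y z * r) / (z - \<beta>) = poly (b n) z * k z" by (simp add: k_def)
      ultimately show "(poly (b n) z / (z * y z) - poly (b n) z / (z * Y z * r) / (z - \<beta>)) / of_real (\<tau> n) =
          poly (b n) z * k z * G n z"
        by (simp only: G_def right_diff_distrib diff_divide_distrib times_divide_eq_right mult_1_right)
    qed
    have Re_eq: "Re ((x - 2 * of_real pi * \<i> * w) / of_real (\<tau> n)) / (2 * pi) = Im w / \<tau> n" for w
      by (simp add: x)
    show ?case unfolding contour_integral_unique[OF int3]
      by (rule conjI[OF has_contour_integral_integrable[OF int3] Re_eq])
  qed
  have "((\<lambda>n. contour_integral ?c (\<lambda>z. poly (b n) z * k z * G n z)) \<longlonglongrightarrow>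
      contour_integral ?c (\<lambda>z. poly c z * k z * (v z / 2)))"
    by (rule contour_integral_uniform_limit_circlepath[OF _ U[unfolded S_def]])
      (use ev R in \<open>auto elim: eventually_mono\<close>)
  then have "(\<lambda>n. Re (contour_integral ?c (\<lambda>z. poly (b n) z * k z * G n z)) / (2 * pi)) \<longlonglongrightarrow>
      Re (contour_integral ?c (\<lambda>z. poly c z * k z * (v z / 2))) / (2 * pi)"
    by (intro tendsto_intros) auto
  then have "(\<lambda>n. Im (poly (b n) \<beta> / (\<beta> * Y \<beta> * r)) / \<tau> n) \<longlonglongrightarrow>
      Re (contour_integral ?c (\<lambda>z. poly c z * k z * (v z / 2))) / (2 * pi)"
    by (rule Lim_transform_eventually) (use ev in \<open>auto elim: eventually_mono\<close>)
  then show ?thesis by (simp only: k_def v_def)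
qed

lemma a_circle: obtains t where "t > 0" "poly a \<beta> = of_real t * \<beta> ^ g"
  using H_space_props(4)[OF a \<beta>] by blast

text \<open>\<open>poly b \<beta> / (\<beta> Y(\<beta>) r)\<close> has a nonpositive square.\<close>

lemma Re_value_zero:
  assumes b: "b \<in> real_polys (g + 2)"
  shows "Re (poly b \<beta> / (\<beta> * Y \<beta> * r)) = 0"
proof -
  obtain t where t: "t > 0" "poly a \<beta> = of_real t * \<beta> ^ g" by (rule a_circle)
  show ?thesis
  proof (rule Re_quotient_zero[OF _ _ t(1)])
    show "poly b \<beta> = - (- (\<beta> ^ (g + 2))) * cnj (poly b \<beta>)" using poly_real_circle[OF b \<beta>] by simp
    have "(\<beta> * Y \<beta> * r)\<^sup>2 = \<beta>\<^sup>2 * (\<beta> * poly a \<beta>) * r\<^sup>2" by (simp only: power_mult_distrib Y0)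
    also have "\<dots> = (\<beta> * r\<^sup>2) * (\<beta>\<^sup>2 * poly a \<beta>)" by (simp add: ac_simps)
    also have "\<dots> = of_real t * - (\<beta> ^ (g + 2))" unfolding \<beta>r t by (simp add: power_add power2_eq_square)
    finally show "(\<beta> * Y \<beta> * r)\<^sup>2 = of_real t * - (\<beta> ^ (g + 2))" .
  qed (use \<beta>r in simp)
qed

lemma poly_m: "poly m z = r * (z - \<beta>)"
  by (simp add: m_def algebra_simps)

lemma m_real: "poly_star 1 m = m" "degree m \<le> 1" "m \<noteq> 0"
proof -
  have "r * cnj r = 1" using \<beta>r(3) complex_norm_square[of r] by simp
  then have "cnj r = cnj r * (- (\<beta> * r\<^sup>2))" unfolding \<beta>r(5) by simp
  also have "\<dots> = - (r * \<beta>) * (r * cnj r)" by (simp add: power2_eq_square)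
  finally have c: "cnj r = - (r * \<beta>)" unfolding \<open>r * cnj r = 1\<close> by simp
  then have "- cnj (r * \<beta>) = r" by (metis complex_cnj_cnj complex_cnj_minus)
  with c show "poly_star 1 m = m"
    by (intro poly_eqI) (auto simp: coeff_poly_star m_def coeff_pCons split: nat.splits)
qed (use \<beta>r in \<open>simp_all add: m_def\<close>)

lemma A_conv: "poly_conv (2 * g + 2) A (a * m\<^sup>2)"
proof -
  have m2: "m\<^sup>2 = node_factor \<beta> 0"
    unfolding poly_eq_poly_eq_iff[symmetric] fun_eq_iff node_factor_eq poly_power poly_m by (simp add: power_mult_distrib)
  have deg: "degree (a * node_factor \<beta> t) \<le> 2 * g + 2" for t
  proof -
    have "degree (node_factor \<beta> t) \<le> 2" by (simp add: node_factor_def)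
    then show ?thesis using degree_mult_le[of a "node_factor \<beta> t"] H_space_props(3)[OF a] by linarith
  qed
  have c: "(\<lambda>n. coeff (node_factor \<beta> (\<tau> n)) i) \<longlonglongrightarrow> coeff (node_factor \<beta> 0) i" for i
  proof -
    have "(\<lambda>n. 2 + complex_of_real (\<tau> n)) \<longlonglongrightarrow> 2 + of_real 0" by (intro tendsto_intros \<tau>)
    then show ?thesis by (auto simp: node_factor_def coeff_pCons split: nat.splits)
  qed
  show ?thesis unfolding poly_conv_def m2 coeff_mult using deg by (auto intro!: tendsto_intros c)
qed

text \<open>The criterion \<open>poly_conv_if_scaled_limits\<close> passes to subsequences, along
  which the period asymptotics must be available again.\<close>

lemma subsequence: "strict_mono s \<Longrightarrow> node_opening g a \<beta> r (\<lambda>n. \<tau> (s n)) R Y"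
  using a \<beta> r \<tau>(1) LIMSEQ_subseq_LIMSEQ[OF \<tau>(2)] A R Y Ysq by unfold_locales (auto simp: o_def)

text \<open>A limit \<open>p\<close> of rescaled polynomials vanishes at \<beta>: its normalised
  value there has real part 0 by symmetry, and imaginary part 0 as the limit of a quantity of order
  \<tau>. So \<open>p = m B\<close>, where \<open>B\<close> is real and has a potential for
  \<open>a\<close> by \<open>potential_limit\<close>; its value at 0 then determines it.\<close>

lemma b_limit: "poly_conv (g + 2) (\<lambda>n. b_at (g + 1) (A n) c) (m * b_at g a (c * r))"
proof (rule poly_conv_if_scaled_limits)
  show "degree (b_at (g + 1) (A n) c) \<le> g + 2" for n
    using b_at_props(1)[OF A] by (simp add: real_polys_def)
  have "degree (b_at g a (c * r)) \<le> g + 1" using b_at_props(1)[OF a] by (simp add: real_polys_def)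
  then show "degree (m * b_at g a (c * r)) \<le> g + 2"
    using degree_mult_le[of m "b_at g a (c * r)"] m_real(2) by linarith
  fix s t t0 p
  assume s: "strict_mono (s :: nat \<Rightarrow> nat)" and t: "t \<longlonglongrightarrow> t0"
    and conv: "poly_conv (g + 2) (\<lambda>n. smult (complex_of_real (t n)) (b_at (g + 1) (A (s n)) c)) p"
  define b where "b = (\<lambda>n. smult (complex_of_real (t n)) (b_at (g + 1) (A (s n)) c))"
  have conv: "poly_conv (g + 2) b p" using conv by (simp only: b_def)
  interpret sub: node_opening g a \<beta> r "\<lambda>n. \<tau> (s n)" R Y by (rule subsequence[OF s])
  have "\<forall>n. \<exists>h. potential (A (s n)) (b_at (g + 1) (A (s n)) c) h" using b_at_props(2)[OF A] by blast
  then obtain h where h: "\<And>n. potential (A (s n)) (b_at (g + 1) (A (s n)) c) (h n)" by metis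
  have pot: "potential (A (s n)) (b n) (\<lambda>l y. t n * h n l y)" for n
    unfolding b_def by (rule potential_scale[OF h])
  have breal: "b n \<in> real_polys (g + 2)" for n
    unfolding b_def using b_at_props(1)[OF A[of "s n"], of c] by (intro real_polys_scale) simp
  have p\<beta>: "poly p \<beta> = 0"
  proof -
    define w where "w = (\<lambda>n. poly (b n) \<beta> / (\<beta> * Y \<beta> * r))"
    have w: "w \<longlonglongrightarrow> poly p \<beta> / (\<beta> * Y \<beta> * r)"
      unfolding w_def using \<beta>r Y0 by (intro tendsto_divide poly_conv_poly[OF conv] tendsto_const) auto
    obtain L where "(\<lambda>n. Im (w n) / \<tau> (s n)) \<longlonglongrightarrow> L"
      unfolding w_def using sub.period_asymptotics[OF pot conv] by blast
    from tendsto_mult[OF this sub.\<tau>(2)]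
    have "(\<lambda>n. Im (w n) / \<tau> (s n) * \<tau> (s n)) \<longlonglongrightarrow> 0" by simp
    then have "(\<lambda>n. Im (w n)) \<longlonglongrightarrow> 0" using \<tau>(1)[of "s _"] by (simp add: less_imp_neq[symmetric])
    then have "Im (poly p \<beta> / (\<beta> * Y \<beta> * r)) = 0" using tendsto_Im[OF w] LIMSEQ_unique by blast
    moreover have "(\<lambda>n. Re (w n)) \<longlonglongrightarrow> 0" by (simp only: w_def Re_value_zero[OF breal] tendsto_const)
    then have "Re (poly p \<beta> / (\<beta> * Y \<beta> * r)) = 0" using tendsto_Re[OF w] LIMSEQ_unique by blast
    ultimately have "poly p \<beta> / (\<beta> * Y \<beta> * r) = 0" by (simp only: complex_eq_iff zero_complex.sel)
    then show ?thesis using \<beta>r Y0 by simp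
  qed
  then obtain p1 where "p = [:- \<beta>, 1:] * p1" by (auto simp: poly_eq_0_iff_dvd)
  moreover have "m * smult (1 / r) p1 = [:- \<beta>, 1:] * p1"
  proof -
    have "m = smult r [:- \<beta>, 1:]" by (simp add: m_def)
    then show ?thesis using \<beta>r(2) by (simp only: mult_smult_left mult_smult_right smult_smult) simp
  qed
  ultimately have "p = m * smult (1 / r) p1" by (rule trans[OF _ sym])
  then obtain B where B: "p = m * B" by blast
  have preal: "p \<in> real_polys (g + 2)" by (rule real_polys_limit[OF conv breal])
  have degB: "degree B \<le> g + 1"
  proof (cases "B = 0")
    case False
    then have "degree p = degree m + degree B" unfolding B using m_real by (intro degree_mult_eq)
    moreover have "degree m = 1" using \<beta>r by (simp add: m_def)
    ultimately show ?thesis using preal by (simp add: real_polys_def)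
  qed simp
  have "m * poly_star (g + 1) B = poly_star (1 + (g + 1)) (m * B)"
    using poly_star_mult[OF m_real(2) degB] m_real(1) by simp
  also have "1 + (g + 1) = g + 2" by simp
  also have "poly_star (g + 2) (m * B) = m * B" using preal unfolding B real_polys_iff by blast
  finally have "poly_star (g + 1) B = B" using m_real(3) by simp
  then have Breal: "B \<in> real_polys (g + 1)" using degB by (simp add: real_polys_iff)
  have "\<exists>k. potential a B k"
  proof (rule potential_limit[OF H_space_props(1)[OF a], where m = m])
    show "poly m x \<noteq> 0" if "x * poly a x = 0" for x
      using that H_space_props(5)[OF a \<beta>] \<beta>r by (auto simp: poly_m)
    show "poly_conv (2 * g + 2) (\<lambda>n. A (s n)) (a * m\<^sup>2)" by (rule poly_conv_subseq[OF A_conv s])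
    show "poly_conv (g + 2) b (m * B)" using conv B by simp
    show "potential (A (s n)) (b n) (\<lambda>l y. t n * h n l y)" for n by (rule pot)
  qed
  then obtain k where k: "potential a B k" by blast
  have "(\<lambda>n. poly (b n) 0) \<longlonglongrightarrow> poly p 0" by (rule poly_conv_poly[OF conv tendsto_const])
  then have "(\<lambda>n. of_real (t n) * c) \<longlonglongrightarrow> poly p 0" by (simp only: b_def poly_smult b_at_props(3)[OF A])
  moreover have "(\<lambda>n. of_real (t n) * c) \<longlonglongrightarrow> of_real t0 * c" by (intro tendsto_intros t)
  ultimately have "poly p 0 = of_real t0 * c" by (rule LIMSEQ_unique)
  \<comment> \<open>Here \<open>m\<close> has the value \<open>- \<beta> r\<close> at 0. Since
    \<beta> r^2 = -1, multiplying by \<open>r\<close> isolates \<open>poly B 0\<close>, which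
    explains the argument \<open>c * r\<close>.\<close>
  then have "- (\<beta> * r) * poly B 0 = of_real t0 * c" by (simp add: B poly_m mult.commute)
  then have "r * (- (\<beta> * r) * poly B 0) = r * (of_real t0 * c)" by simp
  also have "r * (- (\<beta> * r) * poly B 0) = - (\<beta> * r\<^sup>2) * poly B 0" by (simp add: power2_eq_square)
  finally have "poly B 0 = of_real t0 * (c * r)" unfolding \<beta>r(5) by simp
  with b_at_props(4)[OF a Breal k] have "B = smult (of_real t0) (b_at g a (c * r))"
    by (simp only: b_at_scale[OF a])
  then show "p = smult (of_real t0) (m * b_at g a (c * r))" by (simp add: B)
qed

lemma \<kappa>_eq: "\<kappa> = (1 + \<beta> * poly (pderiv a) \<beta> / poly a \<beta>) / 2"
proof -
  have Y': "(Y has_field_derivative deriv Y \<beta>) (at \<beta>)"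
    using holomorphic_derivI[OF Y open_ball] R by simp
  have "((\<lambda>z. (Y z)\<^sup>2) has_field_derivative (poly a \<beta> + \<beta> * poly (pderiv a) \<beta>)) (at \<beta>)"
    by (rule has_field_derivative_transform_within_open[of "\<lambda>z. z * poly a z" _ _ "ball \<beta> R"])
      (use Ysq R in \<open>auto intro!: derivative_eq_intros poly_DERIV\<close>)
  moreover have "((\<lambda>z. (Y z)\<^sup>2) has_field_derivative (2 * Y \<beta> * deriv Y \<beta>)) (at \<beta>)"
    by (rule derivative_eq_intros Y' refl)+ simp
  ultimately have "2 * Y \<beta> * deriv Y \<beta> = poly a \<beta> + \<beta> * poly (pderiv a) \<beta>" by (rule DERIV_unique[rotated])
  moreover have "\<kappa> = \<beta> * (2 * Y \<beta> * deriv Y \<beta>) / (2 * (Y \<beta>)\<^sup>2)" using Y0(1) by (simp add: \<kappa>_def power2_eq_square)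
  ultimately have "\<kappa> = \<beta> * (poly a \<beta> + \<beta> * poly (pderiv a) \<beta>) / (2 * (\<beta> * poly a \<beta>))" by (simp only: Y0)
  then have "\<kappa> = (poly a \<beta> + \<beta> * poly (pderiv a) \<beta>) / (2 * poly a \<beta>)" using \<beta>r(1) by simp
  then show ?thesis using H_space_props(5)[OF a \<beta>] by (simp add: add_divide_distrib)
qed

lemma Re_\<kappa>: "Re \<kappa> = (g + 1) / 2"
  using log_derivative_circle[OF a \<beta>] by (simp add: \<kappa>_eq)

text \<open>From \<open>Re_\<kappa>\<close> the conjugate of \<kappa> is g + 1 - \<kappa>. Together
  with the reflection formulas for \<open>B\<close> and its derivative this makes the numerator
  equal to -\<beta>^(g+1) times its conjugate.\<close>

lemma Re_slope_zero:
  assumes B: "B \<in> real_polys (g + 1)"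
  shows "Re ((\<beta> * poly (pderiv B) \<beta> - poly B \<beta> * \<kappa>) / Y \<beta>) = 0"
proof -
  define x where "x = \<beta> * poly (pderiv B) \<beta>"
  obtain t where t: "t > 0" "poly a \<beta> = of_real t * \<beta> ^ g" by (rule a_circle)
  have \<kappa>: "cnj \<kappa> = of_nat (g + 1) - \<kappa>" using Re_\<kappa> by (simp add: complex_eq_iff)
  have "\<beta> ^ (g + 1) * cnj (x - poly B \<beta> * \<kappa>) = \<beta> ^ (g + 1) * cnj x - (\<beta> ^ (g + 1) * cnj (poly B \<beta>)) * cnj \<kappa>"
    by (simp add: algebra_simps)
  also have "\<dots> = (of_nat (g + 1) * poly B \<beta> - x) - poly B \<beta> * (of_nat (g + 1) - \<kappa>)"
    unfolding x_def real_poly_derivative_circle[OF B \<beta>] by (simp only: \<kappa> flip: poly_real_circle[OF B \<beta>])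
  also have "\<dots> = - (x - poly B \<beta> * \<kappa>)" by (simp add: algebra_simps)
  finally have "x - poly B \<beta> * \<kappa> = - (\<beta> ^ (g + 1)) * cnj (x - poly B \<beta> * \<kappa>)" by simp
  moreover have "(Y \<beta>)\<^sup>2 = of_real t * \<beta> ^ (g + 1)" unfolding Y0 t by simp
  ultimately show ?thesis unfolding x_def by (rule Re_quotient_zero[OF _ _ t(1)]) (use \<beta>r in simp)
qed

text \<open>With the limit \<open>m B\<close> inserted into \<open>period_asymptotics\<close>, the
  integrand is (\<beta> / 2) (B / Y) / (z - \<beta>)^2, and Cauchy's formula yields the derivative
  of B / Y at \<beta>. The normalised values and the slope divided by Y(\<beta>) are purely
  imaginary, so the limit of the imaginary parts determines the complex limit.\<close>

lemma b_rate:
  assumes "B = b_at g a (c * r)"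
  shows "(\<lambda>n. poly (b_at (g + 1) (A n) c) \<beta> / of_real (\<tau> n)) \<longlonglongrightarrow>
    - (\<beta> * r / 2) * (\<beta> * poly (pderiv B) \<beta> - poly B \<beta> * \<kappa>)"
proof -
  define X where "X = \<beta> * poly (pderiv B) \<beta> - poly B \<beta> * \<kappa>"
  define w where "w = (\<lambda>n. poly (b_at (g + 1) (A n) c) \<beta> / (\<beta> * Y \<beta> * r))"
  let ?c = "circlepath \<beta> (R / 2)"
  have "\<forall>n. \<exists>h. potential (A n) (b_at (g + 1) (A n) c) h" using b_at_props(2)[OF A] by blast
  then obtain h where h: "\<And>n. potential (A n) (b_at (g + 1) (A n) c) (h n)" by metis
  have lim: "(\<lambda>n. Im (w n) / \<tau> n) \<longlonglongrightarrow> Re (contour_integral ?c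
      (\<lambda>z. poly (m * B) z * (1 / (z * Y z * r * (z - \<beta>))) * (\<beta> * z / (z - \<beta>)\<^sup>2 / 2))) / (2 * pi)"
    unfolding w_def by (rule period_asymptotics[OF h b_limit[of c, folded assms]])
  have Y': "(Y has_field_derivative deriv Y \<beta>) (at \<beta>)"
    using holomorphic_derivI[OF Y open_ball] R by simp
  have "((\<lambda>z. poly B z / Y z) has_field_derivative X / (\<beta> * Y \<beta>)) (at \<beta>)"
    using Y0 \<beta>r by (auto intro!: derivative_eq_intros poly_DERIV Y' simp: X_def \<kappa>_def field_simps)
  then have D: "deriv (\<lambda>z. poly B z / Y z) \<beta> = X / (\<beta> * Y \<beta>)" by (rule DERIV_imp_deriv)
  have hol: "(\<lambda>z. poly B z / Y z) holomorphic_on ball \<beta> R"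
    using Ysq by (intro holomorphic_intros Y) force
  have "continuous_on (cball \<beta> (R / 2)) (\<lambda>z. poly B z / Y z)"
    using R by (intro continuous_on_subset[OF holomorphic_on_imp_continuous_on[OF hol]]) auto
  moreover have "(\<lambda>z. poly B z / Y z) holomorphic_on ball \<beta> (R / 2)"
    using R by (intro holomorphic_on_subset[OF hol]) auto
  ultimately have "((\<lambda>z. poly B z / Y z / (z - \<beta>) ^ Suc 1) has_contour_integral 2 * of_real pi * \<i> * (X / (\<beta> * Y \<beta>))) ?c"
    using Cauchy_has_contour_integral_higher_derivative_circlepath
      [where z = \<beta> and r = "R / 2" and f = "\<lambda>z. poly B z / Y z" and w = \<beta> and k = 1] R
    by (simp add: D)
  from has_contour_integral_lmul[OF this, of "\<beta> / 2"]
  have "((\<lambda>z. poly (m * B) z * (1 / (z * Y z * r * (z - \<beta>))) * (\<beta> * z / (z - \<beta>)\<^sup>2 / 2)) has_contour_integral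
      \<beta> / 2 * (2 * of_real pi * \<i> * (X / (\<beta> * Y \<beta>)))) ?c"
  proof (rule has_contour_integral_eq)
    fix z assume "z \<in> path_image ?c"
    then have z: "z \<in> sphere \<beta> (R / 2)" using R by simp
    then have "z \<noteq> 0" "z - \<beta> \<noteq> 0" using Ysq[of z] R by auto
    then show "\<beta> / 2 * (poly B z / Y z / (z - \<beta>) ^ Suc 1) =
        poly (m * B) z * (1 / (z * Y z * r * (z - \<beta>))) * (\<beta> * z / (z - \<beta>)\<^sup>2 / 2)"
      using \<beta>r(2) by (simp add: poly_m power2_eq_square ac_simps)
  qed
  from contour_integral_unique[OF this]
  have "contour_integral ?c
      (\<lambda>z. poly (m * B) z * (1 / (z * Y z * r * (z - \<beta>))) * (\<beta> * z / (z - \<beta>)\<^sup>2 / 2)) = of_real pi * (\<i> * (X / Y \<beta>))"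
    using \<beta>r(1) by simp
  with lim have "(\<lambda>n. Im (w n) / \<tau> n) \<longlonglongrightarrow> Re (of_real pi * (\<i> * (X / Y \<beta>))) / (2 * pi)" by (simp only:)
  moreover have "Re (of_real pi * (\<i> * u)) / (2 * pi) = - Im u / 2" for u by simp
  ultimately have lim: "(\<lambda>n. Im (w n) / \<tau> n) \<longlonglongrightarrow> - Im (X / Y \<beta>) / 2" by (simp only:)
  have "B \<in> real_polys (g + 1)" using assms b_at_props(1)[OF a] by simp
  from Re_slope_zero[OF this] have X: "X / Y \<beta> = \<i> * of_real (Im (X / Y \<beta>))"
    by (simp add: X_def complex_eq_iff)
  have "Re (w n) = 0" for n
    unfolding w_def using b_at_props(1)[OF A[of n], of c] by (intro Re_value_zero) simp
  then have w: "w n = \<i> * of_real (Im (w n))" for n by (simp add: complex_eq_iff)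
  have "(\<lambda>n. \<beta> * Y \<beta> * r * (\<i> * of_real (Im (w n) / \<tau> n))) \<longlonglongrightarrow> \<beta> * Y \<beta> * r * (\<i> * of_real (- Im (X / Y \<beta>) / 2))"
    by (intro tendsto_intros lim)
  moreover have "\<beta> * Y \<beta> * r * (\<i> * of_real (Im (w n) / \<tau> n)) = poly (b_at (g + 1) (A n) c) \<beta> / of_real (\<tau> n)" for n
  proof -
    have "\<i> * of_real (Im (w n) / \<tau> n) = w n / of_real (\<tau> n)" by (subst w) simp
    then show ?thesis unfolding w_def using \<beta>r Y0 by simp
  qed
  moreover have "\<beta> * Y \<beta> * r * (\<i> * of_real (- Im (X / Y \<beta>) / 2)) = - (\<beta> * r / 2) * X"
  proof -
    have "\<i> * of_real (- Im (X / Y \<beta>) / 2) = - (X / Y \<beta>) / 2" by (subst (2) X) simp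
    then show ?thesis using Y0 by simp
  qed
  ultimately show ?thesis by (simp only: X_def)
qed

end

section \<open>Position of the new root and the induction on the genus\<close>

lemma b_at_add:
  assumes "a \<in> H_space g"
  shows "b_at g a (c + d) = b_at g a c + b_at g a d"
proof -
  obtain h k where "potential a (b_at g a c) h" "potential a (b_at g a d) k" using b_at_props(2)[OF assms] by blast
  then have pot: "potential a (b_at g a c + b_at g a d) (\<lambda>l y. h l y + k l y)" by (rule potential_add)
  have "b_at g a c + b_at g a d \<in> real_polys (g + 1)"
    using b_at_props(1)[OF assms] by (auto simp: real_polys_iff poly_star_add intro: degree_add_le)
  from b_at_props(4)[OF assms this pot] show ?thesis by (simp add: b_at_props(3)[OF assms])
qed

text \<open>\<open>b_at\<close> is only real-linear in its value at 0, but the combination defining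
  \<open>qpoly\<close> is complex-linear, so a rotation of the initial values comes out as a
  factor.\<close>

lemma b_at_rotate:
  assumes "a \<in> H_space g"
  shows "b_at g a (1 * r) - smult \<i> (b_at g a (\<i> * r)) = smult r (qpoly g a)"
proof -
  have r: "1 * r = of_real (Re r) * 1 + of_real (Im r) * \<i>" "\<i> * r = of_real (- Im r) * 1 + of_real (Re r) * \<i>"
    by (simp_all add: complex_eq_iff)
  have r': "smult r p = smult (of_real (Re r)) p + smult (of_real (Im r) * \<i>) p" for p
    by (metis complex_eq mult.commute smult_add_left)
  show ?thesis unfolding r b_at_add[OF assms] b_at_scale[OF assms] r'
    by (rule poly_eqI) (simp add: qpoly_def complex_eq_iff algebra_simps)
qed

text \<open>The new zero of \<open>q\<close> satisfies \<open>|\<nu>|\<^sup>2 = 1 + slope_excess g a \<beta> \<tau> + o(\<tau>)\<close>.\<close>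

definition slope_excess :: "nat \<Rightarrow> complex poly \<Rightarrow> complex \<Rightarrow> real" where
  "slope_excess g a l = Re (l * poly (pderiv (qpoly g a)) l / poly (qpoly g a) l) - (g + 1) / 2"

context node_opening
begin

lemma q_limit: "poly_conv (g + 2) (\<lambda>n. qpoly (g + 1) (A n)) (smult (r\<^sup>2) ([:- \<beta>, 1:] * qpoly g a))"
proof -
  have "m * b_at g a (1 * r) - smult \<i> (m * b_at g a (\<i> * r)) = m * smult r (qpoly g a)"
    unfolding b_at_rotate[OF a, symmetric] by (simp only: mult_smult_right right_diff_distrib)
  also have "\<dots> = smult (r\<^sup>2) ([:- \<beta>, 1:] * qpoly g a)"
  proof -
    have "m = smult r [:- \<beta>, 1:]" by (simp add: m_def)
    then show ?thesis by (simp only: mult_smult_left mult_smult_right smult_smult power2_eq_square)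
  qed
  finally show ?thesis using poly_conv_qpoly[OF b_limit] by (simp only:)
qed

lemma q_rate: "(\<lambda>n. poly (qpoly (g + 1) (A n)) \<beta> / of_real (\<tau> n)) \<longlonglongrightarrow>
  (\<beta> * poly (pderiv (qpoly g a)) \<beta> - poly (qpoly g a) \<beta> * \<kappa>) / 2"
proof -
  define X where "X = (\<lambda>B. \<beta> * poly (pderiv B) \<beta> - poly B \<beta> * \<kappa>)"
  have X: "X (p - smult c p') = X p - c * X p'" "X (smult c p) = c * X p" for p p' c
    by (simp_all add: X_def pderiv_diff pderiv_smult algebra_simps)
  have "(\<lambda>n. poly (b_at (g + 1) (A n) 1) \<beta> / of_real (\<tau> n) - \<i> * (poly (b_at (g + 1) (A n) \<i>) \<beta> / of_real (\<tau> n)))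
      \<longlonglongrightarrow> - (\<beta> * r / 2) * X (b_at g a (1 * r)) - \<i> * (- (\<beta> * r / 2) * X (b_at g a (\<i> * r)))"
    unfolding X_def by (intro tendsto_intros b_rate refl)
  also have "- (\<beta> * r / 2) * X (b_at g a (1 * r)) - \<i> * (- (\<beta> * r / 2) * X (b_at g a (\<i> * r))) =
      - (\<beta> * r / 2) * X (b_at g a (1 * r) - smult \<i> (b_at g a (\<i> * r)))"
    unfolding X by (simp add: algebra_simps)
  also have "\<dots> = - (\<beta> * r\<^sup>2) * X (qpoly g a) / 2" unfolding b_at_rotate[OF a] X by (simp add: power2_eq_square)
  finally show ?thesis unfolding \<beta>r X_def by (simp add: qpoly_def diff_divide_distrib)
qed

text \<open>In the limit \<open>qpoly\<close> gains the factor \<lambda> - \<beta>, whose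
  contribution Re (l / (l - \<beta>)) equals 1/2 on the circle. This is precisely the increase of
  the threshold with the genus, so signs persist away from \<beta>.\<close>

lemma slope_excess_limit:
  assumes l: "cmod l = 1" "l \<noteq> \<beta>" and nz: "poly (qpoly g a) l \<noteq> 0"
  shows "(\<lambda>n. slope_excess (g + 1) (A n) l) \<longlonglongrightarrow> slope_excess g a l"
proof -
  define Q where "Q = smult (r\<^sup>2) ([:- \<beta>, 1:] * qpoly g a)"
  have Q: "poly Q l = r\<^sup>2 * ((l - \<beta>) * poly (qpoly g a) l)"
    "poly (pderiv Q) l = r\<^sup>2 * (poly (qpoly g a) l + (l - \<beta>) * poly (pderiv (qpoly g a)) l)"
    by (simp_all only: Q_def pderiv_smult pderiv_mult) (simp_all add: pderiv_pCons algebra_simps)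
  have Q0: "poly Q l \<noteq> 0" using nz l \<beta>r by (simp add: Q)
  have "(\<lambda>n. Re (l * poly (pderiv (qpoly (g + 1) (A n))) l / poly (qpoly (g + 1) (A n)) l) - (g + 1 + 1) / 2) \<longlonglongrightarrow>
      Re (l * poly (pderiv Q) l / poly Q l) - (g + 1 + 1) / 2"
    unfolding Q_def using Q0
    by (intro tendsto_intros poly_conv_poly[OF q_limit] poly_conv_poly[OF poly_conv_pderiv[OF q_limit]]) (simp add: Q_def)
  moreover have "Re (l * poly (pderiv Q) l / poly Q l) = 1 / 2 + Re (l * poly (pderiv (qpoly g a)) l / poly (qpoly g a) l)"
  proof -
    have "l * poly (pderiv Q) l / poly Q l = l / (l - \<beta>) + l * poly (pderiv (qpoly g a)) l / poly (qpoly g a) l"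
      unfolding Q using nz l \<beta>r by (simp add: field_simps)
    moreover have "Re (l / (l - \<beta>)) = 1 / 2"
    proof -
      have "l * cnj l = 1" "\<beta> * cnj \<beta> = 1" using l \<beta> complex_norm_square[of l] complex_norm_square[of \<beta>] by simp_all
      then have "l / (l - \<beta>) + cnj (l / (l - \<beta>)) = 1"
        using l by (simp add: add_frac_eq) (simp add: algebra_simps)
      then show ?thesis unfolding complex_add_cnj by (metis Re_complex_of_real mult_2 nonzero_mult_div_cancel_left one_complex.sel(1) zero_neq_numeral)
    qed
    ultimately show ?thesis by simp
  qed
  ultimately show ?thesis by (simp add: slope_excess_def add_divide_distrib diff_diff_eq)
qed

text \<open>After splitting off the root \<nu> near \<beta>, the remaining factor converges to a
  multiple of the old \<open>qpoly\<close> and keeps its root count. The side of the circle on which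
  \<nu> lies is read off from the first-order term supplied by \<open>q_rate\<close>.\<close>

lemma disc_roots_opening:
  assumes nz: "\<And>l. cmod l = 1 \<Longrightarrow> poly (qpoly g a) l \<noteq> 0" and sl: "slope_excess g a \<beta> \<noteq> 0"
  shows "\<forall>\<^sub>F n in sequentially. (\<forall>l. cmod l = 1 \<longrightarrow> poly (qpoly (g + 1) (A n)) l \<noteq> 0) \<and>
    disc_roots (qpoly (g + 1) (A n)) = disc_roots (qpoly g a) + (if slope_excess g a \<beta> < 0 then 1 else 0)"
proof -
  define q where "q = qpoly g a"
  define Q where "Q = smult (r\<^sup>2) ([:- \<beta>, 1:] * q)"
  have Q: "poly Q \<beta> = 0" "poly (pderiv Q) \<beta> = r\<^sup>2 * poly q \<beta>"
    by (simp_all only: Q_def pderiv_smult pderiv_mult) (simp_all add: pderiv_pCons)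
  have q\<beta>: "poly q \<beta> \<noteq> 0" using nz \<beta> by (simp add: q_def)
  have conv: "poly_conv (g + 2) (\<lambda>n. qpoly (g + 1) (A n)) Q" unfolding Q_def q_def by (rule q_limit)
  have "poly (pderiv Q) \<beta> \<noteq> 0" using q\<beta> \<beta>r unfolding Q by simp
  from root_tracking[OF conv Q(1) this] obtain \<nu> N where
    \<nu>: "\<nu> \<longlonglongrightarrow> \<beta>" "\<forall>n\<ge>N. poly (qpoly (g + 1) (A n)) (\<nu> n) = 0" by blast
  \<comment> \<open>A shift of the index after which \<nu> is a root for every \<open>n\<close>, not
    only eventually.\<close>
  define f where "f = (\<lambda>n::nat. n + N)"
  have f: "strict_mono f" by (simp add: f_def strict_mono_def)
  have "[:- \<nu> (f n), 1:] dvd qpoly (g + 1) (A (f n))" for n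
    unfolding poly_eq_0_iff_dvd[symmetric] using \<nu>(2) by (simp add: f_def)
  then have "\<forall>n. \<exists>s. qpoly (g + 1) (A (f n)) = [:- \<nu> (f n), 1:] * s" unfolding dvd_def by blast
  then obtain s where s: "\<And>n. qpoly (g + 1) (A (f n)) = [:- \<nu> (f n), 1:] * s n" by metis
  have \<nu>f: "(\<lambda>n. \<nu> (f n)) \<longlonglongrightarrow> \<beta>" using LIMSEQ_subseq_LIMSEQ[OF \<nu>(1) f] by (simp add: o_def)
  have cs: "poly_conv (g + 2) s (smult (r\<^sup>2) q)"
    by (rule poly_conv_synthetic_div[OF poly_conv_subseq[OF conv f] \<nu>f s]) (simp only: Q_def mult_smult_right)
  have "\<forall>\<^sub>F n in sequentially. (\<forall>z. cmod z = 1 \<longrightarrow> poly (s n) z \<noteq> 0) \<and> disc_roots (s n) = disc_roots (smult (r\<^sup>2) q)"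
    by (rule disc_roots_conv[OF cs]) (use nz \<beta>r in \<open>simp add: q_def\<close>)
  moreover have "disc_roots (smult (r\<^sup>2) q) = disc_roots q" using \<beta>r by (simp add: disc_roots_def)
  ultimately have ev: "\<forall>\<^sub>F n in sequentially. (\<forall>z. cmod z = 1 \<longrightarrow> poly (s n) z \<noteq> 0) \<and> disc_roots (s n) = disc_roots q"
    by simp
  \<comment> \<open>As \<beta> lies on the circle, \<eta> = 1 - cnj \<beta> \<nu> and |\<nu>|^2 - 1
    = -2 Re \<eta> + |\<eta>|^2; the second term is negligible against \<tau>.\<close>
  define \<eta> where "\<eta> = (\<lambda>n. cnj \<beta> * (\<beta> - \<nu> (f n)))"
  define L where "L = (\<beta> * poly (pderiv q) \<beta> / poly q \<beta> - \<kappa>) / 2"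
  have L: "2 * Re L = slope_excess g a \<beta>" by (simp add: L_def slope_excess_def q_def Re_\<kappa>)
  have "(\<lambda>n. cnj \<beta> * (\<beta> - \<nu> (f n))) \<longlonglongrightarrow> cnj \<beta> * (\<beta> - \<beta>)" by (intro tendsto_intros \<nu>f)
  then have \<eta>0: "\<eta> \<longlonglongrightarrow> 0" by (simp add: \<eta>_def)
  have sb: "(\<lambda>n. poly (s n) \<beta>) \<longlonglongrightarrow> r\<^sup>2 * poly q \<beta>" using poly_conv_poly[OF cs tendsto_const, of \<beta>] by simp
  have val: "poly (qpoly (g + 1) (A (f n))) \<beta> = (\<beta> - \<nu> (f n)) * poly (s n) \<beta>" for n
    unfolding s poly_mult by simp
  have \<eta>L: "(\<lambda>n. \<eta> n / of_real (\<tau> (f n))) \<longlonglongrightarrow> - L"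
  proof -
    have qr: "(\<lambda>n. poly (qpoly (g + 1) (A (f n))) \<beta> / of_real (\<tau> (f n))) \<longlonglongrightarrow>
        (\<beta> * poly (pderiv q) \<beta> - poly q \<beta> * \<kappa>) / 2"
      using LIMSEQ_subseq_LIMSEQ[OF q_rate f] by (simp add: o_def q_def)
    have "(\<lambda>n. cnj \<beta> * (poly (qpoly (g + 1) (A (f n))) \<beta> / of_real (\<tau> (f n))) / poly (s n) \<beta>) \<longlonglongrightarrow>
        cnj \<beta> * ((\<beta> * poly (pderiv q) \<beta> - poly q \<beta> * \<kappa>) / 2) / (r\<^sup>2 * poly q \<beta>)"
      using q\<beta> \<beta>r by (intro tendsto_divide[OF tendsto_mult[OF tendsto_const qr] sb]) auto
    also have "cnj \<beta> * ((\<beta> * poly (pderiv q) \<beta> - poly q \<beta> * \<kappa>) / 2) / (r\<^sup>2 * poly q \<beta>) = - L"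
      using q\<beta> \<beta>r(1) unfolding r L_def by (simp add: field_simps)
    finally show ?thesis
    proof (rule Lim_transform_eventually)
      have "r\<^sup>2 * poly q \<beta> \<noteq> 0" using q\<beta> \<beta>r by simp
      from tendsto_imp_eventually_ne[OF sb this]
      show "\<forall>\<^sub>F n in sequentially. cnj \<beta> * (poly (qpoly (g + 1) (A (f n))) \<beta> / of_real (\<tau> (f n))) / poly (s n) \<beta> =
          \<eta> n / of_real (\<tau> (f n))"
        by eventually_elim (unfold val \<eta>_def, simp)
    qed
  qed
  have "(\<lambda>n. - 2 * Re (\<eta> n / of_real (\<tau> (f n))) + cmod (\<eta> n / of_real (\<tau> (f n))) * cmod (\<eta> n)) \<longlonglongrightarrow>
      - 2 * Re (- L) + cmod (- L) * cmod 0"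
    by (intro tendsto_intros \<eta>0 \<eta>L)
  moreover have "- 2 * Re (\<eta> n / of_real (\<tau> (f n))) + cmod (\<eta> n / of_real (\<tau> (f n))) * cmod (\<eta> n) =
      ((cmod (\<nu> (f n)))\<^sup>2 - 1) / \<tau> (f n)" for n
  proof -
    have "cnj \<beta> * \<nu> (f n) = 1 - \<eta> n" by (simp add: \<eta>_def right_diff_distrib \<beta>r)
    then have "cmod (\<nu> (f n)) = cmod (1 - \<eta> n)" using \<beta> arg_cong[of _ _ cmod] by (metis complex_mod_cnj mult_1 norm_mult)
    then have "(cmod (\<nu> (f n)))\<^sup>2 - 1 = - 2 * Re (\<eta> n) + cmod (\<eta> n) * cmod (\<eta> n)"
      by (simp only: cmod_power2 flip: power2_eq_square) (simp add: power2_eq_square algebra_simps)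
    then show ?thesis using \<tau>(1)[of "f n"]
      by (simp only: norm_divide norm_of_real abs_of_pos Re_divide_of_real add_divide_distrib) simp
  qed
  ultimately have lim: "(\<lambda>n. ((cmod (\<nu> (f n)))\<^sup>2 - 1) / \<tau> (f n)) \<longlonglongrightarrow> slope_excess g a \<beta>"
    by (simp add: L)
  have side: "\<forall>\<^sub>F n in sequentially. cmod (\<nu> (f n)) \<noteq> 1 \<and> (cmod (\<nu> (f n)) < 1 \<longleftrightarrow> slope_excess g a \<beta> < 0)"
  proof (cases "slope_excess g a \<beta> < 0")
    case True
    from order_tendstoD(2)[OF lim this] show ?thesis
    proof eventually_elim
      case (elim n)
      then have "(cmod (\<nu> (f n)))\<^sup>2 < 1\<^sup>2" using \<tau>(1)[of "f n"] by (simp add: divide_less_0_iff)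
      then show ?case using True power_less_imp_less_base[of "cmod (\<nu> (f n))" 2 1] by simp
    qed
  next
    case False
    then have pos: "slope_excess g a \<beta> > 0" using sl by simp
    from order_tendstoD(1)[OF lim this] show ?thesis
    proof eventually_elim
      case (elim n)
      then have "1\<^sup>2 < (cmod (\<nu> (f n)))\<^sup>2" using \<tau>(1)[of "f n"] by (simp add: zero_less_divide_iff)
      then show ?case using pos power_less_imp_less_base[of 1 2 "cmod (\<nu> (f n))"] by simp
    qed
  qed
  have "\<forall>\<^sub>F n in sequentially. (\<forall>l. cmod l = 1 \<longrightarrow> poly (qpoly (g + 1) (A (f n))) l \<noteq> 0) \<and>
    disc_roots (qpoly (g + 1) (A (f n))) = disc_roots (qpoly g a) + (if slope_excess g a \<beta> < 0 then 1 else 0)"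
    using ev side
  proof eventually_elim
    case (elim n)
    have "s n \<noteq> 0" using elim(1) by (auto dest: spec[of _ 1])
    then have "disc_roots ([:- \<nu> (f n), 1:] * s n) = disc_roots [:- (1 * \<nu> (f n)), 1:] + disc_roots (s n)"
      by (subst disc_roots_mult) auto
    also have "\<dots> = disc_roots q + (if slope_excess g a \<beta> < 0 then 1 else 0)"
      using elim by (subst disc_roots_linear) auto
    finally show ?case unfolding s q_def using elim by auto
  qed
  then show ?thesis unfolding f_def by (rule iffD1[OF eventually_sequentially_seg])
qed

end

text \<open>The persistence of signs in \<open>slope_excess_limit\<close> excludes \<beta> itself,
  so a witness that happens to be \<beta> is rotated slightly.\<close>

lemma circle_perturb:
  fixes f :: "complex \<Rightarrow> real"
  assumes f: "isCont f l" "f l > 0" and l: "cmod l = 1"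
  obtains l' where "cmod l' = 1" "l' \<noteq> \<beta>" "f l' > 0"
proof (cases "l = \<beta>")
  case False then show ?thesis using f l that by blast
next
  case True
  have "(\<lambda>n. l * cis (1 / Suc n)) \<longlonglongrightarrow> l * cis 0"
    using LIMSEQ_inverse_real_of_nat by (intro tendsto_intros) (simp add: inverse_eq_divide)
  then have "(\<lambda>n. f (l * cis (1 / Suc n))) \<longlonglongrightarrow> f l" using isCont_tendsto_compose[OF f(1)] by simp
  from eventually_happens'[OF _ order_tendstoD(1)[OF this f(2)]]
  obtain n where n: "f (l * cis (1 / Suc n)) > 0" by auto
  have "1 / real (Suc n) \<le> 1" by simp
  then have "sin (1 / Suc n) > 0" using pi_gt3 by (intro sin_gt_zero) (simp, linarith)
  then have "cis (1 / Suc n) \<noteq> 1" by (auto simp: complex_eq_iff)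
  then have "l * cis (1 / Suc n) \<noteq> \<beta>" using l True by auto
  then show ?thesis using that[of "l * cis (1 / Suc n)"] n l by (simp add: norm_mult)
qed

lemma slope_excess_isCont:
  "poly (qpoly g a) l \<noteq> 0 \<Longrightarrow> isCont (slope_excess g a) l"
  unfolding slope_excess_def by (intro continuous_intros isCont_Re) auto

text \<open>Both signs of \<open>slope_excess\<close> are carried along, so that each later node can
  be opened with or without a new root in the disc.\<close>

definition root_count_attained :: "nat \<Rightarrow> nat \<Rightarrow> bool" where
  "root_count_attained g k \<longleftrightarrow> (\<exists>a\<in>H_space g. (\<forall>l. cmod l = 1 \<longrightarrow> poly (qpoly g a) l \<noteq> 0) \<and> disc_roots (qpoly g a) = k \<and>
     (\<exists>l. cmod l = 1 \<and> slope_excess g a l > 0) \<and> (\<exists>l. cmod l = 1 \<and> slope_excess g a l < 0))"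

lemma root_count_opening:
  assumes a: "a \<in> H_space g" and nz: "\<And>l. cmod l = 1 \<Longrightarrow> poly (qpoly g a) l \<noteq> 0"
    and l: "cmod l1 = 1" "slope_excess g a l1 > 0" "cmod l2 = 1" "slope_excess g a l2 < 0"
    and on: "cmod \<beta> = 1" "slope_excess g a \<beta> \<noteq> 0"
  shows "root_count_attained (g + 1) (disc_roots (qpoly g a) + (if slope_excess g a \<beta> < 0 then 1 else 0))"
proof -
  obtain l1' where l1': "cmod l1' = 1" "l1' \<noteq> \<beta>" "slope_excess g a l1' > 0"
    by (rule circle_perturb[OF slope_excess_isCont[OF nz[OF l(1)]] l(2,1)])
  have "isCont (\<lambda>l. - slope_excess g a l) l2" by (intro continuous_intros slope_excess_isCont nz l)
  then obtain l2' where l2': "cmod l2' = 1" "l2' \<noteq> \<beta>" "- slope_excess g a l2' > 0"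
    by (rule circle_perturb) (use l in auto)
  \<comment> \<open>The new roots are to be \<beta> s_n and \<beta> / s_n, approaching the node
    radially from outside and inside.\<close>
  define s where "s = (\<lambda>n::nat. 1 + 1 / real (Suc n))"
  have s1: "s n > 1" for n by (simp add: s_def)
  have s: "s \<longlonglongrightarrow> 1"
    using tendsto_add[OF tendsto_const[of 1] LIMSEQ_inverse_real_of_nat] by (simp add: s_def inverse_eq_divide)
  have a\<beta>: "poly a \<beta> \<noteq> 0" "\<beta> \<noteq> 0" using H_space_props(5)[OF a on(1)] on(1) by auto
  have "(\<lambda>n. poly a (\<beta> * of_real (s n))) \<longlonglongrightarrow> poly a (\<beta> * of_real 1)"
    by (intro tendsto_intros s)
  then have e1: "\<forall>\<^sub>F n in sequentially. poly a (\<beta> * of_real (s n)) \<noteq> 0"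
    by (rule tendsto_imp_eventually_ne) (use a\<beta> in simp)
  have "(\<lambda>n. poly a (\<beta> / of_real (s n))) \<longlonglongrightarrow> poly a (\<beta> / of_real 1)"
    by (intro tendsto_intros s) simp
  then have e2: "\<forall>\<^sub>F n in sequentially. poly a (\<beta> / of_real (s n)) \<noteq> 0"
    by (rule tendsto_imp_eventually_ne) (use a\<beta> in simp)
  obtain N where N: "\<And>n. n \<ge> N \<Longrightarrow> poly a (\<beta> * of_real (s n)) \<noteq> 0 \<and> poly a (\<beta> / of_real (s n)) \<noteq> 0"
    using eventually_conj[OF e1 e2] by (auto simp: eventually_sequentially)
  \<comment> \<open>The shift by \<open>N\<close> keeps the new roots off those of
    \<open>a\<close>.\<close>
  define \<tau> where "\<tau> = (\<lambda>n. (s (n + N) - 1)\<^sup>2 / s (n + N))"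
  have sN: "(\<lambda>n. s (n + N)) \<longlonglongrightarrow> 1" using s by (rule LIMSEQ_ignore_initial_segment)
  have "\<tau> \<longlonglongrightarrow> (1 - 1)\<^sup>2 / 1" unfolding \<tau>_def by (intro tendsto_intros sN) simp
  then have \<tau>0: "\<tau> \<longlonglongrightarrow> 0" by simp
  have \<tau>p: "\<tau> n > 0" for n using s1[of "n + N"] by (simp add: \<tau>_def)
  have A: "a * node_factor \<beta> (\<tau> n) \<in> H_space (g + 1)" for n
    unfolding \<tau>_def by (rule H_space_mult_node_factor[OF a on(1) s1]) (use N[of "n + N"] in auto)
  obtain R Y where Y: "R > 0" "Y holomorphic_on ball \<beta> R"
    "\<And>z. z \<in> ball \<beta> R \<Longrightarrow> (Y z)\<^sup>2 = z * poly a z \<and> z * poly a z \<noteq> 0"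
    using sqrt_branch[of "csqrt (\<beta> * poly a \<beta>)" \<beta> a] a\<beta> by (metis csqrt_eq_0 mult_eq_0_iff power2_csqrt)
  interpret node_opening g a \<beta> "csqrt (- cnj \<beta>)" \<tau> R Y
    by unfold_locales (use a on \<tau>p \<tau>0 A Y in simp_all)
  have "\<forall>\<^sub>F n in sequentially. - slope_excess (g + 1) (A n) l2' > 0"
    by (rule order_tendstoD(1)[OF tendsto_minus[OF slope_excess_limit]]) (use l2' nz in auto)
  moreover have "\<forall>\<^sub>F n in sequentially. slope_excess (g + 1) (A n) l1' > 0"
    by (rule order_tendstoD(1)[OF slope_excess_limit]) (use l1' nz in auto)
  moreover have "\<forall>\<^sub>F n in sequentially. (\<forall>l. cmod l = 1 \<longrightarrow> poly (qpoly (g + 1) (A n)) l \<noteq> 0) \<and>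
      disc_roots (qpoly (g + 1) (A n)) = disc_roots (qpoly g a) + (if slope_excess g a \<beta> < 0 then 1 else 0)"
    by (rule disc_roots_opening[OF _ on(2)]) (rule nz)
  ultimately have "\<forall>\<^sub>F n in sequentially. root_count_attained (g + 1)
      (disc_roots (qpoly g a) + (if slope_excess g a \<beta> < 0 then 1 else 0))"
  proof eventually_elim
    case (elim n)
    then show ?case unfolding root_count_attained_def using A[of n] l1'(1) l2'(1)
      by (intro bexI[of _ "A n"] conjI) auto
  qed
  then show ?thesis by simp
qed

text \<open>In genus 1, \<open>q = 2 + c \<lambda>\<close>, and the root that is known to lie in the
  disc forces |c| > 2. The excess Re (l c / (2 + l c)) - 1 is then negative where l c = |c| and
  positive where l c = -|c|.\<close>

lemma root_count_attained_1: "root_count_attained 1 1"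
proof -
  have one: "(1 :: complex poly) \<in> H_space 0"
    by (auto simp: H_space_def real_polys_def rsquarefree_def)
  \<comment> \<open>A sample curve of genus 1: the node factor with \<beta> = 1 and s = 2 over the
    genus 0 polynomial 1.\<close>
  have "1 * node_factor 1 ((2 - 1)\<^sup>2 / 2) \<in> H_space (0 + 1)"
    by (rule H_space_mult_node_factor[OF one]) auto
  then obtain a where a: "a \<in> H_space 1" by auto
  define q c where "q = qpoly 1 a" and "c = coeff q 1"
  have dq: "degree q \<le> 1" "poly q 0 = 2" using qpoly_props[OF a] by (simp_all add: q_def)
  then have q: "q = [:2, c:]"
    by (intro poly_eqI) (auto simp: coeff_pCons poly_0_coeff_0 c_def coeff_eq_0 split: nat.splits)
  obtain z where z: "cmod z < 1" "poly q z = 0" using qpoly_has_root_in_disc[OF a] by (auto simp: q_def)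
  then have "c * z = - 2" by (simp add: q add_eq_0_iff mult.commute)
  then have cz: "cmod c * cmod z = 2" by (metis norm_minus_cancel norm_mult norm_numeral)
  then have "c \<noteq> 0" by auto
  then have "cmod c * cmod z < cmod c * 1" using z by (intro mult_strict_left_mono) auto
  then have c: "cmod c > 2" using cz by simp
  have nz: "poly q l \<noteq> 0" if "cmod l = 1" for l
  proof
    assume "poly q l = 0"
    then have "l * c = - 2" by (simp add: q add_eq_0_iff)
    then have "cmod l * cmod c = 2" by (metis norm_minus_cancel norm_mult norm_numeral)
    then show False using c that by simp
  qed
  have k: "disc_roots q = 1" using disc_roots_qpoly[OF a] by (simp add: q_def)
  have ex: "slope_excess 1 a l = Re (l * c / (2 + l * c)) - 1" for l
    unfolding slope_excess_def q_def[symmetric] q by (simp add: pderiv_pCons)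
  have cc: "of_real (cmod c) / c * c = of_real (cmod c)" using \<open>c \<noteq> 0\<close> by simp
  have "slope_excess 1 a (of_real (cmod c) / c) = cmod c / (2 + cmod c) - 1"
    unfolding ex cc by (metis Re_complex_of_real of_real_add of_real_divide of_real_numeral)
  then have neg: "slope_excess 1 a (of_real (cmod c) / c) < 0" using c by (simp add: divide_less_eq)
  have cc': "- (of_real (cmod c) / c) * c = of_real (- cmod c)" using \<open>c \<noteq> 0\<close> by simp
  have "slope_excess 1 a (- (of_real (cmod c) / c)) = - cmod c / (2 + - cmod c) - 1"
    unfolding ex cc' by (metis Re_complex_of_real of_real_add of_real_divide of_real_numeral)
  also have "\<dots> = 2 / (cmod c - 2)" using c by (simp add: divide_simps)
  finally have pos: "slope_excess 1 a (- (of_real (cmod c) / c)) > 0" using c by simp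
  have "cmod (of_real (cmod c) / c) = 1" "cmod (- (of_real (cmod c) / c)) = 1"
    using \<open>c \<noteq> 0\<close> by (simp_all add: norm_divide)
  with neg pos show ?thesis unfolding root_count_attained_def
    using a nz k unfolding q_def by blast
qed

lemma root_count_attained_step:
  assumes "root_count_attained g k"
  shows "root_count_attained (g + 1) k" "root_count_attained (g + 1) (k + 1)"
proof -
  obtain a l1 l2 where a: "a \<in> H_space g" and nz: "\<And>l. cmod l = 1 \<Longrightarrow> poly (qpoly g a) l \<noteq> 0"
    and k: "disc_roots (qpoly g a) = k"
    and l: "cmod l1 = 1" "slope_excess g a l1 > 0" "cmod l2 = 1" "slope_excess g a l2 < 0"
    using assms unfolding root_count_attained_def by blast
  note open_at = root_count_opening[OF a nz l, unfolded k]
  show "root_count_attained (g + 1) k" using open_at[of l1] l by simp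
  show "root_count_attained (g + 1) (k + 1)" using open_at[of l2] l by simp
qed

lemma root_count_attained_all:
  assumes "g \<ge> 1" "1 \<le> k" "k \<le> g"
  shows "root_count_attained g k"
  using assms
proof (induction g arbitrary: k rule: nat_induct_at_least)
  case base
  then show ?case using root_count_attained_1 by simp
next
  case (Suc g)
  show ?case
  proof (cases "k \<le> g")
    case True
    then show ?thesis using root_count_attained_step(1)[OF Suc.IH[of k]] Suc by simp
  next
    case False
    then have "k = g + 1" using Suc by simp
    then show ?thesis using root_count_attained_step(2)[OF Suc.IH[of g]] Suc by simp
  qed
qed

theorem theorem3p5:
  fixes g :: nat
  assumes "g \<ge> 1"
  shows "H_space g - S_space g = (\<Union>k\<in>{0..g - 1}. V_set g (1 - int g + 2 * int k)) \<and>
    (\<forall>k\<in>{0..g - 1}. V_set g (1 - int g + 2 * int k) \<noteq> {} \<and>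
        openin (H_topology g) (V_set g (1 - int g + 2 * int k))) \<and>
    disjoint_family_on (\<lambda>k. V_set g (1 - int g + 2 * int k)) {0..g - 1}"
proof (intro conjI ballI)
  \<comment> \<open>The index 1 - g + 2k belongs to g - k roots in the disc; the truncated
    subtraction is harmless, since there are at most \<open>g\<close> of them. As \<open>k\<close>
    is a function of \<open>a\<close>, disjointness follows as well.\<close>
  have idx: "a \<in> V_set g (1 - int g + 2 * int k) \<longleftrightarrow> a \<in> H_space g - S_space g \<and> k = g - disc_roots (qpoly g a)"
    for a k
  proof (cases "a \<in> H_space g")
    case True
    have "int g + 1 - 2 * int (disc_roots (qpoly g a)) = 1 - int g + 2 * int k \<longleftrightarrow> k = g - disc_roots (qpoly g a)"
      using disc_roots_qpoly(2)[OF True assms] by linarith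
    then show ?thesis unfolding V_set_iff using S_space_iff[OF True] True by auto
  qed (simp add: V_set_iff)
  show "H_space g - S_space g = (\<Union>k\<in>{0..g - 1}. V_set g (1 - int g + 2 * int k))"
  proof (intro equalityI subsetI)
    fix a assume a: "a \<in> H_space g - S_space g"
    then have "g - disc_roots (qpoly g a) \<in> {0..g - 1}" using disc_roots_qpoly(1)[of a g] assms by auto
    then show "a \<in> (\<Union>k\<in>{0..g - 1}. V_set g (1 - int g + 2 * int k))" using a idx by blast
  qed (use idx in blast)
  show "V_set g (1 - int g + 2 * int k) \<noteq> {}" if k: "k \<in> {0..g - 1}" for k
  proof -
    have "root_count_attained g (g - k)" using k assms by (intro root_count_attained_all) auto
    then obtain a where a: "a \<in> H_space g" "\<And>l. cmod l = 1 \<Longrightarrow> poly (qpoly g a) l \<noteq> 0" "disc_roots (qpoly g a) = g - k"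
      unfolding root_count_attained_def by blast
    have "a \<notin> S_space g" using a(2) S_space_iff[OF a(1)] by blast
    moreover have "k = g - disc_roots (qpoly g a)" using k assms unfolding a(3) by auto
    ultimately show ?thesis using idx a(1) by blast
  qed
  show "openin (H_topology g) (V_set g (1 - int g + 2 * int k))" for k by (rule openin_V_set)
  show "disjoint_family_on (\<lambda>k. V_set g (1 - int g + 2 * int k)) {0..g - 1}"
    by (auto simp: disjoint_family_on_def idx)
qed

end
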